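(* Let $p(\cdot):\mathbb{R}^n\to[1,\infty)$ be a measurable function with $1<p_-\equiv\operatorname{ess\,inf}p\le p_+\equiv\operatorname{ess\,sup}p<\infty$ and $p(\cdot)\in\mathrm{LH}_0\cap\mathrm{LH}_\infty$. Let $w\in A^{\mathrm{loc}}_{p(\cdot)}$ and $j^*\in\mathbb{Z}$. Let $J\in\mathbb{Z}$ be fixed and let $V,W_1,W_2$ be the square functions associated with the wavelet system $\varphi,\psi^1,\dots,\psi^{2^n-1}$ and with $J$ (see context). Then the following four conditions are equivalent: (X1) $p(\cdot)$ is a constant. (X2) For all $f\in L^{p(\cdot)}(w)$, $$\int_{\mathbb{R}^n}\Big|\sum_{l=1}^{2^n-1}\sum_{k\in\mathbb{Z}^n}\langle f,\psi^l_{j^*,k}\rangle\psi^l_{j^*,k}(x)\Big|^{p(x)}w(x)\,dx\lesssim\int_{\mathbb{R}^n}|f(x)|^{p(x)}w(x)\,dx.$$ (X3) For all $f\in L^{p(\cdot)}(w)$, $$\int_{\mathbb{R}^n}Vf(x)^{p(x)}w(x)\,dx+\int_{\mathbb{R}^n}W_1f(x)^{p(x)}w(x)\,dx\sim\int_{\mathbb{R}^n}|f(x)|^{p(x)}w(x)\,dx.$$ (X4) For all $f\in L^{p(\cdot)}(w)$, $$\int_{\mathbb{R}^n}Vf(x)^{p(x)}w(x)\,dx+\int_{\mathbb{R}^n}W_2f(x)^{p(x)}w(x)\,dx\sim\int_{\mathbb{R}^n}|f(x)|^{p(x)}w(x)\,dx.$$ Here $A\lesssim B$ means $A\le CB$ with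 a constant $C>0$ independent of $f$, and $A\sim B$ means $A\lesssim B$ and $B\lesssim A$.
   Context: Weighted variable Lebesgue spaces: a weight is a measurable function $w$ on $\mathbb{R}^n$ that is positive almost everywhere. For a measurable $p(\cdot):\mathbb{R}^n\to[1,\infty)$ and a weight $w$, for measurable $f$ set $\|f\|_{L^{p(\cdot)}(w)}\equiv\inf\{\lambda>0:\int_{\mathbb{R}^n}(|f(x)|/\lambda)^{p(x)}w(x)\,dx\le1\}$; $L^{p(\cdot)}(w)$ is the set of measurable $f$ with finite norm. Log-Hölder conditions: $r(\cdot)\in\mathrm{LH}_0$ means there is $C>0$ with $|r(x)-r(y)|\le \frac{C}{-\log|x-y|}$ for all $x,y\in\mathbb{R}^n$ with $|x-y|\le\frac12$. $r(\cdot)\in\mathrm{LH}_\infty$ means there are $C>0$ and $r_\infty\in[0,\infty)$ with $|r(x)-r_\infty|\le\frac{C}{\log(e+|x|)}$ for all $x\in\mathbb{R}^n$. Local Muckenhoupt class: let $\mathcal Q$ be the set of all compact cubes with edges parallel to the coordinate axes. With $p'(x)=p(x)/(p(x)-1)$ and $\sigma\equiv w^{-\frac{1}{p(\cdot)-1}}$, $w\in A^{\mathrm{loc}}_{p(\cdot)}$ means $\sup_{Q\in\mathcal Q,\,|Q|\le1}|Q|^{-1}\|\chi_Q\|_{L^{p(\cdot)}(w)}\|\chi_Q\|_{L^{p'(\cdot)}(\sigma)}<\infty$. Wavelets: for a function $F$ on $\mathbb{R}^n$, $j\in\mathbb{Z}$, $k\in\mathbb{Z}^n$, put $F_{j,k}\equiv2^{jn/2}F(2^j\cdot-k)$.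 Fixed throughout are real-valued compactly supported functions $\varphi,\psi^l\in C^1(\mathbb{R}^n)$ ($l=1,\dots,2^n-1$), furnished by standard compactly supported wavelet theory, such that $\operatorname{supp}\varphi=\operatorname{supp}\psi^l=[0,2N-1]^n$ for some $N\in\mathbb{N}$, and such that for every $J\in\mathbb{Z}$ the system $\{\varphi_{J,k},\psi^l_{j,k}: k\in\mathbb{Z}^n,\ j\ge J,\ l=1,\dots,2^n-1\}$ is an orthonormal basis of $L^2(\mathbb{R}^n)$. Square functions: let $Q_{j,k}\equiv\prod_{m=1}^n[2^{-j}k_m,2^{-j}(k_m+1)]$, $\chi_{j,k}\equiv2^{jn/2}\chi_{Q_{j,k}}$, and $\langle f,g\rangle\equiv\int_{\mathbb{R}^n}f\overline g\,dx$. For the fixed integer $J$, $Vf\equiv\big(\sum_{k\in\mathbb{Z}^n}|\langle f,\varphi_{J,k}\rangle\varphi_{J,k}|^2\big)^{1/2}$, $W_1f\equiv\big(\sum_{l=1}^{2^n-1}\sum_{j=J}^\infty\sum_{k\in\mathbb{Z}^n}|\langle f,\psi^l_{j,k}\rangle\psi^l_{j,k}|^2\big)^{1/2}$, $W_2f\equiv\big(\sum_{l=1}^{2^n-1}\sum_{j=J}^\infty\sum_{k\in\mathbb{Z}^n}|\langle f,\psi^l_{j,k}\rangle\chi_{j,k}|^2\big)^{1/2}$. *)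

theory Defs
  imports "HOL-Analysis.Analysis" "HOL-Probability.Essential_Supremum"
begin

section \<open>Variable exponents and weights\<close>

definition essinf :: "'a measure \<Rightarrow> ('a \<Rightarrow> ereal) \<Rightarrow> ereal" where
  "essinf M f = - esssup M (\<lambda>x. - f x)"

text \<open>At \<open>x = y\<close> the right-hand side is \<open>0\<close> by the convention \<open>ln 0 = 0\<close>, as is the
  left-hand side, so the diagonal imposes nothing.\<close>

definition LH0 :: "(real^'n \<Rightarrow> real) \<Rightarrow> bool" where
  "LH0 r \<longleftrightarrow> (\<exists>C>0. \<forall>x y. norm (x - y) \<le> 1/2 \<longrightarrow> \<bar>r x - r y\<bar> \<le> C / (- ln (norm (x - y))))"

definition LHinf :: "(real^'n \<Rightarrow> real) \<Rightarrow> bool" where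
  "LHinf r \<longleftrightarrow> (\<exists>C>0. \<exists>rinf\<ge>0. \<forall>x. \<bar>r x - rinf\<bar> \<le> C / ln (exp 1 + norm x))"

definition is_weight :: "(real^'n \<Rightarrow> real) \<Rightarrow> bool" where
  "is_weight w \<longleftrightarrow> w \<in> borel_measurable lebesgue \<and> (AE x in lebesgue. w x > 0)"

definition modular :: "(real^'n \<Rightarrow> real) \<Rightarrow> (real^'n \<Rightarrow> real) \<Rightarrow> (real^'n \<Rightarrow> complex) \<Rightarrow> ennreal" where
  "modular p w f = (\<integral>\<^sup>+x. ennreal (norm (f x) powr p x) * ennreal (w x) \<partial>lebesgue)"

text \<open>The infimum of the empty set is \<open>\<infinity>\<close> in \<open>ennreal\<close>.\<close>

definition Lp_norm :: "(real^'n \<Rightarrow> real) \<Rightarrow> (real^'n \<Rightarrow> real) \<Rightarrow> (real^'n \<Rightarrow> complex) \<Rightarrow> ennreal" where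
  "Lp_norm p w f = Inf {ennreal s | s. s > 0 \<and> modular p w (\<lambda>x. f x / of_real s) \<le> 1}"

definition Lp_space :: "(real^'n \<Rightarrow> real) \<Rightarrow> (real^'n \<Rightarrow> real) \<Rightarrow> (real^'n \<Rightarrow> complex) set" where
  "Lp_space p w = {f \<in> borel_measurable lebesgue. Lp_norm p w f < \<infinity>}"

definition conj_exponent :: "(real^'n \<Rightarrow> real) \<Rightarrow> real^'n \<Rightarrow> real" where
  "conj_exponent p x = p x / (p x - 1)"

definition dual_weight :: "(real^'n \<Rightarrow> real) \<Rightarrow> (real^'n \<Rightarrow> real) \<Rightarrow> real^'n \<Rightarrow> real" where
  "dual_weight p w x = w x powr (- 1 / (p x - 1))"

definition cubes :: "(real^'n) set set" where
  "cubes = {cbox a (a + vec h) | a h. h > 0}"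

definition A_loc :: "(real^'n \<Rightarrow> real) \<Rightarrow> (real^'n \<Rightarrow> real) set" where
  "A_loc p = {w. is_weight w \<and>
     (SUP Q \<in> {Q \<in> cubes. measure lebesgue Q \<le> 1}.
        ennreal (1 / measure lebesgue Q) * Lp_norm p w (indicator Q)
          * Lp_norm (conj_exponent p) (dual_weight p w) (indicator Q)) < \<infinity>}"


section \<open>Wavelets\<close>

definition C1_function :: "(real^'n \<Rightarrow> real) \<Rightarrow> bool" where
  "C1_function F \<longleftrightarrow> (\<exists>F' :: real^'n \<Rightarrow> ((real^'n) \<Rightarrow>\<^sub>L real).
     (\<forall>x. (F has_derivative blinfun_apply (F' x)) (at x)) \<and> continuous_on UNIV F')"

text \<open>\<open>F\<^sub>j\<^sub>,\<^sub>k\<close>, regarded as a complex-valued function.\<close>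

definition dilate :: "(real^'n \<Rightarrow> real) \<Rightarrow> int \<Rightarrow> int^'n \<Rightarrow> real^'n \<Rightarrow> complex" where
  "dilate F j k x = of_real (2 powr (real_of_int j * real CARD('n) / 2)
     * F (2 powi j *\<^sub>R x - (\<chi> m. real_of_int (k $ m))))"

definition L2_space :: "(real^'n \<Rightarrow> complex) set" where
  "L2_space = {f \<in> borel_measurable lebesgue. (\<integral>\<^sup>+x. ennreal ((norm (f x))\<^sup>2) \<partial>lebesgue) < \<infinity>}"

definition ip :: "(real^'n \<Rightarrow> complex) \<Rightarrow> (real^'n \<Rightarrow> complex) \<Rightarrow> complex" where
  "ip f g = (LINT x|lebesgue. f x * cnj (g x))"

text \<open>Orthonormal family whose finite linear combinations are dense in \<open>L\<^sup>2\<close>.\<close>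

definition L2_orthonormal_basis :: "'i set \<Rightarrow> ('i \<Rightarrow> real^'n \<Rightarrow> complex) \<Rightarrow> bool" where
  "L2_orthonormal_basis I e \<longleftrightarrow>
     (\<forall>i\<in>I. e i \<in> L2_space) \<and>
     (\<forall>i\<in>I. \<forall>i'\<in>I. ip (e i) (e i') = (if i = i' then 1 else 0)) \<and>
     (\<forall>f\<in>L2_space. \<forall>\<epsilon>>0. \<exists>S c. finite S \<and> S \<subseteq> I \<and>
        (\<integral>\<^sup>+x. ennreal ((norm (f x - (\<Sum>i\<in>S. c i * e i x)))\<^sup>2) \<partial>lebesgue) < ennreal (\<epsilon>\<^sup>2))"

text \<open>The index \<open>Inl k\<close> stands for \<open>\<phi>\<^sub>J\<^sub>,\<^sub>k\<close>, and \<open>Inr (l, j, k)\<close> for the \<open>j,k\<close> dilate of the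
  \<open>l\<close>-th wavelet.\<close>

definition wavelet_index :: "int \<Rightarrow> ((int^'n) + nat \<times> int \<times> (int^'n)) set" where
  "wavelet_index J = UNIV <+> ({1..2 ^ CARD('n) - 1} \<times> {J..} \<times> UNIV)"

definition wavelet_family ::
  "(real^'n \<Rightarrow> real) \<Rightarrow> (nat \<Rightarrow> real^'n \<Rightarrow> real) \<Rightarrow> int
     \<Rightarrow> (int^'n) + nat \<times> int \<times> (int^'n) \<Rightarrow> real^'n \<Rightarrow> complex" where
  "wavelet_family \<phi> \<psi> J = case_sum (\<lambda>k. dilate \<phi> J k) (\<lambda>(l, j, k). dilate (\<psi> l) j k)"

definition wavelet_system :: "(real^'n \<Rightarrow> real) \<Rightarrow> (nat \<Rightarrow> real^'n \<Rightarrow> real) \<Rightarrow> bool" where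
  "wavelet_system \<phi> \<psi> \<longleftrightarrow>
     C1_function \<phi> \<and> (\<forall>l\<in>{1..2 ^ CARD('n) - 1}. C1_function (\<psi> l)) \<and>
     (\<exists>N::nat. N \<ge> 1 \<and>
        closure (support_on UNIV \<phi>) = cbox 0 (vec (2 * real N - 1)) \<and>
        (\<forall>l\<in>{1..2 ^ CARD('n) - 1}. closure (support_on UNIV (\<psi> l)) = cbox 0 (vec (2 * real N - 1)))) \<and>
     (\<forall>J. L2_orthonormal_basis (wavelet_index J) (wavelet_family \<phi> \<psi> J))"


section \<open>Square functions\<close>

text \<open>The square functions may be infinite at some points, hence powers on \<open>ennreal\<close>;
  only positive exponents are used.\<close>

definition ennreal_powr :: "ennreal \<Rightarrow> real \<Rightarrow> ennreal" where
  "ennreal_powr t a = (if t = \<infinity> then \<infinity> else ennreal (enn2real t powr a))"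

definition dyadic_cube :: "int \<Rightarrow> int^'n \<Rightarrow> (real^'n) set" where
  "dyadic_cube j k = cbox (\<chi> m. 2 powi (- j) * real_of_int (k $ m))
                          (\<chi> m. 2 powi (- j) * (real_of_int (k $ m) + 1))"

definition chi_jk :: "int \<Rightarrow> int^'n \<Rightarrow> real^'n \<Rightarrow> complex" where
  "chi_jk j k x = of_real (2 powr (real_of_int j * real CARD('n) / 2)) * indicator (dyadic_cube j k) x"

definition sq_V :: "(real^'n \<Rightarrow> real) \<Rightarrow> int \<Rightarrow> (real^'n \<Rightarrow> complex) \<Rightarrow> real^'n \<Rightarrow> ennreal" where
  "sq_V \<phi> J f x =
     ennreal_powr (\<Sum>\<^sub>\<infinity>k\<in>UNIV. ennreal ((norm (ip f (dilate \<phi> J k) * dilate \<phi> J k x))\<^sup>2)) (1/2)"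

definition sq_W1 :: "(nat \<Rightarrow> real^'n \<Rightarrow> real) \<Rightarrow> int \<Rightarrow> (real^'n \<Rightarrow> complex) \<Rightarrow> real^'n \<Rightarrow> ennreal" where
  "sq_W1 \<psi> J f x =
     ennreal_powr (\<Sum>l\<in>{1..2 ^ CARD('n) - 1}. \<Sum>\<^sub>\<infinity>j\<in>{J..}. \<Sum>\<^sub>\<infinity>k\<in>UNIV.
       ennreal ((norm (ip f (dilate (\<psi> l) j k) * dilate (\<psi> l) j k x))\<^sup>2)) (1/2)"

definition sq_W2 :: "(nat \<Rightarrow> real^'n \<Rightarrow> real) \<Rightarrow> int \<Rightarrow> (real^'n \<Rightarrow> complex) \<Rightarrow> real^'n \<Rightarrow> ennreal" where
  "sq_W2 \<psi> J f x =
     ennreal_powr (\<Sum>l\<in>{1..2 ^ CARD('n) - 1}. \<Sum>\<^sub>\<infinity>j\<in>{J..}. \<Sum>\<^sub>\<infinity>k\<in>UNIV.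
       ennreal ((norm (ip f (dilate (\<psi> l) j k) * chi_jk j k x))\<^sup>2)) (1/2)"

text \<open>\<open>modular\<close> for extended nonnegative functions.\<close>

definition emodular :: "(real^'n \<Rightarrow> real) \<Rightarrow> (real^'n \<Rightarrow> real) \<Rightarrow> (real^'n \<Rightarrow> ennreal) \<Rightarrow> ennreal" where
  "emodular p w g = (\<integral>\<^sup>+x. ennreal_powr (g x) (p x) * ennreal (w x) \<partial>lebesgue)"

text \<open>At every \<open>x\<close> only finitely many terms of the sum over \<open>k\<close> are nonzero when \<open>\<psi>\<close> is a
  wavelet system, by compactness of the supports.\<close>

definition level_sum :: "(nat \<Rightarrow> real^'n \<Rightarrow> real) \<Rightarrow> int \<Rightarrow> (real^'n \<Rightarrow> complex) \<Rightarrow> real^'n \<Rightarrow> complex" where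
  "level_sum \<psi> j f x = (\<Sum>l\<in>{1..2 ^ CARD('n) - 1}. \<Sum>\<^sub>\<infinity>k\<in>UNIV.
     ip f (dilate (\<psi> l) j k) * dilate (\<psi> l) j k x)"

definition bounded_by_on :: "'a set \<Rightarrow> ('a \<Rightarrow> ennreal) \<Rightarrow> ('a \<Rightarrow> ennreal) \<Rightarrow> bool" where
  "bounded_by_on X A B \<longleftrightarrow> (\<exists>C::real. C > 0 \<and> (\<forall>f\<in>X. A f \<le> ennreal C * B f))"

definition comparable_on :: "'a set \<Rightarrow> ('a \<Rightarrow> ennreal) \<Rightarrow> ('a \<Rightarrow> ennreal) \<Rightarrow> bool" where
  "comparable_on X A B \<longleftrightarrow> bounded_by_on X A B \<and> bounded_by_on X B A"

end

theory Submission
  imports Defs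
begin

text \<open>For constant \<open>p\<close>, every support cube of a wavelet lies in a comparable cell of one of \<open>2\<^sup>n\<close>
  shifted dyadic grids. Sorting the wavelets so that each cell carries at most one of them, a
  Calderon--Zygmund decomposition of finite depth gives the weak type (1,1) of the square functions,
  hence a domination by sparse averages, hence the weighted upper bounds through Carleson embedding.
  Since the functions multiplying the coefficients have \<open>L\<^sup>2\<close>-norm one, the lower bounds follow
  from Parseval's identity, the Cauchy--Schwarz inequality and the upper bounds for the dual weight.

  Conversely, a modular inequality tested on \<open>t\<close> times the indicator of a small ball around \<open>x\<^sub>0\<close>,
  with \<open>t\<close> tending to \<open>0\<close> and to \<open>\<infinity>\<close>, forces \<open>p x = p x\<^sub>0\<close> whenever the output for such balls does not
  vanish near \<open>x\<close>. Hence \<open>p\<close> takes finitely many values on the support of each wavelet of a fixed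
  level, so countably many values altogether, and a continuous function of this kind is constant.\<close>

section \<open>Laminar families\<close>

text \<open>The local Muckenhoupt class controls only cubes of volume at most one, while wavelets of
  the coarsest level may live on larger ones. Since the levels are bounded below, cubes up to one
  fixed size suffice, and the condition reaches them by repeatedly doubling the side
  (\<open>Apset_all_scales\<close>). The weighted estimates are first proved for finite families,
  with constants independent of the family; monotone convergence supplies the limit. Two arguments
  bound a quantity \<open>I\<close> by a main term plus \<open>I / 2\<close>, so \<open>I\<close>
  must be known to be finite: a sparse sum is a bounded function on a set of finite weight, and in
  the duality argument the weight is truncated. That truncation also puts both functions into L^2,
  where Parseval's identity is available. Other functions are reached by approximation, whose error
  is controlled by the upper bound. \<open>V\<close> and \<open>W\<close> are treated together, as
  one square function over the whole basis. For (X2) the basis is started at level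
  \<open>jstar\<close> itself, so that the level sum is a sum of boundedly many terms of such a
  square function.\<close>

definition laminar :: "'a set set \<Rightarrow> bool" where
  "laminar \<D> \<longleftrightarrow> (\<forall>A\<in>\<D>. \<forall>B\<in>\<D>. A \<subseteq> B \<or> B \<subseteq> A \<or> A \<inter> B = {})"

lemma laminar_subset: "laminar \<D> \<Longrightarrow> \<D>' \<subseteq> \<D> \<Longrightarrow> laminar \<D>'"
  by (meson laminar_def subsetD)

lemma ex_maximal_superset:
  assumes "finite \<D>" "Q \<in> \<D>"
  shows "\<exists>R\<in>\<D>. Q \<subseteq> R \<and> (\<forall>P\<in>\<D>. R \<subseteq> P \<longrightarrow> P = R)"
proof -
  obtain R where "R \<in> \<D>" "Q \<subseteq> R" "\<forall>P\<in>\<D>. R \<subseteq> P \<longrightarrow> R = P"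
    using finite_has_maximal2[OF assms] by auto
  then show ?thesis by (intro bexI[of _ R]) auto
qed

lemma laminar_maximal_disjoint:
  assumes "laminar \<D>"
  shows "disjoint {R \<in> \<D>. \<forall>P\<in>\<D>. R \<subseteq> P \<longrightarrow> P = R}"
proof (rule disjointI)
  fix A B assume "A \<in> {R \<in> \<D>. \<forall>P\<in>\<D>. R \<subseteq> P \<longrightarrow> P = R}"
    "B \<in> {R \<in> \<D>. \<forall>P\<in>\<D>. R \<subseteq> P \<longrightarrow> P = R}" "A \<noteq> B"
  then have "A \<in> \<D>" "B \<in> \<D>" "\<not> A \<subseteq> B" "\<not> B \<subseteq> A" by auto
  then show "A \<inter> B = {}" using assms unfolding laminar_def by meson
qed

lemma laminar_chain_minimum:
  assumes "finite \<C>" "\<C> \<noteq> {}" "laminar \<C>" "\<And>Q. Q \<in> \<C> \<Longrightarrow> x \<in> Q"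
  shows "\<exists>P\<in>\<C>. \<forall>Q\<in>\<C>. P \<subseteq> Q"
proof -
  obtain P where P: "P \<in> \<C>" "\<And>Q. Q \<in> \<C> \<Longrightarrow> Q \<subseteq> P \<Longrightarrow> Q = P"
    using finite_has_minimal[OF assms(1,2)] by metis
  have "P \<subseteq> Q" if "Q \<in> \<C>" for Q
  proof -
    have "P \<subseteq> Q \<or> Q \<subseteq> P \<or> P \<inter> Q = {}" using assms(3) P(1) that unfolding laminar_def by meson
    moreover have "x \<in> P \<inter> Q" using assms(4) P(1) that by auto
    ultimately show ?thesis using P(2)[OF that] by auto
  qed
  with P show ?thesis by blast
qed

lemma superlevel_sets:
  fixes a :: "'a set \<Rightarrow> real"
  assumes "finite \<D>" "\<And>Q. Q \<in> \<D> \<Longrightarrow> Q \<in> sets M" "R \<in> sets M"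
  shows "{x\<in>R. (\<Sum>Q\<in>{Q\<in>\<D>. Q \<subseteq> R \<and> x \<in> Q}. a Q) > s} \<in> sets M"
proof -
  let ?f = "\<lambda>x. \<Sum>Q\<in>{Q\<in>\<D>. Q \<subseteq> R}. a Q * indicator Q x"
  have "(\<Sum>Q\<in>{Q\<in>\<D>. Q \<subseteq> R \<and> x \<in> Q}. a Q) = ?f x" for x
    by (rule sum.mono_neutral_cong_left) (use assms(1) in \<open>auto simp: indicator_def\<close>)
  then have "{x\<in>R. (\<Sum>Q\<in>{Q\<in>\<D>. Q \<subseteq> R \<and> x \<in> Q}. a Q) > s} = R \<inter> {x\<in>space M. ?f x > s}"
    using sets.sets_into_space[OF assms(3)] by auto
  moreover have "?f \<in> borel_measurable M"
    using assms(2) by (intro borel_measurable_sum borel_measurable_times borel_measurable_indicator) auto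
  ultimately show ?thesis
    using assms(3) by (auto intro!: sets.Int)
qed

text \<open>Induction on the number of sets. A maximal \<open>R\<close> is selected, and of the
  subsets of \<open>R\<close> only those are kept along whose chain up to \<open>R\<close> the
  masses \<open>a\<close> add up to more than \<open>(c R)\<^sup>2\<close>. The weak type bound
  makes them cover at most half of \<open>R\<close>, and the rest of \<open>R\<close> becomes
  \<open>E R\<close>. The kept sets and those outside \<open>R\<close> form the next family. The
  threshold is a square because \<open>a\<close> will be a summand of a squared square function and
  \<open>c\<close> a multiple of an average.\<close>

lemma sparse_domination:
  fixes a c :: "'a set \<Rightarrow> real"
  assumes "finite \<D>" "laminar \<D>" "\<D> \<subseteq> fmeasurable M"
    and "\<And>Q. Q \<in> \<D> \<Longrightarrow> 0 \<le> a Q"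
    and pos: "\<And>Q. Q \<in> \<D> \<Longrightarrow> 0 < measure M Q"
    and weak: "\<And>R. R \<in> \<D> \<Longrightarrow>
      measure M {x\<in>R. (\<Sum>Q\<in>{Q\<in>\<D>. Q \<subseteq> R \<and> x \<in> Q}. a Q) > (c R)\<^sup>2} \<le> measure M R / 2"
  shows "\<exists>\<S> E. \<S> \<subseteq> \<D> \<and> disjoint_family_on E \<S>
    \<and> (\<forall>Q\<in>\<S>. E Q \<in> sets M \<and> E Q \<subseteq> Q \<and> measure M Q \<le> 2 * measure M (E Q))
    \<and> (\<forall>x. (\<Sum>Q\<in>{Q\<in>\<D>. x \<in> Q}. a Q) \<le> (\<Sum>Q\<in>{Q\<in>\<S>. x \<in> Q}. (c Q)\<^sup>2))"
  using assms
proof (induction "card \<D>" arbitrary: \<D> rule: less_induct)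
  case less
  note fin = less.prems(1) and lam = less.prems(2) and meas = less.prems(3)
    and a0 = less.prems(4) and mpos = less.prems(5) and weak = less.prems(6)
  show ?case
  proof (cases "\<D> = {}")
    case True
    then show ?thesis by (auto simp: disjoint_family_on_def)
  next
    case False
    obtain R where R: "R \<in> \<D>" and Rmax: "\<And>P. P \<in> \<D> \<Longrightarrow> R \<subseteq> P \<Longrightarrow> P = R"
      using finite_has_maximal[OF fin False] by metis
    \<comment> \<open>By maximality of \<open>R\<close> the sum runs over the chain from
      \<open>Q\<close> up to \<open>R\<close>. It does not decrease when \<open>Q\<close> shrinks,
      so \<open>\<P>\<close> contains with a set all its subsets from \<open>\<D>\<close>.\<close>
    define \<P> where "\<P> = {Q\<in>\<D>. Q \<subseteq> R \<and> (\<Sum>P\<in>{P\<in>\<D>. Q \<subseteq> P}. a P) > (c R)\<^sup>2}"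
    define \<U> where "\<U> = {Q\<in>\<D>. \<not> Q \<subseteq> R}"
    have disj: "Q \<inter> R = {}" if "Q \<in> \<U>" for Q
    proof -
      have "Q \<subseteq> R \<or> R \<subseteq> Q \<or> Q \<inter> R = {}" using lam R that unfolding \<U>_def laminar_def by blast
      then show ?thesis using that Rmax[of Q] unfolding \<U>_def by auto
    qed
    have sR: "Q \<subseteq> R" if "Q \<in> \<D>" "x \<in> Q" "x \<in> R" for Q x
      using disj that unfolding \<U>_def by blast
    define lev where "lev = {x\<in>R. (\<Sum>Q\<in>{Q\<in>\<D>. Q \<subseteq> R \<and> x \<in> Q}. a Q) > (c R)\<^sup>2}"
    have sums_sets: "lev \<in> sets M"
      unfolding lev_def using fin meas R by (intro superlevel_sets) auto
    have P_lev: "\<Union>\<P> \<subseteq> lev"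
    proof
      fix x assume "x \<in> \<Union>\<P>"
      then obtain Q where Q: "Q \<in> \<P>" "x \<in> Q" by blast
      have "(\<Sum>P\<in>{P\<in>\<D>. Q \<subseteq> P}. a P) \<le> (\<Sum>P\<in>{P\<in>\<D>. P \<subseteq> R \<and> x \<in> P}. a P)"
      proof (rule sum_mono2)
        show "{P \<in> \<D>. Q \<subseteq> P} \<subseteq> {P \<in> \<D>. P \<subseteq> R \<and> x \<in> P}"
          using Q sR unfolding \<P>_def by blast
      qed (use fin a0 in auto)
      then show "x \<in> lev" using Q unfolding lev_def \<P>_def by auto
    qed
    have Rf: "R \<in> fmeasurable M" using meas R by auto
    have PsubD: "\<P> \<subseteq> \<D>" by (auto simp: \<P>_def)
    have Psets: "\<Union>\<P> \<in> sets M"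
      using fin PsubD meas finite_subset[OF PsubD fin] by (intro sets.finite_Union) auto
    have levR: "lev \<subseteq> R" unfolding lev_def by auto
    have mP: "measure M (\<Union>\<P>) \<le> measure M R / 2"
    proof -
      have "measure M (\<Union>\<P>) \<le> measure M lev"
        using P_lev fmeasurableI2[OF Rf levR sums_sets] Psets by (intro measure_mono_fmeasurable)
      also have "\<dots> \<le> measure M R / 2" using weak[OF R] unfolding lev_def .
      finally show ?thesis .
    qed
    have RnP: "R \<notin> \<P>"
    proof
      assume "R \<in> \<P>"
      then have "\<Union>\<P> = R" unfolding \<P>_def by blast
      then show False using mP mpos[OF R] by simp
    qed
    define \<D>' where "\<D>' = \<P> \<union> \<U>"
    have D'sub: "\<D>' \<subseteq> \<D>" unfolding \<D>'_def \<P>_def \<U>_def by auto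
    have RnD': "R \<notin> \<D>'" using RnP unfolding \<D>'_def \<U>_def by auto
    have card: "card \<D>' < card \<D>"
      using D'sub RnD' R fin by (intro psubset_card_mono) auto
    \<comment> \<open>Passing to a subfamily only lowers the sums, so the weak type hypothesis is
      inherited.\<close>
    have weak': "measure M {x\<in>P. (\<Sum>Q\<in>{Q\<in>\<D>'. Q \<subseteq> P \<and> x \<in> Q}. a Q) > (c P)\<^sup>2} \<le> measure M P / 2"
      if P: "P \<in> \<D>'" for P
    proof -
      have PD: "P \<in> \<D>" using P D'sub by auto
      have sm: "{x\<in>P. (\<Sum>Q\<in>{Q\<in>\<E>. Q \<subseteq> P \<and> x \<in> Q}. a Q) > (c P)\<^sup>2} \<in> sets M" if "\<E> \<subseteq> \<D>" for \<E>
        using finite_subset[OF that fin] meas PD that by (intro superlevel_sets) auto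
      have "measure M {x\<in>P. (\<Sum>Q\<in>{Q\<in>\<D>'. Q \<subseteq> P \<and> x \<in> Q}. a Q) > (c P)\<^sup>2}
          \<le> measure M {x\<in>P. (\<Sum>Q\<in>{Q\<in>\<D>. Q \<subseteq> P \<and> x \<in> Q}. a Q) > (c P)\<^sup>2}"
      proof (rule measure_mono_fmeasurable)
        have *: "(\<Sum>Q\<in>{Q\<in>\<D>'. Q \<subseteq> P \<and> x \<in> Q}. a Q) \<le> (\<Sum>Q\<in>{Q\<in>\<D>. Q \<subseteq> P \<and> x \<in> Q}. a Q)" for x
          by (rule sum_mono2) (use fin a0 D'sub in auto)
        show "{x\<in>P. (\<Sum>Q\<in>{Q\<in>\<D>'. Q \<subseteq> P \<and> x \<in> Q}. a Q) > (c P)\<^sup>2}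
          \<subseteq> {x\<in>P. (\<Sum>Q\<in>{Q\<in>\<D>. Q \<subseteq> P \<and> x \<in> Q}. a Q) > (c P)\<^sup>2}"
          using * by (auto intro: less_le_trans)
        show "{x\<in>P. (\<Sum>Q\<in>{Q\<in>\<D>. Q \<subseteq> P \<and> x \<in> Q}. a Q) > (c P)\<^sup>2} \<in> fmeasurable M"
          by (rule fmeasurableI2[of P]) (use meas PD sm[of \<D>] in auto)
      qed (rule sm[OF D'sub])
      then show ?thesis using weak[OF PD] by linarith
    qed
    obtain \<S>' E' where S': "\<S>' \<subseteq> \<D>'" and E'd: "disjoint_family_on E' \<S>'"
      and E': "\<And>Q. Q\<in>\<S>' \<Longrightarrow> E' Q \<in> sets M \<and> E' Q \<subseteq> Q \<and> measure M Q \<le> 2 * measure M (E' Q)"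
      and dom': "\<And>x. (\<Sum>Q\<in>{Q\<in>\<D>'. x \<in> Q}. a Q) \<le> (\<Sum>Q\<in>{Q\<in>\<S>'. x \<in> Q}. (c Q)\<^sup>2)"
    proof -
      have "\<exists>\<S> E. \<S> \<subseteq> \<D>' \<and> disjoint_family_on E \<S>
        \<and> (\<forall>Q\<in>\<S>. E Q \<in> sets M \<and> E Q \<subseteq> Q \<and> measure M Q \<le> 2 * measure M (E Q))
        \<and> (\<forall>x. (\<Sum>Q\<in>{Q\<in>\<D>'. x \<in> Q}. a Q) \<le> (\<Sum>Q\<in>{Q\<in>\<S>. x \<in> Q}. (c Q)\<^sup>2))"
        by (rule less.hyps[OF card finite_subset[OF D'sub fin] laminar_subset[OF lam D'sub]])
          (use D'sub meas a0 mpos weak' in auto)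
      then show ?thesis using that by blast
    qed
    define E where "E = E'(R := R - \<Union>\<P>)"
    have RnS: "R \<notin> \<S>'" using S' RnD' by auto
    have E'R: "E' Q \<inter> (R - \<Union>\<P>) = {}" if "Q \<in> \<S>'" for Q
    proof -
      have "Q \<in> \<P> \<or> Q \<in> \<U>" using that S' unfolding \<D>'_def by blast
      then show ?thesis using E'[OF that] disj[of Q] by blast
    qed
    have 1: "insert R \<S>' \<subseteq> \<D>" using R S' D'sub by auto
    have 2: "disjoint_family_on E (insert R \<S>')"
      unfolding disjoint_family_on_def
    proof (intro ballI impI)
      fix P Q assume "P \<in> insert R \<S>'" "Q \<in> insert R \<S>'" "P \<noteq> Q"
      then consider "P = R" "Q \<in> \<S>'" | "Q = R" "P \<in> \<S>'" | "P \<in> \<S>'" "Q \<in> \<S>'" "P \<noteq> R" "Q \<noteq> R"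
        using RnS by blast
      then show "E P \<inter> E Q = {}"
      proof cases
        case 1
        with RnS E'R[of Q] show ?thesis by (auto simp: E_def)
      next
        case 2
        with RnS E'R[of P] show ?thesis by (auto simp: E_def)
      next
        case 3
        with E'd \<open>P \<noteq> Q\<close> show ?thesis by (simp add: E_def disjoint_family_on_def)
      qed
    qed
    have mER: "measure M (R - \<Union>\<P>) = measure M R - measure M (\<Union>\<P>)"
      by (rule measurable_measure_Diff) (use Rf Psets in \<open>auto simp: \<P>_def\<close>)
    have 3: "\<forall>Q\<in>insert R \<S>'. E Q \<in> sets M \<and> E Q \<subseteq> Q \<and> measure M Q \<le> 2 * measure M (E Q)"
      using E' mER mP Rf Psets RnS unfolding E_def by auto
    have 4: "(\<Sum>Q\<in>{Q\<in>\<D>. x \<in> Q}. a Q) \<le> (\<Sum>Q\<in>{Q\<in>insert R \<S>'. x \<in> Q}. (c Q)\<^sup>2)" for x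
    proof (cases "x \<in> R")
      case False
      have "{Q\<in>\<D>. x \<in> Q} \<subseteq> {Q\<in>\<D>'. x \<in> Q}" using False unfolding \<D>'_def \<U>_def by auto
      then have "(\<Sum>Q\<in>{Q\<in>\<D>. x \<in> Q}. a Q) \<le> (\<Sum>Q\<in>{Q\<in>\<D>'. x \<in> Q}. a Q)"
        using D'sub finite_subset[OF D'sub fin] a0 by (intro sum_mono2) auto
      also have "\<dots> \<le> (\<Sum>Q\<in>{Q\<in>\<S>'. x \<in> Q}. (c Q)\<^sup>2)" by (rule dom')
      also have "{Q\<in>\<S>'. x \<in> Q} = {Q\<in>insert R \<S>'. x \<in> Q}" using False by auto
      finally show ?thesis .
    next
      case True
      \<comment> \<open>The sets around \<open>x\<close> that the recursion drops form a chain. Its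
        smallest member is not in \<open>\<P>\<close>, so the whole chain has mass at most
        \<open>(c R)\<^sup>2\<close>, which is the share that \<open>R\<close> pays.\<close>
      let ?C = "{Q\<in>\<D>. x \<in> Q \<and> Q \<notin> \<D>'}"
      have chain: "(\<Sum>Q\<in>?C. a Q) \<le> (c R)\<^sup>2"
      proof (cases "?C = {}")
        case True
        show ?thesis by (subst True) simp
      next
        case False
        have fC: "finite ?C" using fin by simp
        have lC: "laminar ?C" by (rule laminar_subset[OF lam]) blast
        have "\<exists>P\<in>?C. \<forall>Q\<in>?C. P \<subseteq> Q"
          by (rule laminar_chain_minimum[OF fC False lC, where x = x]) blast
        then obtain P where P: "P \<in> ?C" "\<And>Q. Q \<in> ?C \<Longrightarrow> P \<subseteq> Q" by meson
        have "(\<Sum>Q\<in>?C. a Q) \<le> (\<Sum>Q\<in>{Q\<in>\<D>. P \<subseteq> Q}. a Q)"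
          using P fin a0 by (intro sum_mono2) auto
        also have "\<dots> \<le> (c R)\<^sup>2"
        proof -
          have "P \<subseteq> R" "P \<in> \<D>" "P \<notin> \<P>" using P(1) sR[of P x] True unfolding \<D>'_def by simp_all
          then show ?thesis unfolding \<P>_def by simp
        qed
        finally show ?thesis .
      qed
      have "(\<Sum>Q\<in>{Q\<in>\<D>. x \<in> Q}. a Q) = (\<Sum>Q\<in>?C. a Q) + (\<Sum>Q\<in>{Q\<in>\<D>'. x \<in> Q}. a Q)"
      proof (subst sum.union_disjoint[symmetric])
        show "(\<Sum>Q\<in>{Q\<in>\<D>. x \<in> Q}. a Q) = sum a (?C \<union> {Q\<in>\<D>'. x \<in> Q})"
          using D'sub by (intro sum.cong) auto
      qed (use fin finite_subset[OF D'sub fin] in auto)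
      also have "\<dots> \<le> (c R)\<^sup>2 + (\<Sum>Q\<in>{Q\<in>\<S>'. x \<in> Q}. (c Q)\<^sup>2)"
        using chain dom'[of x] by linarith
      also have "\<dots> = (\<Sum>Q\<in>{Q\<in>insert R \<S>'. x \<in> Q}. (c Q)\<^sup>2)"
      proof -
        have "{Q\<in>insert R \<S>'. x \<in> Q} = insert R {Q\<in>\<S>'. x \<in> Q}" using True by auto
        moreover have "finite {Q\<in>\<S>'. x \<in> Q}" using finite_subset[OF S' finite_subset[OF D'sub fin]] by auto
        ultimately show ?thesis using RnS by simp
      qed
      finally show ?thesis .
    qed
    show ?thesis using 1 2 3 4 by blast
  qed
qed

section \<open>Carleson embedding for laminar families\<close>

lemma nn_integral_powr_from_0:
  fixes a c :: real
  assumes "a > -1" "c \<ge> 0"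
  shows "(\<integral>\<^sup>+x. ennreal (x powr a * indicator {0..c} x) \<partial>lborel) = ennreal (c powr (a + 1) / (a + 1))"
proof -
  have "((\<lambda>x. if x \<in> {0..c} then x powr a else 0) has_integral (c powr (a+1) / (a+1))) UNIV"
    using has_integral_powr_from_0[OF assms] by (simp only: has_integral_restrict_UNIV)
  also have "(\<lambda>x. if x \<in> {0..c} then x powr a else 0) = (\<lambda>x. x powr a * indicator {0..c} x)"
    by (auto simp: fun_eq_iff)
  finally show ?thesis
    by (intro nn_integral_has_integral_lborel) auto
qed

lemma sum_emeasure_disjoint_le:
  assumes "finite I" "disjoint_family_on E I" "\<And>i. i \<in> I \<Longrightarrow> E i \<in> sets M"
    "\<And>i. i \<in> I \<Longrightarrow> E i \<subseteq> A" "A \<in> sets M"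
  shows "(\<Sum>i\<in>I. emeasure M (E i)) \<le> emeasure M A"
proof -
  have "(\<Sum>i\<in>I. emeasure M (E i)) = emeasure M (\<Union>i\<in>I. E i)"
    by (rule sum_emeasure) (use assms in auto)
  also have "\<dots> \<le> emeasure M A" using assms by (intro emeasure_mono) auto
  finally show ?thesis .
qed

text \<open>Truncating \<open>h\<close> at height \<open>s / 2\<close> makes the later integration in \<open>s\<close> lossless.\<close>

lemma laminar_weak_type:
  fixes c :: "'a set \<Rightarrow> real" and h :: "'a \<Rightarrow> real"
  assumes fin: "finite \<S>" and lam: "laminar \<S>" and S: "\<S> \<subseteq> sets M"
    and mfin: "\<And>Q. Q \<in> \<S> \<Longrightarrow> emeasure M Q < \<infinity>"
    and h[measurable]: "h \<in> borel_measurable M"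
    and avg: "\<And>Q. Q \<in> \<S> \<Longrightarrow> ennreal (c Q) * emeasure M Q \<le> (\<integral>\<^sup>+x. ennreal (h x) * indicator Q x \<partial>M)"
    and "s > 0" and ge: "\<And>Q. Q \<in> \<S> \<Longrightarrow> c Q \<ge> s"
  shows "ennreal (s / 2) * emeasure M (\<Union>\<S>) \<le> (\<integral>\<^sup>+x. ennreal (h x * indicator {s<..} (2 * h x)) \<partial>M)"
proof -
  define \<M> where "\<M> = {R \<in> \<S>. \<forall>P\<in>\<S>. R \<subseteq> P \<longrightarrow> P = R}"
  have Mfin: "finite \<M>" and MS: "\<M> \<subseteq> \<S>" unfolding \<M>_def using fin by auto
  have Un: "\<Union>\<S> = \<Union>\<M>"
    unfolding \<M>_def using ex_maximal_superset[OF fin] by blast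
  have dis: "disjoint \<M>" unfolding \<M>_def by (rule laminar_maximal_disjoint[OF lam])
  let ?g = "\<lambda>x. ennreal (h x * indicator {s<..} (2 * h x))"
  have gm[measurable]: "?g \<in> borel_measurable M" by measurable
  have one: "ennreal (s / 2) * emeasure M Q \<le> (\<integral>\<^sup>+x. ?g x * indicator Q x \<partial>M)" if Q: "Q \<in> \<S>" for Q
  proof -
    have [measurable]: "Q \<in> sets M" using Q S by auto
    have "ennreal (s/2) * emeasure M Q + ennreal (s/2) * emeasure M Q = ennreal s * emeasure M Q"
      using \<open>s > 0\<close> by (simp flip: distrib_right ennreal_plus)
    also have "\<dots> \<le> ennreal (c Q) * emeasure M Q"
      using ge[OF Q] by (intro mult_right_mono ennreal_leI) auto
    also have "\<dots> \<le> (\<integral>\<^sup>+x. ennreal (h x) * indicator Q x \<partial>M)" by (rule avg[OF Q])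
    also have "\<dots> \<le> (\<integral>\<^sup>+x. ?g x * indicator Q x + ennreal (s/2) * indicator Q x \<partial>M)"
      using \<open>s > 0\<close> by (intro nn_integral_mono) (auto simp: indicator_def intro: ennreal_leI)
    also have "\<dots> = (\<integral>\<^sup>+x. ?g x * indicator Q x \<partial>M) + ennreal (s/2) * emeasure M Q"
      by (subst nn_integral_add) (auto simp: nn_integral_cmult_indicator)
    finally show ?thesis
      using mfin[OF Q] by (auto simp: ennreal_mult_eq_top_iff top.not_eq_extremum)
  qed
  have "ennreal (s / 2) * emeasure M (\<Union>\<S>) = (\<Sum>Q\<in>\<M>. ennreal (s / 2) * emeasure M Q)"
    unfolding Un sum_distrib_left[symmetric]
    by (subst sum_emeasure[of id, simplified])
      (use dis Mfin MS S in \<open>auto simp: disjoint_def disjoint_family_on_def\<close>)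
  also have "\<dots> \<le> (\<Sum>Q\<in>\<M>. \<integral>\<^sup>+x. ?g x * indicator Q x \<partial>M)"
    using one MS by (intro sum_mono) auto
  also have "\<dots> = (\<Sum>Q\<in>\<M>. emeasure (density M ?g) Q)"
    using MS S by (intro sum.cong refl, subst emeasure_density) auto
  also have "\<dots> = emeasure (density M ?g) (\<Union>\<M>)"
    by (subst sum_emeasure[of id, simplified])
      (use dis Mfin MS S in \<open>auto simp: disjoint_def disjoint_family_on_def\<close>)
  also have "\<dots> \<le> emeasure (density M ?g) (space M)" by (metis emeasure_space space_density)
  also have "\<dots> = (\<integral>\<^sup>+x. ?g x \<partial>M)"
    by (subst emeasure_density) (auto intro!: nn_integral_cong)
  finally show ?thesis .
qed

text \<open>Layer-cake integration: for fixed \<open>s\<close> the disjoint sets \<open>E Q\<close>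
  with \<open>c Q \<ge> s\<close> lie in the union of those \<open>Q\<close>, and
  \<open>laminar_weak_type\<close> bounds that union by the part of \<open>h\<close> above
  \<open>s / 2\<close>. After Fubini, \<open>s powr (q - 2)\<close> is integrated up to
  \<open>2 * h x\<close>; this converges because \<open>q > 1\<close> and produces the factor
  \<open>q * 2 powr q / (q - 1)\<close>.\<close>

lemma carleson_embedding:
  fixes c :: "'a set \<Rightarrow> real" and h :: "'a \<Rightarrow> real" and q :: real
  assumes "sigma_finite_measure M"
    and fin: "finite \<S>" and lam: "laminar \<S>" and S: "\<S> \<subseteq> sets M"
    and mfin: "\<And>Q. Q \<in> \<S> \<Longrightarrow> emeasure M Q < \<infinity>"
    and E: "disjoint_family_on E \<S>" "\<And>Q. Q \<in> \<S> \<Longrightarrow> E Q \<in> sets M" "\<And>Q. Q \<in> \<S> \<Longrightarrow> E Q \<subseteq> Q"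
    and h[measurable]: "h \<in> borel_measurable M" and h0: "\<And>x. h x \<ge> 0"
    and c0: "\<And>Q. Q \<in> \<S> \<Longrightarrow> c Q \<ge> 0"
    and avg: "\<And>Q. Q \<in> \<S> \<Longrightarrow> ennreal (c Q) * emeasure M Q \<le> (\<integral>\<^sup>+x. ennreal (h x) * indicator Q x \<partial>M)"
    and q: "q > 1"
  shows "(\<Sum>Q\<in>\<S>. ennreal (c Q powr q) * emeasure M (E Q))
    \<le> ennreal (q * 2 powr q / (q - 1)) * (\<integral>\<^sup>+x. ennreal (h x powr q) \<partial>M)"
proof -
  interpret sigma_finite_measure M by fact
  interpret pair_sigma_finite lborel M ..
  have "(\<Sum>Q\<in>\<S>. ennreal (c Q powr q) * emeasure M (E Q))
      = (\<Sum>Q\<in>\<S>. (\<integral>\<^sup>+s. ennreal (q * (s powr (q - 1) * indicator {0..c Q} s)) * emeasure M (E Q) \<partial>lborel))"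
  proof (rule sum.cong[OF refl])
    fix Q assume "Q \<in> \<S>"
    have "(\<integral>\<^sup>+s. ennreal (q * (s powr (q - 1) * indicator {0..c Q} s)) * emeasure M (E Q) \<partial>lborel)
        = (\<integral>\<^sup>+s. ennreal q * (ennreal (s powr (q - 1) * indicator {0..c Q} s)) \<partial>lborel) * emeasure M (E Q)"
      using q by (subst nn_integral_multc[symmetric]) (auto simp: ennreal_mult)
    also have "\<dots> = ennreal q * ennreal (c Q powr (q - 1 + 1) / (q - 1 + 1)) * emeasure M (E Q)"
      using q c0[OF \<open>Q \<in> \<S>\<close>] by (subst nn_integral_cmult, measurable, subst nn_integral_powr_from_0) auto
    also have "\<dots> = ennreal (c Q powr q) * emeasure M (E Q)"
      using q by (simp add: ennreal_mult[symmetric])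
    finally show "ennreal (c Q powr q) * emeasure M (E Q) =
      (\<integral>\<^sup>+s. ennreal (q * (s powr (q - 1) * indicator {0..c Q} s)) * emeasure M (E Q) \<partial>lborel)" by simp
  qed
  also have "\<dots> = (\<integral>\<^sup>+s. (\<Sum>Q\<in>\<S>. ennreal (q * (s powr (q - 1) * indicator {0..c Q} s)) * emeasure M (E Q)) \<partial>lborel)"
    by (subst nn_integral_sum) auto
  also have "\<dots> \<le> (\<integral>\<^sup>+s. (\<integral>\<^sup>+x. ennreal (2 * q * s powr (q - 2) * indicator {0<..} s * (h x * indicator {s<..} (2 * h x))) \<partial>M) \<partial>lborel)"
  proof (rule nn_integral_mono_AE)
    show "AE s in lborel. (\<Sum>Q\<in>\<S>. ennreal (q * (s powr (q - 1) * indicator {0..c Q} s)) * emeasure M (E Q))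
      \<le> (\<integral>\<^sup>+x. ennreal (2 * q * s powr (q - 2) * indicator {0<..} s * (h x * indicator {s<..} (2 * h x))) \<partial>M)"
    proof (rule AE_I2)
      fix s :: real
      let ?L = "(\<Sum>Q\<in>\<S>. ennreal (q * (s powr (q - 1) * indicator {0..c Q} s)) * emeasure M (E Q))"
      show "?L \<le> (\<integral>\<^sup>+x. ennreal (2 * q * s powr (q - 2) * indicator {0<..} s * (h x * indicator {s<..} (2 * h x))) \<partial>M)"
      proof (cases "s > 0")
        case False
        then have "?L = 0" by (intro sum.neutral) (auto simp: indicator_def)
        then show ?thesis by simp
      next
        case True
        define \<T> where "\<T> = {Q\<in>\<S>. c Q \<ge> s}"
        have T: "\<T> \<subseteq> \<S>" "finite \<T>" unfolding \<T>_def using fin by auto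
        have UT: "\<Union>\<T> \<in> sets M" using T S by (intro sets.finite_Union) auto
        have "?L = (\<Sum>Q\<in>\<T>. ennreal (q * s powr (q - 1)) * emeasure M (E Q))"
          by (rule sum.mono_neutral_cong_right) (use fin True in \<open>auto simp: \<T>_def indicator_def\<close>)
        also have "\<dots> = ennreal (q * s powr (q - 1)) * (\<Sum>Q\<in>\<T>. emeasure M (E Q))"
          by (simp add: sum_distrib_left)
        also have "\<dots> \<le> ennreal (q * s powr (q - 1)) * emeasure M (\<Union>\<T>)"
          using E T UT by (intro mult_left_mono sum_emeasure_disjoint_le)
            (auto intro: disjoint_family_on_mono)
        also have "\<dots> = ennreal (2 * q * s powr (q - 2)) * (ennreal (s/2) * emeasure M (\<Union>\<T>))"
        proof -
          have "q * s powr (q - 1) = (2 * q * s powr (q - 2)) * (s/2)"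
            using True by (simp add: powr_diff power2_eq_square field_simps)
          then show ?thesis using True q by (simp add: ennreal_mult[symmetric] mult.assoc[symmetric])
        qed
        also have "\<dots> \<le> ennreal (2 * q * s powr (q - 2)) * (\<integral>\<^sup>+x. ennreal (h x * indicator {s<..} (2 * h x)) \<partial>M)"
          using T S mfin avg True laminar_subset[OF lam T(1)]
          by (intro mult_left_mono laminar_weak_type) (auto simp: \<T>_def)
        also have "\<dots> = (\<integral>\<^sup>+x. ennreal (2 * q * s powr (q - 2) * indicator {0<..} s * (h x * indicator {s<..} (2 * h x))) \<partial>M)"
          using True q h0 by (subst nn_integral_cmult[symmetric]) (auto simp: ennreal_mult)
        finally show ?thesis .
      qed
    qed
  qed
  also have "\<dots> = (\<integral>\<^sup>+x. (\<integral>\<^sup>+s. ennreal (2 * q * s powr (q - 2) * indicator {0<..} s * (h x * indicator {s<..} (2 * h x))) \<partial>lborel) \<partial>M)"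
  proof (rule Fubini'[symmetric])
    show "(\<lambda>(x, y). ennreal (2 * q * x powr (q - 2) * indicator {0<..} x * (h y * indicator {x<..} (2 * h y))))
        \<in> borel_measurable (lborel \<Otimes>\<^sub>M M)"
    proof -
      have "(\<lambda>(x, y). ennreal (2 * q * x powr (q - 2) * indicator {0<..} x * (h y * indicator {x<..} (2 * h y))))
        = (\<lambda>(x, y). if 0 < x \<and> x < 2 * h y then ennreal (2 * q * x powr (q - 2) * h y) else 0)"
        by (auto simp: indicator_def fun_eq_iff)
      moreover have "\<dots> \<in> borel_measurable (lborel \<Otimes>\<^sub>M M)" by measurable
      ultimately show ?thesis by simp
    qed
  qed
  also have "\<dots> \<le> (\<integral>\<^sup>+x. ennreal (q * 2 powr q / (q - 1)) * ennreal (h x powr q) \<partial>M)"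
  proof (rule nn_integral_mono)
    fix x
    have "(\<integral>\<^sup>+s. ennreal (2 * q * s powr (q - 2) * indicator {0<..} s * (h x * indicator {s<..} (2 * h x))) \<partial>lborel)
        \<le> (\<integral>\<^sup>+s. ennreal (2 * q * h x) * ennreal (s powr (q - 2) * indicator {0..2 * h x} s) \<partial>lborel)"
      using q h0 by (intro nn_integral_mono) (auto simp: indicator_def ennreal_mult[symmetric] mult_ac)
    also have "\<dots> = ennreal (2 * q * h x) * ennreal ((2 * h x) powr (q - 2 + 1) / (q - 2 + 1))"
      using q h0 by (subst nn_integral_cmult, measurable, subst nn_integral_powr_from_0) auto
    also have "\<dots> = ennreal (2 * q * h x * ((2 * h x) powr (q - 1) / (q - 1)))"
      using q h0 by (subst ennreal_mult[symmetric]) auto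
    also have "2 * q * h x * ((2 * h x) powr (q - 1) / (q - 1)) = q * 2 powr q / (q - 1) * h x powr q"
    proof (cases "h x = 0")
      case False
      then have "2 * h x * (2 * h x) powr (q - 1) = (2 * h x) powr q"
        using h0[of x] by (simp add: powr_diff)
      then show ?thesis using h0[of x] by (simp add: powr_mult field_simps)
    qed simp
    finally show "(\<integral>\<^sup>+s. ennreal (2 * q * s powr (q - 2) * indicator {0<..} s * (h x * indicator {s<..} (2 * h x))) \<partial>lborel)
      \<le> ennreal (q * 2 powr q / (q - 1)) * ennreal (h x powr q)"
      using q by (subst ennreal_mult[symmetric]) auto
  qed
  also have "\<dots> = ennreal (q * 2 powr q / (q - 1)) * (\<integral>\<^sup>+x. ennreal (h x powr q) \<partial>M)"
    by (rule nn_integral_cmult) measurable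
  finally show ?thesis .
qed

section \<open>Muckenhoupt weights with a constant exponent\<close>

lemma sigma_finite_lebesgue: "sigma_finite_measure (lebesgue :: ('a::euclidean_space) measure)"
proof
  show "\<exists>A::'a set set. countable A \<and> A \<subseteq> sets lebesgue \<and> \<Union> A = space lebesgue
      \<and> (\<forall>a\<in>A. emeasure lebesgue a \<noteq> \<infinity>)"
  proof (intro exI[of _ "range (\<lambda>n::nat. cball (0::'a) (real n))"] conjI ballI)
    show "\<Union> (range (\<lambda>n::nat. cball (0::'a) (real n))) = space lebesgue"
      by (auto intro: real_arch_simple)
    show "emeasure lebesgue a \<noteq> \<infinity>" if "a \<in> range (\<lambda>n::nat. cball (0::'a) (real n))" for a
    proof -
      have "a \<in> lmeasurable" using that by auto
      then show ?thesis using fmeasurableD2[of a lebesgue] by (simp del: emeasure_completion)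
    qed
  qed auto
qed

text \<open>Positivity at every point, rather than almost everywhere, keeps null sets out of the
  calculations with negative powers of \<open>w\<close>. A weight as in the theorem is changed on a
  null set before this locale is entered.\<close>

locale pos_weight =
  fixes p :: real and w :: "real^'n \<Rightarrow> real"
  assumes p1: "p > 1" and w_meas[measurable]: "w \<in> borel_measurable lebesgue" and w_pos: "\<And>x. w x > 0"
begin

definition \<sigma> :: "real^'n \<Rightarrow> real" where "\<sigma> x = w x powr (- 1 / (p - 1))"
definition q :: real where "q = p / (p - 1)"
definition W :: "(real^'n) measure" where "W = density lebesgue (\<lambda>x. ennreal (w x))"
definition S :: "(real^'n) measure" where "S = density lebesgue (\<lambda>x. ennreal (\<sigma> x))"

text \<open>The Muckenhoupt condition for a single set, in product form and with finiteness built
  in. It is not confined to cubes because it will be passed on to half-open cells.\<close>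

definition Apset :: "real \<Rightarrow> (real^'n) set \<Rightarrow> bool" where
  "Apset A Q \<longleftrightarrow> Q \<in> lmeasurable \<and> 0 < measure lebesgue Q \<and> emeasure W Q < \<infinity> \<and> emeasure S Q < \<infinity>
     \<and> measure W Q * measure S Q powr (p - 1) \<le> A * measure lebesgue Q powr p"

lemma sigma_meas[measurable]: "\<sigma> \<in> borel_measurable lebesgue"
  unfolding \<sigma>_def by measurable

lemma sigma_pos: "\<sigma> x > 0"
  unfolding \<sigma>_def using w_pos[of x] by simp

lemma q1: "q > 1" and q_minus_1: "q - 1 = 1 / (p - 1)" and p_minus_1: "p - 1 = 1 / (q - 1)"
  and pq: "p * (q - 1) = q" and qp: "q * (p - 1) = p"
  using p1 unfolding q_def by (auto simp: field_simps)

lemma sigma_powr_1p: "\<sigma> x powr (1 - p) = w x"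
proof -
  have "- 1 / (p - 1) * (1 - p) = 1" using p1 by (simp add: field_simps)
  then show ?thesis using w_pos[of x] unfolding \<sigma>_def powr_powr by simp
qed

lemma sigma_powr: "\<sigma> x powr (- 1 / (q - 1)) = w x"
  using sigma_powr_1p[of x] p1 by (simp add: q_minus_1)

text \<open>Conjugate exponent and dual weight form an instance of the same locale, and dualizing
  twice gives back \<open>p\<close> and \<open>w\<close>. Every estimate for \<open>W\<close>
  thereby becomes one for \<open>S\<close>.\<close>

lemma dual: "pos_weight q \<sigma>"
  by unfold_locales (auto intro: q1 sigma_pos)

lemma dual_sigma: "pos_weight.\<sigma> q \<sigma> = w"
  by (rule ext) (simp only: pos_weight.\<sigma>_def[OF dual] sigma_powr)

lemma dual_W: "pos_weight.W \<sigma> = S" and dual_S: "pos_weight.S q \<sigma> = W" and dual_q: "pos_weight.q q = p"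
  unfolding pos_weight.W_def[OF dual] pos_weight.S_def[OF dual] pos_weight.q_def[OF dual] dual_sigma
    W_def S_def by (auto simp: q_minus_1 q_def p1) (use p1 in \<open>simp add: field_simps\<close>)

lemma sets_W[simp, measurable_cong]: "sets W = sets lebesgue" and space_W[simp]: "space W = UNIV"
  and sets_S[simp, measurable_cong]: "sets S = sets lebesgue" and space_S[simp]: "space S = UNIV"
  unfolding W_def S_def by auto

lemma sigma_finite_W: "sigma_finite_measure W" and sigma_finite_S: "sigma_finite_measure S"
  unfolding W_def S_def
  by (subst sigma_finite_measure.sigma_finite_iff_density_finite[OF sigma_finite_lebesgue]; simp)+

text \<open>One of the two terms alone is large enough: either \<open>v\<close> is at most
  \<open>K\<close> times \<open>u powr (p - 1) * w x\<close>, and the first term dominates, or this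
  can be solved for \<open>u\<close>, and the second does. The parameter \<open>K\<close> is kept
  free to balance the terms, or to make one of them small enough to be absorbed.\<close>

lemma young_weight:
  assumes u: "u \<ge> 0" and v: "v \<ge> 0" and K: "K > 0"
  shows "u * v \<le> K * (u powr p * w x) + K powr (- 1 / (p - 1)) * (v powr q * \<sigma> x)"
proof (cases "v \<le> u powr (p - 1) * w x * K")
  case True
  then have "u * v \<le> u * (u powr (p - 1) * w x * K)" using u by (intro mult_left_mono)
  also have "\<dots> = K * (u powr p * w x)"
    using u by (cases "u = 0") (auto simp: powr_diff)
  finally show ?thesis using v by (smt (verit) mult_nonneg_nonneg powr_ge_zero sigma_pos)
next
  case False
  let ?b = "1 / (p - 1)"
  have b: "?b > 0" using p1 by simp
  have v0: "v > 0" using False u w_pos[of x] K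
    by (smt (verit) mult_nonneg_nonneg powr_ge_zero)
  have "u powr (p - 1) \<le> v * (w x * K) powr (-1)"
    using False w_pos[of x] K by (simp add: powr_minus field_simps)
  then have "(u powr (p - 1)) powr ?b \<le> (v * (w x * K) powr (-1)) powr ?b"
    using b by (intro powr_mono2) auto
  then have "u \<le> v powr ?b * (w x powr (- ?b) * K powr (- ?b))"
    using p1 u w_pos[of x] K v0 by (simp add: powr_powr powr_mult powr_minus powr_divide divide_simps)
  then have "u * v \<le> v powr ?b * (w x powr (- ?b) * K powr (- ?b)) * v"
    using v by (intro mult_right_mono)
  also have "\<dots> = K powr (- ?b) * ((v powr ?b * v powr 1) * \<sigma> x)"
    using v0 unfolding \<sigma>_def by simp
  also have "v powr ?b * v powr 1 = v powr q"
    using q_minus_1 by (simp only: powr_add[symmetric]) (simp add: algebra_simps)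
  finally show ?thesis
    using K w_pos[of x] u by (simp add: add_increasing)
qed

lemma measure_eqs:
  assumes "E \<in> sets lebesgue"
  shows "emeasure W E = (\<integral>\<^sup>+x. ennreal (w x) * indicator E x \<partial>lebesgue)"
    "emeasure S E = (\<integral>\<^sup>+x. ennreal (\<sigma> x) * indicator E x \<partial>lebesgue)"
  using assms unfolding W_def S_def by (auto simp: emeasure_density)

lemma lebesgue_le_weights:
  assumes E: "E \<in> sets lebesgue" and "K > 0"
  shows "emeasure lebesgue E \<le> ennreal K * emeasure W E + ennreal (K powr (- 1 / (p - 1))) * emeasure S E"
proof -
  have "emeasure lebesgue E = (\<integral>\<^sup>+x. indicator E x \<partial>lebesgue)" using E by simp
  also have "\<dots> \<le> (\<integral>\<^sup>+x. ennreal K * (ennreal (w x) * indicator E x)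
      + ennreal (K powr (- 1 / (p - 1))) * (ennreal (\<sigma> x) * indicator E x) \<partial>lebesgue)"
  proof (rule nn_integral_mono)
    fix x
    have "ennreal 1 \<le> ennreal (K * w x + K powr (- 1 / (p - 1)) * \<sigma> x)"
      using young_weight[of 1 1 K x] \<open>K > 0\<close> by (intro ennreal_leI) simp
    also have "\<dots> = ennreal K * ennreal (w x) + ennreal (K powr (- 1 / (p - 1))) * ennreal (\<sigma> x)"
      using \<open>K > 0\<close> w_pos[of x] sigma_pos[of x] by (simp add: ennreal_mult less_imp_le)
    finally show "indicator E x \<le> ennreal K * (ennreal (w x) * indicator E x)
      + ennreal (K powr (- 1 / (p - 1))) * (ennreal (\<sigma> x) * indicator E x)"
      by (auto simp: indicator_def)
  qed
  also have "\<dots> = ennreal K * emeasure W E + ennreal (K powr (- 1 / (p - 1))) * emeasure S E"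
    using E by (simp add: measure_eqs nn_integral_add nn_integral_cmult)
  finally show ?thesis .
qed

text \<open>Hoelder's inequality for the factorization 1 = w^(1/p) w^(-1/p), up to the factor
  \<open>2 powr p\<close>. It comes from \<open>lebesgue_le_weights\<close> by choosing the free
  parameter.\<close>

lemma measure_le_weights:
  assumes E: "E \<in> lmeasurable" and WE: "emeasure W E < \<infinity>" and SE: "emeasure S E < \<infinity>"
  shows "measure lebesgue E powr p \<le> 2 powr p * measure W E * measure S E powr (p - 1)"
proof (cases "measure lebesgue E = 0")
  case False
  define m where "m = measure lebesgue E"
  have m: "m > 0" using False by (simp add: m_def zero_less_measure_iff)
  have le: "m \<le> K * measure W E + K powr (- 1 / (p - 1)) * measure S E" if "K > 0" for K
  proof -
    have "ennreal m = emeasure lebesgue E"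
      using E unfolding m_def by (simp add: emeasure_eq_measure2)
    also have "\<dots> \<le> ennreal K * emeasure W E + ennreal (K powr (- 1 / (p - 1))) * emeasure S E"
      using E that by (intro lebesgue_le_weights) auto
    also have "\<dots> = ennreal (K * measure W E + K powr (- 1 / (p - 1)) * measure S E)"
      using WE SE that by (simp add: emeasure_eq_ennreal_measure ennreal_mult less_top)
    finally show ?thesis using that by (subst (asm) ennreal_le_iff) auto
  qed
  \<comment> \<open>If \<open>S E\<close> vanished, a small \<open>K\<close> would make the
    right-hand side of \<open>le\<close> smaller than \<open>m\<close>.\<close>
  have Spos: "measure S E > 0"
  proof (rule ccontr)
    assume "\<not> ?thesis"
    then have S0: "measure S E = 0" by (simp add: zero_less_measure_iff)
    show False
    proof (cases "measure W E = 0")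
      case True
      then show False using le[of 1] S0 m by simp
    next
      case False
      then have "measure W E > 0" by (simp add: zero_less_measure_iff)
      then show False using le[of "m / (2 * measure W E)"] S0 m by simp
    qed
  qed
  \<comment> \<open>With this \<open>K\<close> the second term of \<open>le\<close> is exactly
    \<open>m / 2\<close>, so the first is at least \<open>m / 2\<close>.\<close>
  define K where "K = (2 * measure S E / m) powr (p - 1)"
  have K: "K > 0" using Spos m by (simp add: K_def)
  have "K powr (- 1 / (p - 1)) = inverse (2 * measure S E / m)"
    using p1 Spos m by (simp add: K_def powr_powr powr_minus)
  then have "K powr (- 1 / (p - 1)) * measure S E = m / 2" using Spos m by simp
  then have "m / 2 \<le> K * measure W E" using le[OF K] by simp
  also have "K * measure W E = 2 powr (p - 1) * measure S E powr (p - 1) * measure W E / m powr (p - 1)"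
    using m Spos by (simp add: K_def powr_mult powr_divide)
  finally have "m * m powr (p - 1) \<le> 2 * 2 powr (p - 1) * measure S E powr (p - 1) * measure W E"
    using m by (simp add: field_simps)
  moreover have "m * m powr (p - 1) = m powr p" using m by (simp add: powr_diff)
  moreover have "2 * 2 powr (p - 1) = (2::real) powr p" by (simp add: powr_diff)
  ultimately show ?thesis by (simp add: m_def mult_ac)
qed simp

lemma emeasure_pos:
  assumes "E \<in> sets lebesgue" "emeasure lebesgue E > 0"
  shows "emeasure W E > 0"
proof (rule ccontr)
  assume "\<not> ?thesis"
  then have "AE x in lebesgue. ennreal (w x) * indicator E x = 0"
    using assms by (simp add: measure_eqs nn_integral_0_iff_AE)
  then have "AE x in lebesgue. x \<notin> E"
  proof (rule eventually_mono)
    show "x \<notin> E" if "ennreal (w x) * indicator E x = 0" for x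
      using that w_pos[of x] by (auto simp: indicator_def ennreal_eq_0_iff split: if_splits)
  qed
  then have "emeasure lebesgue E = 0"
    using emeasure_eq_0_AE[of "\<lambda>x. x \<in> E" lebesgue] by simp
  then show False using assms by simp
qed

lemma ApsetD:
  assumes "Apset A Q"
  shows "Q \<in> lmeasurable" "Q \<in> sets lebesgue" "0 < measure lebesgue Q" "emeasure W Q < \<infinity>" "emeasure S Q < \<infinity>"
    "measure W Q * measure S Q powr (p - 1) \<le> A * measure lebesgue Q powr p"
    "measure W Q > 0" "measure S Q > 0" "A > 0"
proof -
  show 1: "Q \<in> lmeasurable" "Q \<in> sets lebesgue" "0 < measure lebesgue Q" "emeasure W Q < \<infinity>" "emeasure S Q < \<infinity>"
    "measure W Q * measure S Q powr (p - 1) \<le> A * measure lebesgue Q powr p"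
    using assms unfolding Apset_def by auto
  have e: "emeasure lebesgue Q > 0" using 1 by (simp add: emeasure_eq_measure2)
  have "emeasure W Q > 0" "emeasure S Q > 0"
    using emeasure_pos[OF 1(2) e] pos_weight.emeasure_pos[OF dual 1(2) e] by (auto simp: dual_W)
  then show 2: "measure W Q > 0" "measure S Q > 0"
    using 1 by (auto simp: measure_def enn2real_positive_iff)
  show "A > 0" using 1 2
    by (smt (verit) mult_pos_pos powr_gt_zero zero_less_mult_pos2)
qed

text \<open>The second part is the doubling property: the Muckenhoupt bound on \<open>Q\<close> is
  set against Hoelder's inequality on \<open>E\<close>, and the common factor
  \<open>measure S Q powr (p - 1)\<close> cancels.\<close>

lemma Apset_subset:
  assumes A: "Apset A Q" and E: "E \<in> sets lebesgue" "E \<subseteq> Q" and c: "c > 0" "measure lebesgue Q \<le> c * measure lebesgue E"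
  shows "Apset (A * c powr p) E" "measure W Q \<le> A * (2 * c) powr p * measure W E"
proof -
  note Q = ApsetD[OF A]
  have Ef: "E \<in> lmeasurable" using Q E by (auto intro: fmeasurableI2)
  have WE: "emeasure W E \<le> emeasure W Q" "emeasure S E \<le> emeasure S Q"
    using E Q by (auto intro!: emeasure_mono)
  have fin: "emeasure W E < \<infinity>" "emeasure S E < \<infinity>" using WE Q by auto
  have mle: "measure W E \<le> measure W Q" "measure S E \<le> measure S Q"
    using WE Q unfolding measure_def by (auto intro!: enn2real_mono)
  have Epos: "measure lebesgue E > 0"
    using Q c by (smt (verit) mult_less_0_iff zero_less_mult_pos)
  have pw: "measure lebesgue Q powr p \<le> c powr p * measure lebesgue E powr p"
    using powr_mono2[of p "measure lebesgue Q" "c * measure lebesgue E"] c p1 by (simp add: powr_mult)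
  have "measure W E * measure S E powr (p - 1) \<le> measure W Q * measure S Q powr (p - 1)"
    using mle p1 by (intro mult_mono powr_mono2) auto
  also have "\<dots> \<le> A * measure lebesgue Q powr p" by (rule Q)
  also have "\<dots> \<le> A * (c powr p * measure lebesgue E powr p)"
    using pw Q by (intro mult_left_mono) auto
  finally show "Apset (A * c powr p) E" unfolding Apset_def using Ef Epos fin by (simp add: mult_ac)
  have "measure W Q * measure S Q powr (p - 1) \<le> A * measure lebesgue Q powr p" by (rule Q)
  also have "\<dots> \<le> A * (c powr p * measure lebesgue E powr p)"
    using pw Q by (intro mult_left_mono) auto
  also have "\<dots> \<le> A * (c powr p * (2 powr p * measure W E * measure S E powr (p - 1)))"
    using Q measure_le_weights[OF Ef fin] by (intro mult_left_mono) auto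
  also have "\<dots> \<le> A * (c powr p * (2 powr p * measure W E * measure S Q powr (p - 1)))"
    using Q mle p1 by (intro mult_left_mono powr_mono2) auto
  also have "\<dots> = (A * (2 * c) powr p * measure W E) * measure S Q powr (p - 1)"
    using c by (simp add: powr_mult)
  finally show "measure W Q \<le> A * (2 * c) powr p * measure W E"
    using Q by (simp add: mult_le_cancel_right)
qed

text \<open>Raising the condition to the power \<open>q - 1\<close>, the reciprocal of
  \<open>p - 1\<close>, exchanges the roles of \<open>W\<close> and \<open>S\<close>.\<close>

lemma Apset_dual:
  assumes A: "Apset A Q"
  shows "pos_weight.Apset q \<sigma> (A powr (q - 1)) Q"
proof -
  note Q = ApsetD[OF A]
  have "measure S Q * measure W Q powr (q - 1) = (measure W Q * measure S Q powr (p - 1)) powr (q - 1)"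
    using Q p1 by (simp add: powr_mult powr_powr q_minus_1)
  also have "\<dots> \<le> (A * measure lebesgue Q powr p) powr (q - 1)"
    using Q q1 by (intro powr_mono2) auto
  also have "\<dots> = A powr (q - 1) * measure lebesgue Q powr q"
    using Q by (simp add: powr_mult powr_powr pq)
  finally show ?thesis
    unfolding pos_weight.Apset_def[OF dual] dual_W dual_S using Q by auto
qed

end

section \<open>Extending the Muckenhoupt condition to larger cubes\<close>

lemma finite_vec_set:
  assumes "finite A"
  shows "finite {v :: 'a^'n. \<forall>c. v $ c \<in> A}"
proof (rule finite_imageD)
  show "finite (vec_nth ` {v :: 'a^'n. \<forall>c. v $ c \<in> A})"
    by (rule finite_subset[OF _ finite_PiE[of "UNIV :: 'n set" "\<lambda>_. A"]]) (use assms in \<open>auto simp: PiE_def\<close>)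
  show "inj_on vec_nth {v :: 'a^'n. \<forall>c. v $ c \<in> A}" by (auto intro: inj_onI simp: vec_nth_inject)
qed

lemma measure_cube:
  assumes "s \<ge> 0"
  shows "measure lebesgue (cbox a (a + vec s :: real^'n)) = s ^ CARD('n)"
proof -
  have "cbox a (a + vec s) \<noteq> {}" using assms by (auto simp: interval_ne_empty_cart(1))
  then have "measure lborel (cbox a (a + vec s)) = s ^ CARD('n)"
    by (simp add: content_cbox_cart)
  then show ?thesis by simp
qed

context pos_weight
begin

text \<open>A cube of side \<open>s \<le> 2 * h\<close> is cut into subcubes \<open>Q v\<close> of
  half the side, to which the condition applies. Each of them overlaps the concentric cube
  \<open>M\<close> of half the side in a cube \<open>E v\<close> of a quarter of the side. Doubling
  inside \<open>Q v\<close> bounds its weight by that of \<open>E v\<close>, hence by that of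
  \<open>M\<close>.\<close>

lemma weight_le_middle:
  assumes A: "\<And>a s. 0 < s \<Longrightarrow> s \<le> h \<Longrightarrow> Apset A (cbox a (a + vec s))"
  shows "\<exists>K>0. \<forall>a s. 0 < s \<longrightarrow> s \<le> 2 * h \<longrightarrow> emeasure W (cbox a (a + vec s)) < \<infinity> \<and>
    measure W (cbox a (a + vec s)) \<le> K * measure W (cbox (a + vec (s/4)) (a + vec (s/4) + vec (s/2)))"
proof -
  define V where "V = {v :: real^'n. \<forall>c. v $ c \<in> {0, 1}}"
  have finV: "finite V" unfolding V_def by (rule finite_vec_set) simp
  define K where "K = \<bar>A\<bar> * (2 * 2 ^ CARD('n)) powr p"
  have main: "emeasure W (cbox a (a + vec s)) < \<infinity> \<and>
    measure W (cbox a (a + vec s)) \<le> (real (card V) * K + 1) * measure W (cbox (a + vec (s/4)) (a + vec (s/4) + vec (s/2)))"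
    if s: "0 < s" "s \<le> 2 * h" for a s
  proof -
    define M where "M = cbox (a + vec (s/4)) (a + vec (s/4) + vec (s/2))"
    define Q where "Q v = cbox (a + (s/2) *\<^sub>R v) (a + (s/2) *\<^sub>R v + vec (s/2))" for v
    define E where "E v = cbox (a + (s/4) *\<^sub>R (vec 1 + v)) (a + (s/4) *\<^sub>R (vec 1 + v) + vec (s/4))" for v
    have ApQ: "Apset A (Q v)" for v unfolding Q_def using s by (intro A) auto
    have ApM: "Apset A M" unfolding M_def using s by (intro A) auto
    note M = ApsetD[OF ApM]
    have A0: "A > 0" using M by auto
    have EQ: "E v \<subseteq> Q v" "E v \<subseteq> M" if "v \<in> V" for v
    proof -
      have v: "v $ c = 0 \<or> v $ c = 1" for c using that by (auto simp: V_def)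
      have "x \<in> Q v \<inter> M" if "x \<in> E v" for x
      proof -
        have "a $ c + s/2 * v $ c \<le> x $ c \<and> x $ c \<le> a $ c + s/2 * v $ c + s/2
          \<and> a $ c + s/4 \<le> x $ c \<and> x $ c \<le> a $ c + s/4 + s/2" for c
        proof -
          have "a $ c + s/4 * (1 + v $ c) \<le> x $ c" "x $ c \<le> a $ c + s/4 * (1 + v $ c) + s/4"
            using that unfolding E_def by (auto simp: mem_box_cart)
          then show ?thesis using v[of c] s by auto
        qed
        then show ?thesis unfolding Q_def M_def by (simp add: mem_box_cart)
      qed
      then show "E v \<subseteq> Q v" "E v \<subseteq> M" by auto
    qed
    have WQ: "measure W (Q v) \<le> K * measure W M" if v: "v \<in> V" for v
    proof -
      have "measure lebesgue (Q v) \<le> 2 ^ CARD('n) * measure lebesgue (E v)"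
        using s unfolding Q_def E_def
        by (simp add: measure_cube power_mult_distrib[symmetric] del: measure_completion)
      then have "measure W (Q v) \<le> K * measure W (E v)"
        using Apset_subset(2)[OF ApQ[of v], of "E v" "2 ^ CARD('n)"] EQ[OF v] A0 unfolding K_def
        by (auto simp: E_def)
      also have "\<dots> \<le> K * measure W M"
        using EQ[OF v] M A0 by (intro mult_left_mono measure_mono_fmeasurable) (auto simp: fmeasurable_def E_def K_def)
      finally show ?thesis .
    qed
    have cover: "cbox a (a + vec s) \<subseteq> (\<Union>v\<in>V. Q v)"
    proof
      fix x assume x: "x \<in> cbox a (a + vec s)"
      define v :: "real^'n" where "v = (\<chi> c. if x $ c \<le> a $ c + s/2 then 0 else 1)"
      have "v \<in> V" by (auto simp: V_def v_def)
      moreover have "x \<in> Q v" using x s unfolding Q_def v_def by (auto simp: mem_box_cart add.commute)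
      ultimately show "x \<in> (\<Union>v\<in>V. Q v)" by blast
    qed
    have "emeasure W (cbox a (a + vec s)) \<le> emeasure W (\<Union>v\<in>V. Q v)"
      using cover finV by (intro emeasure_mono) (auto simp: Q_def)
    also have "\<dots> \<le> (\<Sum>v\<in>V. emeasure W (Q v))"
      using finV by (intro emeasure_subadditive_finite) (auto simp: Q_def)
    also have "\<dots> = (\<Sum>v\<in>V. ennreal (measure W (Q v)))"
      using ApsetD(4)[OF ApQ] by (intro sum.cong refl) (simp add: emeasure_eq_ennreal_measure less_top)
    also have "\<dots> = ennreal (\<Sum>v\<in>V. measure W (Q v))" by simp
    finally have le: "emeasure W (cbox a (a + vec s)) \<le> ennreal (\<Sum>v\<in>V. measure W (Q v))" .
    then have "emeasure W (cbox a (a + vec s)) < \<infinity>" by (simp add: le_less_trans)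
    moreover have "measure W (cbox a (a + vec s)) \<le> (\<Sum>v\<in>V. measure W (Q v))"
      using le unfolding measure_def by (intro enn2real_leI) (auto intro: sum_nonneg)
    moreover have "(\<Sum>v\<in>V. measure W (Q v)) \<le> real (card V) * (K * measure W M)"
      using WQ by (intro sum_bounded_above) auto
    ultimately show ?thesis unfolding M_def[symmetric] by (auto simp: algebra_simps intro: add_increasing)
  qed
  show ?thesis
    by (intro exI[of _ "real (card V) * K + 1"] conjI) (use main in \<open>auto simp: K_def intro!: add_nonneg_pos\<close>)
qed

text \<open>\<open>W\<close> and \<open>S\<close> of the large cube are both controlled by their
  values on the concentric cube of half the side, on which the condition is known.\<close>

lemma Apset_double:
  assumes A: "\<And>a s. 0 < s \<Longrightarrow> s \<le> h \<Longrightarrow> Apset A (cbox a (a + vec s))" and h: "h > 0"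
  shows "\<exists>A'. \<forall>a s. 0 < s \<longrightarrow> s \<le> 2 * h \<longrightarrow> Apset A' (cbox a (a + vec s))"
proof -
  obtain K where K: "K > 0" and KW: "\<And>a s. 0 < s \<Longrightarrow> s \<le> 2 * h \<Longrightarrow> emeasure W (cbox a (a + vec s)) < \<infinity> \<and>
    measure W (cbox a (a + vec s)) \<le> K * measure W (cbox (a + vec (s/4)) (a + vec (s/4) + vec (s/2)))"
    using weight_le_middle[of h A, OF A] by metis
  obtain L where L: "L > 0" and LS: "\<And>a s. 0 < s \<Longrightarrow> s \<le> 2 * h \<Longrightarrow> emeasure S (cbox a (a + vec s)) < \<infinity> \<and>
    measure S (cbox a (a + vec s)) \<le> L * measure S (cbox (a + vec (s/4)) (a + vec (s/4) + vec (s/2)))"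
    using pos_weight.weight_le_middle[OF dual, of h "A powr (q - 1)"] Apset_dual[OF A] unfolding dual_W by metis
  have "Apset (K * L powr (p - 1) * A) (cbox a (a + vec s))" if s: "0 < s" "s \<le> 2 * h" for a s
  proof -
    let ?R = "cbox a (a + vec s)" and ?M = "cbox (a + vec (s/4)) (a + vec (s/4) + vec (s/2))"
    have ApM: "Apset A ?M" using s by (intro A) auto
    note M = ApsetD[OF ApM]
    have "measure W ?R * measure S ?R powr (p - 1) \<le> (K * measure W ?M) * (L * measure S ?M) powr (p - 1)"
      using KW[OF s, of a] LS[OF s, of a] p1 K by (intro mult_mono powr_mono2) auto
    also have "\<dots> = K * L powr (p - 1) * (measure W ?M * measure S ?M powr (p - 1))"
      using L by (simp add: powr_mult)
    also have "\<dots> \<le> K * L powr (p - 1) * (A * measure lebesgue ?M powr p)"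
      using M K L by (intro mult_left_mono) auto
    also have "\<dots> \<le> K * L powr (p - 1) * (A * measure lebesgue ?R powr p)"
    proof -
      have "measure lebesgue ?M \<le> measure lebesgue ?R"
        using s by (simp only: measure_cube) (auto intro!: power_mono simp: measure_cube)
      then show ?thesis using M K L p1 by (intro mult_left_mono powr_mono2) auto
    qed
    finally show ?thesis
      unfolding Apset_def using KW[OF s, of a] LS[OF s, of a] s
      by (simp add: measure_cube mult_ac del: measure_completion)
  qed
  then show ?thesis by blast
qed

text \<open>The constant may grow with \<open>k\<close>. This is harmless, because wavelets from a
  fixed coarsest level on live on cubes of bounded size.\<close>

lemma Apset_all_scales:
  assumes A: "\<And>a s. 0 < s \<Longrightarrow> s \<le> 1 \<Longrightarrow> Apset A (cbox a (a + vec s))"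
  shows "\<exists>A'. \<forall>a s. 0 < s \<longrightarrow> s \<le> 2 ^ k \<longrightarrow> Apset A' (cbox a (a + vec s))"
proof (induction k)
  case 0
  then show ?case using A by (intro exI[of _ A]) auto
next
  case (Suc k)
  then obtain A' where "\<And>a s. 0 < s \<Longrightarrow> s \<le> 2 ^ k \<Longrightarrow> Apset A' (cbox a (a + vec s))" by blast
  from Apset_double[OF this] show ?case by simp
qed

end

section \<open>Weighted bounds for sparse sums\<close>

lemma set_lebesgue_integral_nonneg:
  fixes f :: "'a \<Rightarrow> real"
  assumes "\<And>x. 0 \<le> f x"
  shows "0 \<le> (LINT x:A|M. f x)"
  unfolding set_lebesgue_integral_def using assms by (intro Bochner_Integration.integral_nonneg) auto

context pos_weight
begin

lemma nn_integral_W: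
  assumes "f \<in> borel_measurable lebesgue"
  shows "(\<integral>\<^sup>+x. f x \<partial>W) = (\<integral>\<^sup>+x. ennreal (w x) * f x \<partial>lebesgue)"
  unfolding W_def by (rule nn_integral_density) (use assms in auto)

lemma nn_integral_S:
  assumes "f \<in> borel_measurable lebesgue"
  shows "(\<integral>\<^sup>+x. f x \<partial>S) = (\<integral>\<^sup>+x. ennreal (\<sigma> x) * f x \<partial>lebesgue)"
  unfolding S_def by (rule nn_integral_density) (use assms in auto)

text \<open>Young's inequality against the constant 1 dominates \<open>f\<close> by
  \<open>w x * f x powr p + \<sigma> x\<close>. This makes averages and wavelet coefficients
  meaningful for functions that are only known to lie in the weighted space.\<close>

lemma weighted_integrable:
  assumes f[measurable]: "f \<in> borel_measurable lebesgue" and f0: "\<And>x. f x \<ge> 0"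
    and fp: "(\<integral>\<^sup>+x. ennreal (f x powr p) \<partial>W) < \<infinity>"
    and Q: "Q \<in> sets lebesgue" "emeasure S Q < \<infinity>"
  shows "set_integrable lebesgue Q f"
  unfolding set_integrable_def
proof (rule integrableI_bounded)
  show "(\<lambda>x. indicat_real Q x *\<^sub>R f x) \<in> borel_measurable lebesgue" using Q by measurable
  have "(\<integral>\<^sup>+x. ennreal (norm (indicat_real Q x *\<^sub>R f x)) \<partial>lebesgue)
      \<le> (\<integral>\<^sup>+x. ennreal (w x) * ennreal (f x powr p) + ennreal (\<sigma> x) * indicator Q x \<partial>lebesgue)"
  proof (rule nn_integral_mono)
    fix x
    have "ennreal (f x) \<le> ennreal (w x * f x powr p + \<sigma> x)"
      using young_weight[of "f x" 1 1 x] f0 by (intro ennreal_leI) (simp add: mult.commute)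
    also have "\<dots> = ennreal (w x) * ennreal (f x powr p) + ennreal (\<sigma> x)"
      using w_pos[of x] sigma_pos[of x] by (simp add: ennreal_mult less_imp_le)
    finally show "ennreal (norm (indicat_real Q x *\<^sub>R f x)) \<le> ennreal (w x) * ennreal (f x powr p) + ennreal (\<sigma> x) * indicator Q x"
      using f0 by (auto simp: indicator_def)
  qed
  also have "\<dots> = (\<integral>\<^sup>+x. ennreal (f x powr p) \<partial>W) + emeasure S Q"
    using Q by (subst nn_integral_add) (auto simp: nn_integral_W measure_eqs)
  also have "\<dots> < \<infinity>" using fp Q by (simp add: ennreal_add_less_top)
  finally show "(\<integral>\<^sup>+x. ennreal (norm (indicat_real Q x *\<^sub>R f x)) \<partial>lebesgue) < \<infinity>" .
qed

text \<open>The \<open>p\<close>-th power of the sparse sum \<open>F\<close> is written as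
  \<open>F\<close> times \<open>F powr (p - 1)\<close>. Its integral \<open>I\<close> becomes a sum
  of products of two averages: \<open>u\<close>, taken with respect to \<open>S\<close>, and
  \<open>v\<close>, the average of \<open>F powr (p - 1)\<close> with respect to \<open>W\<close>.
  Young's inequality on each set, the Muckenhoupt condition and two Carleson embeddings bound
  \<open>I\<close> by a multiple of the integral of \<open>f powr p\<close> plus at most
  \<open>I / 2\<close>.\<close>

lemma sparse_weighted_bound:
  "\<exists>C>0. \<forall>\<S> E f. finite \<S> \<and> laminar \<S> \<and> disjoint_family_on E \<S> \<and>
    (\<forall>Q\<in>\<S>. Apset A Q \<and> E Q \<in> sets lebesgue \<and> E Q \<subseteq> Q \<and> measure lebesgue Q \<le> 2 * measure lebesgue (E Q)) \<and>
    f \<in> borel_measurable lebesgue \<and> (\<forall>x. f x \<ge> 0) \<longrightarrow>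
    (\<integral>\<^sup>+x. ennreal ((\<Sum>Q\<in>\<S>. (LINT x:Q|lebesgue. f x) / measure lebesgue Q * indicator Q x) powr p) \<partial>W)
      \<le> ennreal C * (\<integral>\<^sup>+x. ennreal (f x powr p) \<partial>W)"
proof -
  \<comment> \<open>\<open>K1\<close> and \<open>K2\<close> are the factors lost in replacing the
    \<open>S\<close>- and \<open>W\<close>-measure of \<open>Q\<close> by those of
    \<open>E Q\<close>; the 4 is twice the sparseness factor 2.\<close>
  define K1 where "K1 = A powr (q - 1) * 4 powr q"
  define K2 where "K2 = A * 4 powr p"
  define C1 where "C1 = p * 2 powr p / (p - 1)"
  define C2 where "C2 = q * 2 powr q / (q - 1)"
  \<comment> \<open>\<open>B\<close> is the factor with which \<open>I\<close> would return on the
    right-hand side. The weight \<open>l\<close> is such that \<open>l powr (- 1 / (p - 1))\<close>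
    equals \<open>1 / (2 * B + 1)\<close>, which brings this factor below one half.\<close>
  define B where "B = A powr (q - 1) * K2 * C2"
  define l where "l = (2 * B + 1) powr (p - 1)"
  have C12: "C1 > 0" "C2 > 0" using p1 q1 by (auto simp: C1_def C2_def)
  show ?thesis
  proof (intro exI[of _ "2 * l * K1 * C1 + 1"] conjI allI impI)
    show "2 * l * K1 * C1 + 1 > 0"
      using C12 by (intro add_nonneg_pos mult_nonneg_nonneg) (auto simp: l_def K1_def)
    fix \<S> :: "(real^'n) set set" and E :: "(real^'n) set \<Rightarrow> (real^'n) set" and f :: "real^'n \<Rightarrow> real"
    assume asm: "finite \<S> \<and> laminar \<S> \<and> disjoint_family_on E \<S> \<and>
      (\<forall>Q\<in>\<S>. Apset A Q \<and> E Q \<in> sets lebesgue \<and> E Q \<subseteq> Q \<and> measure lebesgue Q \<le> 2 * measure lebesgue (E Q)) \<and>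
      f \<in> borel_measurable lebesgue \<and> (\<forall>x. f x \<ge> 0)"
    then have fin: "finite \<S>" and lam: "laminar \<S>" and dis: "disjoint_family_on E \<S>"
      and Ap: "\<And>Q. Q \<in> \<S> \<Longrightarrow> Apset A Q" and Em: "\<And>Q. Q \<in> \<S> \<Longrightarrow> E Q \<in> sets lebesgue"
      and EQ: "\<And>Q. Q \<in> \<S> \<Longrightarrow> E Q \<subseteq> Q" and E2: "\<And>Q. Q \<in> \<S> \<Longrightarrow> measure lebesgue Q \<le> 2 * measure lebesgue (E Q)"
      and f[measurable]: "f \<in> borel_measurable lebesgue" and f0: "\<And>x. f x \<ge> 0" by auto
    define m where "m Q = (LINT x:Q|lebesgue. f x) / measure lebesgue Q" for Q
    define F where "F x = (\<Sum>Q\<in>\<S>. m Q * indicator Q x)" for x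
    define J where "J = (\<integral>\<^sup>+x. ennreal (f x powr p) \<partial>W)"
    note D = ApsetD[OF Ap]
    have "(\<integral>\<^sup>+x. ennreal (F x powr p) \<partial>W) \<le> ennreal (2 * l * K1 * C1 + 1) * J"
    proof (cases "\<S> = {} \<or> J = \<infinity>")
      case True
      have "2 * l * K1 * C1 + 1 > 0"
        using C12 by (intro add_nonneg_pos mult_nonneg_nonneg) (auto simp: l_def K1_def)
      then show ?thesis using True by (auto simp: F_def ennreal_mult_top ennreal_mult_eq_top_iff)
    next
      case False
      then have Jfin: "J < \<infinity>" by (simp add: less_top)
      from False obtain Q0 where Q0: "Q0 \<in> \<S>" by blast
      have A0: "A > 0" using D[OF Q0] by simp
      have m0: "m Q \<ge> 0" for Q unfolding m_def using f0 by (auto intro!: divide_nonneg_nonneg set_lebesgue_integral_nonneg)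
      have F0: "F x \<ge> 0" for x unfolding F_def using m0 by (intro sum_nonneg) auto
      have SL: "Q \<in> sets lebesgue" if "Q \<in> \<S>" for Q using D[OF that] by simp
      have Fm[measurable]: "F \<in> borel_measurable lebesgue"
        unfolding F_def using SL by (intro borel_measurable_sum borel_measurable_times borel_measurable_indicator) auto
      have fint: "set_integrable lebesgue Q f" if "Q \<in> \<S>" for Q
        using weighted_integrable[OF f f0 _ SL[OF that]] Jfin D[OF that] unfolding J_def by auto
      \<comment> \<open>\<open>F\<close> is bounded and lives on a set of finite weight, so
        \<open>I\<close> is finite and can be absorbed later.\<close>
      define Bd where "Bd = (\<Sum>Q\<in>\<S>. m Q)"
      have FBd: "F x \<le> Bd" for x
        unfolding F_def Bd_def using m0 by (intro sum_mono) (auto simp: indicator_def)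
      define U where "U = \<Union>\<S>"
      have Um: "U \<in> sets lebesgue" unfolding U_def using SL fin by (intro sets.finite_Union) auto
      have WU: "emeasure W U < \<infinity>"
      proof -
        have "emeasure W U \<le> (\<Sum>Q\<in>\<S>. emeasure W Q)"
          unfolding U_def using emeasure_subadditive_finite[of \<S> id W] fin SL by auto
        also have "\<dots> < \<infinity>" using D fin by (auto simp: less_top)
        finally show ?thesis .
      qed
      have Fout: "F x = 0" if "x \<notin> U" for x
        unfolding F_def by (rule sum.neutral) (use that in \<open>auto simp: U_def\<close>)
      have Fpow: "integrable W (\<lambda>x. F x powr r)" if r: "r > 0" for r
      proof (rule integrableI_bounded)
        show "(\<lambda>x. F x powr r) \<in> borel_measurable W" by measurable
        have "(\<integral>\<^sup>+x. ennreal (norm (F x powr r)) \<partial>W) \<le> (\<integral>\<^sup>+x. ennreal (Bd powr r) * indicator U x \<partial>W)"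
          using F0 FBd r by (intro nn_integral_mono) (auto simp: indicator_def Fout intro!: ennreal_leI powr_mono2)
        also have "\<dots> = ennreal (Bd powr r) * emeasure W U"
          using Um by (intro nn_integral_cmult_indicator) simp
        also have "\<dots> < \<infinity>" using WU by (simp add: ennreal_mult_less_top)
        finally show "(\<integral>\<^sup>+x. ennreal (norm (F x powr r)) \<partial>W) < \<infinity>" .
      qed
      define I where "I = (LINT x|W. F x powr p)"
      have I0: "I \<ge> 0" unfolding I_def by (intro Bochner_Integration.integral_nonneg) auto
      have I_nn: "(\<integral>\<^sup>+x. ennreal (F x powr p) \<partial>W) = ennreal I"
        unfolding I_def using p1 by (intro nn_integral_eq_integral Fpow) auto
      define v where "v Q = (LINT x:Q|W. F x powr (p - 1)) / measure W Q" for Q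
      \<comment> \<open>The \<open>S\<close>-average of the quotient of \<open>f\<close> by
        \<sigma>: the density of \<open>S\<close> cancels the denominator.\<close>
      define u where "u Q = (LINT x:Q|lebesgue. f x) / measure S Q" for Q
      have v0: "v Q \<ge> 0" and u0: "u Q \<ge> 0" for Q
        unfolding v_def u_def using f0 by (auto intro!: divide_nonneg_nonneg set_lebesgue_integral_nonneg)
      have setint: "set_integrable W Q (\<lambda>x. F x powr (p - 1))" if "Q \<in> \<S>" for Q
        unfolding set_integrable_def using Fpow[of "p - 1"] p1 SL[OF that]
        by (intro integrable_mult_indicator) auto
      have I_eq: "I = (\<Sum>Q\<in>\<S>. m Q * (v Q * measure W Q))"
      proof -
        have "F x powr p = (\<Sum>Q\<in>\<S>. m Q * (indicat_real Q x *\<^sub>R F x powr (p - 1)))" for x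
        proof -
          have "F x powr p = F x * F x powr (p - 1)"
            using F0[of x] by (cases "F x = 0") (auto simp: powr_diff)
          also have "\<dots> = (\<Sum>Q\<in>\<S>. m Q * indicator Q x * F x powr (p - 1))"
            by (subst (1) F_def) (simp add: sum_distrib_right)
          finally show ?thesis by (simp add: mult_ac)
        qed
        then have "I = (LINT x|W. (\<Sum>Q\<in>\<S>. m Q * (indicat_real Q x *\<^sub>R F x powr (p - 1))))"
          unfolding I_def by presburger
        also have "\<dots> = (\<Sum>Q\<in>\<S>. LINT x|W. m Q * (indicat_real Q x *\<^sub>R F x powr (p - 1)))"
          using setint unfolding set_integrable_def
          by (intro Bochner_Integration.integral_sum integrable_mult_right) auto
        also have "\<dots> = (\<Sum>Q\<in>\<S>. m Q * (LINT x:Q|W. F x powr (p - 1)))"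
          unfolding set_lebesgue_integral_def by (simp only: integral_mult_right_zero)
        also have "\<dots> = (\<Sum>Q\<in>\<S>. m Q * (v Q * measure W Q))"
        proof (rule sum.cong[OF refl])
          fix Q assume "Q \<in> \<S>"
          then have "measure W Q \<noteq> 0" using D(7)[of Q] by simp
          then show "m Q * (LINT x:Q|W. F x powr (p - 1)) = m Q * (v Q * measure W Q)" by (simp add: v_def)
        qed
        finally show ?thesis .
      qed
      have EW: "emeasure W (E Q) = ennreal (measure W (E Q))" "emeasure S (E Q) = ennreal (measure S (E Q))"
        if "Q \<in> \<S>" for Q
      proof -
        have "emeasure W (E Q) \<le> emeasure W Q" "emeasure S (E Q) \<le> emeasure S Q"
          using EQ[OF that] SL[OF that] by (auto intro!: emeasure_mono)
        then show "emeasure W (E Q) = ennreal (measure W (E Q))" "emeasure S (E Q) = ennreal (measure S (E Q))"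
          using D(4,5)[OF that] by (auto intro!: emeasure_eq_ennreal_measure dest: le_less_trans)
      qed
      have vsum: "(\<Sum>Q\<in>\<S>. v Q powr q * measure W (E Q)) \<le> C2 * I"
      proof -
        have "(\<Sum>Q\<in>\<S>. ennreal (v Q powr q) * emeasure W (E Q))
          \<le> ennreal (q * 2 powr q / (q - 1)) * (\<integral>\<^sup>+x. ennreal ((F x powr (p - 1)) powr q) \<partial>W)"
        proof (rule carleson_embedding[OF sigma_finite_W fin lam])
          fix Q assume Q: "Q \<in> \<S>"
          have "(\<integral>\<^sup>+x. ennreal (F x powr (p - 1)) * indicator Q x \<partial>W) = ennreal (LINT x:Q|W. F x powr (p - 1))"
            unfolding set_lebesgue_integral_def
            by (subst nn_integral_eq_integral[symmetric]) (use setint[OF Q] in \<open>auto simp: set_integrable_def indicator_def intro!: nn_integral_cong\<close>)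
          then show "ennreal (v Q) * emeasure W Q \<le> (\<integral>\<^sup>+x. ennreal (F x powr (p - 1)) * indicator Q x \<partial>W)"
            using D[OF Q] v0 by (simp add: v_def emeasure_eq_ennreal_measure less_top ennreal_mult''[symmetric])
        qed (use dis SL D Em EQ v0 q1 in auto)
        also have "(\<integral>\<^sup>+x. ennreal ((F x powr (p - 1)) powr q) \<partial>W) = ennreal I"
          unfolding I_nn[symmetric] using qp by (simp add: powr_powr mult.commute)
        finally have "ennreal (\<Sum>Q\<in>\<S>. v Q powr q * measure W (E Q)) \<le> ennreal (C2 * I)"
          using C12 I0 by (simp add: EW ennreal_mult[symmetric] C2_def cong: sum.cong)
        then show ?thesis using C12 I0 by (subst (asm) ennreal_le_iff) auto
      qed
      have Jr: "J = ennreal (enn2real J)" using Jfin by (simp add: less_top)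
      have usum: "(\<Sum>Q\<in>\<S>. u Q powr p * measure S (E Q)) \<le> C1 * enn2real J"
      proof -
        have "(\<Sum>Q\<in>\<S>. ennreal (u Q powr p) * emeasure S (E Q))
          \<le> ennreal (p * 2 powr p / (p - 1)) * (\<integral>\<^sup>+x. ennreal ((f x / \<sigma> x) powr p) \<partial>S)"
        proof (rule carleson_embedding[OF sigma_finite_S fin lam])
          fix Q assume Q: "Q \<in> \<S>"
          have [measurable]: "Q \<in> sets lebesgue" using SL[OF Q] .
          have "(\<integral>\<^sup>+x. ennreal (f x / \<sigma> x) * indicator Q x \<partial>S) = (\<integral>\<^sup>+x. ennreal (indicat_real Q x *\<^sub>R f x) \<partial>lebesgue)"
          proof (subst nn_integral_S)
            show "(\<lambda>x. ennreal (f x / \<sigma> x) * indicator Q x) \<in> borel_measurable lebesgue" by measurable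
            show "(\<integral>\<^sup>+x. ennreal (\<sigma> x) * (ennreal (f x / \<sigma> x) * indicator Q x) \<partial>lebesgue)
              = (\<integral>\<^sup>+x. ennreal (indicat_real Q x *\<^sub>R f x) \<partial>lebesgue)"
            proof (rule nn_integral_cong)
              fix x show "ennreal (\<sigma> x) * (ennreal (f x / \<sigma> x) * indicator Q x) = ennreal (indicat_real Q x *\<^sub>R f x)"
                using sigma_pos[of x] f0[of x] by (auto simp: indicator_def ennreal_mult[symmetric])
            qed
          qed
          also have "\<dots> = ennreal (LINT x:Q|lebesgue. f x)"
            unfolding set_lebesgue_integral_def
            by (rule nn_integral_eq_integral) (use fint[OF Q] f0 in \<open>auto simp: set_integrable_def\<close>)
          finally show "ennreal (u Q) * emeasure S Q \<le> (\<integral>\<^sup>+x. ennreal (f x / \<sigma> x) * indicator Q x \<partial>S)"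
            using D[OF Q] u0 by (simp add: u_def emeasure_eq_ennreal_measure less_top ennreal_mult''[symmetric])
        qed (use dis SL D Em EQ u0 p1 f0 sigma_pos in \<open>auto intro: divide_nonneg_pos\<close>)
        \<comment> \<open>Since \<sigma> to the power \<open>1 - p\<close> is \<open>w\<close>, the
          \<open>p\<close>-th power of the quotient integrates against \<open>S\<close> to the same
          value as that of \<open>f\<close> against \<open>W\<close>.\<close>
        also have "(\<integral>\<^sup>+x. ennreal ((f x / \<sigma> x) powr p) \<partial>S) = J"
        proof -
          have "ennreal (\<sigma> x) * ennreal ((f x / \<sigma> x) powr p) = ennreal (w x) * ennreal (f x powr p)" for x
          proof -
            have "\<sigma> x * (f x / \<sigma> x) powr p = \<sigma> x powr (1 - p) * f x powr p"
              using sigma_pos[of x] f0[of x] by (simp add: powr_divide powr_diff)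
            then show ?thesis using sigma_pos[of x] w_pos[of x]
              by (simp add: ennreal_mult[symmetric] less_imp_le sigma_powr_1p)
          qed
          then show ?thesis unfolding J_def by (subst nn_integral_S, measurable, subst nn_integral_W) auto
        qed
        finally have "ennreal (\<Sum>Q\<in>\<S>. u Q powr p * measure S (E Q)) \<le> ennreal (C1 * enn2real J)"
          using C12 by (subst (asm) Jr) (simp add: EW ennreal_mult[symmetric] C1_def cong: sum.cong)
        then show ?thesis using C12 by (subst (asm) ennreal_le_iff) auto
      qed
      have B0: "B \<ge> 0" using C12 by (simp add: B_def K2_def A0 less_imp_le)
      have l0: "l > 0" using B0 by (simp add: l_def)
      have lb: "l powr (- 1 / (p - 1)) = 1 / (2 * B + 1)"
        using p1 B0 by (simp add: l_def powr_powr powr_minus divide_inverse)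
      have bnd: "m Q * (v Q * measure W Q)
          \<le> l * K1 * (u Q powr p * measure S (E Q)) + 1 / (2 * B + 1) * A powr (q - 1) * K2 * (v Q powr q * measure W (E Q))"
        if Q: "Q \<in> \<S>" for Q
      proof -
        define mm where "mm = measure lebesgue Q"
        define a where "a = measure W Q" define b where "b = measure S Q"
        have pos: "mm > 0" "a > 0" "b > 0" using D[OF Q] unfolding mm_def a_def b_def by auto
        \<comment> \<open>Young's inequality for numbers is the lemma of the locale at weight 1. The
          ratio of Lebesgue measure to \<open>W\<close>-measure in \<open>L\<close> turns the first
          term into \<open>S\<close>-measure exactly and leaves the Muckenhoupt quotient in the
          second.\<close>
        define L where "L = l * mm / a"
        have L: "L > 0" using l0 pos by (simp add: L_def)
        interpret one: pos_weight p "\<lambda>_::real^'n. 1" by unfold_locales (use p1 in auto)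
        have yo: "u Q * v Q \<le> L * u Q powr p + L powr (- 1 / (p - 1)) * v Q powr q"
          using one.young_weight[OF u0[of Q] v0[of Q] L] unfolding one.\<sigma>_def one.q_def q_def by simp
        have "m Q * (v Q * a) = (u Q * v Q) * (b * a / mm)"
          using pos by (simp add: m_def u_def mm_def a_def b_def)
        also have "\<dots> \<le> (L * u Q powr p + L powr (- 1 / (p - 1)) * v Q powr q) * (b * a / mm)"
          using yo pos by (intro mult_right_mono) auto
        also have "\<dots> = l * u Q powr p * b + v Q powr q * (L powr (- 1 / (p - 1)) * (b * a / mm))"
          using pos by (simp add: L_def field_simps)
        also have "L powr (- 1 / (p - 1)) * (b * a / mm) \<le> 1 / (2 * B + 1) * A powr (q - 1) * a"
        proof -
          have "b * a powr (q - 1) \<le> A powr (q - 1) * mm powr q"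
          proof -
            have "a * b powr (p - 1) \<le> A * mm powr p" using D(6)[OF Q] by (simp add: a_def b_def mm_def)
            then have "(a * b powr (p - 1)) powr (q - 1) \<le> (A * mm powr p) powr (q - 1)"
              using pos q1 by (intro powr_mono2) auto
            then show ?thesis using pos A0 p1 by (simp add: powr_mult powr_powr pq) (simp add: q_minus_1 mult.commute)
          qed
          then have *: "b * a powr (q - 1) / mm powr q \<le> A powr (q - 1)" using pos by (simp add: field_simps)
          have "L powr (- 1 / (p - 1)) = 1 / (2 * B + 1) * (mm powr (- (q - 1)) * a powr (q - 1))"
          proof -
            have "L powr (- (q - 1)) = l powr (- (q - 1)) * (mm powr (- (q - 1)) * a powr (q - 1))"
              using pos l0 by (simp add: L_def powr_mult powr_divide powr_minus divide_simps flip: powr_add)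
            then show ?thesis using lb by (simp add: q_minus_1)
          qed
          then have "L powr (- 1 / (p - 1)) * (b * a / mm) = 1 / (2 * B + 1) * (b * a powr (q - 1) / mm powr q) * a"
            using pos by (simp add: powr_diff powr_minus field_simps)
          also have "\<dots> \<le> 1 / (2 * B + 1) * A powr (q - 1) * a"
            using * pos B0 by (intro mult_right_mono mult_left_mono) auto
          finally show ?thesis .
        qed
        then have "l * u Q powr p * b + v Q powr q * (L powr (- 1 / (p - 1)) * (b * a / mm))
            \<le> l * u Q powr p * b + v Q powr q * (1 / (2 * B + 1) * A powr (q - 1) * a)"
          by (intro add_left_mono mult_left_mono) auto
        also have "\<dots> \<le> l * u Q powr p * (K1 * measure S (E Q)) + v Q powr q * (1 / (2 * B + 1) * A powr (q - 1) * (K2 * measure W (E Q)))"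
        proof -
          have a_le: "a \<le> K2 * measure W (E Q)"
            using Apset_subset(2)[OF Ap[OF Q] Em[OF Q] EQ[OF Q], of 2] E2[OF Q] by (simp add: a_def K2_def)
          have b_le: "b \<le> K1 * measure S (E Q)"
            using pos_weight.Apset_subset(2)[OF dual Apset_dual[OF Ap[OF Q]] Em[OF Q] EQ[OF Q], of 2] E2[OF Q]
            by (simp add: b_def K1_def dual_W)
          show ?thesis using a_le b_le l0 B0 by (intro add_mono mult_left_mono) auto
        qed
        finally show ?thesis by (simp add: a_def mult_ac)
      qed
      have "I \<le> (\<Sum>Q\<in>\<S>. l * K1 * (u Q powr p * measure S (E Q)) + 1 / (2 * B + 1) * A powr (q - 1) * K2 * (v Q powr q * measure W (E Q)))"
        unfolding I_eq by (intro sum_mono bnd)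
      also have "\<dots> = l * K1 * (\<Sum>Q\<in>\<S>. u Q powr p * measure S (E Q))
          + 1 / (2 * B + 1) * A powr (q - 1) * K2 * (\<Sum>Q\<in>\<S>. v Q powr q * measure W (E Q))"
        by (simp add: sum.distrib sum_distrib_left)
      also have "\<dots> \<le> l * K1 * (C1 * enn2real J) + 1 / (2 * B + 1) * A powr (q - 1) * K2 * (C2 * I)"
        using usum vsum l0 B0 A0 by (intro add_mono mult_left_mono) (auto simp: K1_def K2_def)
      also have "1 / (2 * B + 1) * A powr (q - 1) * K2 * (C2 * I) = B / (2 * B + 1) * I"
        by (simp add: B_def)
      also have "\<dots> \<le> 1/2 * I" using B0 I0 by (intro mult_right_mono) (auto simp: field_simps)
      finally have "I \<le> 2 * l * K1 * C1 * enn2real J" by simp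
      also have "\<dots> \<le> (2 * l * K1 * C1 + 1) * enn2real J" by (simp add: algebra_simps)
      finally have "ennreal I \<le> ennreal ((2 * l * K1 * C1 + 1) * enn2real J)" by (rule ennreal_leI)
      also have "\<dots> = ennreal (2 * l * K1 * C1 + 1) * J"
        using l0 C12 by (subst (2) Jr) (simp add: ennreal_mult K1_def)
      finally show ?thesis by (simp add: I_nn)
    qed
    then show "(\<integral>\<^sup>+x. ennreal ((\<Sum>Q\<in>\<S>. (LINT x:Q|lebesgue. f x) / measure lebesgue Q * indicator Q x) powr p) \<partial>W)
      \<le> ennreal (2 * l * K1 * C1 + 1) * (\<integral>\<^sup>+x. ennreal (f x powr p) \<partial>W)"
      unfolding F_def m_def J_def .
  qed
qed

end

section \<open>Shifted dyadic grids\<close>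

text \<open>The sign alternates with the level so that the grid with shift \<open>1/3\<close> is nested:
  \<open>2 * (1/3) + 1/3\<close> is an integer.\<close>

definition grid_sign :: "int \<Rightarrow> real" where
  "grid_sign i = (if even i then 1 else -1)"

definition grid_shift :: "real^'n \<Rightarrow> bool" where
  "grid_shift t \<longleftrightarrow> (\<forall>c. t $ c \<in> {0, 1/3})"

definition grid_label :: "real^'n \<Rightarrow> int \<Rightarrow> real^'n \<Rightarrow> int^'n" where
  "grid_label t i x = (\<chi> c. \<lfloor>2 powi i * x $ c - grid_sign i * t $ c\<rfloor>)"

text \<open>Points with equal labels: the cells of one level partition space by construction. They
  are half-open cubes of side 2^(-i), as \<open>mem_cell_iff\<close> shows.\<close>

definition cell :: "real^'n \<Rightarrow> int \<Rightarrow> real^'n \<Rightarrow> (real^'n) set" where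
  "cell t i x = {y. grid_label t i y = grid_label t i x}"

lemma cell_self[simp]: "x \<in> cell t i x" by (simp add: cell_def)

lemma cell_eq: "y \<in> cell t i x \<Longrightarrow> cell t i y = cell t i x" by (simp add: cell_def)

text \<open>Because the signs alternate, the scaled and shifted coordinate at level
  \<open>i + 1\<close> is twice that of level \<open>i\<close> plus the integer
  \<open>3 * grid_sign i * t $ c\<close>. The coarser floor is therefore a function of the finer
  one.\<close>

lemma grid_label_mono:
  assumes t: "grid_shift t" and eq: "grid_label t (i + 1) x = grid_label t (i + 1) y"
  shows "grid_label t i x = grid_label t i y"
proof -
  have "\<lfloor>2 powi i * x $ c - grid_sign i * t $ c\<rfloor> = \<lfloor>2 powi i * y $ c - grid_sign i * t $ c\<rfloor>" for c
  proof -
    obtain z :: int where z: "3 * grid_sign i * t $ c = real_of_int z"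
    proof -
      have "t $ c = 0 \<or> t $ c = 1/3" using t by (auto simp: grid_shift_def)
      then have "3 * grid_sign i * t $ c = 0 \<or> 3 * grid_sign i * t $ c = 1 \<or> 3 * grid_sign i * t $ c = -1"
        by (auto simp: grid_sign_def)
      then have "3 * grid_sign i * t $ c \<in> \<int>" by auto
      then show ?thesis using that by (auto elim: Ints_cases)
    qed
    have *: "2 powi (i + 1) * u - grid_sign (i + 1) * t $ c = 2 * (2 powi i * u - grid_sign i * t $ c) + real_of_int z" for u
      using z by (simp add: power_int_add grid_sign_def split: if_splits)
    have fl: "\<lfloor>v\<rfloor> = (\<lfloor>2 * v + real_of_int z\<rfloor> - z) div 2" for v :: real
    proof -
      have "\<lfloor>2 * v + real_of_int z\<rfloor> - z = \<lfloor>2 * v\<rfloor>" by simp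
      moreover have "\<lfloor>2 * v\<rfloor> div 2 = \<lfloor>v\<rfloor>"
        using floor_divide_real_eq_div[of 2 "2 * v"] by simp
      ultimately show ?thesis by simp
    qed
    have "\<lfloor>2 powi (i + 1) * x $ c - grid_sign (i + 1) * t $ c\<rfloor> = \<lfloor>2 powi (i + 1) * y $ c - grid_sign (i + 1) * t $ c\<rfloor>"
      using eq by (simp add: grid_label_def vec_eq_iff)
    then show ?thesis unfolding * by (subst (1 2) fl) simp
  qed
  then show ?thesis by (simp add: grid_label_def vec_eq_iff)
qed

lemma cell_mono:
  assumes t: "grid_shift t" and "i \<le> j"
  shows "cell t j x \<subseteq> cell t i x"
  using \<open>i \<le> j\<close>
proof (induction j rule: int_ge_induct)
  case (step j)
  have "cell t (j + 1) x \<subseteq> cell t j x"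
    unfolding cell_def by (auto intro: grid_label_mono[OF t])
  then show ?case using step by blast
qed simp

lemma cells_nested:
  assumes t: "grid_shift t" and "i \<le> j"
  shows "cell t j y \<subseteq> cell t i x \<or> cell t j y \<inter> cell t i x = {}"
proof (cases "cell t j y \<inter> cell t i x = {}")
  case False
  then obtain z where z: "z \<in> cell t j y" "z \<in> cell t i x" by blast
  have "cell t j y = cell t j z" "cell t i x = cell t i z" using z cell_eq by blast+
  then show ?thesis using cell_mono[OF assms, of z] by simp
qed simp

definition cell_corner :: "real^'n \<Rightarrow> int \<Rightarrow> real^'n \<Rightarrow> real^'n" where
  "cell_corner t i x = (\<chi> c. 2 powi (- i) * (real_of_int (grid_label t i x $ c) + grid_sign i * t $ c))"

lemma mem_cell_iff:
  "y \<in> cell t i x \<longleftrightarrow> (\<forall>c. cell_corner t i x $ c \<le> y $ c \<and> y $ c < cell_corner t i x $ c + 2 powi (- i))"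
proof -
  have p: "(2::real) powi i > 0" "(2::real) powi (- i) = inverse (2 powi i)"
    by (auto simp: power_int_minus)
  have "(\<lfloor>2 powi i * y $ c - grid_sign i * t $ c\<rfloor> = k)
      \<longleftrightarrow> 2 powi (- i) * (real_of_int k + grid_sign i * t $ c) \<le> y $ c
        \<and> y $ c < 2 powi (- i) * (real_of_int k + grid_sign i * t $ c) + 2 powi (- i)" for c k
    unfolding floor_eq_iff p(2) using p(1) by (auto simp: field_simps)
  then show ?thesis
    unfolding cell_def cell_corner_def by (simp add: vec_eq_iff grid_label_def)
qed

lemma cell_subset_cube: "cell t i x \<subseteq> cbox (cell_corner t i x) (cell_corner t i x + vec (2 powi (- i)))"
  by (auto simp: mem_cell_iff mem_box_cart less_imp_le)

lemma box_subset_cell: "box (cell_corner t i x) (cell_corner t i x + vec (2 powi (- i))) \<subseteq> cell t i x"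
  by (auto simp: mem_cell_iff mem_box_cart less_imp_le)

lemma cell_borel: "cell t i x \<in> sets borel"
proof -
  have "cell t i x = {y. \<forall>c. cell_corner t i x $ c \<le> y $ c \<and> y $ c < cell_corner t i x $ c + 2 powi (- i)}"
    by (auto simp: mem_cell_iff)
  also have "\<dots> = (\<Inter>c\<in>UNIV. {y. cell_corner t i x $ c \<le> y $ c \<and> y $ c < cell_corner t i x $ c + 2 powi (- i)})"
    by auto
  also have "\<dots> \<in> sets borel"
    by (intro sets.finite_INT) (auto intro!: borel_measurable_continuous_onI continuous_intros simp: continuous_on_component)
  finally show ?thesis .
qed

lemma cell_lmeasurable[simp]: "cell t i x \<in> lmeasurable"
  by (rule fmeasurableI2[OF _ cell_subset_cube]) (auto intro: sets_completionI_sets simp: cell_borel)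

lemma cell_sets[simp, measurable]: "cell t i x \<in> sets lebesgue"
  using fmeasurableD[OF cell_lmeasurable] .

lemma measure_cell: "measure lebesgue (cell t i x :: (real^'n) set) = (2 powi (- i)) ^ CARD('n)"
proof (rule antisym)
  have "measure lebesgue (cell t i x) \<le> measure lebesgue (cbox (cell_corner t i x) (cell_corner t i x + vec (2 powi (- i))))"
    by (intro measure_mono_fmeasurable cell_subset_cube) auto
  then show "measure lebesgue (cell t i x :: (real^'n) set) \<le> (2 powi (- i)) ^ CARD('n)"
    by (simp add: measure_cube del: measure_completion)
  have "(2 powi (- i)) ^ CARD('n) = measure lebesgue (cbox (cell_corner t i x) (cell_corner t i x + vec (2 powi (- i))))"
    by (simp add: measure_cube del: measure_completion)
  also have "\<dots> = measure lebesgue (box (cell_corner t i x) (cell_corner t i x + vec (2 powi (- i))))"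
    by (simp add: measure_lborel_box_eq measure_lborel_cbox_eq)
  also have "\<dots> \<le> measure lebesgue (cell t i x)"
    by (intro measure_mono_fmeasurable box_subset_cell) auto
  finally show "(2 powi (- i)) ^ CARD('n) \<le> measure lebesgue (cell t i x :: (real^'n) set)" .
qed

lemma measure_cell_pos[simp]: "measure lebesgue (cell t i x) > 0"
  by (simp add: measure_cell del: measure_completion)

lemma measure_cell_Suc:
  "measure lebesgue (cell t i x :: (real^'n) set) = 2 ^ CARD('n) * measure lebesgue (cell t (i + 1) y :: (real^'n) set)"
proof -
  have "(2::real) powi (- i) = 2 * 2 powi (- (i + 1))"
    using power_int_add[of "2::real" 1 "- (i + 1)"] by simp
  then show ?thesis unfolding measure_cell by (simp only: power_mult_distrib)
qed

text \<open>By comparison of volumes. In particular the level of a cell can be read off from the set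
  alone.\<close>

lemma cell_subset_level:
  assumes "cell t i x \<subseteq> (cell t j y :: (real^'n) set)"
  shows "j \<le> i"
proof (rule ccontr)
  assume "\<not> j \<le> i"
  then have "(2::real) powi (- j) < 2 powi (- i)"
    by (intro power_int_strict_increasing) auto
  then have "((2::real) powi (- j)) ^ CARD('n) < (2 powi (- i)) ^ CARD('n)"
    by (intro power_strict_mono) auto
  moreover have "measure lebesgue (cell t i x) \<le> measure lebesgue (cell t j y)"
    by (intro measure_mono_fmeasurable assms) auto
  ultimately show False by (simp only: measure_cell)
qed

lemma norm_diff_cell:
  fixes y z :: "real^'n"
  assumes "y \<in> cell t i x" "z \<in> cell t i x"
  shows "norm (y - z) \<le> real CARD('n) * 2 powi (- i)"
proof -
  have "norm (y - z) \<le> (\<Sum>c\<in>UNIV. \<bar>(y - z) $ c\<bar>)" by (rule norm_le_l1_cart)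
  also have "\<dots> \<le> (\<Sum>c\<in>(UNIV::'n set). 2 powi (- i))"
  proof (rule sum_mono)
    fix c
    have "cell_corner t i x $ c \<le> y $ c" "y $ c < cell_corner t i x $ c + 2 powi (- i)"
      "cell_corner t i x $ c \<le> z $ c" "z $ c < cell_corner t i x $ c + 2 powi (- i)"
      using assms unfolding mem_cell_iff by auto
    then show "\<bar>(y - z) $ c\<bar> \<le> 2 powi (- i)" by simp
  qed
  finally show ?thesis by simp
qed

text \<open>On a bounded cell the labels of level \<open>j\<close> lie in a bounded box of integer
  vectors. This makes the stopping cells of the weak type estimate a finite partition.\<close>

lemma finite_subcells: "finite (cell t j ` cell t i x :: (real^'n) set set)"
proof -
  let ?u = "\<lambda>y. 2 powi j * y"
  let ?a = "\<lambda>c. cell_corner t i x $ c"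
  define b where "b = Max (range (\<lambda>c. \<bar>2 powi j * ?a c\<bar> + 2 powi j * 2 powi (- i) + \<bar>t $ c\<bar> + 1))"
  have "grid_label t j y \<in> {v. \<forall>c. v $ c \<in> {- \<lceil>b\<rceil>..\<lceil>b\<rceil>}}" if y: "y \<in> cell t i x" for y
  proof -
    have "\<lfloor>2 powi j * y $ c - grid_sign j * t $ c\<rfloor> \<in> {- \<lceil>b\<rceil>..\<lceil>b\<rceil>}" for c
    proof -
      have "?a c \<le> y $ c" "y $ c \<le> ?a c + 2 powi (- i)" using y unfolding mem_cell_iff by (auto simp: less_imp_le)
      then have "2 powi j * ?a c \<le> 2 powi j * y $ c" "2 powi j * y $ c \<le> 2 powi j * (?a c + 2 powi (- i))"
        by (auto intro!: mult_left_mono)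
      moreover have "\<bar>grid_sign j * t $ c\<bar> = \<bar>t $ c\<bar>" by (auto simp: grid_sign_def)
      moreover have "\<bar>2 powi j * ?a c\<bar> + 2 powi j * 2 powi (- i) + \<bar>t $ c\<bar> + 1 \<le> b"
        unfolding b_def by (intro Max_ge) auto
      moreover have "(2::real) powi j * 2 powi (- i) > 0" by simp
      ultimately have *: "\<bar>2 powi j * y $ c - grid_sign j * t $ c\<bar> \<le> b - 1"
        unfolding distrib_left by linarith
      have "real_of_int (- \<lceil>b\<rceil>) \<le> 2 powi j * y $ c - grid_sign j * t $ c"
        using * le_of_int_ceiling[of b] by linarith
      moreover have "2 powi j * y $ c - grid_sign j * t $ c < real_of_int \<lceil>b\<rceil> + 1"
        using * le_of_int_ceiling[of b] by linarith
      ultimately show ?thesis by (simp add: le_floor_iff floor_le_iff)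
    qed
    then show ?thesis by (simp add: grid_label_def)
  qed
  then have "grid_label t j ` cell t i x \<subseteq> {v. \<forall>c. v $ c \<in> {- \<lceil>b\<rceil>..\<lceil>b\<rceil>}}" by blast
  then have "finite (grid_label t j ` cell t i x)" by (rule finite_subset) (rule finite_vec_set, simp)
  then have "finite ((\<lambda>v. {y. grid_label t j y = v}) ` grid_label t j ` cell t i x)" by simp
  then show ?thesis by (simp add: image_image cell_def)
qed

text \<open>The one-third trick, one coordinate at a time. If the scaled edge of the cube crosses no
  integer, the shift 0 serves. Otherwise it crosses some integer, and the lattice shifted by 1/3 has
  no point within less than 1/3 of that integer.\<close>

lemma cube_in_some_cell:
  fixes x :: "real^'n"
  assumes d: "0 \<le> d" "2 powi i * d < 1/3"
  shows "\<exists>t. grid_shift t \<and> cbox x (x + vec d) \<subseteq> cell t i x"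
proof -
  define s where "s = 2 powi i * d"
  have s: "0 \<le> s" "s < 1/3" using d by (auto simp: s_def)
  define t :: "real^'n" where "t = (\<chi> c. if \<lfloor>2 powi i * x $ c\<rfloor> = \<lfloor>2 powi i * x $ c + s\<rfloor> then 0 else 1/3)"
  have "grid_shift t" by (auto simp: grid_shift_def t_def)
  moreover have "y \<in> cell t i x" if y: "y \<in> cbox x (x + vec d)" for y
  proof -
    have "\<lfloor>2 powi i * y $ c - grid_sign i * t $ c\<rfloor> = \<lfloor>2 powi i * x $ c - grid_sign i * t $ c\<rfloor>" for c
    proof -
      define u where "u = 2 powi i * x $ c"
      define v where "v = 2 powi i * y $ c"
      have "x $ c \<le> y $ c" "y $ c \<le> x $ c + d" using y by (auto simp: mem_box_cart)
      then have uv: "u \<le> v" "v \<le> u + s"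
        unfolding u_def v_def s_def by (auto simp: distrib_left[symmetric] intro!: mult_left_mono)
      show ?thesis
      proof (cases "\<lfloor>u\<rfloor> = \<lfloor>u + s\<rfloor>")
        case True
        then have "\<lfloor>u\<rfloor> = \<lfloor>v\<rfloor>" using floor_mono[OF uv(1)] floor_mono[OF uv(2)] by linarith
        then show ?thesis using True by (simp add: t_def u_def v_def)
      next
        case False
        define k where "k = \<lfloor>u + s\<rfloor>"
        have "\<lfloor>u\<rfloor> < k" using False floor_mono[of u "u + s"] s by (simp add: k_def)
        then have k1: "u < real_of_int k" by (simp add: floor_less_iff)
        have k2: "real_of_int k \<le> u + s" by (simp add: k_def)
        have tc: "t $ c = 1/3" using False by (simp add: t_def u_def)
        show ?thesis
        \<comment> \<open>The points of the shifted lattice have distance 1/3 from the integers, on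
          the side given by the sign. Both \<open>u\<close> and \<open>v\<close> are within less
          than 1/3 of \<open>k\<close>, so none of those points separates them.\<close>
        proof (cases "even i")
          case True
          have "\<lfloor>v - 1/3\<rfloor> = k - 1" "\<lfloor>u - 1/3\<rfloor> = k - 1"
            using k1 k2 uv s by (simp_all add: floor_eq_iff)
          then show ?thesis using True unfolding tc by (simp add: u_def v_def grid_sign_def)
        next
          case odd: False
          have "\<lfloor>v + 1/3\<rfloor> = k" "\<lfloor>u + 1/3\<rfloor> = k"
            using k1 k2 uv s by (simp_all add: floor_eq_iff)
          then show ?thesis using odd unfolding tc by (simp add: u_def v_def grid_sign_def)
        qed
      qed
    qed
    then show ?thesis by (simp add: cell_def grid_label_def vec_eq_iff)
  qed
  ultimately show ?thesis by blast
qed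

lemma sum_two_powi_le:
  assumes "finite A" "\<And>i. i \<in> A \<Longrightarrow> i \<le> m"
  shows "(\<Sum>i\<in>A. (2::real) powi (i - m)) \<le> 2"
proof -
  have "(\<Sum>i\<in>A. (2::real) powi (i - m)) = (\<Sum>k\<in>(\<lambda>i. nat (m - i)) ` A. (1/2) ^ k)"
  proof (subst sum.reindex)
    show "inj_on (\<lambda>i. nat (m - i)) A" using assms by (auto intro!: inj_onI dest!: assms(2))
    show "(\<Sum>i\<in>A. (2::real) powi (i - m)) = sum ((\<lambda>k. (1/2) ^ k) \<circ> (\<lambda>i. nat (m - i))) A"
    proof (rule sum.cong[OF refl])
      fix i assume "i \<in> A"
      then have "i - m = - int (nat (m - i))" using assms(2)[of i] by simp
      then show "(2::real) powi (i - m) = ((\<lambda>k. (1/2) ^ k) \<circ> (\<lambda>i. nat (m - i))) i"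
        by (simp add: power_int_minus power_one_over inverse_eq_divide del: of_nat_nat int_nat_eq)
    qed
  qed
  also have "\<dots> \<le> (\<Sum>k. (1/2) ^ k)"
    using assms(1) by (intro sum_le_suminf summable_geometric) auto
  also have "\<dots> = 2" by (simp add: suminf_geometric)
  finally show ?thesis .
qed

section \<open>The weak type estimate\<close>

lemma borel_measurable_cnj[measurable]:
  "f \<in> borel_measurable M \<Longrightarrow> (\<lambda>x. cnj (f x)) \<in> borel_measurable M"
  by (rule borel_measurable_continuous_on[of cnj]) (auto intro: continuous_intros)

lemma markov_step_function:
  fixes h :: "'i \<Rightarrow> real"
  assumes fin: "finite F" and Q: "\<And>\<iota>. \<iota> \<in> F \<Longrightarrow> Q \<iota> \<in> fmeasurable M"
    and h: "\<And>\<iota>. \<iota> \<in> F \<Longrightarrow> h \<iota> \<ge> 0" and s: "s > 0"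
  shows "{x\<in>space M. (\<Sum>\<iota>\<in>F. h \<iota> * indicator (Q \<iota>) x) > s} \<in> sets M"
    "measure M {x\<in>space M. (\<Sum>\<iota>\<in>F. h \<iota> * indicator (Q \<iota>) x) > s} \<le> (\<Sum>\<iota>\<in>F. h \<iota> * measure M (Q \<iota>)) / s"
    "{x\<in>space M. (\<Sum>\<iota>\<in>F. h \<iota> * indicator (Q \<iota>) x) > s} \<in> fmeasurable M"
proof -
  let ?H = "\<lambda>x. \<Sum>\<iota>\<in>F. h \<iota> * indicator (Q \<iota>) x"
  have m[measurable]: "?H \<in> borel_measurable M"
    using Q by (intro borel_measurable_sum borel_measurable_times borel_measurable_indicator) auto
  show S: "{x\<in>space M. ?H x > s} \<in> sets M" by measurable
  have int: "integrable M ?H"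
    using Q by (intro Bochner_Integration.integrable_sum integrable_mult_right integrable_real_indicator)
      (auto simp: fmeasurable_def)
  have eq: "(LINT x|M. ?H x) = (\<Sum>\<iota>\<in>F. h \<iota> * measure M (Q \<iota>))"
  proof -
    have "(LINT x|M. ?H x) = (\<Sum>\<iota>\<in>F. LINT x|M. h \<iota> * indicator (Q \<iota>) x)"
      using Q by (intro Bochner_Integration.integral_sum integrable_mult_right integrable_real_indicator)
        (auto simp: fmeasurable_def)
    also have "\<dots> = (\<Sum>\<iota>\<in>F. h \<iota> * measure M (Q \<iota>))"
    proof (rule sum.cong[OF refl])
      fix \<iota> assume "\<iota> \<in> F"
      then have "Q \<iota> \<inter> space M = Q \<iota>" using Q[of \<iota>] sets.sets_into_space by blast
      then show "(LINT x|M. h \<iota> * indicator (Q \<iota>) x) = h \<iota> * measure M (Q \<iota>)" by simp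
    qed
    finally show ?thesis .
  qed
  have H0: "?H x \<ge> 0" for x using h by (intro sum_nonneg) auto
  have e: "emeasure M {x\<in>space M. ?H x \<ge> s} \<le> ennreal ((1/s) * (LINT x|M. ?H x))"
    using integral_Markov_inequality[OF int _ s] H0 by auto
  have le: "emeasure M {x\<in>space M. ?H x > s} \<le> ennreal ((1/s) * (LINT x|M. ?H x))"
    by (rule order_trans[OF emeasure_mono e]) auto
  then show "{x\<in>space M. ?H x > s} \<in> fmeasurable M"
    using S by (auto simp: fmeasurable_def intro: le_less_trans)
  have "measure M {x\<in>space M. ?H x > s} \<le> (1/s) * (LINT x|M. ?H x)"
    unfolding measure_def using le s H0 by (intro enn2real_leI) (auto intro!: mult_nonneg_nonneg Bochner_Integration.integral_nonneg)
  then show "measure M {x\<in>space M. ?H x > s} \<le> (\<Sum>\<iota>\<in>F. h \<iota> * measure M (Q \<iota>)) / s"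
    by (simp add: eq)
qed

lemma sum_power2_le_power2_sum:
  fixes u :: "'i \<Rightarrow> real"
  assumes "finite F" "\<And>i. i \<in> F \<Longrightarrow> u i \<ge> 0"
  shows "(\<Sum>i\<in>F. (u i)\<^sup>2) \<le> (\<Sum>i\<in>F. u i)\<^sup>2"
  using assms
proof (induction F rule: finite_induct)
  case (insert i F)
  have "0 \<le> u i * (\<Sum>i\<in>F. u i)" using insert by (intro mult_nonneg_nonneg sum_nonneg) auto
  then show ?case using insert by (simp add: power2_sum)
qed simp

lemma set_integral_finite_partition:
  fixes f :: "'a \<Rightarrow> 'b::{banach, second_countable_topology}"
  assumes "finite \<P>" "disjoint \<P>" "\<And>P. P \<in> \<P> \<Longrightarrow> P \<in> sets M" "set_integrable M (\<Union>\<P>) f"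
  shows "(LINT x:\<Union>\<P>|M. f x) = (\<Sum>P\<in>\<P>. LINT x:P|M. f x)"
proof -
  have "(LINT x:(\<Union>P\<in>\<P>. P)|M. f x) = (\<Sum>P\<in>\<P>. LINT x:P|M. f x)"
  proof (rule set_integral_finite_Union)
    show "set_integrable M P f" if "P \<in> \<P>" for P
      by (rule set_integrable_subset[OF assms(4)]) (use that assms(3) in auto)
  qed (use assms in \<open>auto simp: disjoint_def disjoint_family_on_def\<close>)
  then show ?thesis by simp
qed

text \<open>The system \<open>e\<close> stands for wavelets with at most one wavelet attached to each cell. The
  Calderon--Zygmund decomposition stops at the bottom level at the latest, so no
  Lebesgue differentiation is needed: below that level there are no wavelets.\<close>

lemma square_function_weak_type:
  fixes t x0 :: "real^'n" and lev :: "'i \<Rightarrow> int" and pt :: "'i \<Rightarrow> real^'n" and e :: "'i \<Rightarrow> real^'n \<Rightarrow> complex"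
    and f :: "real^'n \<Rightarrow> complex" and B :: real and i0 :: int
  defines "Q \<equiv> \<lambda>\<iota>. cell t (lev \<iota>) (pt \<iota>)" and "R \<equiv> cell t i0 x0"
    and "\<Lambda> \<equiv> 16 * 2 ^ CARD('n) + 64 * B * real CARD('n)"
  assumes t: "grid_shift t" and fin: "finite F" and B: "B \<ge> 0"
    and QR: "\<And>\<iota>. \<iota> \<in> F \<Longrightarrow> Q \<iota> \<subseteq> R" and inj: "inj_on Q F"
    and supp: "\<And>\<iota> x. \<iota> \<in> F \<Longrightarrow> x \<notin> Q \<iota> \<Longrightarrow> e \<iota> x = 0"
    and e_meas[measurable]: "\<And>\<iota>. \<iota> \<in> F \<Longrightarrow> e \<iota> \<in> borel_measurable lebesgue"
    and e_bd: "\<And>\<iota>. \<iota> \<in> F \<Longrightarrow> \<exists>K. \<forall>x. norm (e \<iota> x) \<le> K"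
    and lip: "\<And>\<iota> x y. \<iota> \<in> F \<Longrightarrow> norm (e \<iota> x - e \<iota> y)
        \<le> B * (2 powi lev \<iota> * norm (x - y)) / sqrt (measure lebesgue (Q \<iota>))"
    and bessel: "\<And>g. g \<in> L2_space \<Longrightarrow> (\<Sum>\<iota>\<in>F. (norm (ip g (e \<iota>)))\<^sup>2) \<le> (LINT x|lebesgue. (norm (g x))\<^sup>2)"
    and f_int: "set_integrable lebesgue R f"
  shows "measure lebesgue {x\<in>R. (\<Sum>\<iota>\<in>F. (norm (ip f (e \<iota>)))\<^sup>2 / measure lebesgue (Q \<iota>) * indicator (Q \<iota>) x)
      > (\<Lambda> * ((LINT x:R|lebesgue. norm (f x)) / measure lebesgue R))\<^sup>2} \<le> measure lebesgue R / 2"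
proof -
  define mR where "mR = measure lebesgue R"
  define \<mu> where "\<mu> P = (LINT x:P|lebesgue. norm (f x))" for P
  define a where "a = \<mu> R / mR"
  define N where "N = (2::real) ^ CARD('n)"
  have N1: "N \<ge> 1" by (simp add: N_def)
  have mR: "mR > 0" unfolding mR_def R_def by (rule measure_cell_pos)
  have nf_int: "set_integrable lebesgue R (\<lambda>x. norm (f x))"
    using f_int by (simp add: set_integrable_norm)
  have Rm: "R \<in> sets lebesgue" "R \<in> lmeasurable" unfolding R_def by auto
  have Qm: "Q \<iota> \<in> sets lebesgue" "Q \<iota> \<in> lmeasurable" for \<iota> unfolding Q_def by auto
  have mQ: "measure lebesgue (Q \<iota>) > 0" for \<iota> unfolding Q_def by (rule measure_cell_pos)
  have sub_int: "set_integrable lebesgue P f" "set_integrable lebesgue P (\<lambda>x. norm (f x))"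
    if "P \<subseteq> R" "P \<in> sets lebesgue" for P
    using set_integrable_subset[OF f_int that(2,1)] set_integrable_subset[OF nf_int that(2,1)] by auto
  have \<mu>0: "\<mu> P \<ge> 0" for P unfolding \<mu>_def by (intro set_lebesgue_integral_nonneg) auto
  have \<mu>_mono: "\<mu> P \<le> \<mu> P'" if "P \<subseteq> P'" "P' \<subseteq> R" "P \<in> sets lebesgue" "P' \<in> sets lebesgue" for P P'
    unfolding \<mu>_def set_lebesgue_integral_def
  proof (rule integral_mono)
    show "integrable lebesgue (\<lambda>x. indicat_real P x *\<^sub>R norm (f x))" "integrable lebesgue (\<lambda>x. indicat_real P' x *\<^sub>R norm (f x))"
      using sub_int(2)[of P] sub_int(2)[of P'] that by (auto simp: set_integrable_def)
    show "indicat_real P x *\<^sub>R norm (f x) \<le> indicat_real P' x *\<^sub>R norm (f x)" for x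
      using that by (auto simp: indicator_def)
  qed
  have ip_cell: "ip f (e \<iota>) = (LINT x|lebesgue. (indicator R x *\<^sub>R f x) * cnj (e \<iota> x))" if "\<iota> \<in> F" for \<iota>
    unfolding ip_def
    by (intro Bochner_Integration.integral_cong refl) (use supp[OF that] QR[OF that] in \<open>auto simp: indicator_def\<close>)
  let ?Sf = "\<lambda>x. \<Sum>\<iota>\<in>F. (norm (ip f (e \<iota>)))\<^sup>2 / measure lebesgue (Q \<iota>) * indicator (Q \<iota>) x"
  have a0: "a \<ge> 0" using \<mu>0 mR by (simp add: a_def)
  show ?thesis
  \<comment> \<open>A zero average is treated apart because the stopping height \<open>lam\<close>
    has to be positive.\<close>
  proof (cases "a = 0")
    case True
    then have "\<mu> R = 0" using mR by (simp add: a_def)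
    then have "AE x in lebesgue. indicat_real R x *\<^sub>R norm (f x) = 0"
      using nf_int unfolding \<mu>_def set_lebesgue_integral_def set_integrable_def
      by (subst (asm) integral_nonneg_eq_0_iff_AE) auto
    then have "ip f (e \<iota>) = 0" if "\<iota> \<in> F" for \<iota>
      unfolding ip_cell[OF that] by (intro integral_eq_zero_AE) (auto elim!: eventually_mono)
    then have "?Sf x = 0" for x by simp
    then show ?thesis using mR by (simp add: mR_def[symmetric])
  next
    case False
    then have a: "a > 0" using a0 by simp
    have \<mu>R: "\<mu> R = a * mR" using mR by (simp add: a_def)
    \<comment> \<open>At this height the cells stopped for excess cover at most an eighth of
      \<open>R\<close>. The good and the bad part will cost another eighth each, three eighths in
      all.\<close>
    define lam where "lam = 8 * a"
    have lam: "lam > 0" using a by (simp add: lam_def)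
    \<comment> \<open>One level below the finest wavelet, so that a cell reaching the bottom is
      finer than every \<open>Q \<iota>\<close>.\<close>
    define K where "K = nat (Max (insert i0 (lev ` F)) + 1 - i0)"
    have K: "lev \<iota> < i0 + int K" if "\<iota> \<in> F" for \<iota>
    proof -
      have "lev \<iota> \<le> Max (insert i0 (lev ` F))" using fin that by (intro Max_ge) auto
      then show ?thesis by (simp add: K_def)
    qed
    define st where "st x k \<longleftrightarrow> \<mu> (cell t (i0 + int k) x) > lam * measure lebesgue (cell t (i0 + int k) x) \<or> k = K" for x k
    define kk where "kk x = (LEAST k. st x k)" for x
    define P where "P x = cell t (i0 + int (kk x)) x" for x
    define \<P> where "\<P> = P ` R"
    have stK: "st x K" for x by (simp add: st_def)
    have st_kk: "st x (kk x)" for x unfolding kk_def using stK by (rule LeastI)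
    have kkK: "kk x \<le> K" for x unfolding kk_def using stK by (rule Least_le)
    have cellR: "cell t (i0 + int k) x \<subseteq> R" if "x \<in> R" for x k
      using cell_mono[OF t, of i0 "i0 + int k" x] cell_eq[of x t i0 x0] that unfolding R_def by simp
    have PR: "P x \<subseteq> R" if "x \<in> R" for x unfolding P_def using cellR[OF that] .
    have xP: "x \<in> P x" for x by (simp add: P_def)
    \<comment> \<open>All points of a stopping cell stop at the same level, because they share all
      coarser cells passed before. Hence distinct stopping cells are disjoint.\<close>
    have P_eq: "P y = P x" "kk y = kk x" if y: "y \<in> P x" for x y
    proof -
      have c: "cell t (i0 + int j) y = cell t (i0 + int j) x" if "j \<le> kk x" for j
        by (rule cell_eq) (use cell_mono[OF t, of "i0 + int j" "i0 + int (kk x)" x] y that in \<open>auto simp: P_def\<close>)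
      have st: "st y j = st x j" if "j \<le> kk x" for j unfolding st_def c[OF that] ..
      show "kk y = kk x"
      proof (rule antisym)
        show "kk y \<le> kk x" unfolding kk_def[of y] by (rule Least_le) (use st[of "kk x"] st_kk in simp)
        show "kk x \<le> kk y"
        proof (rule ccontr)
          assume "\<not> kk x \<le> kk y"
          then have "st x (kk y)" "kk y < kk x" using st[of "kk y"] st_kk[of y] by auto
          then show False using not_less_Least[of "kk y" "st x"] by (simp add: kk_def)
        qed
      qed
      then show "P y = P x" using c[of "kk x"] by (simp add: P_def)
    qed
    have finP: "finite \<P>"
    proof (rule finite_subset)
      show "\<P> \<subseteq> (\<Union>k\<in>{..K}. cell t (i0 + int k) ` R)" unfolding \<P>_def P_def using kkK by auto
      show "finite (\<Union>k\<in>{..K}. cell t (i0 + int k) ` R)" unfolding R_def using finite_subcells by auto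
    qed
    have disP: "disjoint \<P>"
    proof (rule disjointI)
      fix A C assume "A \<in> \<P>" "C \<in> \<P>" "A \<noteq> C"
      then show "A \<inter> C = {}" unfolding \<P>_def using P_eq(1) by (metis disjoint_iff imageE)
    qed
    have UnP: "\<Union>\<P> = R" unfolding \<P>_def using PR xP by blast
    have Pm: "p \<in> sets lebesgue" "p \<in> lmeasurable" "p \<subseteq> R" "measure lebesgue p > 0" if "p \<in> \<P>" for p
      using that PR unfolding \<P>_def P_def by (auto simp del: measure_completion)
    have Pint: "integrable lebesgue (indicat_real p)" if "p \<in> \<P>" for p
      by (rule integrable_real_indicator) (use Pm[OF that] fmeasurableD2[OF Pm(2)[OF that]] in \<open>auto simp: less_top simp del: emeasure_completion\<close>)
    have sum\<mu>: "(\<Sum>p\<in>\<P>. \<mu> p) = a * mR"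
      unfolding \<mu>R[symmetric] \<mu>_def using set_integral_finite_partition[OF finP disP, of lebesgue "\<lambda>x. norm (f x)"]
      unfolding UnP using Pm nf_int by auto
    \<comment> \<open>The parent of a stopping cell was not stopped, which costs only the volume
      ratio \<open>N\<close>. If the root itself is the stopping cell, its average is
      \<open>a\<close>, below \<open>lam\<close>.\<close>
    have \<mu>_le: "\<mu> p \<le> N * lam * measure lebesgue p" if "p \<in> \<P>" for p
    proof -
      obtain x where x: "x \<in> R" "p = P x" using \<open>p \<in> \<P>\<close> unfolding \<P>_def by blast
      show ?thesis
      proof (cases "kk x")
        case 0
        then have "p = R" using x cell_eq[of x t i0 x0] by (simp add: P_def R_def)
        then have "\<mu> p = a * measure lebesgue p" using \<mu>R by (simp add: mR_def)
        also have "\<dots> \<le> N * lam * measure lebesgue p"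
          using N1 a mult_mono[of 1 N a "8 * a"] by (intro mult_right_mono) (auto simp: lam_def)
        finally show ?thesis .
      next
        case (Suc k)
        let ?p = "cell t (i0 + int k) x"
        have "\<not> st x k" using not_less_Least[of k "st x"] Suc by (simp add: kk_def)
        then have "\<mu> ?p \<le> lam * measure lebesgue ?p" by (simp add: st_def)
        moreover have "\<mu> p \<le> \<mu> ?p"
          using Pm[OF \<open>p \<in> \<P>\<close>] cellR[OF x(1)] x(2) cell_mono[OF t, of "i0 + int k" "i0 + int (kk x)" x] Suc
          by (intro \<mu>_mono) (auto simp: P_def)
        moreover have "measure lebesgue ?p = N * measure lebesgue p"
          using measure_cell_Suc[of t "i0 + int k" x x] x(2) Suc by (simp add: P_def N_def add_ac del: measure_completion)
        ultimately show ?thesis by (simp add: mult_ac)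
      qed
    qed
    define \<P>s where "\<P>s = {p\<in>\<P>. \<mu> p > lam * measure lebesgue p}"
    define \<Omega> where "\<Omega> = \<Union>\<P>s"
    have Ps: "\<P>s \<subseteq> \<P>" "finite \<P>s" using finP unfolding \<P>s_def by auto
    have \<Omega>m: "\<Omega> \<in> lmeasurable" unfolding \<Omega>_def using Ps Pm by (intro fmeasurable.finite_Union) auto
    have m\<Omega>: "measure lebesgue \<Omega> \<le> mR / 8"
    proof -
      have "measure lebesgue \<Omega> \<le> (\<Sum>p\<in>\<P>s. measure lebesgue p)"
        unfolding \<Omega>_def using measure_UNION_le[of \<P>s id lebesgue] Ps Pm by auto
      also have "\<dots> \<le> (\<Sum>p\<in>\<P>s. \<mu> p / lam)"
        using lam by (intro sum_mono) (auto simp: \<P>s_def field_simps)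
      also have "\<dots> \<le> (\<Sum>p\<in>\<P>. \<mu> p / lam)"
        using Ps finP \<mu>0 lam by (intro sum_mono2) auto
      also have "\<dots> = (a * mR) / lam" by (simp add: sum\<mu> sum_divide_distrib[symmetric])
      also have "\<dots> = mR / 8" using a by (simp add: lam_def)
      finally show ?thesis .
    qed
    \<comment> \<open>Good part \<open>g\<close>: the average of \<open>f\<close> on each stopping
      cell. Bad part \<open>b\<close>: the rest, with mean zero on each of them.\<close>
    define c where "c p = (LINT x:p|lebesgue. f x) /\<^sub>R measure lebesgue p" for p
    define g where "g x = (\<Sum>p\<in>\<P>. indicat_real p x *\<^sub>R c p)" for x
    define b where "b x = indicator R x *\<^sub>R f x - g x" for x
    have c_le: "norm (c p) \<le> \<mu> p / measure lebesgue p" if "p \<in> \<P>" for p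
    proof -
      have "norm (LINT x:p|lebesgue. f x) \<le> \<mu> p"
        unfolding \<mu>_def by (rule set_integral_norm_bound) (use sub_int Pm[OF that] in auto)
      then show ?thesis unfolding c_def using Pm(4)[OF that] by (simp add: divide_right_mono field_simps del: measure_completion)
    qed
    have g_eq: "g x = c (P x)" if "x \<in> R" for x
    proof -
      have "g x = (\<Sum>p\<in>\<P>. if p = P x then c p else 0)"
        unfolding g_def
      proof (rule sum.cong[OF refl])
        fix p assume "p \<in> \<P>"
        then have "x \<in> p \<longleftrightarrow> p = P x" unfolding \<P>_def using xP P_eq(1) by blast
        then show "indicat_real p x *\<^sub>R c p = (if p = P x then c p else 0)" by (auto simp: indicator_def)
      qed
      also have "\<dots> = c (P x)" using finP that by (simp add: \<P>_def)
      finally show ?thesis .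
    qed
    have g_out: "g x = 0" if "x \<notin> R" for x
      unfolding g_def by (rule sum.neutral) (use that Pm(3) in \<open>auto simp: indicator_def\<close>)
    have g_meas[measurable]: "g \<in> borel_measurable lebesgue"
      unfolding g_def using Pm by (intro borel_measurable_sum borel_measurable_scaleR) auto
    have g2: "(norm (g x))\<^sup>2 = (\<Sum>p\<in>\<P>. (norm (c p))\<^sup>2 * indicator p x)" for x
    proof (cases "x \<in> R")
      case True
      have "(\<Sum>p\<in>\<P>. (norm (c p))\<^sup>2 * indicator p x) = (\<Sum>p\<in>\<P>. if p = P x then (norm (c p))\<^sup>2 else 0)"
      proof (rule sum.cong[OF refl])
        fix p assume "p \<in> \<P>"
        then have "x \<in> p \<longleftrightarrow> p = P x" unfolding \<P>_def using xP P_eq(1) by blast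
        then show "(norm (c p))\<^sup>2 * indicator p x = (if p = P x then (norm (c p))\<^sup>2 else 0)" by (auto simp: indicator_def)
      qed
      also have "\<dots> = (norm (c (P x)))\<^sup>2" using finP True by (simp add: \<P>_def)
      finally show ?thesis using g_eq[OF True] by simp
    next
      case False
      then have "(\<Sum>p\<in>\<P>. (norm (c p))\<^sup>2 * indicator p x) = 0"
        by (intro sum.neutral) (use Pm(3) in \<open>auto simp: indicator_def\<close>)
      then show ?thesis using g_out[OF False] by simp
    qed
    have g2_int: "integrable lebesgue (\<lambda>x. (norm (g x))\<^sup>2)"
      unfolding g2 using Pint by (intro Bochner_Integration.integrable_sum integrable_mult_right)
    have g_L2: "g \<in> L2_space"
      unfolding L2_space_def using nn_integral_eq_integral[OF g2_int] by (auto simp: g_meas)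
    have g2_le: "(LINT x|lebesgue. (norm (g x))\<^sup>2) \<le> N * lam * (a * mR)"
    proof -
      have "(LINT x|lebesgue. (norm (g x))\<^sup>2) = (\<Sum>p\<in>\<P>. LINT x|lebesgue. (norm (c p))\<^sup>2 * indicator p x)"
        unfolding g2 using Pint by (intro Bochner_Integration.integral_sum integrable_mult_right)
      also have "\<dots> = (\<Sum>p\<in>\<P>. (norm (c p))\<^sup>2 * measure lebesgue p)" by simp
      also have "\<dots> \<le> (\<Sum>p\<in>\<P>. N * lam * \<mu> p)"
      proof (rule sum_mono)
        fix p assume p: "p \<in> \<P>"
        have "(norm (c p))\<^sup>2 * measure lebesgue p \<le> (\<mu> p / measure lebesgue p)\<^sup>2 * measure lebesgue p"
          using c_le[OF p] by (intro mult_right_mono power_mono) auto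
        also have "\<dots> = \<mu> p / measure lebesgue p * \<mu> p" using Pm(4)[OF p] by (simp add: power2_eq_square del: measure_completion)
        also have "\<dots> \<le> N * lam * \<mu> p"
          using \<mu>_le[OF p] Pm(4)[OF p] \<mu>0 by (intro mult_right_mono) (auto simp: field_simps simp del: measure_completion)
        finally show "(norm (c p))\<^sup>2 * measure lebesgue p \<le> N * lam * \<mu> p" .
      qed
      also have "\<dots> = N * lam * (a * mR)" by (simp add: sum\<mu> sum_distrib_left[symmetric])
      finally show ?thesis .
    qed
    have e_int: "integrable lebesgue (\<lambda>x. g x * cnj (e \<iota> x))"
        "integrable lebesgue (\<lambda>x. (indicator R x *\<^sub>R f x) * cnj (e \<iota> x))" if \<iota>: "\<iota> \<in> F" for \<iota>
    proof -
      obtain L where L: "\<And>x. norm (e \<iota> x) \<le> L" using e_bd[OF \<iota>] by blast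
      have gi: "integrable lebesgue g"
        unfolding g_def using Pint by (intro Bochner_Integration.integrable_sum integrable_scaleR_left)
      have fi: "integrable lebesgue (\<lambda>x. indicator R x *\<^sub>R f x)" using f_int by (simp add: set_integrable_def)
      have *: "integrable lebesgue (\<lambda>x. u x * cnj (e \<iota> x))" if "integrable lebesgue u" for u
      proof (rule Bochner_Integration.integrable_bound[of _ "\<lambda>x. L * norm (u x)"])
        show "integrable lebesgue (\<lambda>x. L * norm (u x))" using that by auto
        show "(\<lambda>x. u x * cnj (e \<iota> x)) \<in> borel_measurable lebesgue" using that e_meas[OF \<iota>] by measurable
        show "AE x in lebesgue. norm (u x * cnj (e \<iota> x)) \<le> norm (L * norm (u x))"
          using L by (intro AE_I2) (auto simp: norm_mult abs_mult mult.commute[of L] intro!: mult_left_mono order_trans[OF L abs_ge_self])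
      qed
      show "integrable lebesgue (\<lambda>x. g x * cnj (e \<iota> x))"
        "integrable lebesgue (\<lambda>x. (indicator R x *\<^sub>R f x) * cnj (e \<iota> x))"
        using *[OF gi] *[OF fi] by auto
    qed
    have split: "ip f (e \<iota>) = ip g (e \<iota>) + ip b (e \<iota>)" if "\<iota> \<in> F" for \<iota>
    proof -
      have "ip b (e \<iota>) = (LINT x|lebesgue. (indicator R x *\<^sub>R f x) * cnj (e \<iota> x)) - ip g (e \<iota>)"
        unfolding ip_def b_def left_diff_distrib
        by (rule Bochner_Integration.integral_diff[OF e_int(2)[OF that] e_int(1)[OF that]])
      then show ?thesis unfolding ip_cell[OF that] by simp
    qed
    \<comment> \<open>A wavelet whose cell lies in \<open>\<Omega>\<close> contributes to the square
      function only on \<open>\<Omega>\<close>, whose measure is already accounted for.\<close>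
    define F' where "F' = {\<iota>\<in>F. \<not> Q \<iota> \<subseteq> \<Omega>}"
    define D where "D = 2 * B * real CARD('n)"
    \<comment> \<open>The level at which \<open>p\<close> was stopped; by \<open>P_eq\<close> it
      does not depend on the chosen point.\<close>
    define tau where "tau p = i0 + int (kk (SOME x. x \<in> R \<and> p = P x))" for p
    have tau: "p = cell t (tau p) x" if "p \<in> \<P>" "x \<in> p" for p x
    proof -
      define y where "y = (SOME x. x \<in> R \<and> p = P x)"
      have "\<exists>x. x \<in> R \<and> p = P x" using that(1) unfolding \<P>_def by blast
      then have y: "y \<in> R \<and> p = P y" unfolding y_def by (rule someI_ex)
      then have "P x = P y" "kk x = kk y" using P_eq[of x y] that(2) by simp_all
      then have "p = cell t (i0 + int (kk y)) x" using y unfolding P_def by simp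
      then show ?thesis unfolding tau_def y_def .
    qed
    \<comment> \<open>On a stopping cell \<open>b\<close> has mean zero, so \<open>e \<iota>\<close>
      may be replaced by its difference from a value inside that cell. The Lipschitz bound then
      gains the ratio of the side lengths, 2^(lev - tau).\<close>
    have bad: "norm (ip b (e \<iota>)) \<le> (\<Sum>p\<in>{p\<in>\<P>. p \<subseteq> Q \<iota>}. D * 2 powi (lev \<iota> - tau p) * \<mu> p) / sqrt (measure lebesgue (Q \<iota>))"
      if \<iota>: "\<iota> \<in> F'" for \<iota>
    proof -
      have \<iota>F: "\<iota> \<in> F" and nO: "\<not> Q \<iota> \<subseteq> \<Omega>" using \<iota> by (auto simp: F'_def)
      have be_int: "integrable lebesgue (\<lambda>x. b x * cnj (e \<iota> x))"
        unfolding b_def left_diff_distrib using e_int[OF \<iota>F] by auto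
      have "ip b (e \<iota>) = (LINT x:R|lebesgue. b x * cnj (e \<iota> x))"
        unfolding ip_def set_lebesgue_integral_def
        by (intro Bochner_Integration.integral_cong refl) (use g_out in \<open>auto simp: b_def indicator_def\<close>)
      also have "\<dots> = (\<Sum>p\<in>\<P>. LINT x:p|lebesgue. b x * cnj (e \<iota> x))"
      proof -
        have "set_integrable lebesgue R (\<lambda>x. b x * cnj (e \<iota> x))"
          unfolding set_integrable_def using be_int Rm by (intro integrable_mult_indicator) auto
        then show ?thesis
          using set_integral_finite_partition[OF finP disP, of lebesgue "\<lambda>x. b x * cnj (e \<iota> x)"] Pm unfolding UnP by auto
      qed
      also have "\<dots> = (\<Sum>p\<in>{p\<in>\<P>. p \<subseteq> Q \<iota>}. LINT x:p|lebesgue. b x * cnj (e \<iota> x))"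
      proof (rule sum.mono_neutral_right[OF finP])
        show "\<forall>p\<in>\<P> - {p\<in>\<P>. p \<subseteq> Q \<iota>}. (LINT x:p|lebesgue. b x * cnj (e \<iota> x)) = 0"
        proof
          fix p assume p: "p \<in> \<P> - {p\<in>\<P>. p \<subseteq> Q \<iota>}"
          then obtain x where x: "x \<in> R" "p = P x" unfolding \<P>_def by blast
          \<comment> \<open>If the wavelet is at least as coarse as \<open>p\<close>, nestedness
            decides. If \<open>p\<close> is coarser, it was stopped for excess and lies in
            \<open>\<Omega>\<close>, so it cannot contain \<open>Q \<iota>\<close>.\<close>
          have "p \<inter> Q \<iota> = {}"
          proof (cases "lev \<iota> \<le> i0 + int (kk x)")
            case True
            then show ?thesis using cells_nested[OF t True, of x "pt \<iota>"] p x by (auto simp: P_def Q_def)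
          next
            case False
            then have "kk x \<noteq> K" using K[OF \<iota>F] by auto
            then have "\<mu> p > lam * measure lebesgue p" using st_kk[of x] unfolding st_def by (simp add: x(2) P_def)
            then have "p \<in> \<P>s" using p by (auto simp: \<P>s_def)
            then have "\<not> Q \<iota> \<subseteq> p" using nO by (auto simp: \<Omega>_def)
            then show ?thesis using cells_nested[OF t, of "i0 + int (kk x)" "lev \<iota>" "pt \<iota>" x] False x
              by (auto simp: P_def Q_def)
          qed
          then show "(LINT x:p|lebesgue. b x * cnj (e \<iota> x)) = 0"
            unfolding set_lebesgue_integral_def
            by (intro integral_eq_zero_AE AE_I2) (use supp[OF \<iota>F] in \<open>auto simp: indicator_def disjoint_iff\<close>)
        qed
      qed auto
      finally have "norm (ip b (e \<iota>)) \<le> (\<Sum>p\<in>{p\<in>\<P>. p \<subseteq> Q \<iota>}. norm (LINT x:p|lebesgue. b x * cnj (e \<iota> x)))"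
        by (simp add: norm_sum)
      also have "\<dots> \<le> (\<Sum>p\<in>{p\<in>\<P>. p \<subseteq> Q \<iota>}. D * 2 powi (lev \<iota> - tau p) * \<mu> p / sqrt (measure lebesgue (Q \<iota>)))"
      proof (rule sum_mono)
        fix p assume "p \<in> {p\<in>\<P>. p \<subseteq> Q \<iota>}"
        then have p: "p \<in> \<P>" by simp
        then obtain z where z: "z \<in> R" "p = P z" unfolding \<P>_def by blast
        have zp: "z \<in> p" using z xP by simp
        have bp: "b x = f x - c p" if "x \<in> p" for x
          using that Pm(3)[OF p] g_eq[of x] P_eq(1)[of x z] z unfolding b_def by (auto simp: indicator_def)
        have bi: "set_integrable lebesgue p b"
        proof -
          have "set_integrable lebesgue p (\<lambda>x. f x - c p)"
            using sub_int(1)[of p] Pm[OF p] Pint[OF p] by (intro set_integral_diff) (auto simp: set_integrable_def)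
          then show ?thesis using bp by (subst set_integrable_cong[OF refl refl, of _ b "\<lambda>x. f x - c p"]) auto
        qed
        have b_zero: "(LINT x:p|lebesgue. b x) = 0"
        proof -
          have "(LINT x:p|lebesgue. b x) = (LINT x:p|lebesgue. f x - c p)"
            by (rule set_lebesgue_integral_cong) (use bp Pm[OF p] in auto)
          also have "\<dots> = (LINT x:p|lebesgue. f x) - (LINT x:p|lebesgue. c p)"
            using sub_int(1)[of p] Pm[OF p] Pint[OF p] by (intro set_integral_diff) (auto simp: set_integrable_def)
          also have "(LINT x:p|lebesgue. c p) = measure lebesgue p *\<^sub>R c p"
            unfolding set_lebesgue_integral_def integral_scaleR_left[OF Pint[OF p]] by simp
          also have "\<dots> = (LINT x:p|lebesgue. f x)" using Pm(4)[OF p] by (simp add: c_def del: measure_completion)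
          finally show ?thesis by simp
        qed
        define dl where "dl = B * (2 powi lev \<iota> * (real CARD('n) * 2 powi (- tau p))) / sqrt (measure lebesgue (Q \<iota>))"
        have de: "norm (e \<iota> x - e \<iota> z) \<le> dl" if "x \<in> p" for x
        proof -
          have "norm (x - z) \<le> real CARD('n) * 2 powi (- tau p)"
            using norm_diff_cell[of x t "tau p" z z] tau[OF p zp] that zp by simp
          then have "B * (2 powi lev \<iota> * norm (x - z)) / sqrt (measure lebesgue (Q \<iota>)) \<le> dl"
            unfolding dl_def using B by (intro divide_right_mono mult_left_mono) auto
          then show ?thesis using lip[OF \<iota>F, of x z] by linarith
        qed
        have be: "set_integrable lebesgue p (\<lambda>x. b x * cnj (e \<iota> x))"
          unfolding set_integrable_def using be_int Pm[OF p] by (intro integrable_mult_indicator) auto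
        have be': "set_integrable lebesgue p (\<lambda>x. b x * cnj (e \<iota> z))"
          using bi unfolding set_integrable_def by (simp add: scaleR_conv_of_real mult.assoc[symmetric])
        have "(LINT x:p|lebesgue. b x * cnj (e \<iota> x)) = (LINT x:p|lebesgue. b x * cnj (e \<iota> x) - b x * cnj (e \<iota> z))"
          using set_integral_diff(2)[OF be be'] b_zero by simp
        also have "norm \<dots> \<le> (LINT x:p|lebesgue. norm (b x * cnj (e \<iota> x) - b x * cnj (e \<iota> z)))"
          by (rule set_integral_norm_bound) (use set_integral_diff(1)[OF be be'] in simp)
        also have "\<dots> \<le> (LINT x:p|lebesgue. dl * (norm (f x) + norm (c p)))"
        proof (rule set_integral_mono)
          show "set_integrable lebesgue p (\<lambda>x. norm (b x * cnj (e \<iota> x) - b x * cnj (e \<iota> z)))"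
            by (rule set_integrable_norm[OF set_integral_diff(1)[OF be be']])
          show "set_integrable lebesgue p (\<lambda>x. dl * (norm (f x) + norm (c p)))"
            using sub_int(2)[of p] Pm[OF p] Pint[OF p]
            by (intro set_integrable_mult_right impI set_integral_add) (auto simp: set_integrable_def)
          fix x assume x: "x \<in> p"
          have "norm (b x * cnj (e \<iota> x) - b x * cnj (e \<iota> z)) = norm (b x) * norm (e \<iota> x - e \<iota> z)"
            by (simp add: right_diff_distrib[symmetric] norm_mult complex_cnj_diff[symmetric] del: complex_cnj_diff)
          also have "\<dots> \<le> (norm (f x) + norm (c p)) * dl"
            using de[OF x] bp[OF x] norm_triangle_ineq4[of "f x" "c p"] by (intro mult_mono) auto
          finally show "norm (b x * cnj (e \<iota> x) - b x * cnj (e \<iota> z)) \<le> dl * (norm (f x) + norm (c p))" by (simp add: mult.commute)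
        qed
        also have "\<dots> = dl * (\<mu> p + norm (c p) * measure lebesgue p)"
          using sub_int(2)[of p] Pm[OF p] Pint[OF p] unfolding \<mu>_def
          by (subst set_integral_mult_right, subst set_integral_add)
            (auto simp: set_integrable_def set_lebesgue_integral_def)
        also have "\<dots> \<le> dl * (2 * \<mu> p)"
        proof -
          have "norm (c p) * measure lebesgue p \<le> \<mu> p" using c_le[OF p] Pm(4)[OF p] by (simp add: field_simps del: measure_completion)
          moreover have "dl \<ge> 0" unfolding dl_def using B by auto
          ultimately show ?thesis by (intro mult_left_mono) auto
        qed
        also have "\<dots> = D * 2 powi (lev \<iota> - tau p) * \<mu> p / sqrt (measure lebesgue (Q \<iota>))"
          by (simp add: dl_def D_def power_int_diff power_int_minus divide_inverse mult_ac)
        finally show "norm (LINT x:p|lebesgue. b x * cnj (e \<iota> x)) \<le> D * 2 powi (lev \<iota> - tau p) * \<mu> p / sqrt (measure lebesgue (Q \<iota>))" .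
      qed
      finally show ?thesis by (simp add: sum_divide_distrib)
    qed
    have D0: "D \<ge> 0" using B by (simp add: D_def)
    \<comment> \<open>For the bad part the l^2 sum of the terms is replaced by their l^1 sum. This
      is affordable because the geometric gain makes the integral of \<open>T\<close> comparable to
      that of the modulus of \<open>f\<close>.\<close>
    define T where "T x = (\<Sum>\<iota>\<in>F'. (norm (ip b (e \<iota>)) / sqrt (measure lebesgue (Q \<iota>))) * indicator (Q \<iota>) x)" for x
    define G where "G x = (\<Sum>\<iota>\<in>F. ((norm (ip g (e \<iota>)))\<^sup>2 / measure lebesgue (Q \<iota>)) * indicator (Q \<iota>) x)" for x
    have finF': "finite F'" and F'F: "F' \<subseteq> F" using fin unfolding F'_def by auto
    have T_int: "(\<Sum>\<iota>\<in>F'. (norm (ip b (e \<iota>)) / sqrt (measure lebesgue (Q \<iota>))) * measure lebesgue (Q \<iota>)) \<le> 2 * D * (a * mR)"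
    proof -
      have "(\<Sum>\<iota>\<in>F'. (norm (ip b (e \<iota>)) / sqrt (measure lebesgue (Q \<iota>))) * measure lebesgue (Q \<iota>))
          \<le> (\<Sum>\<iota>\<in>F'. \<Sum>p\<in>{p\<in>\<P>. p \<subseteq> Q \<iota>}. D * 2 powi (lev \<iota> - tau p) * \<mu> p)"
      proof (rule sum_mono)
        fix \<iota> assume \<iota>: "\<iota> \<in> F'"
        have "(norm (ip b (e \<iota>)) / sqrt (measure lebesgue (Q \<iota>))) * measure lebesgue (Q \<iota>)
            = norm (ip b (e \<iota>)) * sqrt (measure lebesgue (Q \<iota>))"
        proof -
          have "r / sqrt m * m = r * sqrt m" if "m > 0" for r m :: real
          proof -
            have "r / sqrt m * m = r * (m / sqrt m)" by simp
            then show ?thesis by (simp only: real_div_sqrt[OF less_imp_le[OF that]])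
          qed
          then show ?thesis using mQ[of \<iota>] .
        qed
        also have "\<dots> \<le> (\<Sum>p\<in>{p\<in>\<P>. p \<subseteq> Q \<iota>}. D * 2 powi (lev \<iota> - tau p) * \<mu> p)"
          using bad[OF \<iota>] mQ[of \<iota>] by (simp only: pos_le_divide_eq real_sqrt_gt_zero)
        finally show "(norm (ip b (e \<iota>)) / sqrt (measure lebesgue (Q \<iota>))) * measure lebesgue (Q \<iota>)
          \<le> (\<Sum>p\<in>{p\<in>\<P>. p \<subseteq> Q \<iota>}. D * 2 powi (lev \<iota> - tau p) * \<mu> p)" .
      qed
      also have "\<dots> = (\<Sum>p\<in>\<P>. \<Sum>\<iota>\<in>{\<iota>\<in>F'. p \<subseteq> Q \<iota>}. D * 2 powi (lev \<iota> - tau p) * \<mu> p)"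
        by (rule sum.swap_restrict[OF finF' finP])
      also have "\<dots> = (\<Sum>p\<in>\<P>. D * \<mu> p * (\<Sum>\<iota>\<in>{\<iota>\<in>F'. p \<subseteq> Q \<iota>}. 2 powi (lev \<iota> - tau p)))"
        by (simp add: sum_distrib_left mult_ac)
      also have "\<dots> \<le> (\<Sum>p\<in>\<P>. D * \<mu> p * 2)"
      proof (rule sum_mono)
        fix p assume p: "p \<in> \<P>"
        then obtain z where z: "z \<in> p" unfolding \<P>_def using xP by blast
        let ?I = "{\<iota>\<in>F'. p \<subseteq> Q \<iota>}"
        have Qz: "Q \<iota> = cell t (lev \<iota>) z" if "\<iota> \<in> ?I" for \<iota>
        proof -
          have "z \<in> Q \<iota>" using that z by blast
          then show ?thesis unfolding Q_def by (rule cell_eq[symmetric])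
        qed
        \<comment> \<open>Each cell carries at most one wavelet, so those whose cells contain
          \<open>p\<close> have distinct levels, and their gains are terms of one geometric
          series.\<close>
        have "inj_on lev ?I"
        proof (rule inj_onI)
          fix \<iota> \<kappa> assume h: "\<iota> \<in> ?I" "\<kappa> \<in> ?I" "lev \<iota> = lev \<kappa>"
          have "Q \<iota> = Q \<kappa>" unfolding Qz[OF h(1)] Qz[OF h(2)] h(3) ..
          moreover have "\<iota> \<in> F" "\<kappa> \<in> F" using h F'F by blast+
          ultimately show "\<iota> = \<kappa>" by (rule inj_onD[OF inj])
        qed
        then have "(\<Sum>\<iota>\<in>?I. (2::real) powi (lev \<iota> - tau p)) = (\<Sum>i\<in>lev ` ?I. 2 powi (i - tau p))"
          by (simp add: sum.reindex)
        also have "\<dots> \<le> 2"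
        proof (rule sum_two_powi_le)
          fix i assume "i \<in> lev ` ?I"
          then obtain \<iota> where \<iota>: "\<iota> \<in> ?I" "i = lev \<iota>" by blast
          then have "cell t (tau p) z \<subseteq> cell t (lev \<iota>) (pt \<iota>)" using tau[OF p z] unfolding Q_def by blast
          then show "i \<le> tau p" using \<iota>(2) cell_subset_level by blast
        qed (use finF' in auto)
        finally show "D * \<mu> p * (\<Sum>\<iota>\<in>?I. 2 powi (lev \<iota> - tau p)) \<le> D * \<mu> p * 2"
          using D0 \<mu>0 by (intro mult_left_mono) auto
      qed
      also have "\<dots> = 2 * D * (a * mR)"
      proof -
        have "(\<Sum>p\<in>\<P>. D * \<mu> p * 2) = 2 * D * (\<Sum>p\<in>\<P>. \<mu> p)"
          unfolding sum_distrib_left by (rule sum.cong) simp_all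
        then show ?thesis by (simp add: sum\<mu>)
      qed
      finally show ?thesis .
    qed
    have G_int: "(\<Sum>\<iota>\<in>F. ((norm (ip g (e \<iota>)))\<^sup>2 / measure lebesgue (Q \<iota>)) * measure lebesgue (Q \<iota>)) \<le> N * lam * (a * mR)"
    proof -
      have "(\<Sum>\<iota>\<in>F. ((norm (ip g (e \<iota>)))\<^sup>2 / measure lebesgue (Q \<iota>)) * measure lebesgue (Q \<iota>)) = (\<Sum>\<iota>\<in>F. (norm (ip g (e \<iota>)))\<^sup>2)"
        using mQ by (intro sum.cong) (auto simp: less_imp_neq[symmetric] simp del: measure_completion)
      then show ?thesis using bessel[OF g_L2] g2_le by simp
    qed
    have point: "?Sf x \<le> 2 * G x + 2 * (T x)\<^sup>2" if x: "x \<notin> \<Omega>" for x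
    proof -
      have "?Sf x \<le> (\<Sum>\<iota>\<in>F. 2 * (((norm (ip g (e \<iota>)))\<^sup>2 / measure lebesgue (Q \<iota>)) * indicator (Q \<iota>) x)
          + 2 * (((norm (ip b (e \<iota>)))\<^sup>2 / measure lebesgue (Q \<iota>)) * indicator (Q \<iota>) x))"
      proof (rule sum_mono)
        fix \<iota> assume "\<iota> \<in> F"
        have "(norm (ip f (e \<iota>)))\<^sup>2 \<le> (norm (ip g (e \<iota>)) + norm (ip b (e \<iota>)))\<^sup>2"
          unfolding split[OF \<open>\<iota> \<in> F\<close>] by (intro power_mono norm_triangle_ineq) auto
        also have "\<dots> \<le> 2 * (norm (ip g (e \<iota>)))\<^sup>2 + 2 * (norm (ip b (e \<iota>)))\<^sup>2"
          using sum_squares_bound[of "norm (ip g (e \<iota>))" "norm (ip b (e \<iota>))"] by (simp add: power2_sum)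
        finally have "(norm (ip f (e \<iota>)))\<^sup>2 / measure lebesgue (Q \<iota>) \<le> (2 * (norm (ip g (e \<iota>)))\<^sup>2 + 2 * (norm (ip b (e \<iota>)))\<^sup>2) / measure lebesgue (Q \<iota>)"
          by (intro divide_right_mono) auto
        then show "(norm (ip f (e \<iota>)))\<^sup>2 / measure lebesgue (Q \<iota>) * indicator (Q \<iota>) x
          \<le> 2 * (((norm (ip g (e \<iota>)))\<^sup>2 / measure lebesgue (Q \<iota>)) * indicator (Q \<iota>) x)
          + 2 * (((norm (ip b (e \<iota>)))\<^sup>2 / measure lebesgue (Q \<iota>)) * indicator (Q \<iota>) x)"
          by (auto simp: indicator_def add_divide_distrib)
      qed
      also have "\<dots> = 2 * G x + 2 * (\<Sum>\<iota>\<in>F. ((norm (ip b (e \<iota>)))\<^sup>2 / measure lebesgue (Q \<iota>)) * indicator (Q \<iota>) x)"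
        unfolding G_def by (simp add: sum.distrib sum_distrib_left)
      also have "(\<Sum>\<iota>\<in>F. ((norm (ip b (e \<iota>)))\<^sup>2 / measure lebesgue (Q \<iota>)) * indicator (Q \<iota>) x)
          = (\<Sum>\<iota>\<in>F'. ((norm (ip b (e \<iota>)) / sqrt (measure lebesgue (Q \<iota>))) * indicator (Q \<iota>) x)\<^sup>2)"
      proof (rule sum.mono_neutral_cong_right[OF fin F'F])
        show "\<forall>\<iota>\<in>F - F'. (norm (ip b (e \<iota>)))\<^sup>2 / measure lebesgue (Q \<iota>) * indicator (Q \<iota>) x = 0"
          using x unfolding F'_def by (auto simp: indicator_def)
        show "(norm (ip b (e \<iota>)))\<^sup>2 / measure lebesgue (Q \<iota>) * indicator (Q \<iota>) x
          = ((norm (ip b (e \<iota>)) / sqrt (measure lebesgue (Q \<iota>))) * indicator (Q \<iota>) x)\<^sup>2" for \<iota>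
          by (auto simp: indicator_def power_divide)
      qed
      also have "\<dots> \<le> (T x)\<^sup>2"
        unfolding T_def using finF' by (intro sum_power2_le_power2_sum) (auto simp: indicator_def)
      finally show ?thesis by simp
    qed
    \<comment> \<open>The first bound serves Markov's inequality for \<open>G\<close> at height
      \<open>s1\<close>, the second that for \<open>T\<close> at height \<open>s2\<close>. The
      heights are chosen so that \<open>2 * s1 + 2 * s2\<^sup>2\<close> is exactly the
      threshold.\<close>
    have \<Lambda>: "\<Lambda> \<ge> 16 * N" "\<Lambda> \<ge> 32 * D" "\<Lambda> > 0"
      using B N1 unfolding \<Lambda>_def D_def N_def by (auto simp: mult_ac add_nonneg_pos intro!: add_pos_nonneg)
    define s1 where "s1 = (\<Lambda> * a)\<^sup>2 / 4"
    define s2 where "s2 = \<Lambda> * a / 2"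
    have s12: "s1 > 0" "s2 > 0" using \<Lambda>(3) a by (auto simp: s1_def s2_def)
    define A1 where "A1 = {x\<in>space lebesgue. G x > s1}"
    define A2 where "A2 = {x\<in>space lebesgue. T x > s2}"
    have A1: "A1 \<in> lmeasurable" "measure lebesgue A1 \<le> mR / 8"
    proof -
      show "A1 \<in> lmeasurable" unfolding A1_def G_def
        by (rule markov_step_function(3)[OF fin _ _ s12(1)]) (use Qm in auto)
      have "measure lebesgue A1 \<le> (\<Sum>\<iota>\<in>F. ((norm (ip g (e \<iota>)))\<^sup>2 / measure lebesgue (Q \<iota>)) * measure lebesgue (Q \<iota>)) / s1"
        unfolding A1_def G_def by (rule markov_step_function(2)[OF fin _ _ s12(1)]) (use Qm in auto)
      also have "\<dots> \<le> (N * lam * (a * mR)) / s1" using G_int s12 by (intro divide_right_mono) auto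
      also have "\<dots> \<le> mR / 8"
      proof -
        have "256 * N \<le> \<Lambda>\<^sup>2"
        proof -
          have "256 * N \<le> 256 * N\<^sup>2" using N1 by (simp add: power2_eq_square)
          also have "\<dots> = (16 * N)\<^sup>2" by (simp add: power_mult_distrib)
          also have "\<dots> \<le> \<Lambda>\<^sup>2" using \<Lambda> N1 by (intro power_mono) auto
          finally show ?thesis .
        qed
        then have "256 * N * (a\<^sup>2 * mR) \<le> \<Lambda>\<^sup>2 * (a\<^sup>2 * mR)" using mR by (intro mult_right_mono) auto
        then have "N * lam * (a * mR) \<le> mR / 8 * s1"
          unfolding s1_def lam_def by (simp add: power2_eq_square mult_ac)
        then show ?thesis by (simp only: pos_divide_le_eq[OF s12(1)])
      qed
      finally show "measure lebesgue A1 \<le> mR / 8" .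
    qed
    have A2: "A2 \<in> lmeasurable" "measure lebesgue A2 \<le> mR / 8"
    proof -
      show "A2 \<in> lmeasurable" unfolding A2_def T_def
        by (rule markov_step_function(3)[OF finF' _ _ s12(2)]) (use Qm in auto)
      have "measure lebesgue A2 \<le> (\<Sum>\<iota>\<in>F'. (norm (ip b (e \<iota>)) / sqrt (measure lebesgue (Q \<iota>))) * measure lebesgue (Q \<iota>)) / s2"
        unfolding A2_def T_def by (rule markov_step_function(2)[OF finF' _ _ s12(2)]) (use Qm in auto)
      also have "\<dots> \<le> (2 * D * (a * mR)) / s2" using T_int s12 by (intro divide_right_mono) auto
      also have "\<dots> \<le> mR / 8"
      proof -
        have "32 * D * (a * mR) \<le> \<Lambda> * (a * mR)" using \<Lambda> a mR by (intro mult_right_mono) auto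
        then have "2 * D * (a * mR) \<le> mR / 8 * s2"
          unfolding s2_def by (simp add: mult_ac)
        then show ?thesis by (simp only: pos_divide_le_eq[OF s12(2)])
      qed
      finally show "measure lebesgue A2 \<le> mR / 8" .
    qed
    have sub: "{x\<in>R. ?Sf x > (\<Lambda> * a)\<^sup>2} \<subseteq> \<Omega> \<union> (A1 \<union> A2)"
    proof
      fix x assume x: "x \<in> {x\<in>R. ?Sf x > (\<Lambda> * a)\<^sup>2}"
      show "x \<in> \<Omega> \<union> (A1 \<union> A2)"
      proof (rule ccontr)
        assume "\<not> ?thesis"
        then have *: "x \<notin> \<Omega>" "G x \<le> s1" "T x \<le> s2" by (auto simp: A1_def A2_def)
        have "T x \<ge> 0" unfolding T_def by (intro sum_nonneg) auto
        then have "(T x)\<^sup>2 \<le> s2\<^sup>2" using * by (intro power_mono)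
        then have "?Sf x \<le> 2 * s1 + 2 * s2\<^sup>2" using point[OF *(1)] * by linarith
        also have "\<dots> = (\<Lambda> * a)\<^sup>2" by (simp add: s1_def s2_def power_divide power2_eq_square)
        finally show False using x by simp
      qed
    qed
    have Sf_m: "{x\<in>R. ?Sf x > (\<Lambda> * a)\<^sup>2} \<in> sets lebesgue"
    proof -
      have "?Sf \<in> borel_measurable lebesgue"
        using Qm by (intro borel_measurable_sum borel_measurable_times borel_measurable_indicator) auto
      then have "{x\<in>space lebesgue. (\<Lambda> * a)\<^sup>2 < ?Sf x} \<in> sets lebesgue"
        by (rule borel_measurable_less[OF borel_measurable_const])
      then have "R \<inter> {x\<in>space lebesgue. (\<Lambda> * a)\<^sup>2 < ?Sf x} \<in> sets lebesgue" by (rule sets.Int[OF Rm(1)])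
      then show ?thesis by (simp add: Int_def)
    qed
    have "measure lebesgue {x\<in>R. ?Sf x > (\<Lambda> * a)\<^sup>2} \<le> measure lebesgue (\<Omega> \<union> (A1 \<union> A2))"
      using \<Omega>m A1 A2 Sf_m by (intro measure_mono_fmeasurable sub) auto
    also have "\<dots> \<le> measure lebesgue \<Omega> + measure lebesgue (A1 \<union> A2)"
      using \<Omega>m A1 A2 by (intro measure_Un_le) auto
    also have "\<dots> \<le> measure lebesgue \<Omega> + (measure lebesgue A1 + measure lebesgue A2)"
      using A1 A2 by (intro add_left_mono measure_Un_le) auto
    also have "\<dots> \<le> mR / 2" using m\<Omega> A1 A2 mR by linarith
    finally show ?thesis unfolding a_def \<mu>_def mR_def .
  qed
qed

section \<open>Orthonormal systems in \<open>L\<^sup>2\<close>\<close>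

lemma L2_spaceD:
  assumes "f \<in> L2_space"
  shows "f \<in> borel_measurable lebesgue" "integrable lebesgue (\<lambda>x. (norm (f x))\<^sup>2)"
proof -
  show m[measurable]: "f \<in> borel_measurable lebesgue" using assms by (simp add: L2_space_def)
  show "integrable lebesgue (\<lambda>x. (norm (f x))\<^sup>2)"
    by (rule integrableI_bounded) (use assms in \<open>auto simp: L2_space_def\<close>)
qed

lemma L2_spaceI:
  assumes "f \<in> borel_measurable lebesgue" "integrable lebesgue (\<lambda>x. (norm (f x))\<^sup>2)"
  shows "f \<in> L2_space"
  using assms nn_integral_eq_integral[OF assms(2)] by (auto simp: L2_space_def)

lemma L2_prod_integrable:
  assumes f: "f \<in> L2_space" and g: "g \<in> L2_space"
  shows "integrable lebesgue (\<lambda>x. f x * cnj (g x))"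
proof (rule Bochner_Integration.integrable_bound)
  note [measurable] = L2_spaceD(1)[OF f] L2_spaceD(1)[OF g]
  show "integrable lebesgue (\<lambda>x. (norm (f x))\<^sup>2 + (norm (g x))\<^sup>2)"
    using L2_spaceD(2)[OF f] L2_spaceD(2)[OF g] by simp
  show "(\<lambda>x. f x * cnj (g x)) \<in> borel_measurable lebesgue" by measurable
  show "AE x in lebesgue. norm (f x * cnj (g x)) \<le> norm ((norm (f x))\<^sup>2 + (norm (g x))\<^sup>2)"
  proof (rule AE_I2)
    fix x
    have "norm (f x) * norm (g x) \<le> (norm (f x))\<^sup>2 + (norm (g x))\<^sup>2"
    proof -
      have "0 \<le> norm (f x) * norm (g x)" by simp
      then show ?thesis using sum_squares_bound[of "norm (f x)" "norm (g x)"] unfolding mult.assoc by linarith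
    qed
    then show "norm (f x * cnj (g x)) \<le> norm ((norm (f x))\<^sup>2 + (norm (g x))\<^sup>2)" by (simp add: norm_mult)
  qed
qed

lemma L2_add:
  assumes f: "f \<in> L2_space" and g: "g \<in> L2_space"
  shows "(\<lambda>x. f x + g x) \<in> L2_space"
proof (rule L2_spaceI)
  note [measurable] = L2_spaceD(1)[OF f] L2_spaceD(1)[OF g]
  show "(\<lambda>x. f x + g x) \<in> borel_measurable lebesgue" by measurable
  show "integrable lebesgue (\<lambda>x. (norm (f x + g x))\<^sup>2)"
  proof (rule Bochner_Integration.integrable_bound)
    show "integrable lebesgue (\<lambda>x. 2 * (norm (f x))\<^sup>2 + 2 * (norm (g x))\<^sup>2)"
      using L2_spaceD(2)[OF f] L2_spaceD(2)[OF g] by simp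
    show "AE x in lebesgue. norm ((norm (f x + g x))\<^sup>2) \<le> norm (2 * (norm (f x))\<^sup>2 + 2 * (norm (g x))\<^sup>2)"
    proof (rule AE_I2)
      fix x
      have "(norm (f x + g x))\<^sup>2 \<le> (norm (f x) + norm (g x))\<^sup>2"
        by (intro power_mono norm_triangle_ineq) simp
      also have "\<dots> \<le> 2 * (norm (f x))\<^sup>2 + 2 * (norm (g x))\<^sup>2"
        using sum_squares_bound[of "norm (f x)" "norm (g x)"] by (simp add: power2_sum)
      finally show "norm ((norm (f x + g x))\<^sup>2) \<le> norm (2 * (norm (f x))\<^sup>2 + 2 * (norm (g x))\<^sup>2)" by simp
    qed
  qed measurable
qed

lemma L2_cmult: "f \<in> L2_space \<Longrightarrow> (\<lambda>x. c * f x) \<in> L2_space"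
  by (rule L2_spaceI) (auto dest: L2_spaceD simp: norm_mult power_mult_distrib)

lemma L2_zero: "(\<lambda>_. 0) \<in> L2_space"
  by (rule L2_spaceI) auto

lemma L2_sum:
  assumes "\<And>i. i \<in> F \<Longrightarrow> e i \<in> L2_space"
  shows "(\<lambda>x. \<Sum>i\<in>F. c i * e i x) \<in> L2_space"
  using assms by (induction F rule: infinite_finite_induct) (auto intro!: L2_add L2_cmult L2_zero)

lemma L2_diff: "f \<in> L2_space \<Longrightarrow> g \<in> L2_space \<Longrightarrow> (\<lambda>x. f x - g x) \<in> L2_space"
  using L2_add[of f "\<lambda>x. -1 * g x"] L2_cmult[of g "-1"] by simp

lemma ip_diff_left:
  assumes "f \<in> L2_space" "g \<in> L2_space" "h \<in> L2_space"
  shows "ip (\<lambda>x. f x - g x) h = ip f h - ip g h"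
  unfolding ip_def left_diff_distrib
  by (rule Bochner_Integration.integral_diff) (use assms in \<open>auto intro: L2_prod_integrable\<close>)

lemma ip_sum_left:
  assumes "\<And>i. i \<in> F \<Longrightarrow> e i \<in> L2_space" "h \<in> L2_space"
  shows "ip (\<lambda>x. \<Sum>i\<in>F. c i * e i x) h = (\<Sum>i\<in>F. c i * ip (e i) h)"
proof -
  have "ip (\<lambda>x. \<Sum>i\<in>F. c i * e i x) h = (LINT x|lebesgue. (\<Sum>i\<in>F. c i * (e i x * cnj (h x))))"
    unfolding ip_def by (simp add: sum_distrib_right mult.assoc)
  also have "\<dots> = (\<Sum>i\<in>F. LINT x|lebesgue. c i * (e i x * cnj (h x)))"
    using assms by (intro Bochner_Integration.integral_sum integrable_mult_right L2_prod_integrable)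
  finally show ?thesis by (simp add: ip_def)
qed

lemma ip_commute: "ip g f = cnj (ip f g)"
  unfolding ip_def by (subst Bochner_Integration.integral_cnj[symmetric]) (simp add: mult.commute)

lemma ip_self: "ip f f = of_real (LINT x|lebesgue. (norm (f x))\<^sup>2)"
  unfolding ip_def by (simp add: complex_norm_square[symmetric] flip: integral_complex_of_real)

lemma orthogonal_remainder:
  assumes F: "finite F" "\<forall>i\<in>F. e i \<in> L2_space"
    and on: "\<forall>i\<in>F. \<forall>i'\<in>F. ip (e i) (e i') = (if i = i' then 1 else 0)"
    and g: "g \<in> L2_space"
  defines "r \<equiv> \<lambda>x. g x - (\<Sum>i\<in>F. ip g (e i) * e i x)"
  shows "r \<in> L2_space" "i \<in> F \<Longrightarrow> ip r (e i) = 0"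
    "h \<in> L2_space \<Longrightarrow> ip r h = ip g h - (\<Sum>i\<in>F. ip g (e i) * ip (e i) h)"
    "(LINT x|lebesgue. (norm (r x))\<^sup>2) = (LINT x|lebesgue. (norm (g x))\<^sup>2) - (\<Sum>i\<in>F. (norm (ip g (e i)))\<^sup>2)"
proof -
  have s: "(\<lambda>x. \<Sum>i\<in>F. ip g (e i) * e i x) \<in> L2_space" by (rule L2_sum) (use F in auto)
  show r: "r \<in> L2_space" unfolding r_def by (rule L2_diff[OF g s])
  show rh: "ip r h = ip g h - (\<Sum>i\<in>F. ip g (e i) * ip (e i) h)" if "h \<in> L2_space" for h
    unfolding r_def ip_diff_left[OF g s that] using ip_sum_left[of F e h] F that by simp
  show re: "ip r (e i) = 0" if "i \<in> F" for i
  proof -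
    have "(\<Sum>i'\<in>F. ip g (e i') * ip (e i') (e i)) = (\<Sum>i'\<in>F. if i' = i then ip g (e i) else 0)"
      by (rule sum.cong) (use on that in auto)
    then show ?thesis using rh[of "e i"] F that by simp
  qed
  have re': "ip (e i) r = 0" if "i \<in> F" for i
    using re[OF that] ip_commute[of "e i" r] by simp
  have "(\<Sum>i\<in>F. ip g (e i) * ip (e i) r) = 0" using re' by (intro sum.neutral) simp
  then have "ip r r = ip g r" using rh[OF r] by simp
  then have "ip r r = cnj (ip r g)" using ip_commute[of g r] by simp
  also have "\<dots> = cnj (ip g g - (\<Sum>i\<in>F. ip g (e i) * cnj (ip g (e i))))"
  proof -
    have "(\<Sum>i\<in>F. ip g (e i) * ip (e i) g) = (\<Sum>i\<in>F. ip g (e i) * cnj (ip g (e i)))"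
      by (rule sum.cong[OF refl]) (subst ip_commute, rule refl)
    then show ?thesis using rh[OF g] by simp
  qed
  also have "(\<Sum>i\<in>F. ip g (e i) * cnj (ip g (e i))) = of_real (\<Sum>i\<in>F. (norm (ip g (e i)))\<^sup>2)"
    by (simp only: of_real_sum complex_norm_square)
  finally have "ip r r = of_real ((LINT x|lebesgue. (norm (g x))\<^sup>2) - (\<Sum>i\<in>F. (norm (ip g (e i)))\<^sup>2))"
    by (simp add: ip_self)
  then show "(LINT x|lebesgue. (norm (r x))\<^sup>2) = (LINT x|lebesgue. (norm (g x))\<^sup>2) - (\<Sum>i\<in>F. (norm (ip g (e i)))\<^sup>2)"
    by (simp only: ip_self of_real_eq_iff)
qed

lemma bessel_inequality:
  assumes "finite F" "\<forall>i\<in>F. e i \<in> L2_space"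
    and "\<forall>i\<in>F. \<forall>i'\<in>F. ip (e i) (e i') = (if i = i' then 1 else 0)"
    and "g \<in> L2_space"
  shows "(\<Sum>i\<in>F. (norm (ip g (e i)))\<^sup>2) \<le> (LINT x|lebesgue. (norm (g x))\<^sup>2)"
  using orthogonal_remainder(4)[OF assms]
    Bochner_Integration.integral_nonneg[of lebesgue "\<lambda>x. (norm (g x - (\<Sum>i\<in>F. ip g (e i) * e i x)))\<^sup>2"] by simp

text \<open>Cauchy--Schwarz in additive form: the free parameter \<open>s\<close> takes the place of
  the square roots.\<close>

lemma norm_ip_le:
  assumes f: "f \<in> L2_space" and g: "g \<in> L2_space" and s: "s > 0"
  shows "norm (ip f g) \<le> (LINT x|lebesgue. (norm (f x))\<^sup>2) / s + s * (LINT x|lebesgue. (norm (g x))\<^sup>2)"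
proof -
  have "norm (ip f g) \<le> (LINT x|lebesgue. norm (f x * cnj (g x)))"
    unfolding ip_def by (rule integral_norm_bound)
  also have "\<dots> \<le> (LINT x|lebesgue. (norm (f x))\<^sup>2 / s + s * (norm (g x))\<^sup>2)"
  proof (rule integral_mono)
    show "integrable lebesgue (\<lambda>x. norm (f x * cnj (g x)))" using L2_prod_integrable[OF f g] by simp
    show "integrable lebesgue (\<lambda>x. (norm (f x))\<^sup>2 / s + s * (norm (g x))\<^sup>2)"
      using L2_spaceD(2)[OF f] L2_spaceD(2)[OF g] by simp
    fix x
    have "2 * (norm (f x) / sqrt s) * (sqrt s * norm (g x)) \<le> (norm (f x) / sqrt s)\<^sup>2 + (sqrt s * norm (g x))\<^sup>2"
      by (rule sum_squares_bound)
    then have "2 * (norm (f x) * norm (g x)) \<le> (norm (f x))\<^sup>2 / s + s * (norm (g x))\<^sup>2"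
      using s by (simp add: power_divide power_mult_distrib)
    then show "norm (f x * cnj (g x)) \<le> (norm (f x))\<^sup>2 / s + s * (norm (g x))\<^sup>2"
    proof -
      have "0 \<le> norm (f x) * norm (g x)" by simp
      then show ?thesis using \<open>2 * (norm (f x) * norm (g x)) \<le> _\<close> unfolding norm_mult complex_mod_cnj by linarith
    qed
  qed
  also have "\<dots> = (LINT x|lebesgue. (norm (f x))\<^sup>2) / s + s * (LINT x|lebesgue. (norm (g x))\<^sup>2)"
    using L2_spaceD(2)[OF f] L2_spaceD(2)[OF g] by simp
  finally show ?thesis .
qed

text \<open>Density only provides some combination near \<open>f\<close>. The combination with
  coefficients \<open>ip f (e i)\<close> is at least as good, because \<open>f\<close> and the error
  \<open>u\<close> of the given combination have the same remainder after projection.\<close>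

lemma parseval_approx:
  assumes basis: "L2_orthonormal_basis I e" and f: "f \<in> L2_space" and g: "g \<in> L2_space" and \<delta>: "\<delta> > 0"
  shows "\<exists>F. finite F \<and> F \<subseteq> I \<and> norm (ip f g - (\<Sum>i\<in>F. ip f (e i) * ip (e i) g)) \<le> \<delta>"
proof -
  define G where "G = (LINT x|lebesgue. (norm (g x))\<^sup>2)"
  have G: "G \<ge> 0" unfolding G_def by (intro Bochner_Integration.integral_nonneg) simp
  \<comment> \<open>Chosen for \<open>norm_ip_le\<close>: with this \<open>s\<close> the term of
    \<open>g\<close> is at most \<open>\<delta> / 2\<close>, and \<epsilon> is then taken so that
    the term of the remainder is at most \<open>\<delta> / 2\<close> too.\<close>
  define s where "s = \<delta> / (2 * (G + 1))"
  have s: "s > 0" using \<delta> G by (simp add: s_def)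
  have sG: "s * G \<le> \<delta> / 2" using \<delta> G by (simp add: s_def field_simps)
  define \<epsilon> where "\<epsilon> = sqrt (s * \<delta> / 2)"
  have \<epsilon>: "\<epsilon> > 0" "\<epsilon>\<^sup>2 = s * \<delta> / 2" using s \<delta> by (auto simp: \<epsilon>_def)
  obtain F c where F: "finite F" "F \<subseteq> I"
    and c: "(\<integral>\<^sup>+x. ennreal ((norm (f x - (\<Sum>i\<in>F. c i * e i x)))\<^sup>2) \<partial>lebesgue) < ennreal (\<epsilon>\<^sup>2)"
    using basis f \<epsilon>(1) unfolding L2_orthonormal_basis_def by blast
  have eL2: "\<forall>i\<in>F. e i \<in> L2_space"
    using basis F unfolding L2_orthonormal_basis_def by blast
  have on: "\<forall>i\<in>F. \<forall>i'\<in>F. ip (e i) (e i') = (if i = i' then 1 else 0)"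
    using basis F unfolding L2_orthonormal_basis_def by blast
  define u where "u x = f x - (\<Sum>i\<in>F. c i * e i x)" for x
  have u: "u \<in> L2_space" unfolding u_def by (intro L2_diff f L2_sum) (use eL2 in auto)
  define r where "r x = f x - (\<Sum>i\<in>F. ip f (e i) * e i x)" for x
  note rem = orthogonal_remainder[OF F(1) eL2 on f, folded r_def]
  have "r = (\<lambda>x. u x - (\<Sum>i\<in>F. ip u (e i) * e i x))"
  proof
    fix x
    have "ip u (e i) = ip f (e i) - c i" if "i \<in> F" for i
    proof -
      have "ip u (e i) = ip f (e i) - (\<Sum>i'\<in>F. c i' * ip (e i') (e i))"
        unfolding u_def using f eL2 that by (subst ip_diff_left) (auto intro: L2_sum simp: ip_sum_left)
      also have "(\<Sum>i'\<in>F. c i' * ip (e i') (e i)) = (\<Sum>i'\<in>F. if i' = i then c i else 0)"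
        by (rule sum.cong) (use on that in auto)
      finally show ?thesis using F(1) that by simp
    qed
    then have "(\<Sum>i\<in>F. ip u (e i) * e i x) = (\<Sum>i\<in>F. ip f (e i) * e i x) - (\<Sum>i\<in>F. c i * e i x)"
      by (simp add: left_diff_distrib sum_subtractf)
    then show "r x = u x - (\<Sum>i\<in>F. ip u (e i) * e i x)" by (simp add: r_def u_def)
  qed
  then have "(LINT x|lebesgue. (norm (r x))\<^sup>2) \<le> (LINT x|lebesgue. (norm (u x))\<^sup>2)"
    using orthogonal_remainder(4)[OF F(1) eL2 on u] by (simp add: sum_nonneg)
  also have "\<dots> \<le> \<epsilon>\<^sup>2"
  proof -
    have "ennreal (LINT x|lebesgue. (norm (u x))\<^sup>2) = (\<integral>\<^sup>+x. ennreal ((norm (u x))\<^sup>2) \<partial>lebesgue)"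
      using L2_spaceD(2)[OF u] by (intro nn_integral_eq_integral[symmetric]) auto
    also have "\<dots> \<le> ennreal (\<epsilon>\<^sup>2)" using c unfolding u_def by (rule less_imp_le)
    finally show ?thesis by (subst (asm) ennreal_le_iff) auto
  qed
  finally have r2: "(LINT x|lebesgue. (norm (r x))\<^sup>2) / s \<le> \<delta> / 2"
    using s \<epsilon>(2) by (simp add: field_simps)
  have "norm (ip r g) \<le> \<delta>"
    using norm_ip_le[OF rem(1) g s] r2 sG unfolding G_def by linarith
  then show ?thesis using rem(3)[OF g] F by auto
qed

section \<open>Weighted upper bounds\<close>

lemma sum_powr_le:
  fixes X :: "'c \<Rightarrow> real"
  assumes fin: "finite \<C>" and X: "\<And>c. c \<in> \<C> \<Longrightarrow> X c \<ge> 0" and r: "r > 0"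
  shows "(\<Sum>c\<in>\<C>. X c) powr r \<le> real (card \<C>) powr r * (\<Sum>c\<in>\<C>. X c powr r)"
proof (cases "\<C> = {}")
  case False
  obtain c0 where c0: "c0 \<in> \<C>" "\<And>c. c \<in> \<C> \<Longrightarrow> X c \<le> X c0"
    using Max_in[of "X ` \<C>"] Max_ge[of "X ` \<C>"] fin False by (metis (no_types, lifting) finite_imageI image_iff image_is_empty)
  have "(\<Sum>c\<in>\<C>. X c) \<le> real (card \<C>) * X c0" using c0 by (intro sum_bounded_above) auto
  then have "(\<Sum>c\<in>\<C>. X c) powr r \<le> (real (card \<C>) * X c0) powr r"
    using r X by (intro powr_mono2 sum_nonneg) auto
  also have "\<dots> = real (card \<C>) powr r * X c0 powr r" using X[OF c0(1)] by (simp add: powr_mult)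
  also have "\<dots> \<le> real (card \<C>) powr r * (\<Sum>c\<in>\<C>. X c powr r)"
    using fin c0(1) by (intro mult_left_mono member_le_sum) auto
  finally show ?thesis .
qed simp

lemma square_powr_half:
  fixes u :: real
  assumes "u \<ge> 0"
  shows "(u\<^sup>2) powr (r / 2) = u powr r"
proof (cases "u = 0")
  case False
  then have "u\<^sup>2 = u powr 2" using assms by (simp add: powr_numeral)
  then show ?thesis by (simp add: powr_powr)
qed simp

text \<open>The conditions under which the weak type estimate holds on every cell of the family. The
  bound \<open>i0\<close> on the levels keeps the cells within the range of the Muckenhoupt
  condition; the last clause is Bessel's inequality.\<close>

definition grid_family :: "int \<Rightarrow> real \<Rightarrow> real^'n \<Rightarrow> 'i set \<Rightarrow> ('i \<Rightarrow> int) \<Rightarrow> ('i \<Rightarrow> real^'n)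
    \<Rightarrow> ('i \<Rightarrow> real^'n \<Rightarrow> complex) \<Rightarrow> bool" where
  "grid_family i0 B t F lev pt e \<longleftrightarrow>
    grid_shift t \<and> finite F \<and> (\<forall>\<iota>\<in>F. i0 \<le> lev \<iota>) \<and> inj_on (\<lambda>\<iota>. cell t (lev \<iota>) (pt \<iota>)) F \<and>
    (\<forall>\<iota>\<in>F. \<forall>x. x \<notin> cell t (lev \<iota>) (pt \<iota>) \<longrightarrow> e \<iota> x = 0) \<and>
    (\<forall>\<iota>\<in>F. e \<iota> \<in> borel_measurable lebesgue \<and> (\<exists>K. \<forall>x. norm (e \<iota> x) \<le> K)) \<and>
    (\<forall>\<iota>\<in>F. \<forall>x y. norm (e \<iota> x - e \<iota> y)
        \<le> B * (2 powi lev \<iota> * norm (x - y)) / sqrt (measure lebesgue (cell t (lev \<iota>) (pt \<iota>)))) \<and>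
    (\<forall>g\<in>L2_space. (\<Sum>\<iota>\<in>F. (norm (ip g (e \<iota>)))\<^sup>2) \<le> (LINT x|lebesgue. (norm (g x))\<^sup>2))"

context pos_weight
begin

text \<open>The weak type estimate on each cell is the hypothesis of
  \<open>sparse_domination\<close>, with \<open>c R\<close> a multiple of the average of the modulus
  of \<open>f\<close>. So the square function is at most a multiple of a sparse sum, to which
  \<open>sparse_weighted_bound\<close> applies. The order of the quantifiers makes the constant
  uniform in the family.\<close>

lemma grid_square_bound:
  assumes Ap: "\<forall>i\<ge>i0. \<forall>t x. Apset A (cell t i x)" and B: "B \<ge> 0"
  shows "\<exists>C>0. \<forall>(F :: 'i set) t lev pt e f.
    grid_family i0 B t F lev pt e \<and>
    f \<in> borel_measurable lebesgue \<longrightarrow>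
    (\<integral>\<^sup>+x. ennreal ((\<Sum>\<iota>\<in>F. (norm (ip f (e \<iota>)))\<^sup>2 / measure lebesgue (cell t (lev \<iota>) (pt \<iota>))
        * indicator (cell t (lev \<iota>) (pt \<iota>)) x) powr (p / 2)) \<partial>W)
      \<le> ennreal C * (\<integral>\<^sup>+x. ennreal (norm (f x) powr p) \<partial>W)"
proof -
  obtain C0 where C0: "C0 > 0" and sparse: "\<forall>\<S> E f. finite \<S> \<and> laminar \<S> \<and> disjoint_family_on E \<S> \<and>
    (\<forall>Q\<in>\<S>. Apset A Q \<and> E Q \<in> sets lebesgue \<and> E Q \<subseteq> Q \<and> measure lebesgue Q \<le> 2 * measure lebesgue (E Q)) \<and>
    f \<in> borel_measurable lebesgue \<and> (\<forall>x. f x \<ge> 0) \<longrightarrow>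
    (\<integral>\<^sup>+x. ennreal ((\<Sum>Q\<in>\<S>. (LINT x:Q|lebesgue. f x) / measure lebesgue Q * indicator Q x) powr p) \<partial>W)
      \<le> ennreal C0 * (\<integral>\<^sup>+x. ennreal (f x powr p) \<partial>W)"
    using sparse_weighted_bound[of A] by (elim exE conjE) (rule that)
  define \<Lambda> where "\<Lambda> = 16 * 2 ^ CARD('n) + 64 * B * real CARD('n)"
  have L0: "\<Lambda> > 0" using B by (auto simp: \<Lambda>_def intro!: add_pos_nonneg)
  show ?thesis
  proof (intro exI[of _ "\<Lambda> powr p * C0"] conjI allI impI)
    show "\<Lambda> powr p * C0 > 0" using L0 C0 by simp
    fix F :: "'i set" and t :: "real^'n" and lev :: "'i \<Rightarrow> int" and pt :: "'i \<Rightarrow> real^'n"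
      and e :: "'i \<Rightarrow> real^'n \<Rightarrow> complex" and f :: "real^'n \<Rightarrow> complex"
    define Q where "Q \<iota> = cell t (lev \<iota>) (pt \<iota>)" for \<iota>
    assume asm: "grid_family i0 B t F lev pt e \<and> f \<in> borel_measurable lebesgue"
    then have t: "grid_shift t" and fin: "finite F" and lev: "\<And>\<iota>. \<iota> \<in> F \<Longrightarrow> i0 \<le> lev \<iota>"
      and inj: "inj_on Q F" and supp: "\<And>\<iota> x. \<iota> \<in> F \<Longrightarrow> x \<notin> Q \<iota> \<Longrightarrow> e \<iota> x = 0"
      and em: "\<And>\<iota>. \<iota> \<in> F \<Longrightarrow> e \<iota> \<in> borel_measurable lebesgue" and eb: "\<And>\<iota>. \<iota> \<in> F \<Longrightarrow> \<exists>K. \<forall>x. norm (e \<iota> x) \<le> K"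
      and lip: "\<And>\<iota> x y. \<iota> \<in> F \<Longrightarrow> norm (e \<iota> x - e \<iota> y) \<le> B * (2 powi lev \<iota> * norm (x - y)) / sqrt (measure lebesgue (Q \<iota>))"
      and bes: "\<And>g. g\<in>L2_space \<Longrightarrow> (\<Sum>\<iota>\<in>F. (norm (ip g (e \<iota>)))\<^sup>2) \<le> (LINT x|lebesgue. (norm (g x))\<^sup>2)"
      and f: "f \<in> borel_measurable lebesgue"
      unfolding Q_def[abs_def] grid_family_def by blast+
    let ?X = "\<lambda>x. \<Sum>\<iota>\<in>F. (norm (ip f (e \<iota>)))\<^sup>2 / measure lebesgue (Q \<iota>) * indicator (Q \<iota>) x"
    let ?J = "\<integral>\<^sup>+x. ennreal (norm (f x) powr p) \<partial>W"
    have "(\<integral>\<^sup>+x. ennreal (?X x powr (p / 2)) \<partial>W) \<le> ennreal (\<Lambda> powr p * C0) * ?J"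
    proof (cases "?J = \<infinity>")
      case True
      then show ?thesis using L0 C0 by (simp add: ennreal_mult_top)
    next
      case False
      then have Jfin: "?J < \<infinity>" by (simp add: less_top)
      define \<D> where "\<D> = Q ` F"
      \<comment> \<open>\<open>sparse_domination\<close> works with sets instead of indices;
        injectivity of \<open>Q\<close> recovers the index.\<close>
      define a where "a R = (norm (ip f (e (the_inv_into F Q R))))\<^sup>2 / measure lebesgue R" for R
      define avg where "avg R = (LINT x:R|lebesgue. norm (f x)) / measure lebesgue R" for R
      define c where "c R = \<Lambda> * avg R" for R
      have a_Q: "a (Q \<iota>) = (norm (ip f (e \<iota>)))\<^sup>2 / measure lebesgue (Q \<iota>)" if "\<iota> \<in> F" for \<iota>
        unfolding a_def using the_inv_into_f_f[OF inj that] by simp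
      have finD: "finite \<D>" using fin by (simp add: \<D>_def)
      have ApD: "Apset A R" if "R \<in> \<D>" for R using that lev Ap unfolding \<D>_def Q_def by auto
      note DD = ApsetD[OF ApD]
      have lam: "laminar \<D>"
        unfolding laminar_def
      proof (intro ballI)
        fix R1 R2 assume "R1 \<in> \<D>" "R2 \<in> \<D>"
        then obtain \<iota> \<kappa> where *: "R1 = cell t (lev \<iota>) (pt \<iota>)" "R2 = cell t (lev \<kappa>) (pt \<kappa>)" unfolding \<D>_def Q_def by blast
        show "R1 \<subseteq> R2 \<or> R2 \<subseteq> R1 \<or> R1 \<inter> R2 = {}"
        proof (cases "lev \<iota> \<le> lev \<kappa>")
          case True
          then show ?thesis using cells_nested[OF t True, of "pt \<kappa>" "pt \<iota>"] unfolding * by (auto simp: Int_commute)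
        next
          case False
          then have "lev \<kappa> \<le> lev \<iota>" by simp
          then show ?thesis using cells_nested[OF t, of "lev \<kappa>" "lev \<iota>" "pt \<iota>" "pt \<kappa>"] unfolding * by auto
        qed
      qed
      have fint: "set_integrable lebesgue R f" if "R \<in> \<D>" for R
      proof -
        have nf: "(\<lambda>x. norm (f x)) \<in> borel_measurable lebesgue" using f by measurable
        have "set_integrable lebesgue R (\<lambda>x. norm (f x))"
          using weighted_integrable[OF nf _ Jfin DD(2)[OF that] DD(5)[OF that]] by simp
        then show ?thesis
          unfolding set_integrable_def
          by (rule Bochner_Integration.integrable_bound) (use f DD(2)[OF that] in \<open>auto simp: indicator_def\<close>)
      qed
      have weak: "measure lebesgue {x\<in>R. (\<Sum>P\<in>{P\<in>\<D>. P \<subseteq> R \<and> x \<in> P}. a P) > (c R)\<^sup>2} \<le> measure lebesgue R / 2"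
        if R: "R \<in> \<D>" for R
      proof -
        obtain \<kappa> where \<kappa>: "\<kappa> \<in> F" "R = cell t (lev \<kappa>) (pt \<kappa>)" using R unfolding \<D>_def Q_def by blast
        define FR where "FR = {\<iota>\<in>F. Q \<iota> \<subseteq> R}"
        have FR: "FR \<subseteq> F" "finite FR" using fin unfolding FR_def by auto
        have eq: "(\<Sum>P\<in>{P\<in>\<D>. P \<subseteq> R \<and> x \<in> P}. a P)
            = (\<Sum>\<iota>\<in>FR. (norm (ip f (e \<iota>)))\<^sup>2 / measure lebesgue (Q \<iota>) * indicator (Q \<iota>) x)" for x
        proof -
          have "{P\<in>\<D>. P \<subseteq> R \<and> x \<in> P} = Q ` {\<iota>\<in>FR. x \<in> Q \<iota>}" unfolding \<D>_def FR_def by auto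
          moreover have "inj_on Q {\<iota>\<in>FR. x \<in> Q \<iota>}" by (rule inj_on_subset[OF inj]) (use FR in auto)
          ultimately have "(\<Sum>P\<in>{P\<in>\<D>. P \<subseteq> R \<and> x \<in> P}. a P) = (\<Sum>\<iota>\<in>{\<iota>\<in>FR. x \<in> Q \<iota>}. a (Q \<iota>))"
            by (simp add: sum.reindex)
          also have "\<dots> = (\<Sum>\<iota>\<in>FR. (norm (ip f (e \<iota>)))\<^sup>2 / measure lebesgue (Q \<iota>) * indicator (Q \<iota>) x)"
            by (rule sum.mono_neutral_cong_left) (use FR a_Q in \<open>auto simp: indicator_def\<close>)
          finally show ?thesis .
        qed
        have "measure lebesgue {x\<in>cell t (lev \<kappa>) (pt \<kappa>).
            (\<Sum>\<iota>\<in>FR. (norm (ip f (e \<iota>)))\<^sup>2 / measure lebesgue (cell t (lev \<iota>) (pt \<iota>)) * indicator (cell t (lev \<iota>) (pt \<iota>)) x)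
            > ((16 * 2 ^ CARD('n) + 64 * B * real CARD('n)) * ((LINT x:cell t (lev \<kappa>) (pt \<kappa>)|lebesgue. norm (f x))
              / measure lebesgue (cell t (lev \<kappa>) (pt \<kappa>))))\<^sup>2} \<le> measure lebesgue (cell t (lev \<kappa>) (pt \<kappa>)) / 2"
        proof (rule square_function_weak_type[OF t FR(2) B])
          show "cell t (lev \<iota>) (pt \<iota>) \<subseteq> cell t (lev \<kappa>) (pt \<kappa>)" if "\<iota> \<in> FR" for \<iota>
            using that unfolding FR_def \<kappa> Q_def by auto
          show "inj_on (\<lambda>\<iota>. cell t (lev \<iota>) (pt \<iota>)) FR"
            using inj_on_subset[OF inj FR(1)] unfolding Q_def[abs_def] .
          show "set_integrable lebesgue (cell t (lev \<kappa>) (pt \<kappa>)) f" using fint[OF R] unfolding \<kappa> .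
          show "(\<Sum>\<iota>\<in>FR. (norm (ip g (e \<iota>)))\<^sup>2) \<le> (LINT x|lebesgue. (norm (g x))\<^sup>2)" if "g \<in> L2_space" for g
          proof -
            have "(\<Sum>\<iota>\<in>FR. (norm (ip g (e \<iota>)))\<^sup>2) \<le> (\<Sum>\<iota>\<in>F. (norm (ip g (e \<iota>)))\<^sup>2)"
              by (rule sum_mono2[OF fin FR(1)]) simp
            then show ?thesis using bes[OF that] by linarith
          qed
        qed (use FR supp em eb lip in \<open>auto simp: Q_def\<close>)
        then show ?thesis unfolding eq unfolding c_def avg_def \<Lambda>_def \<kappa>(2) Q_def .
      qed
      obtain \<S> E where S: "\<S> \<subseteq> \<D>" and E: "disjoint_family_on E \<S>"
        "\<And>R. R\<in>\<S> \<Longrightarrow> E R \<in> sets lebesgue \<and> E R \<subseteq> R \<and> measure lebesgue R \<le> 2 * measure lebesgue (E R)"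
        and dom: "\<And>x. (\<Sum>R\<in>{R\<in>\<D>. x \<in> R}. a R) \<le> (\<Sum>R\<in>{R\<in>\<S>. x \<in> R}. (c R)\<^sup>2)"
      proof -
        have "\<exists>\<S> E. \<S> \<subseteq> \<D> \<and> disjoint_family_on E \<S>
          \<and> (\<forall>R\<in>\<S>. E R \<in> sets lebesgue \<and> E R \<subseteq> R \<and> measure lebesgue R \<le> 2 * measure lebesgue (E R))
          \<and> (\<forall>x. (\<Sum>R\<in>{R\<in>\<D>. x \<in> R}. a R) \<le> (\<Sum>R\<in>{R\<in>\<S>. x \<in> R}. (c R)\<^sup>2))"
          by (rule sparse_domination[OF finD lam]) (use DD weak in \<open>auto simp: a_def\<close>)
        then show ?thesis using that by blast
      qed
      have finS: "finite \<S>" by (rule finite_subset[OF S finD])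
      define G where "G x = (\<Sum>R\<in>\<S>. avg R * indicator R x)" for x
      have avg0: "avg R \<ge> 0" for R
        unfolding avg_def by (intro divide_nonneg_nonneg set_lebesgue_integral_nonneg) auto
      have XG: "?X x \<le> (\<Lambda> * G x)\<^sup>2" for x
      proof -
        have "?X x = (\<Sum>R\<in>{R\<in>\<D>. x \<in> R}. a R)"
        proof -
          have "{R\<in>\<D>. x \<in> R} = Q ` {\<iota>\<in>F. x \<in> Q \<iota>}" unfolding \<D>_def by auto
          moreover have "inj_on Q {\<iota>\<in>F. x \<in> Q \<iota>}" by (rule inj_on_subset[OF inj]) auto
          ultimately have "(\<Sum>R\<in>{R\<in>\<D>. x \<in> R}. a R) = (\<Sum>\<iota>\<in>{\<iota>\<in>F. x \<in> Q \<iota>}. a (Q \<iota>))"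
            by (simp add: sum.reindex)
          also have "\<dots> = ?X x"
            by (rule sum.mono_neutral_cong_left) (use fin a_Q in \<open>auto simp: indicator_def\<close>)
          finally show ?thesis by simp
        qed
        also have "\<dots> \<le> (\<Sum>R\<in>{R\<in>\<S>. x \<in> R}. (c R)\<^sup>2)" by (rule dom)
        also have "\<dots> = (\<Sum>R\<in>\<S>. (c R * indicator R x)\<^sup>2)"
          by (rule sum.mono_neutral_cong_left) (use finS in \<open>auto simp: indicator_def\<close>)
        also have "\<dots> \<le> (\<Sum>R\<in>\<S>. c R * indicator R x)\<^sup>2"
          by (rule sum_power2_le_power2_sum[OF finS]) (use L0 avg0 in \<open>auto simp: c_def\<close>)
        also have "(\<Sum>R\<in>\<S>. c R * indicator R x) = \<Lambda> * G x"
          unfolding G_def c_def sum_distrib_left by (rule sum.cong) (simp_all add: mult.assoc)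
        finally show ?thesis .
      qed
      have G0: "G x \<ge> 0" for x unfolding G_def using avg0 by (intro sum_nonneg) auto
      have "(\<integral>\<^sup>+x. ennreal (?X x powr (p / 2)) \<partial>W) \<le> (\<integral>\<^sup>+x. ennreal (\<Lambda> powr p) * ennreal (G x powr p) \<partial>W)"
      proof (rule nn_integral_mono)
        fix x
        have "?X x powr (p / 2) \<le> ((\<Lambda> * G x)\<^sup>2) powr (p / 2)"
          using XG[of x] p1 by (intro powr_mono2 sum_nonneg) auto
        also have "\<dots> = \<Lambda> powr p * G x powr p"
          using L0 G0[of x] by (subst square_powr_half) (simp_all add: powr_mult)
        finally show "ennreal (?X x powr (p / 2)) \<le> ennreal (\<Lambda> powr p) * ennreal (G x powr p)"
          by (simp add: ennreal_mult[symmetric] ennreal_leI)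
      qed
      also have "\<dots> = ennreal (\<Lambda> powr p) * (\<integral>\<^sup>+x. ennreal (G x powr p) \<partial>W)"
      proof (rule nn_integral_cmult)
        have "G \<in> borel_measurable lebesgue"
          unfolding G_def using DD(2) S by (intro borel_measurable_sum borel_measurable_times borel_measurable_indicator) auto
        then show "(\<lambda>x. ennreal (G x powr p)) \<in> borel_measurable W" by measurable
      qed
      also have "\<dots> \<le> ennreal (\<Lambda> powr p) * (ennreal C0 * ?J)"
      proof (rule mult_left_mono)
        have nf: "(\<lambda>x. norm (f x)) \<in> borel_measurable lebesgue" using f by measurable
        show "(\<integral>\<^sup>+x. ennreal (G x powr p) \<partial>W) \<le> ennreal C0 * ?J"
          unfolding G_def avg_def
          by (rule sparse[rule_format, of \<S> E "\<lambda>x. norm (f x)"])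
            (use finS laminar_subset[OF lam S] E ApD S nf in auto)
      qed simp
      also have "\<dots> = ennreal (\<Lambda> powr p * C0) * ?J"
        using C0 by (simp add: ennreal_mult mult.assoc)
      finally show ?thesis .
    qed
    then show "(\<integral>\<^sup>+x. ennreal ((\<Sum>\<iota>\<in>F. (norm (ip f (e \<iota>)))\<^sup>2 / measure lebesgue (cell t (lev \<iota>) (pt \<iota>))
        * indicator (cell t (lev \<iota>) (pt \<iota>)) x) powr (p / 2)) \<partial>W)
      \<le> ennreal (\<Lambda> powr p * C0) * ?J"
      unfolding Q_def .
  qed
qed

end

section \<open>Wavelet systems\<close>

locale wavelets =
  fixes \<phi> :: "real^'n \<Rightarrow> real" and \<psi> :: "nat \<Rightarrow> real^'n \<Rightarrow> real" and N :: nat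
  assumes phi_C1: "C1_function \<phi>" and psi_C1: "\<And>l. l \<in> {1..2 ^ CARD('n) - 1} \<Longrightarrow> C1_function (\<psi> l)"
    and N1: "N \<ge> 1"
    and phi_supp: "closure (support_on UNIV \<phi>) = cbox 0 (vec (2 * real N - 1))"
    and psi_supp: "\<And>l. l \<in> {1..2 ^ CARD('n) - 1} \<Longrightarrow> closure (support_on UNIV (\<psi> l)) = cbox 0 (vec (2 * real N - 1))"
    and basis: "\<And>J. L2_orthonormal_basis (wavelet_index J) (wavelet_family \<phi> \<psi> J)"

lemma wavelet_system_imp_wavelets:
  assumes "wavelet_system \<phi> \<psi>"
  obtains N where "wavelets \<phi> \<psi> N"
  using assms unfolding wavelet_system_def wavelets_def by blast

context wavelets
begin

definition L :: real where "L = 2 * real N - 1"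

text \<open>Type 0 is the scaling function. The upper bounds rest on size, smoothness and Bessel's
  inequality, which \<open>\<phi>\<close> shares with the wavelets.\<close>

definition mother :: "nat \<Rightarrow> real^'n \<Rightarrow> real" where "mother l = (if l = 0 then \<phi> else \<psi> l)"

definition types :: "nat set" where "types = {0..2 ^ CARD('n) - 1}"

lemma L1: "L \<ge> 1" using N1 by (simp add: L_def)

lemma mother_C1: "l \<in> types \<Longrightarrow> C1_function (mother l)"
  using phi_C1 psi_C1[of l] by (auto simp: mother_def types_def)

lemma mother_supp: "l \<in> types \<Longrightarrow> closure (support_on UNIV (mother l)) = cbox 0 (vec L)"
  using phi_supp psi_supp[of l] by (auto simp: mother_def types_def L_def)

lemma mother_zero: "l \<in> types \<Longrightarrow> x \<notin> cbox 0 (vec L) \<Longrightarrow> mother l x = 0"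
  using mother_supp[of l] closure_subset[of "support_on UNIV (mother l)"] by (auto simp: support_on_def)

lemma mother_cont: "l \<in> types \<Longrightarrow> continuous_on UNIV (mother l)"
  using mother_C1[of l] unfolding C1_function_def
  by (metis continuous_at_imp_continuous_on has_derivative_continuous)

lemma mother_bounded: "l \<in> types \<Longrightarrow> \<exists>K. \<forall>x. \<bar>mother l x\<bar> \<le> K"
proof -
  assume l: "l \<in> types"
  have "compact (mother l ` cbox 0 (vec L))"
    using mother_cont[OF l] by (intro compact_continuous_image) (auto intro: continuous_on_subset)
  then obtain K where K: "\<And>y. y \<in> mother l ` cbox 0 (vec L) \<Longrightarrow> norm y \<le> K"
    by (meson bounded_iff compact_imp_bounded)
  have "\<bar>mother l x\<bar> \<le> max K 0" for x
  proof (cases "x \<in> cbox 0 (vec L)")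
    case True
    then have "norm (mother l x) \<le> K" by (intro K imageI)
    then show ?thesis by simp
  next
    case False
    then show ?thesis using mother_zero[OF l] by simp
  qed
  then show ?thesis by blast
qed

lemma mother_lipschitz: "l \<in> types \<Longrightarrow> \<exists>B\<ge>0. \<forall>x y. \<bar>mother l x - mother l y\<bar> \<le> B * norm (x - y)"
proof -
  assume l: "l \<in> types"
  obtain F' :: "real^'n \<Rightarrow> ((real^'n) \<Rightarrow>\<^sub>L real)" where
    F': "\<And>x. (mother l has_derivative blinfun_apply (F' x)) (at x)" and F'c: "continuous_on UNIV F'"
    using mother_C1[OF l] unfolding C1_function_def by blast
  have "compact (F' ` cbox 0 (vec L))"
    using F'c by (intro compact_continuous_image) (auto intro: continuous_on_subset)
  then obtain K where K: "\<And>y. y \<in> F' ` cbox 0 (vec L) \<Longrightarrow> norm y \<le> K"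
    by (meson bounded_iff compact_imp_bounded)
  have bd: "onorm (blinfun_apply (F' x)) \<le> max K 0" for x
  proof (cases "x \<in> cbox 0 (vec L)")
    case True
    then have "norm (F' x) \<le> K" by (intro K imageI)
    then show ?thesis by (simp add: norm_blinfun.rep_eq)
  next
    case False
    have "(mother l has_derivative (\<lambda>_. 0)) (at x)"
    proof (rule has_derivative_transform_within_open[of "\<lambda>_. 0" _ _ _ "- cbox 0 (vec L)"])
      show "\<And>y. y \<in> - cbox 0 (vec L) \<Longrightarrow> 0 = mother l y" using mother_zero[OF l] by simp
    qed (use False in auto)
    then have "blinfun_apply (F' x) = (\<lambda>_. 0)" using F' has_derivative_unique by blast
    then show ?thesis by (simp add: onorm_zero)
  qed
  have "norm (mother l x - mother l y) \<le> max K 0 * norm (x - y)" for x y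
    by (rule differentiable_bound[of UNIV "mother l" "\<lambda>x. blinfun_apply (F' x)"]) (use F' bd in auto)
  then show ?thesis by (intro exI[of _ "max K 0"]) auto
qed

text \<open>Scale, position and type determine an index. Scaling functions get the scale
  \<open>J\<close> and are told apart from the wavelets of that scale by type 0.\<close>

definition sc :: "int \<Rightarrow> (int^'n) + nat \<times> int \<times> (int^'n) \<Rightarrow> int" where
  "sc J \<iota> = (case \<iota> of Inl k \<Rightarrow> J | Inr (l, j, k) \<Rightarrow> j)"
definition ps :: "(int^'n) + nat \<times> int \<times> (int^'n) \<Rightarrow> int^'n" where
  "ps \<iota> = (case \<iota> of Inl k \<Rightarrow> k | Inr (l, j, k) \<Rightarrow> k)"
definition ty :: "(int^'n) + nat \<times> int \<times> (int^'n) \<Rightarrow> nat" where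
  "ty \<iota> = (case \<iota> of Inl k \<Rightarrow> 0 | Inr (l, j, k) \<Rightarrow> l)"

lemma index_eqI:
  assumes "\<iota> \<in> wavelet_index J" "\<kappa> \<in> wavelet_index J" "sc J \<iota> = sc J \<kappa>" "ps \<iota> = ps \<kappa>" "ty \<iota> = ty \<kappa>"
  shows "\<iota> = \<kappa>"
  using assms unfolding wavelet_index_def sc_def ps_def ty_def by (auto split: sum.splits)

lemma index_props:
  assumes "\<iota> \<in> wavelet_index J"
  shows "sc J \<iota> \<ge> J" "ty \<iota> \<in> types" "wavelet_family \<phi> \<psi> J \<iota> = dilate (mother (ty \<iota>)) (sc J \<iota>) (ps \<iota>)"
  using assms unfolding wavelet_index_def sc_def ps_def ty_def wavelet_family_def types_def mother_def
  by (auto split: sum.splits)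

definition vertex :: "int \<Rightarrow> int^'n \<Rightarrow> real^'n" where
  "vertex j k = (\<chi> m. 2 powi (- j) * real_of_int (k $ m))"

definition supp_cube :: "int \<Rightarrow> int^'n \<Rightarrow> (real^'n) set" where
  "supp_cube j k = cbox (vertex j k) (vertex j k + vec (2 powi (- j) * L))"

lemma mem_supp_cube_iff:
  "x \<in> supp_cube j k \<longleftrightarrow> 2 powi j *\<^sub>R x - (\<chi> m. real_of_int (k $ m)) \<in> cbox 0 (vec L)"
proof -
  have p: "(2::real) powi j > 0" "(2::real) powi (- j) = inverse (2 powi j)"
    by (auto simp: power_int_minus)
  have "2 powi (- j) * real_of_int (k $ m) \<le> x $ m \<and> x $ m \<le> 2 powi (- j) * real_of_int (k $ m) + 2 powi (- j) * L
    \<longleftrightarrow> 0 \<le> 2 powi j * x $ m - real_of_int (k $ m) \<and> 2 powi j * x $ m - real_of_int (k $ m) \<le> L" for m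
    unfolding p(2) using p(1) by (auto simp: field_simps)
  then show ?thesis
    unfolding supp_cube_def vertex_def by (simp add: mem_box_cart)
qed

lemma dilate_zero: "l \<in> types \<Longrightarrow> x \<notin> supp_cube j k \<Longrightarrow> dilate (mother l) j k x = 0"
  unfolding mem_supp_cube_iff dilate_def by (simp add: mother_zero)

lemma dilate_cont: "l \<in> types \<Longrightarrow> continuous_on UNIV (dilate (mother l) j k)"
proof -
  assume l: "l \<in> types"
  have "continuous_on UNIV (\<lambda>x. mother l (2 powi j *\<^sub>R x - (\<chi> m. real_of_int (k $ m))))"
    by (rule continuous_on_compose2[OF mother_cont[OF l]]) (auto intro!: continuous_intros)
  then show ?thesis unfolding dilate_def[abs_def] by (intro continuous_intros)
qed

lemma dilate_meas: "l \<in> types \<Longrightarrow> dilate (mother l) j k \<in> borel_measurable lebesgue"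
  using borel_measurable_continuous_onI[OF dilate_cont] by (auto intro: measurable_completion simp: measurable_lborel2)

lemma dilate_bounded: "l \<in> types \<Longrightarrow> \<exists>K. \<forall>x. norm (dilate (mother l) j k x) \<le> K"
proof -
  assume l: "l \<in> types"
  obtain K where "\<And>x. \<bar>mother l x\<bar> \<le> K" using mother_bounded[OF l] by blast
  then show ?thesis unfolding dilate_def
    by (intro exI[of _ "2 powr (real_of_int j * real CARD('n) / 2) * K"]) (auto simp: norm_mult abs_mult intro!: mult_left_mono)
qed

end

section \<open>Weighted bounds for finite families of wavelets\<close>

context pos_weight
begin

text \<open>The closed cube around a cell has the same measure, so \<open>Apset_subset\<close> hands
  the condition down with factor 1.\<close>

lemma Apset_cells:
  assumes A: "\<And>a s. 0 < s \<Longrightarrow> s \<le> 1 \<Longrightarrow> Apset A (cbox a (a + vec s))"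
  shows "\<exists>A'. \<forall>i\<ge>i0. \<forall>t x. Apset A' (cell t i x)"
proof -
  define k where "k = nat (- i0)"
  obtain A' where A': "\<And>a s. 0 < s \<Longrightarrow> s \<le> 2 ^ k \<Longrightarrow> Apset A' (cbox a (a + vec s))"
    using Apset_all_scales[OF A, of k] by blast
  have "Apset (A' * 1 powr p) (cell t i x)" if "i \<ge> i0" for i t x
  proof (rule Apset_subset(1)[OF A' cell_sets cell_subset_cube])
    show "(2::real) powi (- i) \<le> 2 ^ k"
    proof -
      have "(2::real) powi (- i) \<le> 2 powi (int k)" using that by (intro power_int_increasing) (auto simp: k_def)
      then show ?thesis by simp
    qed
    show "measure lebesgue (cbox (cell_corner t i x) (cell_corner t i x + vec (2 powi (- i)))) \<le> 1 * measure lebesgue (cell t i x)"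
      by (simp add: measure_cube measure_cell del: measure_completion)
  qed auto
  then show ?thesis by auto
qed

end

locale weighted_wavelets = wavelets \<phi> \<psi> N + pos_weight p w
  for \<phi> :: "real^'n \<Rightarrow> real" and \<psi> N p and w :: "real^'n \<Rightarrow> real" +
  fixes A :: real
  assumes A: "\<And>a s. 0 < s \<Longrightarrow> s \<le> 1 \<Longrightarrow> Apset A (cbox a (a + vec s))"
begin

text \<open>The indices are sorted into finitely many classes, by the grid whose cell holds the
  support cube, by type, and by position modulo \<open>2 ^ m\<close>. Within a class each cell
  carries at most one wavelet, so \<open>grid_square_bound\<close> applies; adding up the classes
  costs a constant.\<close>

lemma finite_square_bound:
  "\<exists>C>0. \<forall>F f. finite F \<and> F \<subseteq> wavelet_index J \<and> f \<in> borel_measurable lebesgue \<longrightarrow>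
    (\<integral>\<^sup>+x. ennreal ((\<Sum>\<iota>\<in>F. (norm (ip f (wavelet_family \<phi> \<psi> J \<iota>)))\<^sup>2 * 2 powr (real_of_int (sc J \<iota>) * real CARD('n))
        * indicator (supp_cube (sc J \<iota>) (ps \<iota>)) x) powr (p / 2)) \<partial>W)
      \<le> ennreal C * (\<integral>\<^sup>+x. ennreal (norm (f x) powr p) \<partial>W)"
proof -
  define n where "n = real CARD('n)"
  \<comment> \<open>The cells are taken \<open>m\<close> levels coarser than the wavelets. The
    support cube then has less than a third of the side of the cell, as
    \<open>cube_in_some_cell\<close> requires.\<close>
  obtain m :: nat where m: "3 * L < 2 ^ m" using real_arch_pow[of 2 "3 * L"] by auto
  obtain Bl where Bl: "\<And>l. l \<in> types \<Longrightarrow> Bl l \<ge> 0 \<and> (\<forall>x y. \<bar>mother l x - mother l y\<bar> \<le> Bl l * norm (x - y))"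
    using mother_lipschitz by metis
  define B0 where "B0 = (\<Sum>l\<in>types. Bl l)"
  have fint: "finite types" by (simp add: types_def)
  have Bl_le: "Bl l \<le> B0" if "l \<in> types" for l
    unfolding B0_def using Bl that fint by (intro member_le_sum) auto
  have B0: "B0 \<ge> 0" unfolding B0_def using Bl by (intro sum_nonneg) auto
  \<comment> \<open>Lipschitz constant relative to the cells: \<open>2 ^ m\<close> comes from the
    change of level, the last factor from the normalization by the volume of the cell.\<close>
  define B where "B = B0 * 2 ^ m * 2 powr (real m * n / 2)"
  have B: "B \<ge> 0" using B0 by (simp add: B_def)
  define i0 where "i0 = J - int m"
  obtain A' where A': "\<forall>i\<ge>i0. \<forall>t x. Apset A' (cell t i x)" using Apset_cells[OF A, of i0] by blast
  define lev where "lev \<iota> = sc J \<iota> - int m" for \<iota>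
  define pt where "pt \<iota> = vertex (sc J \<iota>) (ps \<iota>)" for \<iota>
  define e where "e = wavelet_family \<phi> \<psi> J"
  have meas_cell: "measure lebesgue (cell t (lev \<iota>) x :: (real^'n) set) = 2 powr (- (real_of_int (sc J \<iota>) * n)) * 2 powr (real m * n)" for t x \<iota>
  proof -
    have "measure lebesgue (cell t (lev \<iota>) x :: (real^'n) set) = 2 powr (real_of_int (- lev \<iota>) * n)"
    proof -
      have "(2::real) powi (- lev \<iota>) = 2 powr real_of_int (- lev \<iota>)" by (subst powr_real_of_int') simp_all
      then show ?thesis unfolding measure_cell n_def by (simp only: powr_power mult.commute)
    qed
    also have "real_of_int (- lev \<iota>) * n = - (real_of_int (sc J \<iota>) * n) + real m * n"
      by (simp add: lev_def algebra_simps)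
    finally show ?thesis by (simp only: powr_add)
  qed
  have ex_t: "\<exists>t. grid_shift t \<and> supp_cube (sc J \<iota>) (ps \<iota>) \<subseteq> cell t (lev \<iota>) (pt \<iota>)" for \<iota>
    unfolding supp_cube_def pt_def
  proof (rule cube_in_some_cell)
    show "0 \<le> 2 powi - sc J \<iota> * L" using L1 by simp
    have "2 powi lev \<iota> * (2 powi - sc J \<iota> * L) = L / 2 ^ m"
      by (simp add: lev_def power_int_diff power_int_minus field_simps)
    also have "\<dots> < 1/3" using m by (simp add: field_simps)
    finally show "2 powi lev \<iota> * (2 powi - sc J \<iota> * L) < 1/3" .
  qed
  define tt where "tt \<iota> = (SOME t. grid_shift t \<and> supp_cube (sc J \<iota>) (ps \<iota>) \<subseteq> cell t (lev \<iota>) (pt \<iota>))" for \<iota>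
  have tt: "grid_shift (tt \<iota>)" "supp_cube (sc J \<iota>) (ps \<iota>) \<subseteq> cell (tt \<iota>) (lev \<iota>) (pt \<iota>)" for \<iota>
    using someI_ex[OF ex_t[of \<iota>]] unfolding tt_def by auto
  define cls where "cls \<iota> = (tt \<iota>, ty \<iota>, (\<chi> c. ps \<iota> $ c mod 2 ^ m) :: int^'n)" for \<iota>
  define \<C> where "\<C> = {t :: real^'n. grid_shift t} \<times> types \<times> {v :: int^'n. \<forall>c. v $ c \<in> {0..<2 ^ m}}"
  have finC: "finite \<C>"
    unfolding \<C>_def grid_shift_def using fint by (intro finite_cartesian_product finite_vec_set) auto
  have clsC: "cls \<iota> \<in> \<C>" if "\<iota> \<in> wavelet_index J" for \<iota>
    using tt(1)[of \<iota>] index_props(2)[OF that] by (simp add: cls_def \<C>_def)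
  obtain C0 where C0: "C0 > 0" and grid: "\<forall>(F :: ((int^'n) + nat \<times> int \<times> (int^'n)) set) t lev pt e f.
    grid_family i0 B t F lev pt e \<and>
    f \<in> borel_measurable lebesgue \<longrightarrow>
    (\<integral>\<^sup>+x. ennreal ((\<Sum>\<iota>\<in>F. (norm (ip f (e \<iota>)))\<^sup>2 / measure lebesgue (cell t (lev \<iota>) (pt \<iota>))
        * indicator (cell t (lev \<iota>) (pt \<iota>)) x) powr (p / 2)) \<partial>W)
      \<le> ennreal C0 * (\<integral>\<^sup>+x. ennreal (norm (f x) powr p) \<partial>W)"
    using grid_square_bound[where ?'i = "(int^'n) + nat \<times> int \<times> (int^'n)", OF A' B]
    by (elim exE conjE) (rule that)
  define M where "M = (2 powr (real m * n)) powr (p / 2)"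
  define C where "C = M * (real (card \<C>) powr (p / 2) * (real (card \<C>) * C0)) + 1"
  show ?thesis
  proof (intro exI[of _ C] conjI allI impI)
    show "C > 0" unfolding C_def M_def using C0 by (intro add_nonneg_pos mult_nonneg_nonneg) auto
    fix F :: "((int^'n) + nat \<times> int \<times> (int^'n)) set" and f :: "real^'n \<Rightarrow> complex"
    assume "finite F \<and> F \<subseteq> wavelet_index J \<and> f \<in> borel_measurable lebesgue"
    then have fin: "finite F" and FI: "F \<subseteq> wavelet_index J" and f: "f \<in> borel_measurable lebesgue" by auto
    let ?J = "\<integral>\<^sup>+x. ennreal (norm (f x) powr p) \<partial>W"
    define Fc where "Fc c = {\<iota>\<in>F. cls \<iota> = c}" for c
    define X where "X c x = (\<Sum>\<iota>\<in>Fc c. (norm (ip f (e \<iota>)))\<^sup>2 / measure lebesgue (cell (fst c) (lev \<iota>) (pt \<iota>))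
        * indicator (cell (fst c) (lev \<iota>) (pt \<iota>)) x)" for c x
    have X0: "X c x \<ge> 0" for c x unfolding X_def by (intro sum_nonneg) auto
    have Xm: "(\<lambda>x. ennreal (X c x powr (p / 2))) \<in> borel_measurable W" for c
    proof -
      have "X c \<in> borel_measurable lebesgue"
        unfolding X_def by (intro borel_measurable_sum borel_measurable_times borel_measurable_indicator) auto
      then show ?thesis by measurable
    qed
    have bound: "(\<integral>\<^sup>+x. ennreal (X c x powr (p / 2)) \<partial>W) \<le> ennreal C0 * ?J" if c: "c \<in> \<C>" for c
    proof -
      have FcF: "Fc c \<subseteq> F" "finite (Fc c)" using fin unfolding Fc_def by auto
      have ttc: "tt \<iota> = fst c" if "\<iota> \<in> Fc c" for \<iota> using that unfolding Fc_def cls_def by auto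
      have "inj_on (\<lambda>\<iota>. cell (fst c) (lev \<iota>) (pt \<iota>)) (Fc c)"
      proof (rule inj_onI)
        fix \<iota> \<kappa> assume \<iota>: "\<iota> \<in> Fc c" and \<kappa>: "\<kappa> \<in> Fc c"
          and eq: "cell (fst c) (lev \<iota>) (pt \<iota>) = cell (fst c) (lev \<kappa>) (pt \<kappa>)"
        have "lev \<iota> = lev \<kappa>"
          using cell_subset_level[of "fst c" "lev \<iota>" "pt \<iota>" "lev \<kappa>" "pt \<kappa>"]
            cell_subset_level[of "fst c" "lev \<kappa>" "pt \<kappa>" "lev \<iota>" "pt \<iota>"] eq by simp
        then have sc: "sc J \<iota> = sc J \<kappa>" by (simp add: lev_def)
        have ty: "ty \<iota> = ty \<kappa>" and md: "\<And>d. ps \<iota> $ d mod 2 ^ m = ps \<kappa> $ d mod 2 ^ m"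
          using \<iota> \<kappa> unfolding Fc_def cls_def by (auto simp: vec_eq_iff)
        \<comment> \<open>Two corners in one cell differ by fewer than \<open>2 ^ m\<close> steps in
          each coordinate, so positions congruent modulo \<open>2 ^ m\<close> coincide.\<close>
        have "ps \<iota> $ d = ps \<kappa> $ d" for d
        proof -
          have mem: "pt \<kappa> \<in> cell (fst c) (lev \<iota>) (pt \<iota>)" "pt \<iota> \<in> cell (fst c) (lev \<iota>) (pt \<iota>)"
            unfolding eq using eq cell_self[of "pt \<iota>" "fst c" "lev \<iota>"] by auto
          have "\<bar>pt \<kappa> $ d - pt \<iota> $ d\<bar> < 2 powi (- lev \<iota>)"
            using mem unfolding mem_cell_iff by (smt (verit))
          then have "2 powi (- sc J \<iota>) * \<bar>real_of_int (ps \<kappa> $ d) - real_of_int (ps \<iota> $ d)\<bar> < 2 powi (- sc J \<iota>) * 2 ^ m"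
            by (simp add: pt_def vertex_def sc lev_def right_diff_distrib[symmetric] abs_mult power_int_diff power_int_minus field_simps)
          then have "\<bar>real_of_int (ps \<kappa> $ d - ps \<iota> $ d)\<bar> < 2 ^ m" by (simp add: mult_less_cancel_left)
          then have lt: "\<bar>ps \<kappa> $ d - ps \<iota> $ d\<bar> < 2 ^ m"
            by (metis of_int_abs of_int_less_iff of_int_numeral of_int_power)
          have "(2::int) ^ m dvd ps \<kappa> $ d - ps \<iota> $ d" using md[of d] by (metis mod_eq_dvd_iff)
          then show ?thesis using lt dvd_imp_le_int[of "ps \<kappa> $ d - ps \<iota> $ d" "2 ^ m"] by fastforce
        qed
        then have "ps \<iota> = ps \<kappa>" by (simp add: vec_eq_iff)
        then show "\<iota> = \<kappa>" using \<iota> \<kappa> FcF FI sc ty by (intro index_eqI[of \<iota> J \<kappa>]) auto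
      qed
      moreover have "e \<iota> x = 0" if \<iota>: "\<iota> \<in> Fc c" "x \<notin> cell (fst c) (lev \<iota>) (pt \<iota>)" for \<iota> x
      proof -
        have I: "\<iota> \<in> wavelet_index J" using \<iota> FcF FI by auto
        have "x \<notin> supp_cube (sc J \<iota>) (ps \<iota>)" using tt(2)[of \<iota>] ttc[OF \<iota>(1)] \<iota>(2) by auto
        then show ?thesis unfolding e_def index_props(3)[OF I] using index_props(2)[OF I] by (intro dilate_zero)
      qed
      moreover have "e \<iota> \<in> borel_measurable lebesgue" "\<exists>K. \<forall>x. norm (e \<iota> x) \<le> K" if \<iota>: "\<iota> \<in> Fc c" for \<iota>
      proof -
        have I: "\<iota> \<in> wavelet_index J" using \<iota> FcF FI by auto
        show "e \<iota> \<in> borel_measurable lebesgue" "\<exists>K. \<forall>x. norm (e \<iota> x) \<le> K"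
          unfolding e_def index_props(3)[OF I] using index_props(2)[OF I] dilate_meas dilate_bounded by auto
      qed
      moreover have "norm (e \<iota> x - e \<iota> y) \<le> B * (2 powi lev \<iota> * norm (x - y)) / sqrt (measure lebesgue (cell (fst c) (lev \<iota>) (pt \<iota>)))"
        if \<iota>: "\<iota> \<in> Fc c" for \<iota> x y
      proof -
        have I: "\<iota> \<in> wavelet_index J" using \<iota> FcF FI by auto
        let ?j = "sc J \<iota>"
        let ?z = "(\<chi> m. real_of_int (ps \<iota> $ m)) :: real^'n"
        have "norm (e \<iota> x - e \<iota> y) = 2 powr (real_of_int ?j * n / 2) * \<bar>mother (ty \<iota>) (2 powi ?j *\<^sub>R x - ?z) - mother (ty \<iota>) (2 powi ?j *\<^sub>R y - ?z)\<bar>"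
          unfolding e_def index_props(3)[OF I] dilate_def n_def
          by (simp only: of_real_diff[symmetric] right_diff_distrib[symmetric] norm_of_real abs_mult) simp
        also have "\<dots> \<le> 2 powr (real_of_int ?j * n / 2) * (B0 * norm ((2 powi ?j *\<^sub>R x - ?z) - (2 powi ?j *\<^sub>R y - ?z)))"
        proof (rule mult_left_mono)
          have "\<bar>mother (ty \<iota>) (2 powi ?j *\<^sub>R x - ?z) - mother (ty \<iota>) (2 powi ?j *\<^sub>R y - ?z)\<bar>
            \<le> Bl (ty \<iota>) * norm ((2 powi ?j *\<^sub>R x - ?z) - (2 powi ?j *\<^sub>R y - ?z))"
            using Bl[OF index_props(2)[OF I]] by blast
          also have "\<dots> \<le> B0 * norm ((2 powi ?j *\<^sub>R x - ?z) - (2 powi ?j *\<^sub>R y - ?z))"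
            using Bl_le[OF index_props(2)[OF I]] by (intro mult_right_mono) auto
          finally show "\<bar>mother (ty \<iota>) (2 powi ?j *\<^sub>R x - ?z) - mother (ty \<iota>) (2 powi ?j *\<^sub>R y - ?z)\<bar>
            \<le> B0 * norm ((2 powi ?j *\<^sub>R x - ?z) - (2 powi ?j *\<^sub>R y - ?z))" .
        qed simp
        also have "(2 powi ?j *\<^sub>R x - ?z) - (2 powi ?j *\<^sub>R y - ?z) = 2 powi ?j *\<^sub>R (x - y)"
          by (simp add: algebra_simps)
        also have "norm (2 powi ?j *\<^sub>R (x - y)) = 2 powi lev \<iota> * 2 ^ m * norm (x - y)"
          by (simp add: lev_def power_int_diff)
        also have "2 powr (real_of_int ?j * n / 2) * (B0 * (2 powi lev \<iota> * 2 ^ m * norm (x - y)))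
          = B * (2 powi lev \<iota> * norm (x - y)) / sqrt (measure lebesgue (cell (fst c) (lev \<iota>) (pt \<iota>)))"
        proof -
          have "sqrt (measure lebesgue (cell (fst c) (lev \<iota>) (pt \<iota>))) = 2 powr (- (real_of_int ?j * n / 2)) * 2 powr (real m * n / 2)"
            unfolding meas_cell by (simp add: real_sqrt_mult powr_half_sqrt[symmetric] powr_powr)
          then have "2 powr (real m * n / 2) / sqrt (measure lebesgue (cell (fst c) (lev \<iota>) (pt \<iota>))) = 2 powr (real_of_int ?j * n / 2)"
            by (simp only:) (simp add: powr_minus field_simps)
          then show ?thesis by (simp add: B_def mult_ac flip: times_divide_eq_right times_divide_eq_left)
        qed
        finally show ?thesis .
      qed
      moreover have "(\<Sum>\<iota>\<in>Fc c. (norm (ip g (e \<iota>)))\<^sup>2) \<le> (LINT x|lebesgue. (norm (g x))\<^sup>2)" if "g \<in> L2_space" for g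
      proof (rule bessel_inequality[OF FcF(2) _ _ that])
        have sub: "Fc c \<subseteq> wavelet_index J" using FcF FI by auto
        show "\<forall>i\<in>Fc c. e i \<in> L2_space" "\<forall>i\<in>Fc c. \<forall>i'\<in>Fc c. ip (e i) (e i') = (if i = i' then 1 else 0)"
          using basis[of J] sub unfolding L2_orthonormal_basis_def e_def by blast+
      qed
      moreover have "grid_shift (fst c)" using c by (auto simp: \<C>_def)
      moreover have "\<forall>\<iota>\<in>Fc c. i0 \<le> lev \<iota>"
      proof
        fix \<iota> assume "\<iota> \<in> Fc c"
        then have "\<iota> \<in> wavelet_index J" using FcF FI by auto
        then show "i0 \<le> lev \<iota>" using index_props(1) unfolding lev_def i0_def by fastforce
      qed
      ultimately have "grid_family i0 B (fst c) (Fc c) lev pt e"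
        unfolding grid_family_def using FcF(2) by blast
      then show ?thesis
        unfolding X_def using f by (intro grid[rule_format] conjI)
    qed
    have sumX: "(\<Sum>\<iota>\<in>F. (norm (ip f (e \<iota>)))\<^sup>2 * 2 powr (real_of_int (sc J \<iota>) * n) * indicator (supp_cube (sc J \<iota>) (ps \<iota>)) x)
        \<le> 2 powr (real m * n) * (\<Sum>c\<in>\<C>. X c x)" for x
    proof -
      have "(\<Sum>\<iota>\<in>F. (norm (ip f (e \<iota>)))\<^sup>2 * 2 powr (real_of_int (sc J \<iota>) * n) * indicator (supp_cube (sc J \<iota>) (ps \<iota>)) x)
        \<le> (\<Sum>\<iota>\<in>F. 2 powr (real m * n) * ((norm (ip f (e \<iota>)))\<^sup>2 / measure lebesgue (cell (tt \<iota>) (lev \<iota>) (pt \<iota>)) * indicator (cell (tt \<iota>) (lev \<iota>) (pt \<iota>)) x))"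
      proof (rule sum_mono)
        fix \<iota> assume "\<iota> \<in> F"
        have "indicator (supp_cube (sc J \<iota>) (ps \<iota>)) x \<le> (indicator (cell (tt \<iota>) (lev \<iota>) (pt \<iota>)) x :: real)"
          using tt(2)[of \<iota>] by (auto simp: indicator_def)
        then have "(norm (ip f (e \<iota>)))\<^sup>2 * 2 powr (real_of_int (sc J \<iota>) * n) * indicator (supp_cube (sc J \<iota>) (ps \<iota>)) x
          \<le> (norm (ip f (e \<iota>)))\<^sup>2 * 2 powr (real_of_int (sc J \<iota>) * n) * indicator (cell (tt \<iota>) (lev \<iota>) (pt \<iota>)) x"
          by (intro mult_left_mono) auto
        also have "\<dots> = 2 powr (real m * n) * ((norm (ip f (e \<iota>)))\<^sup>2 / measure lebesgue (cell (tt \<iota>) (lev \<iota>) (pt \<iota>)) * indicator (cell (tt \<iota>) (lev \<iota>) (pt \<iota>)) x)"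
          unfolding meas_cell by (simp add: powr_minus field_simps)
        finally show "(norm (ip f (e \<iota>)))\<^sup>2 * 2 powr (real_of_int (sc J \<iota>) * n) * indicator (supp_cube (sc J \<iota>) (ps \<iota>)) x
          \<le> 2 powr (real m * n) * ((norm (ip f (e \<iota>)))\<^sup>2 / measure lebesgue (cell (tt \<iota>) (lev \<iota>) (pt \<iota>)) * indicator (cell (tt \<iota>) (lev \<iota>) (pt \<iota>)) x)" .
      qed
      also have "\<dots> = 2 powr (real m * n) * (\<Sum>c\<in>\<C>. X c x)"
      proof -
        have "(\<Sum>c\<in>\<C>. X c x) = (\<Sum>c\<in>\<C>. \<Sum>\<iota>\<in>{\<iota>\<in>F. cls \<iota> = c}. (norm (ip f (e \<iota>)))\<^sup>2 / measure lebesgue (cell (tt \<iota>) (lev \<iota>) (pt \<iota>))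
            * indicator (cell (tt \<iota>) (lev \<iota>) (pt \<iota>)) x)"
          unfolding X_def Fc_def by (intro sum.cong refl) (auto simp: cls_def)
        also have "\<dots> = (\<Sum>\<iota>\<in>F. (norm (ip f (e \<iota>)))\<^sup>2 / measure lebesgue (cell (tt \<iota>) (lev \<iota>) (pt \<iota>)) * indicator (cell (tt \<iota>) (lev \<iota>) (pt \<iota>)) x)"
          by (rule sum.group[OF fin finC]) (use clsC FI in auto)
        finally show ?thesis by (simp add: sum_distrib_left)
      qed
      finally show ?thesis .
    qed
    have "(\<integral>\<^sup>+x. ennreal ((\<Sum>\<iota>\<in>F. (norm (ip f (e \<iota>)))\<^sup>2 * 2 powr (real_of_int (sc J \<iota>) * n)
        * indicator (supp_cube (sc J \<iota>) (ps \<iota>)) x) powr (p / 2)) \<partial>W)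
      \<le> (\<integral>\<^sup>+x. (\<Sum>c\<in>\<C>. ennreal (M * real (card \<C>) powr (p / 2)) * ennreal (X c x powr (p / 2))) \<partial>W)"
    proof (rule nn_integral_mono)
      fix x
      have "(\<Sum>\<iota>\<in>F. (norm (ip f (e \<iota>)))\<^sup>2 * 2 powr (real_of_int (sc J \<iota>) * n) * indicator (supp_cube (sc J \<iota>) (ps \<iota>)) x) powr (p / 2)
          \<le> (2 powr (real m * n) * (\<Sum>c\<in>\<C>. X c x)) powr (p / 2)"
        using sumX[of x] p1 by (intro powr_mono2 sum_nonneg) auto
      also have "\<dots> = M * (\<Sum>c\<in>\<C>. X c x) powr (p / 2)"
        using X0 by (simp add: M_def powr_mult sum_nonneg)
      also have "\<dots> \<le> M * (real (card \<C>) powr (p / 2) * (\<Sum>c\<in>\<C>. X c x powr (p / 2)))"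
        using sum_powr_le[OF finC, of "\<lambda>c. X c x" "p / 2"] X0 p1 by (intro mult_left_mono) (auto simp: M_def)
      finally show "ennreal ((\<Sum>\<iota>\<in>F. (norm (ip f (e \<iota>)))\<^sup>2 * 2 powr (real_of_int (sc J \<iota>) * n) * indicator (supp_cube (sc J \<iota>) (ps \<iota>)) x) powr (p / 2))
        \<le> (\<Sum>c\<in>\<C>. ennreal (M * real (card \<C>) powr (p / 2)) * ennreal (X c x powr (p / 2)))"
        by (simp add: sum_distrib_left[symmetric] ennreal_mult[symmetric] sum_nonneg M_def mult.assoc ennreal_leI)
    qed
    also have "\<dots> = (\<Sum>c\<in>\<C>. ennreal (M * real (card \<C>) powr (p / 2)) * (\<integral>\<^sup>+x. ennreal (X c x powr (p / 2)) \<partial>W))"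
      using Xm by (subst nn_integral_sum) (auto simp: nn_integral_cmult)
    also have "\<dots> \<le> (\<Sum>c\<in>\<C>. ennreal (M * real (card \<C>) powr (p / 2)) * (ennreal C0 * ?J))"
      using bound by (intro sum_mono mult_left_mono) auto
    also have "\<dots> = ennreal (M * (real (card \<C>) powr (p / 2) * (real (card \<C>) * C0))) * ?J"
      using C0 by (simp add: ennreal_of_nat_eq_real_of_nat ennreal_mult[symmetric] mult.assoc[symmetric] M_def) (simp add: mult_ac)
    also have "\<dots> \<le> ennreal C * ?J" unfolding C_def by (intro mult_right_mono ennreal_leI) auto
    finally show "(\<integral>\<^sup>+x. ennreal ((\<Sum>\<iota>\<in>F. (norm (ip f (wavelet_family \<phi> \<psi> J \<iota>)))\<^sup>2 * 2 powr (real_of_int (sc J \<iota>) * real CARD('n))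
        * indicator (supp_cube (sc J \<iota>) (ps \<iota>)) x) powr (p / 2)) \<partial>W) \<le> ennreal C * ?J"
      unfolding e_def n_def .
  qed
qed

end

section \<open>Extended real powers and sums\<close>

lemma ennreal_powr_ennreal: "x \<ge> 0 \<Longrightarrow> ennreal_powr (ennreal x) a = ennreal (x powr a)"
  by (simp add: ennreal_powr_def)

lemma ennreal_powr_top[simp]: "ennreal_powr top a = top"
  by (simp add: ennreal_powr_def)

text \<open>An adjunction between the powers \<open>a\<close> and \<open>1 / a\<close>; monotonicity
  and the interchange with suprema are derived from it.\<close>

lemma ennreal_powr_le_iff:
  assumes "a > 0" "y \<ge> 0"
  shows "ennreal_powr t a \<le> ennreal y \<longleftrightarrow> t \<le> ennreal (y powr (1 / a))"
proof (cases t)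
  case (real x)
  have "x powr a \<le> y \<longleftrightarrow> x \<le> y powr (1 / a)"
  proof
    assume "x powr a \<le> y"
    then have "(x powr a) powr (1 / a) \<le> y powr (1 / a)" using assms by (intro powr_mono2) auto
    then show "x \<le> y powr (1 / a)" using assms real by (simp add: powr_powr)
  next
    assume "x \<le> y powr (1 / a)"
    then have "x powr a \<le> (y powr (1 / a)) powr a" using assms real by (intro powr_mono2) auto
    then show "x powr a \<le> y" using assms by (simp add: powr_powr)
  qed
  then show ?thesis using real assms by (simp add: ennreal_powr_ennreal)
next
  case top
  then show ?thesis by (simp add: ennreal_powr_def top_unique)
qed

lemma ennreal_powr_mono:
  assumes "a > 0" "s \<le> t"
  shows "ennreal_powr s a \<le> ennreal_powr t a"
proof (cases "ennreal_powr t a")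
  case (real y)
  then have "t \<le> ennreal (y powr (1 / a))" using ennreal_powr_le_iff[OF assms(1), of y t] by simp
  then show ?thesis using ennreal_powr_le_iff[OF assms(1), of y s] assms(2) real by auto
qed simp

lemma ennreal_powr_powr: "ennreal_powr (ennreal_powr t a) b = ennreal_powr t (a * b)"
  by (cases t) (auto simp: ennreal_powr_def powr_powr)

lemma ennreal_powr_SUP:
  fixes X :: "nat \<Rightarrow> ennreal"
  assumes a: "a > 0"
  shows "ennreal_powr (SUP k. X k) a = (SUP k. ennreal_powr (X k) a)"
proof (rule antisym)
  show "(SUP k. ennreal_powr (X k) a) \<le> ennreal_powr (SUP k. X k) a"
    by (intro SUP_least ennreal_powr_mono a SUP_upper) simp
  show "ennreal_powr (SUP k. X k) a \<le> (SUP k. ennreal_powr (X k) a)"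
  proof (cases "SUP k. ennreal_powr (X k) a")
    case (real y)
    have "X k \<le> ennreal (y powr (1 / a))" for k
    proof -
      have "ennreal_powr (X k) a \<le> ennreal y" unfolding real(2)[symmetric] by (rule SUP_upper) simp
      then show ?thesis using ennreal_powr_le_iff[OF a real(1)] by simp
    qed
    then have "(SUP k. X k) \<le> ennreal (y powr (1 / a))" by (intro SUP_least)
    then show ?thesis unfolding real(2) using ennreal_powr_le_iff[OF a real(1)] by simp
  next
    case top
    show ?thesis unfolding top by (rule top_greatest)
  qed
qed

lemma ennreal_powr_add_le:
  assumes a: "a > 0"
  shows "ennreal_powr (s + t) a \<le> ennreal (2 powr a) * (ennreal_powr s a + ennreal_powr t a)"
proof (cases "s = \<infinity> \<or> t = \<infinity>")
  case True
  then show ?thesis by (auto simp: ennreal_mult_top)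
next
  case False
  then obtain x y where xy: "s = ennreal x" "t = ennreal y" "x \<ge> 0" "y \<ge> 0"
    by (metis ennreal_cases infinity_ennreal_def)
  have "(x + y) powr a \<le> (2 * max x y) powr a" using a xy by (intro powr_mono2) auto
  also have "\<dots> = 2 powr a * max x y powr a" using xy by (simp add: powr_mult)
  also have "\<dots> \<le> 2 powr a * (x powr a + y powr a)" by (intro mult_left_mono) (auto simp: max_def)
  finally show ?thesis
    using xy by (simp add: ennreal_powr_ennreal ennreal_leI flip: ennreal_plus ennreal_mult)
qed

lemma measurable_ennreal_powr[measurable]:
  assumes [measurable]: "f \<in> borel_measurable M"
  shows "(\<lambda>x. ennreal_powr (f x) a) \<in> borel_measurable M"
  unfolding ennreal_powr_def by measurable

lemma infsum_ennreal_eq_SUP: "infsum (f :: 'a \<Rightarrow> ennreal) A = (SUP F\<in>{F. finite F \<and> F \<subseteq> A}. sum f F)"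
  by (rule nonneg_infsum_complete) simp

lemma sum_le_infsum_ennreal: "finite F \<Longrightarrow> F \<subseteq> A \<Longrightarrow> sum f F \<le> (infsum f A :: ennreal)"
  unfolding infsum_ennreal_eq_SUP by (intro SUP_upper) simp

lemma infsum_ennreal_leI: "(\<And>F. finite F \<Longrightarrow> F \<subseteq> A \<Longrightarrow> sum f F \<le> b) \<Longrightarrow> infsum f A \<le> (b :: ennreal)"
  unfolding infsum_ennreal_eq_SUP by (intro SUP_least) simp

lemma infsum_ennreal_mono: "(\<And>x. x \<in> A \<Longrightarrow> f x \<le> g x) \<Longrightarrow> infsum f A \<le> (infsum g A :: ennreal)"
proof (rule infsum_ennreal_leI)
  fix F assume F: "finite F" "F \<subseteq> A" and le: "\<And>x. x \<in> A \<Longrightarrow> f x \<le> g x"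
  have "sum f F \<le> sum g F" using F le by (intro sum_mono) auto
  also have "\<dots> \<le> infsum g A" by (rule sum_le_infsum_ennreal[OF F])
  finally show "sum f F \<le> infsum g A" .
qed

lemma infsum_ennreal_add: "infsum (\<lambda>x. f x + g x) A = infsum f A + (infsum g A :: ennreal)"
  by (intro infsum_add nonneg_summable_on_complete zero_le)

lemma infsum_ennreal_cmult: "infsum (\<lambda>x. c * f x) A = c * (infsum f A :: ennreal)"
proof -
  have "infsum (\<lambda>x. c * f x) A = (SUP F\<in>{F. finite F \<and> F \<subseteq> A}. c * sum f F)"
    unfolding infsum_ennreal_eq_SUP by (simp add: sum_distrib_left)
  also have "\<dots> = c * (SUP F\<in>{F. finite F \<and> F \<subseteq> A}. sum f F)"
    by (subst SUP_mult_left_ennreal) auto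
  finally show ?thesis by (simp add: infsum_ennreal_eq_SUP)
qed

lemma infsum_ennreal_Sigma:
  fixes f :: "'a \<Rightarrow> 'b \<Rightarrow> ennreal"
  shows "infsum (\<lambda>(x, y). f x y) (A \<times> B) = (\<Sum>\<^sub>\<infinity>x\<in>A. \<Sum>\<^sub>\<infinity>y\<in>B. f x y)"
proof (rule antisym)
  show "infsum (\<lambda>(x, y). f x y) (A \<times> B) \<le> (\<Sum>\<^sub>\<infinity>x\<in>A. \<Sum>\<^sub>\<infinity>y\<in>B. f x y)"
  proof (rule infsum_ennreal_leI)
    fix F assume F: "finite F" "F \<subseteq> A \<times> B"
    have "(\<Sum>(x, y)\<in>F. f x y) \<le> (\<Sum>(x, y)\<in>fst ` F \<times> snd ` F. f x y)"
      using F by (intro sum_mono2) (auto simp: rev_image_eqI)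
    also have "\<dots> = (\<Sum>x\<in>fst ` F. \<Sum>y\<in>snd ` F. f x y)" by (rule sum.cartesian_product[symmetric])
    also have "\<dots> \<le> (\<Sum>x\<in>fst ` F. \<Sum>\<^sub>\<infinity>y\<in>B. f x y)"
      using F by (intro sum_mono sum_le_infsum_ennreal) auto
    also have "\<dots> \<le> (\<Sum>\<^sub>\<infinity>x\<in>A. \<Sum>\<^sub>\<infinity>y\<in>B. f x y)" using F by (intro sum_le_infsum_ennreal) auto
    finally show "(\<Sum>(x, y)\<in>F. f x y) \<le> (\<Sum>\<^sub>\<infinity>x\<in>A. \<Sum>\<^sub>\<infinity>y\<in>B. f x y)" .
  qed
  show "(\<Sum>\<^sub>\<infinity>x\<in>A. \<Sum>\<^sub>\<infinity>y\<in>B. f x y) \<le> infsum (\<lambda>(x, y). f x y) (A \<times> B)"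
  proof (rule infsum_ennreal_leI)
    fix X assume X: "finite X" "X \<subseteq> A"
    have "(\<Sum>x\<in>X. \<Sum>\<^sub>\<infinity>y\<in>B. f x y) = infsum (\<lambda>(x, y). f x y) (X \<times> B)"
      using X(1)
    proof (induction X rule: finite_induct)
      case (insert x X)
      have "insert x X \<times> B = Pair x ` B \<union> X \<times> B" by auto
      then have "infsum (\<lambda>(x, y). f x y) (insert x X \<times> B) = infsum (\<lambda>(x, y). f x y) (Pair x ` B) + infsum (\<lambda>(x, y). f x y) (X \<times> B)"
        using insert by (simp only:) (rule infsum_Un_disjoint, auto intro!: nonneg_summable_on_complete)
      also have "infsum (\<lambda>(x, y). f x y) (Pair x ` B) = (\<Sum>\<^sub>\<infinity>y\<in>B. f x y)"
        by (subst infsum_reindex) (auto simp: inj_on_def o_def)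
      finally show ?case using insert by simp
    qed simp
    also have "\<dots> \<le> infsum (\<lambda>(x, y). f x y) (A \<times> B)"
      by (intro infsum_ennreal_leI sum_le_infsum_ennreal) (use X in auto)
    finally show "(\<Sum>x\<in>X. \<Sum>\<^sub>\<infinity>y\<in>B. f x y) \<le> infsum (\<lambda>(x, y). f x y) (A \<times> B)" .
  qed
qed

text \<open>One increasing sequence of finite sets serves all summands simultaneously. Applied at
  every point \<open>x\<close>, it makes infinite sums accessible to monotone convergence and proves
  their measurability.\<close>

lemma countable_exhaustion:
  assumes "countable I"
  obtains Fk :: "nat \<Rightarrow> 'i set" where "incseq Fk" "\<And>k. finite (Fk k)" "\<And>k. Fk k \<subseteq> I"
    "\<And>f :: 'i \<Rightarrow> ennreal. infsum f I = (SUP k. sum f (Fk k))"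
proof -
  obtain en :: "'i \<Rightarrow> nat" where en: "inj_on en I" using assms by (auto simp: countable_def)
  define Fk where "Fk k = {i\<in>I. en i \<le> k}" for k
  have fin: "finite (Fk k)" for k
    by (rule finite_imageD[of en]) (auto simp: Fk_def intro!: finite_subset[of _ "{..k}"] intro: inj_on_subset[OF en])
  have sub: "Fk k \<subseteq> I" for k by (auto simp: Fk_def)
  have inc: "incseq Fk" by (auto simp: incseq_def Fk_def)
  have "infsum f I = (SUP k. sum f (Fk k))" for f :: "'i \<Rightarrow> ennreal"
  proof (rule antisym)
    show "infsum f I \<le> (SUP k. sum f (Fk k))"
    proof (rule infsum_ennreal_leI)
      fix F assume F: "finite F" "F \<subseteq> I"
      define k where "k = Max (insert 0 (en ` F))"
      have "F \<subseteq> Fk k" using F by (auto simp: Fk_def k_def)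
      then have "sum f F \<le> sum f (Fk k)" by (intro sum_mono2 fin) auto
      also have "\<dots> \<le> (SUP k. sum f (Fk k))" by (rule SUP_upper) simp
      finally show "sum f F \<le> (SUP k. sum f (Fk k))" .
    qed
    show "(SUP k. sum f (Fk k)) \<le> infsum f I" by (intro SUP_least sum_le_infsum_ennreal fin sub)
  qed
  then show ?thesis using that inc fin sub by blast
qed

lemma countable_int_vec: "countable (UNIV :: (int^'n) set)"
proof (rule countable_image_inj_on)
  show "countable (range (vec_nth :: int^'n \<Rightarrow> _))" by (rule countableI_type)
  show "inj (vec_nth :: int^'n \<Rightarrow> _)" by (auto intro: injI simp: vec_nth_inject)
qed

lemma countable_wavelet_index: "countable (wavelet_index J :: ((int^'n) + nat \<times> int \<times> (int^'n)) set)"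
  unfolding wavelet_index_def by (intro countable_Plus countable_SIGMA countable_int_vec) auto

section \<open>Upper bounds for infinite square functions\<close>

context wavelets
begin

text \<open>A squared square function over the whole basis, covering \<open>V\<close> and
  \<open>W\<close> at once; \<open>usq_split\<close> separates them. The basis fixes the
  coefficients, while the functions multiplying them are left free.\<close>

definition usq :: "((int^'n) + nat \<times> int \<times> (int^'n) \<Rightarrow> real^'n \<Rightarrow> complex) \<Rightarrow> int \<Rightarrow> (real^'n \<Rightarrow> complex) \<Rightarrow> real^'n \<Rightarrow> ennreal" where
  "usq \<eta> J f x = (\<Sum>\<^sub>\<infinity>\<iota>\<in>wavelet_index J. ennreal ((norm (ip f (wavelet_family \<phi> \<psi> J \<iota>) * \<eta> \<iota> x))\<^sup>2))"

text \<open>The functions \<open>\<eta> \<iota>\<close> are the profiles of a square function: the wavelets themselves for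
  \<open>W\<^sub>1\<close>, normalized indicators of dyadic cubes for \<open>W\<^sub>2\<close>.\<close>

definition profiles :: "int \<Rightarrow> ((int^'n) + nat \<times> int \<times> (int^'n) \<Rightarrow> real^'n \<Rightarrow> complex) \<Rightarrow> real \<Rightarrow> bool" where
  "profiles J \<eta> D \<longleftrightarrow> D > 0 \<and> (\<forall>\<iota>\<in>wavelet_index J. \<eta> \<iota> \<in> borel_measurable lebesgue \<and>
     (\<forall>x. (norm (\<eta> \<iota> x))\<^sup>2 \<le> D * 2 powr (real_of_int (sc J \<iota>) * real CARD('n)) * indicator (supp_cube (sc J \<iota>) (ps \<iota>)) x) \<and>
     integrable lebesgue (\<lambda>x. (norm (\<eta> \<iota> x))\<^sup>2) \<and> (LINT x|lebesgue. (norm (\<eta> \<iota> x))\<^sup>2) = 1)"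

lemma usq_measurable:
  assumes "profiles J \<eta> D"
  shows "usq \<eta> J f \<in> borel_measurable lebesgue"
proof -
  obtain Fk :: "nat \<Rightarrow> ((int^'n) + nat \<times> int \<times> (int^'n)) set" where Fk: "incseq Fk" "\<And>k. finite (Fk k)" "\<And>k. Fk k \<subseteq> wavelet_index J"
    "\<And>f :: _ \<Rightarrow> ennreal. infsum f (wavelet_index J) = (SUP k. sum f (Fk k))"
    using countable_exhaustion[OF countable_wavelet_index] by blast
  have "(\<lambda>x. \<Sum>\<iota>\<in>Fk k. ennreal ((norm (ip f (wavelet_family \<phi> \<psi> J \<iota>) * \<eta> \<iota> x))\<^sup>2)) \<in> borel_measurable lebesgue" for k
  proof (rule borel_measurable_sum)
    fix \<iota> assume "\<iota> \<in> Fk k"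
    then have [measurable]: "\<eta> \<iota> \<in> borel_measurable lebesgue" using assms Fk(3) by (auto simp: profiles_def)
    show "(\<lambda>x. ennreal ((norm (ip f (wavelet_family \<phi> \<psi> J \<iota>) * \<eta> \<iota> x))\<^sup>2)) \<in> borel_measurable lebesgue" by measurable
  qed
  then show ?thesis
    unfolding usq_def[abs_def] Fk(4) by (intro borel_measurable_SUP) auto
qed

end

context weighted_wavelets
begin

text \<open>The bounds for finite families have a common constant, so monotone convergence along an
  exhaustion of the index set carries them over. The size bound in \<open>profiles\<close> reduces
  every admissible \<open>\<eta>\<close> to indicators of support cubes.\<close>

lemma square_function_upper:
  assumes prof: "profiles J \<eta> D"
  shows "\<exists>C>0. \<forall>f. f \<in> borel_measurable lebesgue \<longrightarrow>
    (\<integral>\<^sup>+x. ennreal_powr (usq \<eta> J f x) (p / 2) \<partial>W) \<le> ennreal C * (\<integral>\<^sup>+x. ennreal (norm (f x) powr p) \<partial>W)"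
proof -
  obtain C0 where C0: "C0 > 0" and fb: "\<forall>F f. finite F \<and> F \<subseteq> wavelet_index J \<and> f \<in> borel_measurable lebesgue \<longrightarrow>
    (\<integral>\<^sup>+x. ennreal ((\<Sum>\<iota>\<in>F. (norm (ip f (wavelet_family \<phi> \<psi> J \<iota>)))\<^sup>2 * 2 powr (real_of_int (sc J \<iota>) * real CARD('n))
        * indicator (supp_cube (sc J \<iota>) (ps \<iota>)) x) powr (p / 2)) \<partial>W)
      \<le> ennreal C0 * (\<integral>\<^sup>+x. ennreal (norm (f x) powr p) \<partial>W)"
    using finite_square_bound[of J] by (elim exE conjE) (rule that)
  obtain Fk :: "nat \<Rightarrow> ((int^'n) + nat \<times> int \<times> (int^'n)) set" where Fk: "incseq Fk" "\<And>k. finite (Fk k)" "\<And>k. Fk k \<subseteq> wavelet_index J"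
    "\<And>f :: _ \<Rightarrow> ennreal. infsum f (wavelet_index J) = (SUP k. sum f (Fk k))"
    using countable_exhaustion[OF countable_wavelet_index] by blast
  have D: "D > 0" using prof by (simp add: profiles_def)
  show ?thesis
  proof (intro exI[of _ "D powr (p / 2) * C0"] conjI allI impI)
    show "D powr (p / 2) * C0 > 0" using D C0 by simp
    fix f :: "real^'n \<Rightarrow> complex" assume f: "f \<in> borel_measurable lebesgue"
    let ?J = "\<integral>\<^sup>+x. ennreal (norm (f x) powr p) \<partial>W"
    define T where "T k x = (\<Sum>\<iota>\<in>Fk k. ennreal ((norm (ip f (wavelet_family \<phi> \<psi> J \<iota>) * \<eta> \<iota> x))\<^sup>2))" for k x
    have Tm: "T k \<in> borel_measurable lebesgue" for k
      unfolding T_def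
    proof (rule borel_measurable_sum)
      fix \<iota> assume "\<iota> \<in> Fk k"
      then have [measurable]: "\<eta> \<iota> \<in> borel_measurable lebesgue" using prof Fk(3) by (auto simp: profiles_def)
      show "(\<lambda>x. ennreal ((norm (ip f (wavelet_family \<phi> \<psi> J \<iota>) * \<eta> \<iota> x))\<^sup>2)) \<in> borel_measurable lebesgue" by measurable
    qed
    have Tk: "(\<integral>\<^sup>+x. ennreal_powr (T k x) (p / 2) \<partial>W) \<le> ennreal (D powr (p / 2) * C0) * ?J" for k
    proof -
      define Y where "Y x = (\<Sum>\<iota>\<in>Fk k. (norm (ip f (wavelet_family \<phi> \<psi> J \<iota>)))\<^sup>2 * 2 powr (real_of_int (sc J \<iota>) * real CARD('n))
        * indicator (supp_cube (sc J \<iota>) (ps \<iota>)) x)" for x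
      have [measurable]: "Y \<in> borel_measurable lebesgue"
        unfolding Y_def by (intro borel_measurable_sum borel_measurable_times borel_measurable_indicator) (auto simp: supp_cube_def)
      have "(\<integral>\<^sup>+x. ennreal_powr (T k x) (p / 2) \<partial>W) \<le> (\<integral>\<^sup>+x. ennreal (D powr (p / 2)) * ennreal (Y x powr (p / 2)) \<partial>W)"
      proof (rule nn_integral_mono)
        fix x
        have Y0: "Y x \<ge> 0" unfolding Y_def by (intro sum_nonneg) auto
        have "T k x = ennreal (\<Sum>\<iota>\<in>Fk k. (norm (ip f (wavelet_family \<phi> \<psi> J \<iota>) * \<eta> \<iota> x))\<^sup>2)"
          unfolding T_def by (rule sum_ennreal) simp
        also have "\<dots> \<le> ennreal (D * Y x)"
        proof (rule ennreal_leI)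
          have "(\<Sum>\<iota>\<in>Fk k. (norm (ip f (wavelet_family \<phi> \<psi> J \<iota>) * \<eta> \<iota> x))\<^sup>2)
            \<le> (\<Sum>\<iota>\<in>Fk k. (norm (ip f (wavelet_family \<phi> \<psi> J \<iota>)))\<^sup>2 * (D * 2 powr (real_of_int (sc J \<iota>) * real CARD('n)) * indicator (supp_cube (sc J \<iota>) (ps \<iota>)) x))"
          proof (rule sum_mono)
            fix \<iota> assume "\<iota> \<in> Fk k"
            then have "(norm (\<eta> \<iota> x))\<^sup>2 \<le> D * 2 powr (real_of_int (sc J \<iota>) * real CARD('n)) * indicator (supp_cube (sc J \<iota>) (ps \<iota>)) x"
              using prof Fk(3) unfolding profiles_def by blast
            then show "(norm (ip f (wavelet_family \<phi> \<psi> J \<iota>) * \<eta> \<iota> x))\<^sup>2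
              \<le> (norm (ip f (wavelet_family \<phi> \<psi> J \<iota>)))\<^sup>2 * (D * 2 powr (real_of_int (sc J \<iota>) * real CARD('n)) * indicator (supp_cube (sc J \<iota>) (ps \<iota>)) x)"
              unfolding norm_mult power_mult_distrib by (intro mult_left_mono) auto
          qed
          also have "\<dots> = D * Y x" unfolding Y_def sum_distrib_left by (rule sum.cong) (simp_all only: mult_ac)
          finally show "(\<Sum>\<iota>\<in>Fk k. (norm (ip f (wavelet_family \<phi> \<psi> J \<iota>) * \<eta> \<iota> x))\<^sup>2) \<le> D * Y x" .
        qed
        finally have "ennreal_powr (T k x) (p / 2) \<le> ennreal_powr (ennreal (D * Y x)) (p / 2)"
          using p1 by (intro ennreal_powr_mono) auto
        also have "\<dots> = ennreal ((D * Y x) powr (p / 2))"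
          using D Y0 by (intro ennreal_powr_ennreal mult_nonneg_nonneg) simp_all
        also have "\<dots> = ennreal (D powr (p / 2) * Y x powr (p / 2))"
          using D Y0 by (subst powr_mult) simp_all
        also have "\<dots> = ennreal (D powr (p / 2)) * ennreal (Y x powr (p / 2))" by (rule ennreal_mult) simp_all
        finally show "ennreal_powr (T k x) (p / 2) \<le> ennreal (D powr (p / 2)) * ennreal (Y x powr (p / 2))" .
      qed
      also have "\<dots> = ennreal (D powr (p / 2)) * (\<integral>\<^sup>+x. ennreal (Y x powr (p / 2)) \<partial>W)"
        by (rule nn_integral_cmult) measurable
      also have "\<dots> \<le> ennreal (D powr (p / 2)) * (ennreal C0 * ?J)"
      proof (rule mult_left_mono)
        show "(\<integral>\<^sup>+x. ennreal (Y x powr (p / 2)) \<partial>W) \<le> ennreal C0 * ?J"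
          unfolding Y_def by (rule fb[rule_format]) (intro conjI Fk f)
      qed simp
      also have "\<dots> = ennreal (D powr (p / 2) * C0) * ?J" using C0 by (simp add: ennreal_mult mult.assoc)
      finally show ?thesis .
    qed
    have "(\<integral>\<^sup>+x. ennreal_powr (usq \<eta> J f x) (p / 2) \<partial>W) = (\<integral>\<^sup>+x. (SUP k. ennreal_powr (T k x) (p / 2)) \<partial>W)"
    proof -
      have "usq \<eta> J f x = (SUP k. T k x)" for x unfolding usq_def Fk(4) T_def ..
      then show ?thesis using p1 by (simp only: ennreal_powr_SUP[of "p / 2"] zero_less_divide_iff) (simp add: ennreal_powr_SUP)
    qed
    also have "\<dots> = (SUP k. \<integral>\<^sup>+x. ennreal_powr (T k x) (p / 2) \<partial>W)"
    proof (rule nn_integral_monotone_convergence_SUP)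
      show "incseq (\<lambda>k x. ennreal_powr (T k x) (p / 2))"
      proof (rule incseq_SucI, rule le_funI)
        fix k x
        have "T k x \<le> T (Suc k) x"
          unfolding T_def using Fk(1,2) by (intro sum_mono2) (auto simp: incseq_Suc_iff)
        then show "ennreal_powr (T k x) (p / 2) \<le> ennreal_powr (T (Suc k) x) (p / 2)"
          using p1 by (intro ennreal_powr_mono) auto
      qed
      show "(\<lambda>x. ennreal_powr (T k x) (p / 2)) \<in> borel_measurable W" for k
        using Tm[of k] by measurable
    qed
    also have "\<dots> \<le> ennreal (D powr (p / 2) * C0) * ?J" by (intro SUP_least Tk)
    finally show "(\<integral>\<^sup>+x. ennreal_powr (usq \<eta> J f x) (p / 2) \<partial>W) \<le> ennreal (D powr (p / 2) * C0) * ?J" .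
  qed
qed

end

section \<open>Lower bounds by duality\<close>

context wavelets
begin

lemma pairing_le_square_functions:
  assumes prof: "profiles J \<eta> D" and f: "f \<in> L2_space" and g: "g \<in> L2_space"
  shows "ennreal (norm (ip f g)) \<le> (\<integral>\<^sup>+x. ennreal_powr (usq \<eta> J f x) (1/2) * ennreal_powr (usq \<eta> J g x) (1/2) \<partial>lebesgue)"
    (is "_ \<le> ?P")
proof (rule ennreal_le_epsilon)
  fix \<delta> :: real assume \<delta>: "\<delta> > 0"
  define e where "e = wavelet_family \<phi> \<psi> J"
  obtain F where F: "finite F" "F \<subseteq> wavelet_index J"
    and le: "norm (ip f g - (\<Sum>i\<in>F. ip f (e i) * ip (e i) g)) \<le> \<delta>"
    using parseval_approx[OF basis[of J] f g \<delta>] unfolding e_def by blast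
  let ?a = "\<lambda>i x. norm (ip f (e i) * \<eta> i x)" and ?b = "\<lambda>i x. norm (ip g (e i) * \<eta> i x)"
  have \<eta>: "integrable lebesgue (\<lambda>x. (norm (\<eta> i x))\<^sup>2)" "(LINT x|lebesgue. (norm (\<eta> i x))\<^sup>2) = 1" if "i \<in> F" for i
    using prof F(2) that unfolding profiles_def by auto
  have "norm (ip f g) \<le> \<delta> + norm (\<Sum>i\<in>F. ip f (e i) * ip (e i) g)"
    using le norm_triangle_ineq2[of "ip f g" "\<Sum>i\<in>F. ip f (e i) * ip (e i) g"] by linarith
  also have "\<dots> \<le> \<delta> + (\<Sum>i\<in>F. norm (ip f (e i)) * norm (ip g (e i)))"
  proof -
    have "norm (\<Sum>i\<in>F. ip f (e i) * ip (e i) g) \<le> (\<Sum>i\<in>F. norm (ip f (e i) * ip (e i) g))" by (rule norm_sum)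
    also have "\<dots> = (\<Sum>i\<in>F. norm (ip f (e i)) * norm (ip g (e i)))"
    proof (rule sum.cong[OF refl])
      fix i
      have "norm (ip (e i) g) = norm (ip g (e i))" using ip_commute[of "e i" g] by simp
      then show "norm (ip f (e i) * ip (e i) g) = norm (ip f (e i)) * norm (ip g (e i))" by (simp add: norm_mult)
    qed
    finally show ?thesis by simp
  qed
  finally have "ennreal (norm (ip f g)) \<le> ennreal \<delta> + ennreal (\<Sum>i\<in>F. norm (ip f (e i)) * norm (ip g (e i)))"
    using \<delta> by (simp add: sum_nonneg ennreal_leI flip: ennreal_plus)
  also have "ennreal (\<Sum>i\<in>F. norm (ip f (e i)) * norm (ip g (e i))) \<le> ?P"
  proof -
    have int: "integrable lebesgue (\<lambda>x. ?a i x * ?b i x)" if "i \<in> F" for i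
    proof -
      have "integrable lebesgue (\<lambda>x. (norm (ip f (e i)) * norm (ip g (e i))) * (norm (\<eta> i x))\<^sup>2)"
        using \<eta>(1)[OF that] by simp
      then show ?thesis by (simp add: norm_mult power2_eq_square mult_ac)
    qed
    \<comment> \<open>As each profile has L^2-norm one, its squared modulus can be inserted under an
      integral; Cauchy--Schwarz is then applied at every point separately.\<close>
    have "(\<Sum>i\<in>F. norm (ip f (e i)) * norm (ip g (e i))) = (\<Sum>i\<in>F. LINT x|lebesgue. ?a i x * ?b i x)"
    proof (rule sum.cong[OF refl])
      fix i assume i: "i \<in> F"
      have "(LINT x|lebesgue. ?a i x * ?b i x) = (LINT x|lebesgue. (norm (ip f (e i)) * norm (ip g (e i))) * (norm (\<eta> i x))\<^sup>2)"
        by (simp add: norm_mult power2_eq_square mult_ac)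
      also have "\<dots> = norm (ip f (e i)) * norm (ip g (e i))" using \<eta>(2)[OF i] by simp
      finally show "norm (ip f (e i)) * norm (ip g (e i)) = (LINT x|lebesgue. ?a i x * ?b i x)" by simp
    qed
    also have "\<dots> = (LINT x|lebesgue. (\<Sum>i\<in>F. ?a i x * ?b i x))"
      using int by (intro Bochner_Integration.integral_sum[symmetric])
    also have "ennreal \<dots> = (\<integral>\<^sup>+x. ennreal (\<Sum>i\<in>F. ?a i x * ?b i x) \<partial>lebesgue)"
      using int by (intro nn_integral_eq_integral[symmetric] Bochner_Integration.integrable_sum AE_I2 sum_nonneg) auto
    also have "\<dots> \<le> ?P"
    proof (rule nn_integral_mono)
      fix x
      have usq_ge: "ennreal (\<Sum>i\<in>F. (norm (ip h (e i) * \<eta> i x))\<^sup>2) \<le> usq \<eta> J h x" for h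
      proof -
        have "ennreal (\<Sum>i\<in>F. (norm (ip h (e i) * \<eta> i x))\<^sup>2) = (\<Sum>i\<in>F. ennreal ((norm (ip h (e i) * \<eta> i x))\<^sup>2))"
          by (rule sum_ennreal[symmetric]) simp
        also have "\<dots> \<le> usq \<eta> J h x" unfolding usq_def e_def by (rule sum_le_infsum_ennreal[OF F])
        finally show ?thesis .
      qed
      have root: "ennreal (sqrt s) = ennreal_powr (ennreal s) (1/2)" if "s \<ge> 0" for s
        using that by (simp add: ennreal_powr_ennreal powr_half_sqrt)
      have "(\<Sum>i\<in>F. ?a i x * ?b i x) \<le> sqrt (\<Sum>i\<in>F. (?a i x)\<^sup>2) * sqrt (\<Sum>i\<in>F. (?b i x)\<^sup>2)"
      proof -
        have "(\<Sum>i\<in>F. ?a i x * ?b i x)\<^sup>2 \<le> (\<Sum>i\<in>F. (?a i x)\<^sup>2) * (\<Sum>i\<in>F. (?b i x)\<^sup>2)"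
          by (rule Cauchy_Schwarz_ineq_sum)
        then show ?thesis by (simp add: real_le_rsqrt flip: real_sqrt_mult)
      qed
      then have "ennreal (\<Sum>i\<in>F. ?a i x * ?b i x) \<le> ennreal (sqrt (\<Sum>i\<in>F. (?a i x)\<^sup>2)) * ennreal (sqrt (\<Sum>i\<in>F. (?b i x)\<^sup>2))"
        by (subst ennreal_mult[symmetric]) (auto intro: sum_nonneg ennreal_leI)
      also have "\<dots> \<le> ennreal_powr (usq \<eta> J f x) (1/2) * ennreal_powr (usq \<eta> J g x) (1/2)"
        using usq_ge[of f] usq_ge[of g] by (subst (1 2) root) (auto intro!: mult_mono ennreal_powr_mono sum_nonneg)
      finally show "ennreal (\<Sum>i\<in>F. ?a i x * ?b i x) \<le> ennreal_powr (usq \<eta> J f x) (1/2) * ennreal_powr (usq \<eta> J g x) (1/2)" .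
    qed
    finally show ?thesis .
  qed
  finally show "ennreal (norm (ip f g)) \<le> ?P + ennreal \<delta>" by (simp add: add.commute add_left_mono)
qed

end

context pos_weight
begin

lemma young_weight_ennreal:
  assumes K: "K > 0"
  shows "ennreal_powr a (1/2) * ennreal_powr b (1/2)
    \<le> ennreal K * (ennreal (w x) * ennreal_powr a (p / 2))
      + ennreal (K powr (- 1 / (p - 1))) * (ennreal (\<sigma> x) * ennreal_powr b (q / 2))"
proof (cases "a = \<infinity> \<or> b = \<infinity>")
  case True
  have "ennreal K * (ennreal (w x) * \<infinity>) = \<infinity>" "ennreal (K powr (- 1 / (p - 1))) * (ennreal (\<sigma> x) * \<infinity>) = \<infinity>"
    using K w_pos[of x] sigma_pos[of x] by (simp_all add: ennreal_mult_top)
  then show ?thesis using True by auto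
next
  case False
  then obtain r s where rs: "a = ennreal r" "b = ennreal s" "r \<ge> 0" "s \<ge> 0"
    by (metis ennreal_cases infinity_ennreal_def)
  have "sqrt r * sqrt s \<le> K * (sqrt r powr p * w x) + K powr (- 1 / (p - 1)) * (sqrt s powr q * \<sigma> x)"
    by (rule young_weight) (use rs K in auto)
  also have "sqrt r powr p = r powr (p / 2)" using rs by (simp add: powr_half_sqrt[symmetric] powr_powr)
  also have "sqrt s powr q = s powr (q / 2)" using rs by (simp add: powr_half_sqrt[symmetric] powr_powr)
  finally have "ennreal (sqrt r * sqrt s) \<le> ennreal (K * (r powr (p / 2) * w x) + K powr (- 1 / (p - 1)) * (s powr (q / 2) * \<sigma> x))"
    by (rule ennreal_leI)
  also have "\<dots> = ennreal K * (ennreal (w x) * ennreal_powr a (p / 2))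
      + ennreal (K powr (- 1 / (p - 1))) * (ennreal (\<sigma> x) * ennreal_powr b (q / 2))"
    using rs K w_pos[of x] sigma_pos[of x]
    by (simp add: ennreal_powr_ennreal ennreal_mult less_imp_le mult_ac)
  finally show ?thesis using rs by (simp add: ennreal_powr_ennreal powr_half_sqrt ennreal_mult)
qed

end

context weighted_wavelets
begin

lemma dual_weighted_wavelets: "weighted_wavelets \<phi> \<psi> N q \<sigma> (A powr (q - 1))"
proof (intro weighted_wavelets.intro dual weighted_wavelets_axioms.intro)
  show "wavelets \<phi> \<psi> N" by unfold_locales
  show "pos_weight.Apset q \<sigma> (A powr (q - 1)) (cbox a (a + vec s))" if "0 < s" "s \<le> 1" for a s
    by (rule Apset_dual[OF A[OF that]])
qed

text \<open>The dual function \<open>g\<close> is f |f|^(p-2) w, so that its pairing with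
  \<open>f\<close> is the modular. Restricting it to the points with \<open>w x \<le> M\<close>
  makes it bounded; then both functions lie in L^2 and \<open>I\<close> is finite. Young's
  inequality and the upper bound for the dual weight leave \<open>I / 2\<close> on the right, which
  is absorbed before \<open>M\<close> tends to infinity.\<close>

lemma square_function_lower_nice:
  assumes prof: "profiles J \<eta> D"
  shows "\<exists>C>0. \<forall>f R. f \<in> borel_measurable lebesgue \<and> (\<forall>x. norm (f x) \<le> R) \<and> (\<forall>x. norm x > R \<longrightarrow> f x = 0) \<longrightarrow>
    (\<integral>\<^sup>+x. ennreal (norm (f x) powr p) \<partial>W) \<le> ennreal C * (\<integral>\<^sup>+x. ennreal_powr (usq \<eta> J f x) (p / 2) \<partial>W)"
proof -
  obtain Cd where Cd: "Cd > 0" and up: "\<And>g. g \<in> borel_measurable lebesgue \<Longrightarrow>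
    (\<integral>\<^sup>+x. ennreal_powr (usq \<eta> J g x) (q / 2) \<partial>S) \<le> ennreal Cd * (\<integral>\<^sup>+x. ennreal (norm (g x) powr q) \<partial>S)"
    using weighted_wavelets.square_function_upper[OF dual_weighted_wavelets prof] unfolding dual_W by blast
  \<comment> \<open>Makes the factor in front of \<open>I\<close> on the right equal to one half,
    see \<open>KC\<close>.\<close>
  define K where "K = (2 * Cd) powr (p - 1)"
  have K: "K > 0" using Cd by (simp add: K_def)
  have KC: "K powr (- 1 / (p - 1)) * Cd = 1/2"
    using p1 Cd by (simp add: K_def powr_powr powr_minus field_simps)
  show ?thesis
  proof (intro exI[of _ "2 * K"] conjI allI impI)
    show "2 * K > 0" using K by simp
    fix f :: "real^'n \<Rightarrow> complex" and R :: real
    assume asm: "f \<in> borel_measurable lebesgue \<and> (\<forall>x. norm (f x) \<le> R) \<and> (\<forall>x. norm x > R \<longrightarrow> f x = 0)"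
    then have f[measurable]: "f \<in> borel_measurable lebesgue" and fR: "\<And>x. norm (f x) \<le> R" and fs: "\<And>x. norm x > R \<Longrightarrow> f x = 0"
      by auto
    have R0: "R \<ge> 0" using fR[of 0] norm_ge_zero order_trans by blast
    have bs_int: "integrable lebesgue u" if [measurable]: "u \<in> borel_measurable lebesgue"
      and b: "\<And>x. norm (u x) \<le> c" and z: "\<And>x. norm x > R \<Longrightarrow> u x = 0" for u :: "real^'n \<Rightarrow> real" and c
    proof (rule Bochner_Integration.integrable_bound)
      show "integrable lebesgue (\<lambda>x. c * indicator (cball (0::real^'n) R) x)"
        using fmeasurableD2[OF lmeasurable_cball, of "0 :: real^'n" R]
        by (intro integrable_mult_right integrable_real_indicator) (auto simp: less_top simp del: emeasure_completion)
      show "AE x in lebesgue. norm (u x) \<le> norm (c * indicator (cball (0::real^'n) R) x)"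
      proof (rule AE_I2)
        fix x
        have "c \<ge> 0" using b[of x] norm_ge_zero order_trans by blast
        then show "norm (u x) \<le> norm (c * indicator (cball (0::real^'n) R) x)"
          using b[of x] z[of x] by (auto simp: indicator_def)
      qed
    qed measurable
    have bs_L2: "u \<in> L2_space" if u[measurable]: "u \<in> borel_measurable lebesgue"
      and b: "\<And>x. norm (u x) \<le> c" and z: "\<And>x. norm x > R \<Longrightarrow> u x = 0" for u :: "real^'n \<Rightarrow> complex" and c
    proof (rule L2_spaceI[OF u])
      show "integrable lebesgue (\<lambda>x. (norm (u x))\<^sup>2)"
        by (rule bs_int[of _ "c\<^sup>2"]) (use b z in \<open>auto intro: power_mono\<close>)
    qed
    let ?U = "\<integral>\<^sup>+x. ennreal_powr (usq \<eta> J f x) (p / 2) \<partial>W"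
    have main: "(\<integral>\<^sup>+x. ennreal (norm (f x) powr p * (w x * indicator {..real M} (w x))) \<partial>lebesgue) \<le> ennreal (2 * K) * ?U" for M :: nat
    proof -
      define h where "h x = norm (f x) powr p * (w x * indicator {..real M} (w x))" for x
      have hm[measurable]: "h \<in> borel_measurable lebesgue" unfolding h_def by measurable
      have wM: "0 \<le> w x * indicator {..real M} (w x)" "w x * indicator {..real M} (w x) \<le> real M" for x
        using w_pos[of x] by (auto simp: indicator_def)
      have h0: "h x \<ge> 0" for x unfolding h_def using wM by auto
      have h_int: "integrable lebesgue h"
      proof (rule bs_int)
        show "norm (h x) \<le> R powr p * real M" for x
          using h0[of x] wM[of x] fR[of x] p1 unfolding h_def by (auto intro!: mult_mono powr_mono2)
        show "h x = 0" if "norm x > R" for x using fs[OF that] by (simp add: h_def)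
      qed measurable
      define I where "I = (LINT x|lebesgue. h x)"
      have I0: "I \<ge> 0" unfolding I_def using h0 by (intro Bochner_Integration.integral_nonneg)
      have I_nn: "(\<integral>\<^sup>+x. ennreal (h x) \<partial>lebesgue) = ennreal I"
        unfolding I_def using h0 by (intro nn_integral_eq_integral h_int) auto
      define g where "g x = f x * of_real (norm (f x) powr (p - 2) * (w x * indicator {..real M} (w x)))" for x
      have gm[measurable]: "g \<in> borel_measurable lebesgue" unfolding g_def by measurable
      have ng: "norm (g x) = norm (f x) powr (p - 1) * (w x * indicator {..real M} (w x))" for x
      proof (cases "f x = 0")
        case False
        then have "norm (f x) * norm (f x) powr (p - 2) = norm (f x) powr (p - 1)"
          using powr_add[of "norm (f x)" 1 "p - 2"] by simp
        then show ?thesis unfolding g_def norm_mult norm_of_real abs_mult by (simp add: mult.assoc[symmetric] abs_of_pos[OF w_pos])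
      qed (simp add: g_def)
      have fg: "f x * cnj (g x) = of_real (h x)" for x
      proof (cases "f x = 0")
        case False
        then have "(norm (f x))\<^sup>2 * norm (f x) powr (p - 2) = norm (f x) powr p"
          using powr_add[of "norm (f x)" 2 "p - 2"] by (simp add: powr_numeral)
        moreover have "f x * cnj (f x) = of_real ((norm (f x))\<^sup>2)" by (simp only: complex_norm_square)
        ultimately show ?thesis unfolding g_def h_def
          by (simp add: mult.assoc[symmetric] of_real_mult[symmetric] del: of_real_mult of_real_power)
      qed (simp add: h_def)
      have fL2: "f \<in> L2_space" by (rule bs_L2[OF f fR fs])
      have gL2: "g \<in> L2_space"
      proof (rule bs_L2[OF gm])
        show "norm (g x) \<le> R powr (p - 1) * real M" for x
          unfolding ng using wM[of x] fR[of x] p1 by (auto intro!: mult_mono powr_mono2)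
        show "g x = 0" if "norm x > R" for x using fs[OF that] by (simp add: g_def)
      qed
      have "ip f g = of_real I" unfolding ip_def fg I_def by (rule integral_complex_of_real)
      then have "ennreal I = ennreal (norm (ip f g))" using I0 by simp
      also have "\<dots> \<le> (\<integral>\<^sup>+x. ennreal_powr (usq \<eta> J f x) (1/2) * ennreal_powr (usq \<eta> J g x) (1/2) \<partial>lebesgue)"
        by (rule pairing_le_square_functions[OF prof fL2 gL2])
      also have "\<dots> \<le> (\<integral>\<^sup>+x. ennreal K * (ennreal (w x) * ennreal_powr (usq \<eta> J f x) (p / 2))
          + ennreal (K powr (- 1 / (p - 1))) * (ennreal (\<sigma> x) * ennreal_powr (usq \<eta> J g x) (q / 2)) \<partial>lebesgue)"
        by (intro nn_integral_mono young_weight_ennreal K)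
      also have "\<dots> = ennreal K * ?U + ennreal (K powr (- 1 / (p - 1))) * (\<integral>\<^sup>+x. ennreal_powr (usq \<eta> J g x) (q / 2) \<partial>S)"
      proof -
        have [measurable]: "usq \<eta> J f \<in> borel_measurable lebesgue" "usq \<eta> J g \<in> borel_measurable lebesgue"
          using usq_measurable[OF prof] by auto
        have "(\<integral>\<^sup>+x. ennreal K * (ennreal (w x) * ennreal_powr (usq \<eta> J f x) (p / 2))
          + ennreal (K powr (- 1 / (p - 1))) * (ennreal (\<sigma> x) * ennreal_powr (usq \<eta> J g x) (q / 2)) \<partial>lebesgue)
          = ennreal K * (\<integral>\<^sup>+x. ennreal (w x) * ennreal_powr (usq \<eta> J f x) (p / 2) \<partial>lebesgue)
          + ennreal (K powr (- 1 / (p - 1))) * (\<integral>\<^sup>+x. ennreal (\<sigma> x) * ennreal_powr (usq \<eta> J g x) (q / 2) \<partial>lebesgue)"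
          by (subst nn_integral_add) (auto simp: nn_integral_cmult)
        then show ?thesis by (simp add: nn_integral_W nn_integral_S)
      qed
      also have "\<dots> \<le> ennreal K * ?U + ennreal (1/2) * ennreal I"
      proof -
        have "(\<integral>\<^sup>+x. ennreal (norm (g x) powr q) \<partial>S) = (\<integral>\<^sup>+x. ennreal (h x) \<partial>lebesgue)"
        proof (subst nn_integral_S)
          show "(\<lambda>x. ennreal (norm (g x) powr q)) \<in> borel_measurable lebesgue" by measurable
          show "(\<integral>\<^sup>+x. ennreal (\<sigma> x) * ennreal (norm (g x) powr q) \<partial>lebesgue) = (\<integral>\<^sup>+x. ennreal (h x) \<partial>lebesgue)"
          proof (rule nn_integral_cong)
            fix x
            have "\<sigma> x * norm (g x) powr q = h x"
            proof (cases "w x \<le> real M")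
              case True
              have "norm (g x) powr q = norm (f x) powr p * w x powr q"
                using True w_pos[of x] qp by (simp add: ng powr_mult powr_powr mult.commute)
              moreover have "\<sigma> x * w x powr q = w x"
              proof -
                have "\<sigma> x * w x powr q = w x powr (- 1 / (p - 1) + q)" by (simp only: \<sigma>_def powr_add)
                also have "- 1 / (p - 1) + q = 1" using q_minus_1 by simp
                finally show ?thesis using w_pos[of x] by simp
              qed
              ultimately show ?thesis using True by (simp add: h_def)
            next
              case False
              then show ?thesis using q1 by (simp add: ng h_def)
            qed
            then show "ennreal (\<sigma> x) * ennreal (norm (g x) powr q) = ennreal (h x)"
              using sigma_pos[of x] by (simp add: ennreal_mult[symmetric] less_imp_le)
          qed
        qed
        then have "(\<integral>\<^sup>+x. ennreal_powr (usq \<eta> J g x) (q / 2) \<partial>S) \<le> ennreal Cd * ennreal I"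
          using up[OF gm] I_nn by simp
        then have "ennreal (K powr (- 1 / (p - 1))) * (\<integral>\<^sup>+x. ennreal_powr (usq \<eta> J g x) (q / 2) \<partial>S)
          \<le> ennreal (K powr (- 1 / (p - 1))) * (ennreal Cd * ennreal I)" by (intro mult_left_mono) auto
        also have "\<dots> = ennreal (1/2) * ennreal I"
        proof -
          have "ennreal (K powr (- 1 / (p - 1))) * (ennreal Cd * ennreal I) = ennreal (K powr (- 1 / (p - 1)) * Cd * I)"
            using Cd I0 by (simp add: ennreal_mult mult.assoc)
          also have "\<dots> = ennreal (1/2 * I)" unfolding KC ..
          also have "\<dots> = ennreal (1/2) * ennreal I" using I0 by (intro ennreal_mult) auto
          finally show ?thesis .
        qed
        finally show ?thesis by (intro add_left_mono)
      qed
      finally have le: "ennreal I \<le> ennreal K * ?U + ennreal (1/2) * ennreal I" .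
      have "ennreal I \<le> ennreal (2 * K) * ?U"
      proof (cases "?U = \<infinity>")
        case True
        then show ?thesis using K by (simp add: ennreal_mult_top)
      next
        case False
        then obtain v where v: "?U = ennreal v" "v \<ge> 0" by (metis ennreal_cases infinity_ennreal_def)
        have "ennreal I \<le> ennreal (K * v + 1/2 * I)"
        proof -
          have "ennreal (K * v + 1/2 * I) = ennreal (K * v) + ennreal (1/2 * I)" using K v I0 by (intro ennreal_plus) auto
          also have "\<dots> = ennreal K * ?U + ennreal (1/2) * ennreal I"
            unfolding v(1) using K v I0 by (intro arg_cong2[where f = "(+)"] ennreal_mult) auto
          finally show ?thesis using le by simp
        qed
        then have "I \<le> K * v + 1/2 * I" using K v I0 by (subst (asm) ennreal_le_iff) auto
        then have "I \<le> 2 * K * v" by simp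
        then show ?thesis using K v by (simp add: ennreal_mult[symmetric] ennreal_leI)
      qed
      then show ?thesis using I_nn unfolding h_def by simp
    qed
    have "(\<integral>\<^sup>+x. ennreal (norm (f x) powr p) \<partial>W) = (\<integral>\<^sup>+x. (SUP M. ennreal (norm (f x) powr p * (w x * indicator {..real M} (w x)))) \<partial>lebesgue)"
    proof (subst nn_integral_W)
      show "(\<lambda>x. ennreal (norm (f x) powr p)) \<in> borel_measurable lebesgue" by measurable
      show "(\<integral>\<^sup>+x. ennreal (w x) * ennreal (norm (f x) powr p) \<partial>lebesgue) = (\<integral>\<^sup>+x. (SUP M. ennreal (norm (f x) powr p * (w x * indicator {..real M} (w x)))) \<partial>lebesgue)"
      proof (rule nn_integral_cong)
        fix x
        obtain M0 :: nat where M0: "w x \<le> real M0" using real_arch_simple by blast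
        have "(SUP M. ennreal (norm (f x) powr p * (w x * indicator {..real M} (w x)))) = ennreal (norm (f x) powr p * w x)"
        proof (rule antisym)
          show "(SUP M. ennreal (norm (f x) powr p * (w x * indicator {..real M} (w x)))) \<le> ennreal (norm (f x) powr p * w x)"
            using w_pos[of x] by (intro SUP_least ennreal_leI) (auto simp: indicator_def)
          have "ennreal (norm (f x) powr p * w x) = ennreal (norm (f x) powr p * (w x * indicator {..real M0} (w x)))" using M0 by simp
          also have "\<dots> \<le> (SUP M. ennreal (norm (f x) powr p * (w x * indicator {..real M} (w x))))" by (rule SUP_upper) simp
          finally show "ennreal (norm (f x) powr p * w x) \<le> (SUP M. ennreal (norm (f x) powr p * (w x * indicator {..real M} (w x))))" .
        qed
        then show "ennreal (w x) * ennreal (norm (f x) powr p) = (SUP M. ennreal (norm (f x) powr p * (w x * indicator {..real M} (w x))))"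
          using w_pos[of x] by (simp add: ennreal_mult[symmetric] mult.commute less_imp_le)
      qed
    qed
    also have "\<dots> = (SUP M. \<integral>\<^sup>+x. ennreal (norm (f x) powr p * (w x * indicator {..real M} (w x))) \<partial>lebesgue)"
    proof (rule nn_integral_monotone_convergence_SUP)
      show "incseq (\<lambda>M x. ennreal (norm (f x) powr p * (w x * indicator {..real M} (w x))))"
        using w_pos by (intro incseq_SucI le_funI ennreal_leI mult_left_mono) (auto simp: indicator_def less_imp_le)
    qed measurable
    also have "\<dots> \<le> ennreal (2 * K) * ?U" by (intro SUP_least main)
    finally show "(\<integral>\<^sup>+x. ennreal (norm (f x) powr p) \<partial>W) \<le> ennreal (2 * K) * ?U" .
  qed
qed

lemma emeasure_S_cbox: "emeasure S (cbox a b) < \<infinity>"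
proof -
  obtain r where r: "\<And>x. x \<in> cbox a b \<Longrightarrow> norm x \<le> r" using bounded_cbox[of a b] unfolding bounded_iff by blast
  obtain k :: nat where k: "2 * \<bar>r\<bar> + 1 \<le> 2 ^ k" using real_arch_pow[of 2 "2 * \<bar>r\<bar> + 1"] by (auto intro: less_imp_le)
  obtain A' where A': "\<And>a s. 0 < s \<Longrightarrow> s \<le> 2 ^ k \<Longrightarrow> Apset A' (cbox a (a + vec s))"
    using Apset_all_scales[OF A, of k] by blast
  define Q where "Q = cbox (vec (- \<bar>r\<bar>)) (vec (- \<bar>r\<bar>) + vec (2 ^ k) :: real^'n)"
  have "cbox a b \<subseteq> Q"
  proof
    fix x assume x: "x \<in> cbox a b"
    have "- \<bar>r\<bar> \<le> x $ c \<and> x $ c \<le> - \<bar>r\<bar> + 2 ^ k" for c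
      using component_le_norm_cart[of x c] r[OF x] k by linarith
    then show "x \<in> Q" unfolding Q_def by (simp add: mem_box_cart)
  qed
  then have "emeasure S (cbox a b) \<le> emeasure S Q" by (intro emeasure_mono) (auto simp: Q_def)
  also have "\<dots> < \<infinity>" unfolding Q_def by (rule ApsetD(5)[OF A']) auto
  finally show ?thesis .
qed

text \<open>Secures the additivity of \<open>ip\<close>: the integral of a nonintegrable function is
  0 by convention, and coefficients of a sum could then not be split.\<close>

lemma weighted_ip_integrable:
  assumes f: "f \<in> borel_measurable lebesgue" and fp: "(\<integral>\<^sup>+x. ennreal (norm (f x) powr p) \<partial>W) < \<infinity>"
    and \<iota>: "\<iota> \<in> wavelet_index J"
  shows "integrable lebesgue (\<lambda>x. f x * cnj (wavelet_family \<phi> \<psi> J \<iota> x))"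
proof -
  define Q where "Q = supp_cube (sc J \<iota>) (ps \<iota>)"
  define e where "e = dilate (mother (ty \<iota>)) (sc J \<iota>) (ps \<iota>)"
  have e[measurable]: "e \<in> borel_measurable lebesgue" unfolding e_def by (rule dilate_meas[OF index_props(2)[OF \<iota>]])
  obtain K where K: "\<And>x. norm (e x) \<le> K" using dilate_bounded[OF index_props(2)[OF \<iota>]] unfolding e_def by blast
  have Q: "Q \<in> sets lebesgue" "emeasure S Q < \<infinity>" unfolding Q_def supp_cube_def using emeasure_S_cbox by auto
  have nf: "(\<lambda>x. norm (f x)) \<in> borel_measurable lebesgue" using f by measurable
  have fi: "integrable lebesgue (\<lambda>x. indicat_real Q x *\<^sub>R norm (f x))"
    using weighted_integrable[OF nf _ fp Q] by (simp add: set_integrable_def)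
  have "integrable lebesgue (\<lambda>x. f x * cnj (e x))"
  proof (rule Bochner_Integration.integrable_bound)
    show "integrable lebesgue (\<lambda>x. K * (indicat_real Q x *\<^sub>R norm (f x)))" using fi by (rule integrable_mult_right)
    show "(\<lambda>x. f x * cnj (e x)) \<in> borel_measurable lebesgue" using f by measurable
    show "AE x in lebesgue. norm (f x * cnj (e x)) \<le> norm (K * (indicat_real Q x *\<^sub>R norm (f x)))"
    proof (rule AE_I2)
      fix x
      have K0: "K \<ge> 0" using K[of x] norm_ge_zero order_trans by blast
      show "norm (f x * cnj (e x)) \<le> norm (K * (indicat_real Q x *\<^sub>R norm (f x)))"
      proof (cases "x \<in> Q")
        case True
        then show ?thesis using K[of x] K0 by (simp add: norm_mult abs_mult mult.commute[of K] mult_left_mono)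
      next
        case False
        then have "e x = 0" unfolding e_def Q_def by (rule dilate_zero[OF index_props(2)[OF \<iota>]])
        then show ?thesis by simp
      qed
    qed
  qed
  then show ?thesis unfolding e_def index_props(3)[OF \<iota>] .
qed

text \<open>The truncations \<open>f1 m\<close> are covered by
  \<open>square_function_lower_nice\<close>. The remainder \<open>f2 m\<close> enters through
  \<open>V (f2 m)\<close>, which the upper bound controls by the modular of \<open>f2 m\<close>.
  Truncation separates supports, so the modulars of the two parts add up to that of
  \<open>f\<close>, and the one of \<open>f2 m\<close> becomes arbitrarily small.\<close>

lemma square_function_lower:
  assumes prof: "profiles J \<eta> D"
  shows "\<exists>C>0. \<forall>f. f \<in> borel_measurable lebesgue \<and> (\<integral>\<^sup>+x. ennreal (norm (f x) powr p) \<partial>W) < \<infinity> \<longrightarrow>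
    (\<integral>\<^sup>+x. ennreal (norm (f x) powr p) \<partial>W) \<le> ennreal C * (\<integral>\<^sup>+x. ennreal_powr (usq \<eta> J f x) (p / 2) \<partial>W)"
proof -
  obtain C1 where C1: "C1 > 0" and up: "\<And>f. f \<in> borel_measurable lebesgue \<Longrightarrow>
    (\<integral>\<^sup>+x. ennreal_powr (usq \<eta> J f x) (p / 2) \<partial>W) \<le> ennreal C1 * (\<integral>\<^sup>+x. ennreal (norm (f x) powr p) \<partial>W)"
    using square_function_upper[OF prof] by blast
  obtain C2 where C2: "C2 > 0" and low: "\<And>f R. f \<in> borel_measurable lebesgue \<and> (\<forall>x. norm (f x) \<le> R) \<and> (\<forall>x. norm x > R \<longrightarrow> f x = 0) \<Longrightarrow>
    (\<integral>\<^sup>+x. ennreal (norm (f x) powr p) \<partial>W) \<le> ennreal C2 * (\<integral>\<^sup>+x. ennreal_powr (usq \<eta> J f x) (p / 2) \<partial>W)"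
    using square_function_lower_nice[OF prof] by blast
  define C3 where "C3 = C2 * 4 powr (p / 2)"
  have C3: "C3 > 0" using C2 by (simp add: C3_def)
  show ?thesis
  proof (intro exI[of _ C3] conjI allI impI C3)
    fix f :: "real^'n \<Rightarrow> complex"
    assume asm: "f \<in> borel_measurable lebesgue \<and> (\<integral>\<^sup>+x. ennreal (norm (f x) powr p) \<partial>W) < \<infinity>"
    then have f[measurable]: "f \<in> borel_measurable lebesgue" and fin: "(\<integral>\<^sup>+x. ennreal (norm (f x) powr p) \<partial>W) < \<infinity>" by auto
    define I where "I h = (\<integral>\<^sup>+x. ennreal (norm (h x) powr p) \<partial>W)" for h :: "real^'n \<Rightarrow> complex"
    define V where "V h = (\<integral>\<^sup>+x. ennreal_powr (usq \<eta> J h x) (p / 2) \<partial>W)" for h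
    define B where "B m = {x. norm (f x) \<le> real m \<and> norm x \<le> real m}" for m :: nat
    define f1 where "f1 m x = indicator (B m) x * f x" for m x
    define f2 where "f2 m x = f x - f1 m x" for m x
    have Bm[measurable]: "B m \<in> sets lebesgue" for m
    proof -
      have "{x\<in>space lebesgue. norm (f x) \<le> real m} \<in> sets lebesgue" by measurable
      moreover have "cball 0 (real m) \<in> sets lebesgue" by simp
      ultimately have "{x\<in>space lebesgue. norm (f x) \<le> real m} \<inter> cball 0 (real m) \<in> sets lebesgue" by (rule sets.Int)
      also have "{x\<in>space lebesgue. norm (f x) \<le> real m} \<inter> cball 0 (real m) = B m" by (auto simp: B_def)
      finally show ?thesis .
    qed
    have f1m[measurable]: "f1 m \<in> borel_measurable lebesgue" for m unfolding f1_def by measurable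
    have f2m[measurable]: "f2 m \<in> borel_measurable lebesgue" for m unfolding f2_def by measurable
    have f1_eq: "f1 m x = (if x \<in> B m then f x else 0)" "f2 m x = (if x \<in> B m then 0 else f x)" for m x
      by (auto simp: f1_def f2_def)
    have split: "I f = I (f1 m) + I (f2 m)" for m
    proof -
      have "I f = (\<integral>\<^sup>+x. ennreal (norm (f1 m x) powr p) + ennreal (norm (f2 m x) powr p) \<partial>W)"
        unfolding I_def by (intro nn_integral_cong) (auto simp: f1_eq)
      also have "\<dots> = I (f1 m) + I (f2 m)" unfolding I_def by (rule nn_integral_add) measurable
      finally show ?thesis .
    qed
    have Ifin: "I f < \<infinity>" "I (f1 m) < \<infinity>" "I (f2 m) < \<infinity>" for m
      using fin split[of m] unfolding I_def[of f, symmetric] by (auto simp: ennreal_add_less_top)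
    have Isup: "I f = (SUP m. I (f1 m))"
    proof -
      have "ennreal (norm (f x) powr p) = (SUP m. ennreal (norm (f1 m x) powr p))" for x
      proof (rule antisym)
        obtain m :: nat where m: "max (norm (f x)) (norm x) \<le> real m" using real_arch_simple by blast
        then have "f1 m x = f x" by (auto simp: f1_eq B_def)
        then show "ennreal (norm (f x) powr p) \<le> (SUP m. ennreal (norm (f1 m x) powr p))"
          by (intro SUP_upper2[of m]) simp_all
        show "(SUP m. ennreal (norm (f1 m x) powr p)) \<le> ennreal (norm (f x) powr p)"
          by (intro SUP_least) (auto simp: f1_eq)
      qed
      then have "I f = (\<integral>\<^sup>+x. (SUP m. ennreal (norm (f1 m x) powr p)) \<partial>W)" unfolding I_def by simp
      also have "\<dots> = (SUP m. \<integral>\<^sup>+x. ennreal (norm (f1 m x) powr p) \<partial>W)"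
      proof (rule nn_integral_monotone_convergence_SUP)
        show "incseq (\<lambda>m x. ennreal (norm (f1 m x) powr p))"
          by (intro incseq_SucI le_funI) (auto simp: f1_eq B_def)
      qed measurable
      finally show ?thesis unfolding I_def .
    qed
    have Vf1: "V (f1 m) \<le> ennreal (4 powr (p / 2)) * (V f + V (f2 m))" for m
    proof -
      have pt: "usq \<eta> J (f1 m) x \<le> 2 * usq \<eta> J f x + 2 * usq \<eta> J (f2 m) x" for x
      proof -
        have "usq \<eta> J (f1 m) x \<le> (\<Sum>\<^sub>\<infinity>\<iota>\<in>wavelet_index J. 2 * ennreal ((norm (ip f (wavelet_family \<phi> \<psi> J \<iota>) * \<eta> \<iota> x))\<^sup>2)
            + 2 * ennreal ((norm (ip (f2 m) (wavelet_family \<phi> \<psi> J \<iota>) * \<eta> \<iota> x))\<^sup>2))"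
          unfolding usq_def
        proof (rule infsum_ennreal_mono)
          fix \<iota> :: "(int^'n) + nat \<times> int \<times> (int^'n)" assume \<iota>: "\<iota> \<in> wavelet_index J"
          let ?e = "wavelet_family \<phi> \<psi> J \<iota>"
          have "ip (f2 m) ?e = ip f ?e - ip (f1 m) ?e"
            unfolding ip_def f2_def left_diff_distrib
          proof (rule Bochner_Integration.integral_diff)
            show "integrable lebesgue (\<lambda>x. f x * cnj (?e x))" by (rule weighted_ip_integrable[OF f fin \<iota>])
            show "integrable lebesgue (\<lambda>x. f1 m x * cnj (?e x))"
              by (rule weighted_ip_integrable[OF f1m _ \<iota>]) (use Ifin(2) in \<open>simp add: I_def\<close>)
          qed
          then have "ip (f1 m) ?e * \<eta> \<iota> x = ip f ?e * \<eta> \<iota> x - ip (f2 m) ?e * \<eta> \<iota> x" by (simp add: left_diff_distrib)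
          then have "(norm (ip (f1 m) ?e * \<eta> \<iota> x))\<^sup>2 \<le> (norm (ip f ?e * \<eta> \<iota> x) + norm (ip (f2 m) ?e * \<eta> \<iota> x))\<^sup>2"
            by (intro power_mono) (simp_all add: norm_triangle_ineq4)
          also have "\<dots> \<le> 2 * (norm (ip f ?e * \<eta> \<iota> x))\<^sup>2 + 2 * (norm (ip (f2 m) ?e * \<eta> \<iota> x))\<^sup>2"
            using sum_squares_bound[of "norm (ip f ?e * \<eta> \<iota> x)" "norm (ip (f2 m) ?e * \<eta> \<iota> x)"]
            unfolding power2_sum by linarith
          finally have "ennreal ((norm (ip (f1 m) ?e * \<eta> \<iota> x))\<^sup>2)
            \<le> ennreal (2 * (norm (ip f ?e * \<eta> \<iota> x))\<^sup>2 + 2 * (norm (ip (f2 m) ?e * \<eta> \<iota> x))\<^sup>2)" by (rule ennreal_leI)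
          also have "\<dots> = 2 * ennreal ((norm (ip f ?e * \<eta> \<iota> x))\<^sup>2) + 2 * ennreal ((norm (ip (f2 m) ?e * \<eta> \<iota> x))\<^sup>2)"
            by (subst ennreal_plus) (auto simp: ennreal_mult ennreal_numeral[symmetric] simp del: ennreal_numeral)
          finally show "ennreal ((norm (ip (f1 m) ?e * \<eta> \<iota> x))\<^sup>2)
            \<le> 2 * ennreal ((norm (ip f ?e * \<eta> \<iota> x))\<^sup>2) + 2 * ennreal ((norm (ip (f2 m) ?e * \<eta> \<iota> x))\<^sup>2)" .
        qed
        also have "\<dots> = 2 * usq \<eta> J f x + 2 * usq \<eta> J (f2 m) x"
          unfolding usq_def infsum_ennreal_add infsum_ennreal_cmult ..
        finally show ?thesis .
      qed
      have [measurable]: "usq \<eta> J f \<in> borel_measurable lebesgue" "usq \<eta> J (f2 m) \<in> borel_measurable lebesgue"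
        using usq_measurable[OF prof] by auto
      have "V (f1 m) \<le> (\<integral>\<^sup>+x. ennreal (4 powr (p / 2)) * (ennreal_powr (usq \<eta> J f x) (p / 2) + ennreal_powr (usq \<eta> J (f2 m) x) (p / 2)) \<partial>W)"
        unfolding V_def
      proof (rule nn_integral_mono)
        fix x
        have two: "ennreal_powr (2 * t) (p / 2) = ennreal (2 powr (p / 2)) * ennreal_powr t (p / 2)" for t
        proof (cases t)
          case (real r)
          then have eq: "2 * t = ennreal (2 * r)" by (simp add: ennreal_mult)
          have "ennreal_powr (2 * t) (p / 2) = ennreal ((2 * r) powr (p / 2))"
            unfolding eq by (rule ennreal_powr_ennreal) (use real in simp)
          also have "\<dots> = ennreal (2 powr (p / 2)) * ennreal (r powr (p / 2))"
            using real by (simp add: powr_mult ennreal_mult)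
          finally show ?thesis using real by (simp add: ennreal_powr_ennreal)
        next
          case top
          then show ?thesis by (simp add: ennreal_powr_def ennreal_mult_top)
        qed
        have "ennreal_powr (usq \<eta> J (f1 m) x) (p / 2) \<le> ennreal_powr (2 * usq \<eta> J f x + 2 * usq \<eta> J (f2 m) x) (p / 2)"
          using pt p1 by (intro ennreal_powr_mono) auto
        also have "\<dots> \<le> ennreal (2 powr (p / 2)) * (ennreal_powr (2 * usq \<eta> J f x) (p / 2) + ennreal_powr (2 * usq \<eta> J (f2 m) x) (p / 2))"
          using p1 by (intro ennreal_powr_add_le) auto
        also have "\<dots> = (ennreal (2 powr (p / 2)) * ennreal (2 powr (p / 2))) * (ennreal_powr (usq \<eta> J f x) (p / 2) + ennreal_powr (usq \<eta> J (f2 m) x) (p / 2))"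
          unfolding two by (simp only: distrib_left mult.assoc)
        also have "ennreal (2 powr (p / 2)) * ennreal (2 powr (p / 2)) = ennreal (4 powr (p / 2))"
          by (simp add: ennreal_mult[symmetric] powr_mult[symmetric])
        finally show "ennreal_powr (usq \<eta> J (f1 m) x) (p / 2)
          \<le> ennreal (4 powr (p / 2)) * (ennreal_powr (usq \<eta> J f x) (p / 2) + ennreal_powr (usq \<eta> J (f2 m) x) (p / 2))" .
      qed
      also have "\<dots> = ennreal (4 powr (p / 2)) * (V f + V (f2 m))"
        unfolding V_def by (subst nn_integral_cmult) (auto simp: nn_integral_add)
      finally show ?thesis .
    qed
    have bound: "I f \<le> ennreal C3 * V f + ennreal (C3 * C1 + 1) * I (f2 m)" for m
    proof -
      have "I (f1 m) \<le> ennreal C2 * V (f1 m)"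
        unfolding I_def V_def by (rule low[of _ "real m"], intro conjI f1m) (auto simp: f1_eq B_def)
      also have "\<dots> \<le> ennreal C2 * (ennreal (4 powr (p / 2)) * (V f + ennreal C1 * I (f2 m)))"
        by (intro mult_left_mono order_trans[OF Vf1] add_left_mono) (auto simp: V_def I_def intro: up)
      also have "\<dots> = ennreal C3 * V f + ennreal (C3 * C1) * I (f2 m)"
        using C1 C2 by (simp add: C3_def ennreal_mult distrib_left mult.assoc)
      finally have "I f \<le> (ennreal C3 * V f + ennreal (C3 * C1) * I (f2 m)) + I (f2 m)"
        unfolding split[of m] by (rule add_right_mono)
      also have "\<dots> = ennreal C3 * V f + ennreal (C3 * C1 + 1) * I (f2 m)"
        using C1 C3 by (simp add: distrib_right add.assoc)
      finally show ?thesis .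
    qed
    have "I f \<le> ennreal C3 * V f"
    proof (rule ennreal_le_epsilon)
      fix \<epsilon> :: real assume \<epsilon>: "\<epsilon> > 0"
      define \<delta> where "\<delta> = \<epsilon> / (C3 * C1 + 1)"
      have c: "C3 * C1 + 1 > 0" using C1 C3 by (intro add_pos_pos) auto
      have \<delta>: "\<delta> > 0" using \<epsilon> c by (simp add: \<delta>_def)
      have "\<exists>m. I f \<le> I (f1 m) + ennreal \<delta>"
      proof (rule ccontr)
        assume "\<not> ?thesis"
        then have "(SUP m. I (f1 m) + ennreal \<delta>) \<le> I f" by (intro SUP_least) (auto simp: not_le less_imp_le)
        then have "I f + ennreal \<delta> \<le> I f" using ennreal_SUP_add_left[of UNIV "\<lambda>m. I (f1 m)" "ennreal \<delta>"] Isup by simp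
        moreover obtain v where "I f = ennreal v" "v \<ge> 0" using Ifin(1) by (metis ennreal_cases infinity_ennreal_def less_irrefl)
        ultimately show False using \<delta> by (simp flip: ennreal_plus)
      qed
      then obtain m where m: "I f \<le> I (f1 m) + ennreal \<delta>" by blast
      have "I (f2 m) \<le> ennreal \<delta>"
      proof -
        have "I (f1 m) + I (f2 m) \<le> I (f1 m) + ennreal \<delta>" using m unfolding split[of m] .
        then show ?thesis using Ifin(2)[of m] by (auto simp: ennreal_add_left_cancel_le)
      qed
      then have "ennreal (C3 * C1 + 1) * I (f2 m) \<le> ennreal (C3 * C1 + 1) * ennreal \<delta>" by (intro mult_left_mono) auto
      also have "\<dots> = ennreal \<epsilon>" using c \<delta> by (simp add: ennreal_mult[symmetric] \<delta>_def)
      finally show "I f \<le> ennreal C3 * V f + ennreal \<epsilon>" using bound[of m] add_left_mono order_trans by blast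
    qed
    then show "(\<integral>\<^sup>+x. ennreal (norm (f x) powr p) \<partial>W) \<le> ennreal C3 * (\<integral>\<^sup>+x. ennreal_powr (usq \<eta> J f x) (p / 2) \<partial>W)"
      unfolding I_def V_def .
  qed
qed

end

section \<open>The square functions of the theorem as instances of profiles\<close>

lemma borel_measurable_infsum_ennreal:
  fixes f :: "'i \<Rightarrow> 'a \<Rightarrow> ennreal"
  assumes "countable I" "\<And>i. i \<in> I \<Longrightarrow> f i \<in> borel_measurable M"
  shows "(\<lambda>x. \<Sum>\<^sub>\<infinity>i\<in>I. f i x) \<in> borel_measurable M"
proof -
  obtain Fk :: "nat \<Rightarrow> 'i set" where Fk: "incseq Fk" "\<And>k. finite (Fk k)" "\<And>k. Fk k \<subseteq> I"
    "\<And>f :: 'i \<Rightarrow> ennreal. infsum f I = (SUP k. sum f (Fk k))"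
    using countable_exhaustion[OF assms(1)] by blast
  have "(\<lambda>x. \<Sum>i\<in>Fk k. f i x) \<in> borel_measurable M" for k
    using Fk(3)[of k] assms(2) by (intro borel_measurable_sum) auto
  then show ?thesis unfolding Fk(4) by (intro borel_measurable_SUP) auto
qed

context wavelets
begin

definition e_fam :: "int \<Rightarrow> (int^'n) + nat \<times> int \<times> (int^'n) \<Rightarrow> real^'n \<Rightarrow> complex" where
  "e_fam J = wavelet_family \<phi> \<psi> J"

text \<open>The scaling functions remain their own profiles, because (X4) combines
  \<open>W\<^sub>2\<close> with the same \<open>V\<close> as (X3).\<close>

definition chi_fam :: "int \<Rightarrow> (int^'n) + nat \<times> int \<times> (int^'n) \<Rightarrow> real^'n \<Rightarrow> complex" where
  "chi_fam J = case_sum (\<lambda>k. dilate \<phi> J k) (\<lambda>(l, j, k). chi_jk j k)"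

lemma dilate_norm_le:
  assumes l: "l \<in> types" and K: "\<And>x. \<bar>mother l x\<bar> \<le> K"
  shows "(norm (dilate (mother l) j k x))\<^sup>2 \<le> K\<^sup>2 * 2 powr (real_of_int j * real CARD('n)) * indicator (supp_cube j k) x"
proof (cases "x \<in> supp_cube j k")
  case True
  have "(norm (dilate (mother l) j k x))\<^sup>2 = (2 powr (real_of_int j * real CARD('n) / 2))\<^sup>2 * \<bar>mother l (2 powi j *\<^sub>R x - (\<chi> m. real_of_int (k $ m)))\<bar>\<^sup>2"
    unfolding dilate_def norm_of_real by (simp add: power_mult_distrib)
  also have "\<dots> \<le> (2 powr (real_of_int j * real CARD('n) / 2))\<^sup>2 * K\<^sup>2"
    using K by (intro mult_left_mono power_mono) auto
  also have "(2 powr (real_of_int j * real CARD('n) / 2))\<^sup>2 = (2::real) powr (real_of_int j * real CARD('n))"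
    by (simp add: powr_power)
  finally show ?thesis using True by (simp add: mult.commute)
next
  case False
  then show ?thesis using dilate_zero[OF l False] by simp
qed

lemma mother_common_bound: "\<exists>K>0. \<forall>l\<in>types. \<forall>x. \<bar>mother l x\<bar> \<le> K"
proof -
  obtain Kl where Kl: "\<And>l x. l \<in> types \<Longrightarrow> \<bar>mother l x\<bar> \<le> Kl l" using mother_bounded by metis
  have fin: "finite types" by (simp add: types_def)
  have "\<bar>mother l x\<bar> \<le> (\<Sum>l\<in>types. \<bar>Kl l\<bar>) + 1" if "l \<in> types" for l x
  proof -
    have "\<bar>Kl l\<bar> \<le> (\<Sum>l\<in>types. \<bar>Kl l\<bar>)" using fin that by (intro member_le_sum) auto
    then show ?thesis using Kl[OF that, of x] by linarith
  qed
  then show ?thesis by (intro exI[of _ "(\<Sum>l\<in>types. \<bar>Kl l\<bar>) + 1"]) (auto intro!: add_nonneg_pos sum_nonneg)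
qed

lemma e_fam_unit:
  assumes "\<iota> \<in> wavelet_index J"
  shows "integrable lebesgue (\<lambda>x. (norm (e_fam J \<iota> x))\<^sup>2)" "(LINT x|lebesgue. (norm (e_fam J \<iota> x))\<^sup>2) = 1"
proof -
  have L2: "e_fam J \<iota> \<in> L2_space" and one: "ip (e_fam J \<iota>) (e_fam J \<iota>) = 1"
    using basis[of J] assms unfolding L2_orthonormal_basis_def e_fam_def by auto
  show "integrable lebesgue (\<lambda>x. (norm (e_fam J \<iota> x))\<^sup>2)" by (rule L2_spaceD(2)[OF L2])
  show "(LINT x|lebesgue. (norm (e_fam J \<iota> x))\<^sup>2) = 1" using one unfolding ip_self by simp
qed

lemma e_fam_profiles: "\<exists>D. profiles J (e_fam J) D"
proof -
  obtain K where K: "K > 0" "\<And>l x. l \<in> types \<Longrightarrow> \<bar>mother l x\<bar> \<le> K" using mother_common_bound by blast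
  have "profiles J (e_fam J) (K\<^sup>2)"
    unfolding profiles_def
  proof (intro conjI ballI allI)
    show "K\<^sup>2 > 0" using K by simp
    fix \<iota> :: "(int^'n) + nat \<times> int \<times> (int^'n)" assume \<iota>: "\<iota> \<in> wavelet_index J"
    note ip = index_props[OF \<iota>]
    show "e_fam J \<iota> \<in> borel_measurable lebesgue" unfolding e_fam_def ip(3) by (rule dilate_meas[OF ip(2)])
    show "(norm (e_fam J \<iota> x))\<^sup>2 \<le> K\<^sup>2 * 2 powr (real_of_int (sc J \<iota>) * real CARD('n)) * indicator (supp_cube (sc J \<iota>) (ps \<iota>)) x" for x
      unfolding e_fam_def ip(3) by (rule dilate_norm_le[OF ip(2) K(2)[OF ip(2)]])
  qed (use e_fam_unit in auto)
  then show ?thesis by blast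
qed

lemma dyadic_cube_eq: "dyadic_cube j k = cbox (vertex j k) (vertex j k + vec (2 powi (- j)))"
  unfolding dyadic_cube_def vertex_def by (rule arg_cong2[where f = cbox]) (auto simp: vec_eq_iff algebra_simps)

text \<open>Rests on \<open>L \<ge> 1\<close>. It lets the indicators in \<open>W\<^sub>2\<close>
  share the size bound of the wavelets.\<close>

lemma dyadic_cube_subset: "dyadic_cube j k \<subseteq> supp_cube j k"
proof
  fix x assume x: "x \<in> dyadic_cube j k"
  have "(2::real) powi (- j) * 1 \<le> 2 powi (- j) * L" using L1 by (intro mult_left_mono) auto
  moreover have "vertex j k $ c \<le> x $ c" "x $ c \<le> vertex j k $ c + 2 powi (- j)" for c
    using x unfolding dyadic_cube_eq by (auto simp: mem_box_cart)
  ultimately have "vertex j k $ c \<le> x $ c \<and> x $ c \<le> vertex j k $ c + 2 powi (- j) * L" for c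
    by (metis add_left_mono mult.right_neutral order_trans)
  then show "x \<in> supp_cube j k" unfolding supp_cube_def by (simp add: mem_box_cart)
qed

lemma chi_norm: "(norm (chi_jk j k x :: complex))\<^sup>2 = 2 powr (real_of_int j * real CARD('n)) * indicator (dyadic_cube j (k :: int^'n)) x"
  unfolding chi_jk_def norm_mult norm_of_real power_mult_distrib
  by (auto simp: powr_power indicator_def)

lemma chi_fam_profiles: "\<exists>D. profiles J (chi_fam J) D"
proof -
  obtain K where K: "K > 0" "\<And>l x. l \<in> types \<Longrightarrow> \<bar>mother l x\<bar> \<le> K" using mother_common_bound by blast
  have "profiles J (chi_fam J) (K\<^sup>2 + 1)"
    unfolding profiles_def
  proof (intro conjI ballI)
    show "K\<^sup>2 + 1 > 0" by (simp add: add_nonneg_pos)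
    fix \<iota> :: "(int^'n) + nat \<times> int \<times> (int^'n)" assume \<iota>: "\<iota> \<in> wavelet_index J"
    have "chi_fam J \<iota> \<in> borel_measurable lebesgue \<and>
     (\<forall>x. (norm (chi_fam J \<iota> x))\<^sup>2 \<le> (K\<^sup>2 + 1) * 2 powr (real_of_int (sc J \<iota>) * real CARD('n)) * indicator (supp_cube (sc J \<iota>) (ps \<iota>)) x) \<and>
     integrable lebesgue (\<lambda>x. (norm (chi_fam J \<iota> x))\<^sup>2) \<and> (LINT x|lebesgue. (norm (chi_fam J \<iota> x))\<^sup>2) = 1"
    proof (cases \<iota>)
      case (Inl k)
      have eq: "chi_fam J \<iota> = e_fam J \<iota>" by (simp add: Inl chi_fam_def e_fam_def wavelet_family_def)
      note ip = index_props[OF \<iota>]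
      have m: "e_fam J \<iota> \<in> borel_measurable lebesgue" unfolding e_fam_def ip(3) by (rule dilate_meas[OF ip(2)])
      have "(norm (e_fam J \<iota> x))\<^sup>2 \<le> (K\<^sup>2 + 1) * 2 powr (real_of_int (sc J \<iota>) * real CARD('n)) * indicator (supp_cube (sc J \<iota>) (ps \<iota>)) x" for x
      proof -
        have "(norm (e_fam J \<iota> x))\<^sup>2 \<le> K\<^sup>2 * 2 powr (real_of_int (sc J \<iota>) * real CARD('n)) * indicator (supp_cube (sc J \<iota>) (ps \<iota>)) x"
          unfolding e_fam_def ip(3) by (rule dilate_norm_le[OF ip(2) K(2)[OF ip(2)]])
        also have "\<dots> \<le> (K\<^sup>2 + 1) * 2 powr (real_of_int (sc J \<iota>) * real CARD('n)) * indicator (supp_cube (sc J \<iota>) (ps \<iota>)) x"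
          by (intro mult_right_mono) auto
        finally show ?thesis .
      qed
      then show ?thesis unfolding eq using m e_fam_unit[OF \<iota>] by blast
    next
      case (Inr z)
      obtain l j k where z: "z = (l, j, k)" by (cases z)
      have eq: "chi_fam J \<iota> = chi_jk j k" "sc J \<iota> = j" "ps \<iota> = k" by (simp_all add: Inr z chi_fam_def sc_def ps_def)
      have dm: "dyadic_cube j k \<in> lmeasurable" unfolding dyadic_cube_def by simp
      have "chi_jk j k \<in> borel_measurable lebesgue"
        unfolding chi_jk_def using dm by (intro borel_measurable_times borel_measurable_const borel_measurable_indicator) auto
      moreover have "(norm (chi_jk j k x :: complex))\<^sup>2 \<le> (K\<^sup>2 + 1) * 2 powr (real_of_int j * real CARD('n)) * indicator (supp_cube j k) x" for x
      proof -
        have "(norm (chi_jk j k x :: complex))\<^sup>2 \<le> 1 * 2 powr (real_of_int j * real CARD('n)) * indicator (supp_cube j k) x"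
          unfolding chi_norm using dyadic_cube_subset[of j k] by (auto simp: indicator_def)
        also have "\<dots> \<le> (K\<^sup>2 + 1) * 2 powr (real_of_int j * real CARD('n)) * indicator (supp_cube j k) x"
          by (intro mult_right_mono) auto
        finally show ?thesis .
      qed
      moreover have "integrable lebesgue (\<lambda>x. (norm (chi_jk j k x :: complex))\<^sup>2)"
        unfolding chi_norm using dm fmeasurableD2[OF dm]
        by (intro integrable_mult_right integrable_real_indicator) (auto simp: less_top simp del: emeasure_completion)
      moreover have "(LINT x|lebesgue. (norm (chi_jk j k x :: complex))\<^sup>2) = 1"
      proof -
        have "(LINT x|lebesgue. (norm (chi_jk j k x :: complex))\<^sup>2) = 2 powr (real_of_int j * real CARD('n)) * measure lebesgue (dyadic_cube j k)"
          unfolding chi_norm by simp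
        also have "measure lebesgue (dyadic_cube j k) = (2 powi (- j)) ^ CARD('n)"
          unfolding dyadic_cube_eq by (rule measure_cube) simp
        also have "(2::real) powi (- j) = 2 powr real_of_int (- j)" by (subst powr_real_of_int') simp_all
        also have "2 powr (real_of_int j * real CARD('n)) * (2 powr real_of_int (- j)) ^ CARD('n) = (1::real)"
          by (simp add: powr_power powr_add[symmetric] mult.commute)
        finally show ?thesis .
      qed
      ultimately show ?thesis unfolding eq by blast
    qed
    then show "chi_fam J \<iota> \<in> borel_measurable lebesgue"
      "\<forall>x. (norm (chi_fam J \<iota> x))\<^sup>2 \<le> (K\<^sup>2 + 1) * 2 powr (real_of_int (sc J \<iota>) * real CARD('n)) * indicator (supp_cube (sc J \<iota>) (ps \<iota>)) x"
      "integrable lebesgue (\<lambda>x. (norm (chi_fam J \<iota> x))\<^sup>2)" "(LINT x|lebesgue. (norm (chi_fam J \<iota> x))\<^sup>2) = 1" by blast+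
  qed
  then show ?thesis by blast
qed

definition Vs :: "int \<Rightarrow> (real^'n \<Rightarrow> complex) \<Rightarrow> real^'n \<Rightarrow> ennreal" where
  "Vs J f x = (\<Sum>\<^sub>\<infinity>k\<in>UNIV. ennreal ((norm (ip f (dilate \<phi> J k) * dilate \<phi> J k x))\<^sup>2))"

definition Ws :: "(nat \<Rightarrow> int \<Rightarrow> int^'n \<Rightarrow> real^'n \<Rightarrow> complex) \<Rightarrow> int \<Rightarrow> (real^'n \<Rightarrow> complex) \<Rightarrow> real^'n \<Rightarrow> ennreal" where
  "Ws h J f x = (\<Sum>l\<in>{1..2 ^ CARD('n) - 1}. \<Sum>\<^sub>\<infinity>j\<in>{J..}. \<Sum>\<^sub>\<infinity>k\<in>UNIV.
     ennreal ((norm (ip f (dilate (\<psi> l) j k) * h l j k x))\<^sup>2))"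

lemma usq_split:
  assumes "\<And>k. \<eta> (Inl k) = dilate \<phi> J k" "\<And>l j k. \<eta> (Inr (l, j, k)) = h l j k"
  shows "usq \<eta> J f x = Vs J f x + Ws h J f x"
proof -
  let ?u = "\<lambda>\<iota>. ennreal ((norm (ip f (wavelet_family \<phi> \<psi> J \<iota>) * \<eta> \<iota> x))\<^sup>2)"
  let ?T = "{1..2 ^ CARD('n) - 1} \<times> {J..} \<times> (UNIV :: (int^'n) set)"
  have "usq \<eta> J f x = infsum ?u (Inl ` UNIV \<union> Inr ` ?T)"
    unfolding usq_def wavelet_index_def Plus_def ..
  also have "\<dots> = infsum ?u (Inl ` UNIV) + infsum ?u (Inr ` ?T)"
    by (intro infsum_Un_disjoint nonneg_summable_on_complete) auto
  also have "infsum ?u (Inl ` UNIV) = Vs J f x"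
    unfolding Vs_def by (subst infsum_reindex) (auto simp: o_def wavelet_family_def assms)
  also have "infsum ?u (Inr ` ?T) = (\<Sum>\<^sub>\<infinity>z\<in>?T. ?u (Inr z))"
    by (subst infsum_reindex) (auto simp: o_def)
  also have "\<dots> = infsum (\<lambda>(l, z). ?u (Inr (l, z))) ?T" by (intro infsum_cong) auto
  also have "\<dots> = (\<Sum>\<^sub>\<infinity>l\<in>{1..2 ^ CARD('n) - 1}. \<Sum>\<^sub>\<infinity>z\<in>{J..} \<times> UNIV. ?u (Inr (l, z)))"
    by (rule infsum_ennreal_Sigma)
  also have "\<dots> = (\<Sum>l\<in>{1..2 ^ CARD('n) - 1}. \<Sum>\<^sub>\<infinity>z\<in>{J..} \<times> UNIV. ?u (Inr (l, z)))" by simp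
  also have "\<dots> = Ws h J f x"
    unfolding Ws_def
  proof (rule sum.cong[OF refl])
    fix l :: nat
    have "(\<Sum>\<^sub>\<infinity>z\<in>{J..} \<times> UNIV. ?u (Inr (l, z))) = infsum (\<lambda>(j, k). ?u (Inr (l, j, k))) ({J..} \<times> UNIV)"
      by (intro infsum_cong) auto
    also have "\<dots> = (\<Sum>\<^sub>\<infinity>j\<in>{J..}. \<Sum>\<^sub>\<infinity>k\<in>UNIV. ?u (Inr (l, j, k)))" by (rule infsum_ennreal_Sigma)
    finally show "(\<Sum>\<^sub>\<infinity>z\<in>{J..} \<times> UNIV. ?u (Inr (l, z))) = (\<Sum>\<^sub>\<infinity>j\<in>{J..}. \<Sum>\<^sub>\<infinity>k\<in>UNIV. ennreal ((norm (ip f (dilate (\<psi> l) j k) * h l j k x))\<^sup>2))"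
      by (simp add: wavelet_family_def assms)
  qed
  finally show ?thesis .
qed

lemma Vs_measurable: "Vs J f \<in> borel_measurable lebesgue"
  unfolding Vs_def[abs_def]
proof (rule borel_measurable_infsum_ennreal[OF countable_int_vec])
  fix k :: "int^'n"
  have [measurable]: "dilate \<phi> J k \<in> borel_measurable lebesgue"
    using dilate_meas[of 0 J k] by (simp add: types_def mother_def)
  show "(\<lambda>x. ennreal ((norm (ip f (dilate \<phi> J k) * dilate \<phi> J k x))\<^sup>2)) \<in> borel_measurable lebesgue" by measurable
qed

lemma Ws_measurable:
  assumes "\<And>l j k. l \<in> {1..2 ^ CARD('n) - 1} \<Longrightarrow> h l j k \<in> borel_measurable lebesgue"
  shows "Ws h J f \<in> borel_measurable lebesgue"
  unfolding Ws_def[abs_def]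
proof (intro borel_measurable_sum borel_measurable_infsum_ennreal countable_int_vec)
  fix l j and k :: "int^'n" assume "l \<in> {1..2 ^ CARD('n) - 1 :: nat}"
  then have [measurable]: "h l j k \<in> borel_measurable lebesgue" by (rule assms)
  show "(\<lambda>x. ennreal ((norm (ip f (dilate (\<psi> l) j k) * h l j k x))\<^sup>2)) \<in> borel_measurable lebesgue" by measurable
qed auto

lemma overlap_finite:
  "\<exists>M::nat. \<forall>j x. finite {k. x \<in> supp_cube j k} \<and> card {k. x \<in> supp_cube j k} \<le> M"
proof -
  define D where "D = {d :: int^'n. \<forall>c. d $ c \<in> {0..\<lceil>L\<rceil>}}"
  have finD: "finite D" unfolding D_def by (rule finite_vec_set) simp
  have "finite {k. x \<in> supp_cube j k} \<and> card {k. x \<in> supp_cube j k} \<le> card D" for j x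
  proof -
    define y where "y c = \<lfloor>2 powi j * x $ c\<rfloor>" for c
    have sub: "{k. x \<in> supp_cube j k} \<subseteq> (\<lambda>d. \<chi> c. y c - d $ c) ` D"
    proof
      fix k assume "k \<in> {k. x \<in> supp_cube j k}"
      then have b: "0 \<le> 2 powi j * x $ c - real_of_int (k $ c)" "2 powi j * x $ c - real_of_int (k $ c) \<le> L" for c
        unfolding mem_Collect_eq mem_supp_cube_iff by (auto simp: mem_box_cart)
      define d :: "int^'n" where "d = (\<chi> c. y c - k $ c)"
      have "0 \<le> d $ c \<and> d $ c \<le> \<lceil>L\<rceil>" for c
        using b[of c] unfolding d_def y_def by simp linarith
      then have "d \<in> D" by (simp add: D_def)
      moreover have "k = (\<chi> c. y c - d $ c)" by (simp add: d_def vec_eq_iff)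
      ultimately show "k \<in> (\<lambda>d. \<chi> c. y c - d $ c) ` D" by blast
    qed
    have "card {k. x \<in> supp_cube j k} \<le> card ((\<lambda>d. (\<chi> c. y c - d $ c) :: int^'n) ` D)"
      using finD sub by (intro card_mono) auto
    also have "\<dots> \<le> card D" by (rule card_image_le[OF finD])
    finally show ?thesis using finite_subset[OF sub] finD by auto
  qed
  then show ?thesis by blast
qed

lemma level_sum_finite:
  assumes "l \<in> {1..2 ^ CARD('n) - 1}"
  shows "(\<Sum>\<^sub>\<infinity>k\<in>UNIV. ip f (dilate (\<psi> l) j k) * dilate (\<psi> l) j k x)
    = (\<Sum>k\<in>{k. x \<in> supp_cube j k}. ip f (dilate (\<psi> l) j k) * dilate (\<psi> l) j k x)"
proof -
  have "finite {k. x \<in> supp_cube j k}" using overlap_finite by blast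
  moreover have "dilate (\<psi> l) j k x = 0" if "x \<notin> supp_cube j k" for k
    using dilate_zero[of l x j k] assms that by (auto simp: types_def mother_def)
  ultimately have "(\<Sum>\<^sub>\<infinity>k\<in>UNIV. ip f (dilate (\<psi> l) j k) * dilate (\<psi> l) j k x)
    = (\<Sum>\<^sub>\<infinity>k\<in>{k. x \<in> supp_cube j k}. ip f (dilate (\<psi> l) j k) * dilate (\<psi> l) j k x)"
    by (intro infsum_cong_neutral) auto
  then show ?thesis using \<open>finite {k. x \<in> supp_cube j k}\<close> by simp
qed

text \<open>The square function is started at level \<open>j\<close> itself, which is possible
  because there is a basis for every starting level. At each point only boundedly many terms of that
  level survive, so Cauchy--Schwarz suffices.\<close>

lemma level_sum_le:
  "\<exists>M>0. \<forall>f x. ennreal ((norm (level_sum \<psi> j f x))\<^sup>2) \<le> ennreal M * usq (e_fam j) j f x"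
proof -
  obtain M where M: "\<And>j x. finite {k. x \<in> supp_cube j k}" "\<And>j x. card {k. x \<in> supp_cube j k} \<le> M"
    using overlap_finite by blast
  let ?n = "2 ^ CARD('n) - 1 :: nat"
  have "ennreal ((norm (level_sum \<psi> j f x))\<^sup>2) \<le> ennreal (real (?n * M) + 1) * usq (e_fam j) j f x" for f x
  proof -
    let ?K = "{k. x \<in> supp_cube j k}"
    define a where "a z = ip f (dilate (\<psi> (fst z)) j (snd z)) * dilate (\<psi> (fst z)) j (snd z) x" for z
    let ?Z = "{1..?n} \<times> ?K"
    have fin: "finite ?Z" using M by auto
    have ls: "level_sum \<psi> j f x = (\<Sum>z\<in>?Z. a z)"
      unfolding level_sum_def a_def using level_sum_finite
      by (simp add: sum.cartesian_product case_prod_unfold)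
    have "(norm (level_sum \<psi> j f x))\<^sup>2 \<le> (\<Sum>z\<in>?Z. norm (a z) * 1)\<^sup>2"
      unfolding ls by (intro power_mono) (auto intro: norm_sum)
    also have "\<dots> \<le> (\<Sum>z\<in>?Z. (norm (a z))\<^sup>2) * (\<Sum>z\<in>?Z. 1\<^sup>2)" by (rule Cauchy_Schwarz_ineq_sum)
    also have "\<dots> \<le> (\<Sum>z\<in>?Z. (norm (a z))\<^sup>2) * (real (?n * M) + 1)"
    proof -
      have "card ?Z \<le> ?n * M" using M(2)[where x=x and j=j] by (simp add: card_cartesian_product)
      then have "real (card ?Z) \<le> real (?n * M)" by (rule of_nat_mono)
      then show ?thesis by (intro mult_left_mono sum_nonneg) (auto simp del: card_cartesian_product)
    qed
    finally have "ennreal ((norm (level_sum \<psi> j f x))\<^sup>2) \<le> ennreal ((real (?n * M) + 1) * (\<Sum>z\<in>?Z. (norm (a z))\<^sup>2))"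
      by (intro ennreal_leI) (simp only: mult.commute)
    also have "\<dots> = ennreal (real (?n * M) + 1) * (\<Sum>z\<in>?Z. ennreal ((norm (a z))\<^sup>2))"
      by (subst ennreal_mult) (auto intro: sum_nonneg)
    also have "\<dots> \<le> ennreal (real (?n * M) + 1) * usq (e_fam j) j f x"
    proof (rule mult_left_mono)
      define G where "G z = (Inr (fst z, j, snd z) :: (int^'n) + nat \<times> int \<times> (int^'n))" for z
      have "(\<Sum>z\<in>?Z. ennreal ((norm (a z))\<^sup>2)) = (\<Sum>\<iota>\<in>G ` ?Z. ennreal ((norm (ip f (wavelet_family \<phi> \<psi> j \<iota>) * e_fam j \<iota> x))\<^sup>2))"
        by (subst sum.reindex) (auto simp: G_def inj_on_def a_def e_fam_def wavelet_family_def)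
      also have "\<dots> \<le> usq (e_fam j) j f x"
        unfolding usq_def by (rule sum_le_infsum_ennreal) (use fin in \<open>auto simp: G_def wavelet_index_def\<close>)
      finally show "(\<Sum>z\<in>?Z. ennreal ((norm (a z))\<^sup>2)) \<le> usq (e_fam j) j f x" .
    qed simp
    finally show ?thesis .
  qed
  then show ?thesis by (intro exI[of _ "real (?n * M) + 1"]) (auto intro!: add_nonneg_pos)
qed

end

text \<open>For a constant exponent the modular is homogeneous, so a finite norm gives the finite
  modular that \<open>square_function_lower\<close> asks for.\<close>

lemma Lp_spaceD_const:
  assumes "f \<in> Lp_space (\<lambda>_. p) w" "p > 0" and w[measurable]: "w \<in> borel_measurable lebesgue"
  shows "f \<in> borel_measurable lebesgue" "modular (\<lambda>_. p) w f < \<infinity>"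
proof -
  show f: "f \<in> borel_measurable lebesgue" using assms by (simp add: Lp_space_def)
  have "Lp_norm (\<lambda>_. p) w f < \<infinity>" using assms by (simp add: Lp_space_def)
  then obtain s where s: "s > 0" and le: "modular (\<lambda>_. p) w (\<lambda>x. f x / of_real s) \<le> 1"
    unfolding Lp_norm_def by (auto simp: Inf_less_iff)
  have pw: "ennreal (norm (f x) powr p) * ennreal (w x) = ennreal (s powr p) * (ennreal (norm (f x / of_real s) powr p) * ennreal (w x))" for x
  proof -
    have "norm (f x) powr p = s powr p * norm (f x / of_real s) powr p"
      using s by (simp add: norm_divide powr_divide)
    then show ?thesis by (simp add: ennreal_mult mult.assoc)
  qed
  note [measurable] = f
  have "modular (\<lambda>_. p) w f = (\<integral>\<^sup>+x. ennreal (s powr p) * (ennreal (norm (f x / of_real s) powr p) * ennreal (w x)) \<partial>lebesgue)"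
    unfolding modular_def by (intro nn_integral_cong pw)
  also have "\<dots> = ennreal (s powr p) * modular (\<lambda>_. p) w (\<lambda>x. f x / of_real s)"
    unfolding modular_def by (rule nn_integral_cmult) measurable
  also have "\<dots> < \<infinity>" using le by (simp add: ennreal_mult_less_top le_less_trans[OF le])
  finally show "modular (\<lambda>_. p) w f < \<infinity>" .
qed

section \<open>The three modular estimates for a constant exponent\<close>

context weighted_wavelets
begin

lemma modular_eq:
  assumes "f \<in> borel_measurable lebesgue"
  shows "modular (\<lambda>_. p) w f = (\<integral>\<^sup>+x. ennreal (norm (f x) powr p) \<partial>W)"
proof -
  have "(\<lambda>x. ennreal (norm (f x) powr p)) \<in> borel_measurable lebesgue" using assms by measurable
  then show ?thesis unfolding modular_def by (subst nn_integral_W) (auto simp: mult.commute)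
qed

lemma emodular_eq:
  assumes "u \<in> borel_measurable lebesgue"
  shows "emodular (\<lambda>_. p) w (\<lambda>x. ennreal_powr (u x) (1/2)) = (\<integral>\<^sup>+x. ennreal_powr (u x) (p / 2) \<partial>W)"
proof -
  have "(\<lambda>x. ennreal_powr (u x) (p / 2)) \<in> borel_measurable lebesgue" using assms by measurable
  then show ?thesis unfolding emodular_def ennreal_powr_powr by (subst nn_integral_W) (auto simp: mult.commute)
qed

text \<open>Each of \<open>V\<close> and \<open>W\<close> is at most the joint square function,
  whose \<open>p\<close>-th power is in turn at most a constant times the sum of theirs; so
  two-sided bounds for \<open>usq\<close> are enough.\<close>

lemma square_function_comparable:
  assumes prof: "profiles J \<eta> D"
    and eq: "\<And>f x. usq \<eta> J f x = Vs J f x + Ws h J f x"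
    and hm: "\<And>l j k. l \<in> {1..2 ^ CARD('n) - 1} \<Longrightarrow> h l j k \<in> borel_measurable lebesgue"
  shows "comparable_on (Lp_space (\<lambda>_. p) w)
    (\<lambda>f. emodular (\<lambda>_. p) w (\<lambda>x. ennreal_powr (Vs J f x) (1/2)) + emodular (\<lambda>_. p) w (\<lambda>x. ennreal_powr (Ws h J f x) (1/2)))
    (modular (\<lambda>_. p) w)"
proof -
  note [measurable] = Vs_measurable Ws_measurable[OF hm]
  have em: "emodular (\<lambda>_. p) w (\<lambda>x. ennreal_powr (Vs J f x) (1/2)) = (\<integral>\<^sup>+x. ennreal_powr (Vs J f x) (p / 2) \<partial>W)"
    "emodular (\<lambda>_. p) w (\<lambda>x. ennreal_powr (Ws h J f x) (1/2)) = (\<integral>\<^sup>+x. ennreal_powr (Ws h J f x) (p / 2) \<partial>W)" for f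
    by (intro emodular_eq Vs_measurable Ws_measurable hm; assumption)+
  have p0: "p / 2 > 0" using p1 by simp
  obtain C1 where C1: "C1 > 0" and up: "\<And>f. f \<in> borel_measurable lebesgue \<Longrightarrow>
    (\<integral>\<^sup>+x. ennreal_powr (usq \<eta> J f x) (p / 2) \<partial>W) \<le> ennreal C1 * (\<integral>\<^sup>+x. ennreal (norm (f x) powr p) \<partial>W)"
    using square_function_upper[OF prof] by blast
  obtain C2 where C2: "C2 > 0" and low: "\<And>f. f \<in> borel_measurable lebesgue \<and> (\<integral>\<^sup>+x. ennreal (norm (f x) powr p) \<partial>W) < \<infinity> \<Longrightarrow>
    (\<integral>\<^sup>+x. ennreal (norm (f x) powr p) \<partial>W) \<le> ennreal C2 * (\<integral>\<^sup>+x. ennreal_powr (usq \<eta> J f x) (p / 2) \<partial>W)"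
    using square_function_lower[OF prof] by blast
  show ?thesis
    unfolding comparable_on_def bounded_by_on_def em
  proof (intro conjI exI ballI)
    show "2 * C1 > 0" "C2 * 2 powr (p / 2) > 0" using C1 C2 by simp_all
    fix f assume f: "f \<in> Lp_space (\<lambda>_. p) w"
    have fm: "f \<in> borel_measurable lebesgue" and fin: "modular (\<lambda>_. p) w f < \<infinity>"
      using Lp_spaceD_const[OF f _ w_meas] p1 by auto
    have "(\<integral>\<^sup>+x. ennreal_powr (Vs J f x) (p / 2) \<partial>W) \<le> (\<integral>\<^sup>+x. ennreal_powr (usq \<eta> J f x) (p / 2) \<partial>W)"
      "(\<integral>\<^sup>+x. ennreal_powr (Ws h J f x) (p / 2) \<partial>W) \<le> (\<integral>\<^sup>+x. ennreal_powr (usq \<eta> J f x) (p / 2) \<partial>W)"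
      unfolding eq by (intro nn_integral_mono ennreal_powr_mono p0; simp)+
    then have "(\<integral>\<^sup>+x. ennreal_powr (Vs J f x) (p / 2) \<partial>W) + (\<integral>\<^sup>+x. ennreal_powr (Ws h J f x) (p / 2) \<partial>W)
      \<le> ennreal C1 * modular (\<lambda>_. p) w f + ennreal C1 * modular (\<lambda>_. p) w f"
      unfolding modular_eq[OF fm] using up[OF fm] by (intro add_mono) (blast intro: order_trans)+
    also have "\<dots> = ennreal (2 * C1) * modular (\<lambda>_. p) w f"
      using C1 by (simp add: distrib_right[symmetric] ennreal_plus[symmetric] del: ennreal_plus)
    finally show "(\<integral>\<^sup>+x. ennreal_powr (Vs J f x) (p / 2) \<partial>W) + (\<integral>\<^sup>+x. ennreal_powr (Ws h J f x) (p / 2) \<partial>W)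
      \<le> ennreal (2 * C1) * modular (\<lambda>_. p) w f" .
    have "modular (\<lambda>_. p) w f \<le> ennreal C2 * (\<integral>\<^sup>+x. ennreal_powr (usq \<eta> J f x) (p / 2) \<partial>W)"
      using low[of f] fm fin unfolding modular_eq[OF fm] by blast
    also have "\<dots> \<le> ennreal C2 * (\<integral>\<^sup>+x. ennreal (2 powr (p / 2)) * (ennreal_powr (Vs J f x) (p / 2) + ennreal_powr (Ws h J f x) (p / 2)) \<partial>W)"
      unfolding eq by (intro mult_left_mono nn_integral_mono ennreal_powr_add_le p0) simp
    also have "(\<integral>\<^sup>+x. ennreal (2 powr (p / 2)) * (ennreal_powr (Vs J f x) (p / 2) + ennreal_powr (Ws h J f x) (p / 2)) \<partial>W)
      = ennreal (2 powr (p / 2)) * ((\<integral>\<^sup>+x. ennreal_powr (Vs J f x) (p / 2) \<partial>W) + (\<integral>\<^sup>+x. ennreal_powr (Ws h J f x) (p / 2) \<partial>W))"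
    proof -
      have [measurable]: "(\<lambda>x. ennreal_powr (Vs J f x) (p / 2)) \<in> borel_measurable W" "(\<lambda>x. ennreal_powr (Ws h J f x) (p / 2)) \<in> borel_measurable W"
        using Vs_measurable Ws_measurable[OF hm] by auto
      show ?thesis by (subst nn_integral_cmult, measurable, subst nn_integral_add) auto
    qed
    finally show "modular (\<lambda>_. p) w f \<le> ennreal (C2 * 2 powr (p / 2))
      * ((\<integral>\<^sup>+x. ennreal_powr (Vs J f x) (p / 2) \<partial>W) + (\<integral>\<^sup>+x. ennreal_powr (Ws h J f x) (p / 2) \<partial>W))"
      using C2 by (simp add: ennreal_mult mult.assoc)
  qed
qed

lemma W1_comparable:
  "comparable_on (Lp_space (\<lambda>_. p) w)
    (\<lambda>f. emodular (\<lambda>_. p) w (sq_V \<phi> J f) + emodular (\<lambda>_. p) w (sq_W1 \<psi> J f)) (modular (\<lambda>_. p) w)"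
proof -
  obtain D where D: "profiles J (e_fam J) D" using e_fam_profiles by blast
  have "usq (e_fam J) J f x = Vs J f x + Ws (\<lambda>l j k. dilate (\<psi> l) j k) J f x" for f x
    by (rule usq_split) (auto simp: e_fam_def wavelet_family_def)
  moreover have "dilate (\<psi> l) j k \<in> borel_measurable lebesgue" if "l \<in> {1..2 ^ CARD('n) - 1}" for l j k
    using dilate_meas[of l j k] that by (auto simp: types_def mother_def)
  ultimately show ?thesis
    using square_function_comparable[OF D, of "\<lambda>l j k. dilate (\<psi> l) j k"]
    unfolding sq_V_def[abs_def] sq_W1_def[abs_def] Vs_def Ws_def by blast
qed

lemma W2_comparable:
  "comparable_on (Lp_space (\<lambda>_. p) w)
    (\<lambda>f. emodular (\<lambda>_. p) w (sq_V \<phi> J f) + emodular (\<lambda>_. p) w (sq_W2 \<psi> J f)) (modular (\<lambda>_. p) w)"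
proof -
  obtain D where D: "profiles J (chi_fam J) D" using chi_fam_profiles by blast
  have "usq (chi_fam J) J f x = Vs J f x + Ws (\<lambda>l j k. chi_jk j k) J f x" for f x
    by (rule usq_split) (auto simp: chi_fam_def)
  moreover have "chi_jk j (k :: int^'n) \<in> borel_measurable lebesgue" for j k
    unfolding chi_jk_def dyadic_cube_def
    by (intro borel_measurable_times borel_measurable_const borel_measurable_indicator) simp
  ultimately show ?thesis
    using square_function_comparable[OF D, of "\<lambda>l j k. chi_jk j k"]
    unfolding sq_V_def[abs_def] sq_W2_def[abs_def] Vs_def Ws_def by blast
qed

lemma level_sum_bounded:
  "bounded_by_on (Lp_space (\<lambda>_. p) w) (\<lambda>f. modular (\<lambda>_. p) w (level_sum \<psi> j f)) (modular (\<lambda>_. p) w)"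
proof -
  obtain M where M: "M > 0" and le: "\<And>f x. ennreal ((norm (level_sum \<psi> j f x))\<^sup>2) \<le> ennreal M * usq (e_fam j) j f x"
    using level_sum_le by blast
  obtain D where D: "profiles j (e_fam j) D" using e_fam_profiles by blast
  obtain C1 where C1: "C1 > 0" and up: "\<And>f. f \<in> borel_measurable lebesgue \<Longrightarrow>
    (\<integral>\<^sup>+x. ennreal_powr (usq (e_fam j) j f x) (p / 2) \<partial>W) \<le> ennreal C1 * (\<integral>\<^sup>+x. ennreal (norm (f x) powr p) \<partial>W)"
    using square_function_upper[OF D] by blast
  show ?thesis
    unfolding bounded_by_on_def
  proof (intro exI conjI ballI)
    show "M powr (p / 2) * C1 > 0" using M C1 by simp
    fix f assume f: "f \<in> Lp_space (\<lambda>_. p) w"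
    have fm: "f \<in> borel_measurable lebesgue" using Lp_spaceD_const[OF f _ w_meas] p1 by auto
    have um[measurable]: "usq (e_fam j) j f \<in> borel_measurable lebesgue" by (rule usq_measurable[OF D])
    have "modular (\<lambda>_. p) w (level_sum \<psi> j f) \<le> (\<integral>\<^sup>+x. ennreal (M powr (p / 2)) * (ennreal (w x) * ennreal_powr (usq (e_fam j) j f x) (p / 2)) \<partial>lebesgue)"
      unfolding modular_def
    proof (rule nn_integral_mono)
      fix x
      have "ennreal (norm (level_sum \<psi> j f x) powr p) = ennreal_powr (ennreal ((norm (level_sum \<psi> j f x))\<^sup>2)) (p / 2)"
        by (simp add: ennreal_powr_ennreal square_powr_half)
      also have "\<dots> \<le> ennreal_powr (ennreal M * usq (e_fam j) j f x) (p / 2)"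
        using p1 by (intro ennreal_powr_mono le) auto
      also have "\<dots> = ennreal (M powr (p / 2)) * ennreal_powr (usq (e_fam j) j f x) (p / 2)"
      proof (cases "usq (e_fam j) j f x")
        case (real r)
        then have eq: "ennreal M * usq (e_fam j) j f x = ennreal (M * r)" using M by (simp add: ennreal_mult)
        have "ennreal_powr (ennreal M * usq (e_fam j) j f x) (p / 2) = ennreal ((M * r) powr (p / 2))"
          unfolding eq by (rule ennreal_powr_ennreal) (use real M in simp)
        also have "\<dots> = ennreal (M powr (p / 2)) * ennreal (r powr (p / 2))"
          using real M by (simp add: powr_mult ennreal_mult)
        finally show ?thesis using real by (simp add: ennreal_powr_ennreal)
      next
        case top
        then show ?thesis using M by (simp add: ennreal_mult_top)
      qed
      finally have "ennreal (norm (level_sum \<psi> j f x) powr p) * ennreal (w x)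
        \<le> (ennreal (M powr (p / 2)) * ennreal_powr (usq (e_fam j) j f x) (p / 2)) * ennreal (w x)" by (rule mult_right_mono) simp
      then show "ennreal (norm (level_sum \<psi> j f x) powr p) * ennreal (w x)
        \<le> ennreal (M powr (p / 2)) * (ennreal (w x) * ennreal_powr (usq (e_fam j) j f x) (p / 2))"
        by (simp only: mult_ac)
    qed
    also have "\<dots> = ennreal (M powr (p / 2)) * (\<integral>\<^sup>+x. ennreal_powr (usq (e_fam j) j f x) (p / 2) \<partial>W)"
      by (subst nn_integral_cmult, measurable, subst nn_integral_W) auto
    also have "\<dots> \<le> ennreal (M powr (p / 2)) * (ennreal C1 * modular (\<lambda>_. p) w f)"
      unfolding modular_eq[OF fm] by (intro mult_left_mono up fm) simp
    finally show "modular (\<lambda>_. p) w (level_sum \<psi> j f) \<le> ennreal (M powr (p / 2) * C1) * modular (\<lambda>_. p) w f"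
      using C1 by (simp add: ennreal_mult mult.assoc)
  qed
qed

end

section \<open>From the norm condition on cubes to Muckenhoupt constants\<close>

lemma Lp_norm_lessE:
  assumes "Lp_norm q v f < ennreal c"
  obtains s where "s > 0" "s < c" "modular q v (\<lambda>x. f x / of_real s) \<le> 1"
  using assms unfolding Lp_norm_def by (auto simp: Inf_less_iff ennreal_less_iff)

lemma modular_indicator:
  assumes "s > 0"
  shows "modular q v (\<lambda>x. indicator Q x / of_real s)
    = (\<integral>\<^sup>+x. ennreal ((1 / s) powr q x) * (ennreal (v x) * indicator Q x) \<partial>lebesgue)"
  unfolding modular_def
proof (rule nn_integral_cong)
  fix x
  show "ennreal (norm (indicator Q x / of_real s :: complex) powr q x) * ennreal (v x)
    = ennreal ((1 / s) powr q x) * (ennreal (v x) * indicator Q x)"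
    using assms by (cases "x \<in> Q") (simp_all add: norm_divide)
qed

text \<open>A vanishing norm would bound the integral of \<open>v\<close> over \<open>Q\<close> by
  every positive number. Positivity matters because 0 times infinity is 0: only with it does a
  finite product of the two norms in \<open>A_loc\<close> make each of them finite.\<close>

lemma Lp_norm_indicator_pos:
  assumes v[measurable]: "v \<in> borel_measurable lebesgue" and v0: "AE x in lebesgue. v x > 0" and q: "AE x in lebesgue. q x \<ge> 1"
    and Q[measurable]: "Q \<in> sets lebesgue" and Qpos: "emeasure lebesgue Q > 0"
  shows "Lp_norm q v (indicator Q) > 0"
proof (rule ccontr)
  assume "\<not> ?thesis"
  then have z: "Lp_norm q v (indicator Q) = 0" by simp
  have small: "(\<integral>\<^sup>+x. ennreal (v x) * indicator Q x \<partial>lebesgue) \<le> ennreal e" if e: "0 < e" "e \<le> 1" for e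
  proof -
    obtain s where s: "s > 0" "s < e" and le: "modular q v (\<lambda>x. indicator Q x / of_real s) \<le> 1"
      using Lp_norm_lessE[of q v "indicator Q" e] z e by auto
    have "ennreal (1 / s) * (\<integral>\<^sup>+x. ennreal (v x) * indicator Q x \<partial>lebesgue)
        = (\<integral>\<^sup>+x. ennreal (1 / s) * (ennreal (v x) * indicator Q x) \<partial>lebesgue)"
      by (rule nn_integral_cmult[symmetric]) measurable
    also have "\<dots> \<le> modular q v (\<lambda>x. indicator Q x / of_real s)"
      unfolding modular_indicator[OF s(1)]
    proof (rule nn_integral_mono_AE, rule eventually_mono[OF q])
      fix x assume "q x \<ge> 1"
      then have "(1 / s) powr 1 \<le> (1 / s) powr q x" using s e by (intro powr_mono) auto
      then have "1 / s \<le> (1 / s) powr q x" using s by simp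
      then show "ennreal (1 / s) * (ennreal (v x) * indicator Q x) \<le> ennreal ((1 / s) powr q x) * (ennreal (v x) * indicator Q x)"
        by (intro mult_right_mono ennreal_leI) auto
    qed
    also have "\<dots> \<le> 1" by (rule le)
    finally have "ennreal s * (ennreal (1 / s) * (\<integral>\<^sup>+x. ennreal (v x) * indicator Q x \<partial>lebesgue)) \<le> ennreal s * 1"
      by (rule mult_left_mono) simp
    moreover have "ennreal s * (ennreal (1 / s) * I) = I" for I
      using s by (simp add: mult.assoc[symmetric] ennreal_mult[symmetric])
    ultimately have "(\<integral>\<^sup>+x. ennreal (v x) * indicator Q x \<partial>lebesgue) \<le> ennreal s" by simp
    also have "\<dots> \<le> ennreal e" using s by (intro ennreal_leI) simp
    finally show ?thesis .
  qed
  have "(\<integral>\<^sup>+x. ennreal (v x) * indicator Q x \<partial>lebesgue) \<le> 0"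
  proof (rule ennreal_le_epsilon)
    fix e :: real assume "e > 0"
    then have "(\<integral>\<^sup>+x. ennreal (v x) * indicator Q x \<partial>lebesgue) \<le> ennreal (min e 1)" by (intro small) auto
    also have "\<dots> \<le> ennreal e" by (intro ennreal_leI) simp
    finally show "(\<integral>\<^sup>+x. ennreal (v x) * indicator Q x \<partial>lebesgue) \<le> 0 + ennreal e" by simp
  qed
  then have z: "(\<integral>\<^sup>+x. ennreal (v x) * indicator Q x \<partial>lebesgue) = 0" by simp
  have "(\<lambda>x. ennreal (v x) * indicator Q x) \<in> borel_measurable lebesgue" by measurable
  then have "AE x in lebesgue. ennreal (v x) * indicator Q x = 0" using z nn_integral_0_iff_AE by blast
  then have "AE x in lebesgue. x \<notin> Q"
    using v0
  proof eventually_elim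
    case (elim x)
    then show ?case by (auto simp: indicator_def ennreal_eq_0_iff split: if_splits)
  qed
  then have "emeasure lebesgue Q = 0" using emeasure_eq_0_AE[of "\<lambda>x. x \<in> Q" lebesgue] by simp
  then show False using Qpos by simp
qed

lemma Lp_norm_indicator_finite:
  assumes v[measurable]: "v \<in> borel_measurable lebesgue" and q: "\<And>x. q x \<le> P" and Q[measurable]: "Q \<in> sets lebesgue"
    and q0: "\<And>x. 0 \<le> q x" and fin: "Lp_norm q v (indicator Q) < \<infinity>"
  shows "(\<integral>\<^sup>+x. ennreal (v x) * indicator Q x \<partial>lebesgue) < \<infinity>"
proof -
  obtain s where s: "s > 0" and le: "modular q v (\<lambda>x. indicator Q x / of_real s) \<le> 1"
    using fin unfolding Lp_norm_def by (auto simp: Inf_less_iff)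
  \<comment> \<open>A common positive lower bound for the powers of \<open>1 / s\<close>, available
    because the exponents are at most \<open>P\<close>.\<close>
  define c where "c = (min (1 / s) 1) powr P"
  have c: "c > 0" using s by (auto simp: c_def min_def)
  have "ennreal c * (\<integral>\<^sup>+x. ennreal (v x) * indicator Q x \<partial>lebesgue) = (\<integral>\<^sup>+x. ennreal c * (ennreal (v x) * indicator Q x) \<partial>lebesgue)"
    by (rule nn_integral_cmult[symmetric]) measurable
  also have "\<dots> \<le> modular q v (\<lambda>x. indicator Q x / of_real s)"
    unfolding modular_indicator[OF s]
  proof (rule nn_integral_mono)
    fix x
    have "c \<le> (min (1 / s) 1) powr q x" unfolding c_def using s q[of x] by (intro powr_mono') auto
    also have "\<dots> \<le> (1 / s) powr q x" using s q0[of x] by (intro powr_mono2) auto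
    finally show "ennreal c * (ennreal (v x) * indicator Q x) \<le> ennreal ((1 / s) powr q x) * (ennreal (v x) * indicator Q x)"
      by (intro mult_right_mono ennreal_leI) auto
  qed
  also have "\<dots> < \<infinity>" using le by (simp add: le_less_trans)
  finally show ?thesis using c by (auto simp: ennreal_mult_less_top)
qed

lemma Lp_norm_indicator_const:
  assumes v[measurable]: "v \<in> borel_measurable lebesgue" and Q[measurable]: "Q \<in> sets lebesgue" and "0 < q"
    and lt: "Lp_norm (\<lambda>_. q) v (indicator Q) < ennreal c"
  shows "(\<integral>\<^sup>+x. ennreal (v x) * indicator Q x \<partial>lebesgue) \<le> ennreal (c powr q)"
proof -
  obtain s where s: "s > 0" "s < c" and le: "modular (\<lambda>_. q) v (\<lambda>x. indicator Q x / of_real s) \<le> 1"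
    using Lp_norm_lessE[OF lt] by blast
  have "ennreal ((1 / s) powr q) * (\<integral>\<^sup>+x. ennreal (v x) * indicator Q x \<partial>lebesgue) \<le> 1"
    using le unfolding modular_indicator[OF s(1)] by (subst nn_integral_cmult[symmetric]) auto
  then have "ennreal (s powr q) * (ennreal ((1 / s) powr q) * (\<integral>\<^sup>+x. ennreal (v x) * indicator Q x \<partial>lebesgue)) \<le> ennreal (s powr q) * 1"
    by (rule mult_left_mono) simp
  moreover have "ennreal (s powr q) * (ennreal ((1 / s) powr q) * I) = I" for I
  proof -
    have "s powr q * (1 / s) powr q = 1" using s by (simp add: powr_mult[symmetric])
    then show ?thesis by (simp add: mult.assoc[symmetric] ennreal_mult[symmetric])
  qed
  ultimately have "(\<integral>\<^sup>+x. ennreal (v x) * indicator Q x \<partial>lebesgue) \<le> ennreal (s powr q)" by simp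
  also have "\<dots> \<le> ennreal (c powr q)" using s assms by (intro ennreal_leI powr_mono2) auto
  finally show ?thesis .
qed

lemma A_loc_product:
  fixes w :: "real^'n \<Rightarrow> real"
  assumes w: "w \<in> A_loc p"
  shows "\<exists>B>0. \<forall>a s. 0 < s \<and> s \<le> 1 \<longrightarrow>
    Lp_norm p w (indicator (cbox a (a + vec s))) * Lp_norm (conj_exponent p) (dual_weight p w) (indicator (cbox a (a + vec s)))
      \<le> ennreal (B * measure lebesgue (cbox a (a + vec s)))"
proof -
  let ?S = "SUP Q \<in> {Q \<in> cubes. measure lebesgue Q \<le> 1}.
        ennreal (1 / measure lebesgue Q) * Lp_norm p w (indicator Q)
          * Lp_norm (conj_exponent p) (dual_weight p w) (indicator (Q :: (real^'n) set))"
  have "?S < \<infinity>" using w by (simp add: A_loc_def)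
  then obtain B where B: "?S = ennreal B" "B \<ge> 0" by (cases ?S) auto
  show ?thesis
  proof (intro exI[of _ "B + 1"] conjI allI impI)
    show "B + 1 > 0" using B by simp
    fix a :: "real^'n" and s :: real assume s: "0 < s \<and> s \<le> 1"
    define Q where "Q = cbox a (a + vec s)"
    have mQ: "measure lebesgue Q = s ^ CARD('n)" unfolding Q_def using s by (intro measure_cube) auto
    have m: "0 < measure lebesgue Q" "measure lebesgue Q \<le> 1" unfolding mQ using s by (auto simp: power_le_one)
    have "Q \<in> {Q \<in> cubes. measure lebesgue Q \<le> 1}" using m s unfolding cubes_def Q_def by auto
    then have "ennreal (1 / measure lebesgue Q) * Lp_norm p w (indicator Q)
          * Lp_norm (conj_exponent p) (dual_weight p w) (indicator Q) \<le> ennreal B"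
      unfolding B(1)[symmetric] by (rule SUP_upper)
    then have "ennreal (measure lebesgue Q) * (ennreal (1 / measure lebesgue Q) * Lp_norm p w (indicator Q)
          * Lp_norm (conj_exponent p) (dual_weight p w) (indicator Q)) \<le> ennreal (measure lebesgue Q) * ennreal B"
      by (rule mult_left_mono) simp
    moreover have "ennreal (measure lebesgue Q) * (ennreal (1 / measure lebesgue Q) * X * Y) = X * Y" for X Y
    proof -
      have "ennreal (measure lebesgue Q) * ennreal (1 / measure lebesgue Q) = 1"
        using m by (simp add: ennreal_mult[symmetric] del: measure_completion)
      then show ?thesis by (metis mult.assoc mult_1)
    qed
    moreover have "ennreal (measure lebesgue Q) * ennreal B \<le> ennreal ((B + 1) * measure lebesgue Q)"
      using m B by (simp add: ennreal_mult[symmetric] mult.commute ennreal_leI mult_right_mono del: measure_completion)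
    ultimately show "Lp_norm p w (indicator Q) * Lp_norm (conj_exponent p) (dual_weight p w) (indicator Q) \<le> ennreal ((B + 1) * measure lebesgue Q)"
      by (simp del: measure_completion)
  qed
qed

lemma dual_weight_measurable[measurable]:
  assumes [measurable]: "p \<in> borel_measurable lebesgue" "w \<in> borel_measurable lebesgue"
  shows "dual_weight p w \<in> borel_measurable lebesgue"
  unfolding dual_weight_def[abs_def] by measurable

lemma cube_emeasure_pos:
  assumes "s > 0"
  shows "emeasure lebesgue (cbox a (a + vec s) :: (real^'n) set) > 0"
proof -
  have "measure lebesgue (cbox a (a + vec s) :: (real^'n) set) > 0" using measure_cube[of s a] assms by simp
  then show ?thesis by (metis enn2real_positive_iff measure_def)
qed

lemma A_loc_norms:
  fixes w :: "real^'n \<Rightarrow> real"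
  assumes w: "w \<in> A_loc p" and pm: "p \<in> borel_measurable lebesgue" and p1: "\<And>x. p x > 1" and s: "0 < s" "s \<le> 1"
  shows "Lp_norm p w (indicator (cbox a (a + vec s))) > 0" "Lp_norm p w (indicator (cbox a (a + vec s))) < \<infinity>"
    "Lp_norm (conj_exponent p) (dual_weight p w) (indicator (cbox a (a + vec s))) > 0"
    "Lp_norm (conj_exponent p) (dual_weight p w) (indicator (cbox a (a + vec s))) < \<infinity>"
proof -
  let ?Q = "cbox a (a + vec s)"
  have wm: "w \<in> borel_measurable lebesgue" and w0: "AE x in lebesgue. w x > 0"
    using w by (auto simp: A_loc_def is_weight_def)
  show 1: "Lp_norm p w (indicator ?Q) > 0"
    using p1 by (intro Lp_norm_indicator_pos wm w0 cube_emeasure_pos s) (auto intro: less_imp_le)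
  have "conj_exponent p x \<ge> 1" for x using p1[of x] by (simp add: conj_exponent_def)
  then show 2: "Lp_norm (conj_exponent p) (dual_weight p w) (indicator ?Q) > 0"
    by (intro Lp_norm_indicator_pos dual_weight_measurable pm wm cube_emeasure_pos s)
      (use w0 in \<open>auto simp: dual_weight_def elim!: eventually_mono\<close>)
  obtain B where "Lp_norm p w (indicator ?Q) * Lp_norm (conj_exponent p) (dual_weight p w) (indicator ?Q) \<le> ennreal (B * measure lebesgue ?Q)"
    using A_loc_product[OF w] s by blast
  then have "Lp_norm p w (indicator ?Q) * Lp_norm (conj_exponent p) (dual_weight p w) (indicator ?Q) < \<infinity>"
    by (simp add: le_less_trans)
  then show "Lp_norm p w (indicator ?Q) < \<infinity>" "Lp_norm (conj_exponent p) (dual_weight p w) (indicator ?Q) < \<infinity>"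
    using 1 2 by (auto simp: ennreal_mult_less_top)
qed

lemma A_loc_const_Apset:
  fixes w w' :: "real^'n \<Rightarrow> real"
  assumes w: "w \<in> A_loc (\<lambda>_. p)" and p1: "p > 1"
    and pw: "pos_weight p w'" and eq: "AE x in lebesgue. w' x = w x"
  shows "\<exists>A. \<forall>a s. 0 < s \<and> s \<le> 1 \<longrightarrow> pos_weight.Apset p w' A (cbox a (a + vec s))"
proof -
  interpret pos_weight p w' by (rule pw)
  have wm[measurable]: "w \<in> borel_measurable lebesgue" and w0: "AE x in lebesgue. w x > 0"
    using w by (auto simp: A_loc_def is_weight_def)
  obtain B where B: "B > 0" and prod: "\<And>a s. 0 < s \<and> s \<le> 1 \<Longrightarrow>
    Lp_norm (\<lambda>_. p) w (indicator (cbox a (a + vec s))) * Lp_norm (conj_exponent (\<lambda>_. p)) (dual_weight (\<lambda>_. p) w) (indicator (cbox a (a + vec s)))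
      \<le> ennreal (B * measure lebesgue (cbox a (a + vec s)))"
    using A_loc_product[OF w] by blast
  have ce: "conj_exponent (\<lambda>_. p) = (\<lambda>_::real^'n. q)" by (rule ext) (simp add: conj_exponent_def q_def)
  have "Apset ((4 * B) powr p) (cbox a (a + vec s))" if s: "0 < s \<and> s \<le> 1" for a s
  proof -
    define Q where "Q = cbox a (a + vec s)"
    have Qm[measurable]: "Q \<in> sets lebesgue" unfolding Q_def by simp
    have mQ: "measure lebesgue Q > 0" unfolding Q_def using measure_cube[of s a] s by simp
    note nn = A_loc_norms[OF w, of s a, folded Q_def]
    have n1: "Lp_norm (\<lambda>_. p) w (indicator Q) > 0" "Lp_norm (\<lambda>_. p) w (indicator Q) < \<infinity>"
      "Lp_norm (\<lambda>_. q) (dual_weight (\<lambda>_. p) w) (indicator Q) > 0" "Lp_norm (\<lambda>_. q) (dual_weight (\<lambda>_. p) w) (indicator Q) < \<infinity>"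
      using nn p1 s unfolding ce by auto
    obtain n1' n2' where n: "Lp_norm (\<lambda>_. p) w (indicator Q) = ennreal n1'" "n1' > 0"
      "Lp_norm (\<lambda>_. q) (dual_weight (\<lambda>_. p) w) (indicator Q) = ennreal n2'" "n2' > 0"
    proof -
      have ex: "\<exists>r>0. X = ennreal r" if "X > 0" "X < \<infinity>" for X :: ennreal using that by (cases X) auto
      show ?thesis using ex[OF n1(1,2)] ex[OF n1(3,4)] that by blast
    qed
    have "ennreal (n1' * n2') \<le> ennreal (B * measure lebesgue Q)"
      using prod[OF s, of a] n unfolding ce Q_def[symmetric] by (simp add: ennreal_mult less_imp_le del: measure_completion)
    then have nB: "n1' * n2' \<le> B * measure lebesgue Q" using B mQ by (subst (asm) ennreal_le_iff) (auto simp del: measure_completion)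
    \<comment> \<open>The factor 2 leaves room above the infimum that defines the norm, as
      \<open>Lp_norm_indicator_const\<close> needs a strict bound. This factor and its counterpart
      for \<open>S\<close> make up the 4 in the constant.\<close>
    have WQ: "emeasure W Q \<le> ennreal ((2 * n1') powr p)"
    proof -
      have "emeasure W Q = (\<integral>\<^sup>+x. ennreal (w x) * indicator Q x \<partial>lebesgue)"
        unfolding measure_eqs(1)[OF Qm] by (rule nn_integral_cong_AE) (use eq in \<open>auto elim!: eventually_mono\<close>)
      also have "\<dots> \<le> ennreal ((2 * n1') powr p)"
        by (rule Lp_norm_indicator_const) (use n p1 in \<open>auto simp: ennreal_less_iff\<close>)
      finally show ?thesis .
    qed
    have SQ: "emeasure S Q \<le> ennreal ((2 * n2') powr q)"
    proof -
      have "emeasure S Q = (\<integral>\<^sup>+x. ennreal (dual_weight (\<lambda>_. p) w x) * indicator Q x \<partial>lebesgue)"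
        unfolding measure_eqs(2)[OF Qm]
        by (rule nn_integral_cong_AE) (use eq in \<open>auto simp: dual_weight_def \<sigma>_def elim!: eventually_mono\<close>)
      also have "\<dots> \<le> ennreal ((2 * n2') powr q)"
        by (rule Lp_norm_indicator_const) (use n q1 in \<open>auto simp: ennreal_less_iff\<close>)
      finally show ?thesis .
    qed
    have mW: "measure W Q \<le> (2 * n1') powr p" and mS: "measure S Q \<le> (2 * n2') powr q"
      unfolding measure_def using WQ SQ by (auto intro!: enn2real_leI)
    have "measure W Q * measure S Q powr (p - 1) \<le> (2 * n1') powr p * ((2 * n2') powr q) powr (p - 1)"
      using mW mS p1 by (intro mult_mono powr_mono2) auto
    also have "\<dots> = (4 * (n1' * n2')) powr p"
      using n qp by (simp add: powr_powr powr_mult[symmetric] mult_ac)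
    also have "\<dots> \<le> (4 * (B * measure lebesgue Q)) powr p"
      using nB n p1 by (intro powr_mono2) auto
    also have "\<dots> = (4 * B) powr p * measure lebesgue Q powr p"
      using B mQ by (simp add: powr_mult mult.assoc[symmetric] del: measure_completion)
    finally show ?thesis
      unfolding Apset_def Q_def[symmetric] using WQ SQ mQ by (auto simp: Q_def intro: le_less_trans)
  qed
  then show ?thesis by blast
qed

section \<open>Modular inequalities force a constant exponent\<close>

lemma ennreal_finiteE:
  assumes "t < (\<infinity> :: ennreal)"
  obtains r where "t = ennreal r" "r \<ge> 0"
  using assms by (cases t) auto

lemma ball_sets_lebesgue[measurable]: "ball (x :: 'a::euclidean_space) r \<in> sets lebesgue"
  by simp

text \<open>Local integrability of \<open>w\<close> is the form in which the Muckenhoupt condition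
  enters the converse: it puts indicators of balls into the space and makes their modulars
  finite.\<close>

locale variable_exponent =
  fixes p w :: "real^'n \<Rightarrow> real" and P :: real
  assumes p_cont: "continuous_on UNIV p" and p_ge1: "\<And>x. p x \<ge> 1" and p_le: "\<And>x. p x \<le> P"
    and w_meas[measurable]: "w \<in> borel_measurable lebesgue" and w_pos: "AE x in lebesgue. w x > 0"
    and w_loc: "\<And>x0 r. (\<integral>\<^sup>+x. ennreal (w x) * indicator (ball x0 r) x \<partial>lebesgue) < \<infinity>"
begin

definition ind :: "real \<Rightarrow> (real^'n) set \<Rightarrow> real^'n \<Rightarrow> complex" where
  "ind t B x = of_real (t * indicator B x)"

lemma ind_in_Lp:
  assumes t: "t > 0"
  shows "ind t (ball x0 r) \<in> Lp_space p w"
proof -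
  obtain W where W: "(\<integral>\<^sup>+x. ennreal (w x) * indicator (ball x0 r) x \<partial>lebesgue) = ennreal W" "W \<ge> 0"
    by (rule ennreal_finiteE[OF w_loc[of x0 r]])
  \<comment> \<open>As all exponents are at least 1 and \<open>t / s\<close> is at most 1, the
    modular is at most \<open>t / s * W\<close>, which this choice brings below 1.\<close>
  define s where "s = t * (1 + W)"
  have s: "s > 0" "s \<ge> t" using t W by (auto simp: s_def algebra_simps intro!: add_pos_nonneg)
  have "modular p w (\<lambda>x. ind t (ball x0 r) x / of_real s) \<le> (\<integral>\<^sup>+x. ennreal (t / s) * (ennreal (w x) * indicator (ball x0 r) x) \<partial>lebesgue)"
    unfolding modular_def
  proof (rule nn_integral_mono)
    fix x
    show "ennreal (norm (ind t (ball x0 r) x / of_real s) powr p x) * ennreal (w x) \<le> ennreal (t / s) * (ennreal (w x) * indicator (ball x0 r) x)"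
    proof (cases "x \<in> ball x0 r")
      case True
      have "(t / s) powr p x \<le> (t / s) powr 1" using s t p_ge1[of x] by (intro powr_mono') auto
      then have "ennreal ((t / s) powr p x) \<le> ennreal (t / s)" using s t by (intro ennreal_leI) simp
      then show ?thesis using True s t by (simp add: ind_def norm_divide mult_right_mono flip: of_real_divide)
    qed (simp add: ind_def)
  qed
  also have "\<dots> = ennreal (t / s) * ennreal W"
    unfolding W(1)[symmetric] by (rule nn_integral_cmult) measurable
  also have "\<dots> \<le> 1"
  proof -
    have "t / s * W \<le> 1" using s t W by (simp add: s_def field_simps)
    then show ?thesis using s t W by (simp add: ennreal_mult[symmetric] ennreal_leI flip: ennreal_1)
  qed
  finally have "Lp_norm p w (ind t (ball x0 r)) \<le> ennreal s"
    unfolding Lp_norm_def using s by (intro Inf_lower) auto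
  then have "Lp_norm p w (ind t (ball x0 r)) < \<infinity>" by (simp add: le_less_trans)
  moreover have "ind t (ball x0 r) \<in> borel_measurable lebesgue" unfolding ind_def[abs_def] by measurable
  ultimately show ?thesis by (simp add: Lp_space_def)
qed

lemma weight_open_pos:
  assumes "open A" "A \<noteq> {}"
  shows "(\<integral>\<^sup>+x. ennreal (w x) * indicator A x \<partial>lebesgue) > 0"
proof (rule ccontr)
  assume "\<not> ?thesis"
  then have z: "(\<integral>\<^sup>+x. ennreal (w x) * indicator A x \<partial>lebesgue) = 0" by (simp add: not_gr_zero)
  have "A \<in> sets lebesgue" using assms(1) by (simp add: lebesgue_openin)
  then have "(\<lambda>x. ennreal (w x) * indicator A x) \<in> borel_measurable lebesgue" by measurable
  then have "AE x in lebesgue. ennreal (w x) * indicator A x = 0" using z nn_integral_0_iff_AE by blast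
  then have "AE x in lebesgue. x \<notin> A"
    using w_pos
  proof eventually_elim
    case (elim x)
    then show ?case by (auto simp: indicator_def ennreal_eq_0_iff split: if_splits)
  qed
  then have "emeasure lebesgue A = 0" using emeasure_eq_0_AE[of "\<lambda>x. x \<in> A" lebesgue] by simp
  then have "negligible A" using assms by (simp add: negligible_iff_null_sets null_sets_def lebesgue_openin)
  then show False using assms open_not_negligible by blast
qed

text \<open>Testing with large or small multiples \<open>t\<close> of an indicator compares the exponents.\<close>

lemma exponent_transfer:
  assumes bnd: "\<And>f. f \<in> Lp_space p w \<Longrightarrow> emodular p w (G f) \<le> ennreal C * modular p w f" and C: "C > 0"
    and A: "open A" "y \<in> A" and c0: "c0 > 0"
    and G: "\<And>t x. t > 0 \<Longrightarrow> x \<in> A \<Longrightarrow> ennreal (t * c0) \<le> G (ind t (ball x0 r)) x"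
    and near: "\<And>x. x \<in> ball x0 r \<Longrightarrow> \<bar>p x - p0\<bar> \<le> \<delta>"
  shows "\<bar>p y - p0\<bar> \<le> \<delta>"
proof (rule ccontr)
  assume "\<not> ?thesis"
  \<comment> \<open>The sign 1 treats an exponent at \<open>y\<close> that is too large, tested with
    \<open>t\<close> tending to infinity; the sign -1 one that is too small, tested with
    \<open>t\<close> tending to 0.\<close>
  then have "1 * p y > 1 * p0 + \<delta> \<or> (-1) * p y > (-1) * p0 + \<delta>" by linarith
  then obtain \<epsilon> :: real where e: "\<epsilon> = 1 \<or> \<epsilon> = -1" "\<epsilon> * p y > \<epsilon> * p0 + \<delta>" by blast
  define \<beta> where "\<beta> = \<epsilon> * p0 + \<delta>"
  obtain \<alpha> where \<alpha>: "\<beta> < \<alpha>" "\<alpha> < \<epsilon> * p y" using e(2) dense unfolding \<beta>_def by blast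
  \<comment> \<open>A neighbourhood of \<open>y\<close> on which the exponent stays beyond the
    intermediate value \<alpha>; the ball keeps its weight finite.\<close>
  define A' where "A' = (A \<inter> {x. \<epsilon> * p x > \<alpha>}) \<inter> ball y 1"
  have "open {x. \<epsilon> * p x > \<alpha>}"
    by (intro open_Collect_less continuous_on_const continuous_on_mult_left p_cont)
  then have A': "open A'" "y \<in> A'" using A \<alpha> by (auto simp: A'_def)
  have [measurable]: "A' \<in> sets lebesgue" using A'(1) by (simp add: lebesgue_openin)
  obtain m where m: "(\<integral>\<^sup>+x. ennreal (w x) * indicator A' x \<partial>lebesgue) = ennreal m" "m > 0"
  proof -
    have "(\<integral>\<^sup>+x. ennreal (w x) * indicator A' x \<partial>lebesgue) \<le> (\<integral>\<^sup>+x. ennreal (w x) * indicator (ball y 1) x \<partial>lebesgue)"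
      by (intro nn_integral_mono) (auto simp: A'_def indicator_def)
    also have "\<dots> < \<infinity>" by (rule w_loc)
    finally obtain m where "(\<integral>\<^sup>+x. ennreal (w x) * indicator A' x \<partial>lebesgue) = ennreal m" "m \<ge> 0"
      by (rule ennreal_finiteE)
    moreover have "(\<integral>\<^sup>+x. ennreal (w x) * indicator A' x \<partial>lebesgue) > 0" using A' by (intro weight_open_pos) auto
    ultimately show ?thesis using that by auto
  qed
  obtain W where W: "(\<integral>\<^sup>+x. ennreal (w x) * indicator (ball x0 r) x \<partial>lebesgue) = ennreal W" "W \<ge> 0"
    by (rule ennreal_finiteE[OF w_loc[of x0 r]])
  \<comment> \<open>A positive lower bound for the powers of \<open>c0\<close>, uniform in the
    exponent whether \<open>c0\<close> is below or above 1.\<close>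
  define c where "c = (min c0 1) powr P"
  have c: "c > 0" using c0 by (simp add: c_def)
  have c_le: "c \<le> c0 powr p x" for x
  proof -
    have P0: "p x \<ge> 0" "p x \<le> P" using p_ge1[of x] p_le[of x] by linarith+
    have "c \<le> (min c0 1) powr p x" unfolding c_def using c0 P0 by (intro powr_mono') auto
    also have "\<dots> \<le> c0 powr p x" using c0 P0 by (intro powr_mono2) auto
    finally show ?thesis .
  qed
  \<comment> \<open>With \<open>t = exp (\<epsilon> * u)\<close> both sides are exponentials in
    \<open>u\<close>, with rate \<alpha> on the left and the smaller rate \<beta> on the right.
    Letting \<open>u\<close> grow gives the contradiction.\<close>
  have ineq: "c * m * exp (u * \<alpha>) \<le> C * W * exp (u * \<beta>)" if u: "u \<ge> 0" for u
  proof -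
    define t where "t = exp (\<epsilon> * u)"
    have t: "t > 0" by (simp add: t_def)
    have tp: "t powr a = exp (u * (\<epsilon> * a))" for a by (simp add: t_def powr_def mult_ac)
    have "ennreal (c * m * exp (u * \<alpha>)) = ennreal (c * exp (u * \<alpha>)) * ennreal m"
      using c m by (simp add: ennreal_mult[symmetric] mult_ac)
    also have "\<dots> = (\<integral>\<^sup>+x. ennreal (c * exp (u * \<alpha>)) * (ennreal (w x) * indicator A' x) \<partial>lebesgue)"
      unfolding m(1)[symmetric] by (rule nn_integral_cmult[symmetric]) measurable
    also have "\<dots> \<le> emodular p w (G (ind t (ball x0 r)))"
      unfolding emodular_def
    proof (rule nn_integral_mono)
      fix x
      show "ennreal (c * exp (u * \<alpha>)) * (ennreal (w x) * indicator A' x) \<le> ennreal_powr (G (ind t (ball x0 r)) x) (p x) * ennreal (w x)"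
      proof (cases "x \<in> A'")
        case True
        then have x: "x \<in> A" "\<epsilon> * p x > \<alpha>" by (auto simp: A'_def)
        have "exp (u * \<alpha>) \<le> exp (u * (\<epsilon> * p x))" using u x by (simp add: mult_left_mono)
        then have "c * exp (u * \<alpha>) \<le> c0 powr p x * t powr p x" unfolding tp using c_le[of x] c by (intro mult_mono) auto
        also have "\<dots> = (t * c0) powr p x" using t c0 by (simp add: powr_mult)
        finally have "ennreal (c * exp (u * \<alpha>)) \<le> ennreal_powr (ennreal (t * c0)) (p x)"
          using t c0 by (simp add: ennreal_powr_ennreal ennreal_leI)
        also have "\<dots> \<le> ennreal_powr (G (ind t (ball x0 r)) x) (p x)"
          using p_ge1[of x] by (intro ennreal_powr_mono G t x) auto
        finally show ?thesis using True by (simp add: mult_right_mono)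
      qed simp
    qed
    also have "\<dots> \<le> ennreal C * modular p w (ind t (ball x0 r))" by (rule bnd[OF ind_in_Lp[OF t]])
    also have "modular p w (ind t (ball x0 r)) \<le> (\<integral>\<^sup>+x. ennreal (exp (u * \<beta>)) * (ennreal (w x) * indicator (ball x0 r) x) \<partial>lebesgue)"
      unfolding modular_def
    proof (rule nn_integral_mono)
      fix x
      show "ennreal (norm (ind t (ball x0 r) x) powr p x) * ennreal (w x) \<le> ennreal (exp (u * \<beta>)) * (ennreal (w x) * indicator (ball x0 r) x)"
      proof (cases "x \<in> ball x0 r")
        case True
        have "\<epsilon> * p x \<le> \<beta>" using near[OF True] e(1) unfolding \<beta>_def by (auto simp: abs_le_iff)
        then have "t powr p x \<le> exp (u * \<beta>)" unfolding tp using u by (simp add: mult_left_mono)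
        then have "ennreal (t powr p x) * ennreal (w x) \<le> ennreal (exp (u * \<beta>)) * ennreal (w x)"
          by (intro mult_right_mono ennreal_leI) auto
        then show ?thesis using True t by (simp add: ind_def)
      qed (simp add: ind_def)
    qed
    also have "\<dots> = ennreal (exp (u * \<beta>)) * ennreal W"
      unfolding W(1)[symmetric] by (rule nn_integral_cmult) measurable
    finally have "ennreal (c * m * exp (u * \<alpha>)) \<le> ennreal C * (ennreal (exp (u * \<beta>)) * ennreal W)"
      by (simp add: mult_left_mono)
    also have "\<dots> = ennreal (C * W * exp (u * \<beta>))" using C W by (simp add: ennreal_mult[symmetric] mult_ac)
    finally show ?thesis using C W by (subst (asm) ennreal_le_iff) auto
  qed
  define D where "D = C * W / (c * m)"
  have "1 + u * (\<alpha> - \<beta>) \<le> D" if u: "u \<ge> 0" for u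
  proof -
    have "1 + u * (\<alpha> - \<beta>) \<le> exp (u * (\<alpha> - \<beta>))" by (rule exp_ge_add_one_self)
    also have "\<dots> \<le> D"
    proof -
      have "c * m * exp (u * \<alpha>) / exp (u * \<beta>) \<le> C * W" using ineq[OF u] by (simp add: pos_divide_le_eq)
      then have "c * m * exp (u * (\<alpha> - \<beta>)) \<le> C * W" by (simp add: right_diff_distrib exp_diff)
      then show ?thesis unfolding D_def using c m by (simp add: pos_le_divide_eq mult.commute)
    qed
    finally show ?thesis .
  qed
  from this[of "(\<bar>D\<bar> + 1) / (\<alpha> - \<beta>)"] show False using \<alpha> by (simp add: divide_nonneg_pos)
qed

text \<open>The approximating point may vary with \<delta>. A finite set of values is closed, so
  approximation to every precision still makes \<open>p0\<close> one of them.\<close>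

lemma finite_exponent_values:
  assumes Y: "finite Y" and near: "\<And>\<delta>. \<delta> > 0 \<Longrightarrow> \<exists>y\<in>Y. \<bar>p y - p0\<bar> \<le> \<delta>"
  shows "p0 \<in> p ` Y"
proof (rule ccontr)
  assume "p0 \<notin> p ` Y"
  moreover have "closed (p ` Y)" using Y by (intro finite_imp_closed) simp
  ultimately obtain \<delta> where \<delta>: "\<delta> > 0" "ball p0 \<delta> \<subseteq> - p ` Y"
    by (metis Compl_iff openE open_Compl)
  obtain y where y: "y \<in> Y" "\<bar>p y - p0\<bar> \<le> \<delta> / 2" using near[of "\<delta> / 2"] \<delta> by auto
  then have "\<bar>p0 - p y\<bar> < \<delta>" using \<delta>(1) by (simp add: abs_minus_commute)
  then have "p y \<in> ball p0 \<delta>" by (simp add: dist_real_def)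
  then show False using \<delta> y by blast
qed

lemma p_near: "\<delta> > 0 \<Longrightarrow> \<exists>r>0. \<forall>x\<in>ball x0 r. \<bar>p x - p x0\<bar> \<le> \<delta>"
proof -
  assume "\<delta> > 0"
  then obtain r where "r > 0" "\<And>x. dist x x0 < r \<Longrightarrow> dist (p x) (p x0) < \<delta>"
    using p_cont unfolding continuous_on_iff by (metis UNIV_I)
  then show ?thesis by (intro exI[of _ r]) (auto simp: dist_real_def dist_commute less_imp_le)
qed

end

text \<open>A function space with finitely many generators is determined by finitely many
  evaluations. When a generator is added and the old points fail, some combination \<open>b\<close>
  vanishes on them but not at a point \<open>x0\<close>, and \<open>b a\<close> is nonzero. Adding
  \<open>x0\<close> is enough: subtracting a multiple of \<open>b\<close> removes the new generator
  from any combination, and evaluation at \<open>x0\<close> shows that the multiple was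
  zero.\<close>

lemma finite_testing_set:
  fixes e :: "'i \<Rightarrow> 'x \<Rightarrow> complex"
  assumes "finite I"
  shows "\<exists>Y. finite Y \<and> (\<forall>c. (\<forall>y\<in>Y. (\<Sum>i\<in>I. c i * e i y) = 0) \<longrightarrow> (\<forall>x. (\<Sum>i\<in>I. c i * e i x) = 0))"
  using assms
proof (induction I rule: finite_induct)
  case (insert a I)
  then obtain Y where Y: "finite Y" and test: "\<And>c. (\<forall>y\<in>Y. (\<Sum>i\<in>I. c i * e i y) = 0) \<Longrightarrow> (\<forall>x. (\<Sum>i\<in>I. c i * e i x) = 0)"
    by blast
  let ?u = "\<lambda>c x. \<Sum>i\<in>insert a I. c i * e i x"
  have u: "?u c x = c a * e a x + (\<Sum>i\<in>I. c i * e i x)" for c x using insert by simp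
  show ?case
  proof (cases "\<forall>c. (\<forall>y\<in>Y. ?u c y = 0) \<longrightarrow> (\<forall>x. ?u c x = 0)")
    case True
    then show ?thesis using Y by blast
  next
    case False
    then obtain b x0 where b: "\<forall>y\<in>Y. ?u b y = 0" "?u b x0 \<noteq> 0" by blast
    have ba: "b a \<noteq> 0"
    proof
      assume "b a = 0"
      then have "\<forall>y\<in>Y. (\<Sum>i\<in>I. b i * e i y) = 0" using b(1) unfolding u by simp
      then have "(\<Sum>i\<in>I. b i * e i x0) = 0" using test by blast
      then show False using b(2) \<open>b a = 0\<close> unfolding u by simp
    qed
    have "\<forall>x. ?u c x = 0" if c: "\<forall>y\<in>insert x0 Y. ?u c y = 0" for c
    proof -
      define d where "d i = c i - c a / b a * b i" for i
      have da: "d a = 0" using ba by (simp add: d_def)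
      have ud: "(\<Sum>i\<in>I. d i * e i x) = ?u c x - c a / b a * ?u b x" for x
      proof -
        have "(\<Sum>i\<in>I. d i * e i x) = ?u d x" unfolding u using da by simp
        also have "\<dots> = ?u c x - c a / b a * ?u b x"
          unfolding d_def by (simp only: left_diff_distrib sum_subtractf sum_distrib_left mult.assoc)
        finally show ?thesis .
      qed
      have "\<forall>y\<in>Y. (\<Sum>i\<in>I. d i * e i y) = 0" unfolding ud using c b(1) by simp
      then have z: "(\<Sum>i\<in>I. d i * e i x) = 0" for x using test by blast
      have "c a / b a * ?u b x0 = 0" using z[of x0] c unfolding ud by simp
      then have "c a = 0" using b(2) ba by simp
      then show ?thesis using z unfolding ud by simp
    qed
    then show ?thesis using Y by (intro exI[of _ "insert x0 Y"]) blast
  qed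
qed (simp add: exI[of _ "{}"])

section \<open>Wavelet estimates tested on indicators of balls\<close>

locale wavelet_exponent = wavelets \<phi> \<psi> N + variable_exponent p w P
  for \<phi> :: "real^'n \<Rightarrow> real" and \<psi> N p and w :: "real^'n \<Rightarrow> real" and P
begin

lemma one_type: "Suc 0 \<in> {1..2 ^ CARD('n) - 1 :: nat}" "Suc 0 \<in> types" "mother (Suc 0) = \<psi> (Suc 0)"
proof -
  have "(2::nat) ^ 1 \<le> 2 ^ CARD('n)" by (rule power_increasing) (auto simp: Suc_le_eq)
  then show "Suc 0 \<in> {1..2 ^ CARD('n) - 1 :: nat}" "Suc 0 \<in> types" by (auto simp: types_def)
qed (simp add: mother_def)

abbreviation psi1 :: "int \<Rightarrow> int^'n \<Rightarrow> real^'n \<Rightarrow> complex" where "psi1 j k \<equiv> dilate (\<psi> (Suc 0)) j k"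

text \<open>The support of the wavelet is a full cube, so the points where it does not vanish are
  dense there, and continuity of \<open>p\<close> extends to the cube what is proved at those
  points.\<close>

lemma supp_cube_subset_closure: "supp_cube j k \<subseteq> closure {x. psi1 j k x \<noteq> 0}"
proof
  fix x assume x: "x \<in> supp_cube j k"
  define v :: "real^'n" where "v = (\<chi> m. real_of_int (k $ m))"
  have "2 powi j *\<^sub>R x - v \<in> closure (support_on UNIV (\<psi> (Suc 0)))"
    using x mother_supp[OF one_type(2)] unfolding mem_supp_cube_iff one_type(3) v_def by simp
  then have *: "\<exists>z. \<psi> (Suc 0) z \<noteq> 0 \<and> dist z (2 powi j *\<^sub>R x - v) < d" if "d > 0" for d
    using that unfolding closure_approachable by (auto simp: support_on_def)
  show "x \<in> closure {x. psi1 j k x \<noteq> 0}"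
    unfolding closure_approachable
  proof (intro allI impI)
    fix d :: real assume d: "d > 0"
    obtain z where z: "\<psi> (Suc 0) z \<noteq> 0" "dist z (2 powi j *\<^sub>R x - v) < 2 powi j * d"
      using *[of "2 powi j * d"] d by auto
    define y where "y = (2 powi (- j)) *\<^sub>R (z + v)"
    have yz: "2 powi j *\<^sub>R y - v = z" by (simp add: y_def power_int_minus)
    have "dist z (2 powi j *\<^sub>R x - v) = 2 powi j * dist y x"
      unfolding yz[symmetric] dist_norm by (simp flip: scaleR_diff_right)
    then have "dist y x < d" using z(2) by simp
    moreover have "psi1 j k y \<noteq> 0" unfolding dilate_def using yz z(1) by (simp add: v_def)
    ultimately show "\<exists>y\<in>{x. psi1 j k x \<noteq> 0}. dist y x < d" by blast
  qed
qed

lemma supp_cubes_cover: "\<exists>k. x \<in> supp_cube j k"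
proof -
  define k :: "int^'n" where "k = (\<chi> m. \<lfloor>2 powi j * x $ m\<rfloor>)"
  have "0 \<le> 2 powi j * x $ m - real_of_int (k $ m) \<and> 2 powi j * x $ m - real_of_int (k $ m) \<le> L" for m
    using L1 unfolding k_def by simp linarith
  then have "x \<in> supp_cube j k" unfolding mem_supp_cube_iff by (simp add: mem_box_cart)
  then show ?thesis by blast
qed

lemma exponent_constant:
  assumes Y: "\<And>k. finite (Y k)" and val: "\<And>k x. psi1 j k x \<noteq> 0 \<Longrightarrow> p x \<in> p ` Y k"
  shows "p constant_on UNIV"
proof -
  have sub: "p ` supp_cube j k \<subseteq> p ` Y k" for k
  proof -
    have "p ` supp_cube j k \<subseteq> p ` closure {x. psi1 j k x \<noteq> 0}" by (intro image_mono supp_cube_subset_closure)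
    also have "\<dots> \<subseteq> closure (p ` {x. psi1 j k x \<noteq> 0})"
      by (rule continuous_image_closure_subset[OF p_cont]) simp
    also have "\<dots> \<subseteq> p ` Y k"
      using val Y by (intro closure_minimal finite_imp_closed) auto
    finally show ?thesis .
  qed
  have "range p \<subseteq> (\<Union>k. p ` Y k)"
  proof
    fix v assume "v \<in> range p"
    then obtain x where x: "v = p x" by blast
    obtain k where "x \<in> supp_cube j k" using supp_cubes_cover by blast
    then show "v \<in> (\<Union>k. p ` Y k)" using sub[of k] x by blast
  qed
  moreover have "countable (\<Union>k. p ` Y k)"
    by (intro countable_UN countable_int_vec) (use Y in \<open>auto intro: countable_finite\<close>)
  ultimately have cnt: "countable (range p)" by (rule countable_subset)
  have "connected (range p)" using p_cont by (intro connected_continuous_image) auto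
  then have "p x = p y" for x y
    using connected_uncountable[of "range p" "p x" "p y"] cnt by auto
  then show ?thesis unfolding constant_on_def by blast
qed

lemma ip_ind: "ip (ind t B) g = of_real t * ip (ind 1 B) g"
proof -
  have "ip (ind t B) g = (LINT x|lebesgue. of_real t * (ind 1 B x * cnj (g x)))"
    unfolding ip_def ind_def by (simp add: mult.assoc)
  then show ?thesis unfolding ip_def by simp
qed

text \<open>The wavelet is real and continuous: near \<open>x0\<close> it keeps its sign and at
  least half its modulus, so its integral over a small ball cannot vanish.\<close>

lemma ball_coefficient_nonzero:
  assumes "psi1 j k x0 \<noteq> 0"
  shows "\<exists>r0>0. \<forall>r. 0 < r \<and> r \<le> r0 \<longrightarrow> ip (ind 1 (ball x0 r)) (psi1 j k) \<noteq> 0"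
proof -
  define g where "g x = 2 powr (real_of_int j * real CARD('n) / 2) * \<psi> (Suc 0) (2 powi j *\<^sub>R x - (\<chi> m. real_of_int (k $ m)))" for x
  have pg: "psi1 j k x = of_real (g x)" for x by (simp add: dilate_def g_def)
  have gc: "continuous_on UNIV g"
  proof -
    have "continuous_on UNIV (\<lambda>x. Re (psi1 j k x))" using dilate_cont[OF one_type(2)] unfolding one_type(3) by (intro continuous_intros)
    then show ?thesis by (simp add: pg)
  qed
  have g0: "g x0 \<noteq> 0" using assms by (simp add: pg)
  then obtain r0 where r0: "r0 > 0" "\<And>x. dist x x0 < r0 \<Longrightarrow> dist (g x) (g x0) < \<bar>g x0\<bar> / 2"
    using gc unfolding continuous_on_iff by (metis UNIV_I half_gt_zero zero_less_abs_iff)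
  have "ip (ind 1 (ball x0 r)) (psi1 j k) \<noteq> 0" if r: "0 < r" "r \<le> r0" for r
  proof -
    let ?B = "ball x0 r"
    have Bm: "measure lebesgue ?B > 0" using r by (simp add: content_ball_pos)
    have Bi: "integrable lebesgue (indicat_real ?B)"
      using fmeasurableD2[OF lmeasurable_ball, of x0 r]
      by (intro integrable_real_indicator) (auto simp: less_top simp del: emeasure_completion)
    have gi: "integrable lebesgue (\<lambda>x. indicat_real ?B x * g x)"
    proof (rule Bochner_Integration.integrable_bound)
      show "integrable lebesgue (\<lambda>x. (2 * \<bar>g x0\<bar>) * indicat_real ?B x)" using Bi by simp
      show "(\<lambda>x. indicat_real ?B x * g x) \<in> borel_measurable lebesgue"
      proof (intro borel_measurable_times borel_measurable_indicator)
        show "g \<in> borel_measurable lebesgue"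
          by (rule measurable_completion) (use borel_measurable_continuous_onI[OF gc] in simp)
      qed simp
      show "AE x in lebesgue. norm (indicat_real ?B x * g x) \<le> norm ((2 * \<bar>g x0\<bar>) * indicat_real ?B x)"
      proof (rule AE_I2)
        fix x
        show "norm (indicat_real ?B x * g x) \<le> norm ((2 * \<bar>g x0\<bar>) * indicat_real ?B x)"
        proof (cases "x \<in> ?B")
          case True
          then have "\<bar>g x - g x0\<bar> < \<bar>g x0\<bar> / 2" using r0(2)[of x] r by (simp add: dist_real_def dist_commute)
          then have "\<bar>g x\<bar> \<le> 2 * \<bar>g x0\<bar>" by linarith
          then show ?thesis using True by simp
        qed simp
      qed
    qed
    have sg: "(LINT x|lebesgue. sgn (g x0) * (indicat_real ?B x * g x)) \<ge> (LINT x|lebesgue. (\<bar>g x0\<bar> / 2) * indicat_real ?B x)"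
    proof (rule integral_mono)
      show "integrable lebesgue (\<lambda>x. (\<bar>g x0\<bar> / 2) * indicat_real ?B x)" using Bi by simp
      show "integrable lebesgue (\<lambda>x. sgn (g x0) * (indicat_real ?B x * g x))" using gi by simp
      fix x
      show "(\<bar>g x0\<bar> / 2) * indicat_real ?B x \<le> sgn (g x0) * (indicat_real ?B x * g x)"
      proof (cases "x \<in> ?B")
        case True
        then have d: "\<bar>g x - g x0\<bar> < \<bar>g x0\<bar> / 2" using r0(2)[of x] r by (simp add: dist_real_def dist_commute)
        have "\<bar>g x0\<bar> / 2 \<le> sgn (g x0) * g x"
        proof (cases "g x0 > 0")
          case True
          then have "g x0 / 2 \<le> g x" using d by linarith
          then show ?thesis using True by simp
        next
          case False
          then have "g x0 < 0" using g0 by simp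
          moreover from this have "g x \<le> g x0 / 2" using d by linarith
          ultimately show ?thesis by simp
        qed
        then show ?thesis using True by simp
      qed simp
    qed
    have "(\<bar>g x0\<bar> / 2) * measure lebesgue ?B > 0" using g0 Bm by simp
    then have "(LINT x|lebesgue. sgn (g x0) * (indicat_real ?B x * g x)) > 0" using sg by simp
    then have "(LINT x|lebesgue. indicat_real ?B x * g x) \<noteq> 0" by auto
    moreover have "ip (ind 1 ?B) (psi1 j k) = of_real (LINT x|lebesgue. indicat_real ?B x * g x)"
      unfolding ip_def ind_def pg by (simp flip: integral_complex_of_real)
    ultimately show ?thesis by simp
  qed
  then show ?thesis using r0(1) by blast
qed

text \<open>A square function dominates each of its terms, so nothing cancels. A single point
  \<open>y k\<close>, inside an open set where the profile \<open>h k\<close> is bounded below,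
  therefore gives \<open>p x0 = p (y k)\<close> for every \<open>x0\<close> at which the wavelet is
  nonzero.\<close>

lemma square_function_exponent_constant:
  assumes bnd: "\<And>f. f \<in> Lp_space p w \<Longrightarrow> emodular p w (G f) \<le> ennreal C * modular p w f" and C: "C > 0"
    and G: "\<And>f x k. ennreal (norm (ip f (psi1 j k)) * h k x) \<le> G f x"
    and h: "\<And>k. \<exists>A y c. open A \<and> y \<in> A \<and> c > 0 \<and> (\<forall>x\<in>A. h k x \<ge> c)"
  shows "p constant_on UNIV"
proof -
  define y where "y k = (SOME y. \<exists>A c. open A \<and> y \<in> A \<and> c > 0 \<and> (\<forall>x\<in>A. h k x \<ge> c))" for k
  have y: "\<exists>A c. open A \<and> y k \<in> A \<and> c > 0 \<and> (\<forall>x\<in>A. h k x \<ge> c)" for k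
    unfolding y_def using h[of k] by (intro someI_ex[of "\<lambda>y. \<exists>A c. open A \<and> y \<in> A \<and> c > 0 \<and> (\<forall>x\<in>A. h k x \<ge> c)"]) blast
  show ?thesis
  proof (rule exponent_constant[of "\<lambda>k. {y k}"])
    fix k x0 assume nz: "psi1 j k x0 \<noteq> 0"
    show "p x0 \<in> p ` {y k}"
    proof (rule finite_exponent_values)
      fix \<delta> :: real assume "\<delta> > 0"
      obtain A c where A: "open A" "y k \<in> A" "c > 0" "\<And>x. x \<in> A \<Longrightarrow> h k x \<ge> c" using y[of k] by blast
      obtain r1 where r1: "r1 > 0" "\<And>x. x\<in>ball x0 r1 \<Longrightarrow> \<bar>p x - p x0\<bar> \<le> \<delta>" using p_near[OF \<open>\<delta> > 0\<close>] by blast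
      obtain r2 where r2: "r2 > 0" "\<And>r. 0 < r \<and> r \<le> r2 \<Longrightarrow> ip (ind 1 (ball x0 r)) (psi1 j k) \<noteq> 0"
        using ball_coefficient_nonzero[OF nz] by blast
      define r where "r = min r1 r2"
      define a where "a = norm (ip (ind 1 (ball x0 r)) (psi1 j k))"
      have r: "0 < r" "r \<le> r1" "r \<le> r2" using r1 r2 by (auto simp: r_def)
      have a: "a > 0" using r2(2)[of r] r by (simp add: a_def)
      have "\<bar>p (y k) - p x0\<bar> \<le> \<delta>"
      proof (rule exponent_transfer[OF bnd C A(1,2), of "a * c"])
        show "a * c > 0" using a A by simp
        show "\<bar>p x - p x0\<bar> \<le> \<delta>" if "x \<in> ball x0 r" for x using r1(2)[of x] that r by simp
        fix t :: real and x assume t: "t > 0" and x: "x \<in> A"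
        have "t * (a * c) \<le> norm (ip (ind t (ball x0 r)) (psi1 j k)) * h k x"
          unfolding ip_ind[of t] norm_mult using t a A(3) A(4)[OF x] by (simp add: a_def mult.assoc mult_left_mono)
        then show "ennreal (t * (a * c)) \<le> G (ind t (ball x0 r)) x"
          using G[of "ind t (ball x0 r)" k x] by (meson ennreal_leI order_trans)
      qed
      then show "\<exists>z\<in>{y k}. \<bar>p z - p x0\<bar> \<le> \<delta>" by simp
    qed simp
  qed simp
qed

lemma W1_exponent_constant:
  assumes bnd: "\<And>f. f \<in> Lp_space p w \<Longrightarrow> emodular p w (sq_W1 \<psi> J f) \<le> ennreal C * modular p w f" and C: "C > 0"
  shows "p constant_on UNIV"
proof (rule square_function_exponent_constant[OF bnd C, of J "\<lambda>k x. norm (psi1 J k x)"])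
  fix f :: "real^'n \<Rightarrow> complex" and x :: "real^'n" and k :: "int^'n"
  let ?T = "\<lambda>l j. \<Sum>\<^sub>\<infinity>k\<in>UNIV. ennreal ((norm (ip f (dilate (\<psi> l) j k) * dilate (\<psi> l) j k x))\<^sup>2)"
  have "ennreal ((norm (ip f (psi1 J k) * psi1 J k x))\<^sup>2) \<le> ?T (Suc 0) J"
    using sum_le_infsum_ennreal[of "{k}" UNIV "\<lambda>k. ennreal ((norm (ip f (psi1 J k) * psi1 J k x))\<^sup>2)"] by simp
  also have "\<dots> \<le> (\<Sum>\<^sub>\<infinity>j\<in>{J..}. ?T (Suc 0) j)"
    using sum_le_infsum_ennreal[of "{J}" "{J..}" "?T (Suc 0)"] by simp
  also have "\<dots> \<le> (\<Sum>l\<in>{1..2 ^ CARD('n) - 1}. \<Sum>\<^sub>\<infinity>j\<in>{J..}. ?T l j)"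
    using one_type(1) by (intro member_le_sum[of "Suc 0" _ "\<lambda>l. \<Sum>\<^sub>\<infinity>j\<in>{J..}. ?T l j"]) auto
  finally have "ennreal_powr (ennreal ((norm (ip f (psi1 J k) * psi1 J k x))\<^sup>2)) (1/2) \<le> sq_W1 \<psi> J f x"
    unfolding sq_W1_def by (intro ennreal_powr_mono) auto
  then show "ennreal (norm (ip f (psi1 J k)) * norm (psi1 J k x)) \<le> sq_W1 \<psi> J f x"
    by (simp add: ennreal_powr_ennreal square_powr_half norm_mult)
next
  fix k
  obtain z where z: "psi1 J k z \<noteq> 0"
  proof -
    have "vertex J k \<in> supp_cube J k" unfolding supp_cube_def using L1 by (auto simp: mem_box_cart)
    then have "vertex J k \<in> closure {x. psi1 J k x \<noteq> 0}" using supp_cube_subset_closure[of J k] by blast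
    then have "{x. psi1 J k x \<noteq> 0} \<noteq> {}" using closure_empty by force
    then show ?thesis using that by blast
  qed
  have "open {x. norm (psi1 J k z) / 2 < norm (psi1 J k x)}"
    using dilate_cont[OF one_type(2)] unfolding one_type(3) by (intro open_Collect_less continuous_intros)
  then show "\<exists>A y c. open A \<and> y \<in> A \<and> c > 0 \<and> (\<forall>x\<in>A. norm (psi1 J k x) \<ge> c)"
    using z by (intro exI[of _ "{x. norm (psi1 J k z) / 2 < norm (psi1 J k x)}"] exI[of _ z] exI[of _ "norm (psi1 J k z) / 2"]) auto
qed

lemma W2_exponent_constant:
  assumes bnd: "\<And>f. f \<in> Lp_space p w \<Longrightarrow> emodular p w (sq_W2 \<psi> J f) \<le> ennreal C * modular p w f" and C: "C > 0"
  shows "p constant_on UNIV"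
proof (rule square_function_exponent_constant[OF bnd C, of J "\<lambda>k x. norm (chi_jk J k x)"])
  fix f :: "real^'n \<Rightarrow> complex" and x :: "real^'n" and k :: "int^'n"
  let ?T = "\<lambda>l j. \<Sum>\<^sub>\<infinity>k\<in>UNIV. ennreal ((norm (ip f (dilate (\<psi> l) j k) * chi_jk j k x))\<^sup>2)"
  have "ennreal ((norm (ip f (psi1 J k) * chi_jk J k x))\<^sup>2) \<le> ?T (Suc 0) J"
    using sum_le_infsum_ennreal[of "{k}" UNIV "\<lambda>k. ennreal ((norm (ip f (psi1 J k) * chi_jk J k x))\<^sup>2)"] by simp
  also have "\<dots> \<le> (\<Sum>\<^sub>\<infinity>j\<in>{J..}. ?T (Suc 0) j)"
    using sum_le_infsum_ennreal[of "{J}" "{J..}" "?T (Suc 0)"] by simp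
  also have "\<dots> \<le> (\<Sum>l\<in>{1..2 ^ CARD('n) - 1}. \<Sum>\<^sub>\<infinity>j\<in>{J..}. ?T l j)"
    using one_type(1) by (intro member_le_sum[of "Suc 0" _ "\<lambda>l. \<Sum>\<^sub>\<infinity>j\<in>{J..}. ?T l j"]) auto
  finally have "ennreal_powr (ennreal ((norm (ip f (psi1 J k) * chi_jk J k x))\<^sup>2)) (1/2) \<le> sq_W2 \<psi> J f x"
    unfolding sq_W2_def by (intro ennreal_powr_mono) auto
  then show "ennreal (norm (ip f (psi1 J k)) * norm (chi_jk J k x)) \<le> sq_W2 \<psi> J f x"
    by (simp add: ennreal_powr_ennreal square_powr_half norm_mult)
next
  fix k :: "int^'n"
  let ?a = "(\<chi> m. 2 powi (- J) * real_of_int (k $ m)) :: real^'n"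
  let ?b = "(\<chi> m. 2 powi (- J) * (real_of_int (k $ m) + 1)) :: real^'n"
  have "box ?a ?b \<noteq> {}" by (simp add: interval_ne_empty_cart(2))
  then obtain z where z: "z \<in> box ?a ?b" by blast
  have "norm (chi_jk J k x :: complex) = 2 powr (real_of_int J * real CARD('n) / 2)" if "x \<in> box ?a ?b" for x
  proof -
    have "x \<in> dyadic_cube J k" using that box_subset_cbox unfolding dyadic_cube_def by blast
    then show ?thesis by (simp add: chi_jk_def)
  qed
  then show "\<exists>A y c. open A \<and> y \<in> A \<and> c > 0 \<and> (\<forall>x\<in>A. norm (chi_jk J k x :: complex) \<ge> c)"
    using z by (intro exI[of _ "box ?a ?b"] exI[of _ z] exI[of _ "2 powr (real_of_int J * real CARD('n) / 2)"]) auto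
qed

end

context wavelet_exponent
begin

lemma finite_supp_cubes_meeting_ball: "finite {k. supp_cube j k \<inter> ball x0 R \<noteq> {}}"
proof -
  define b where "b = 2 powi j * (norm x0 + \<bar>R\<bar>) + L"
  have "{k. supp_cube j k \<inter> ball x0 R \<noteq> {}} \<subseteq> {k. \<forall>c. k $ c \<in> {- \<lceil>b\<rceil>..\<lceil>b\<rceil>}}"
  proof
    fix k assume "k \<in> {k. supp_cube j k \<inter> ball x0 R \<noteq> {}}"
    then obtain x where x: "x \<in> supp_cube j k" "x \<in> ball x0 R" by blast
    have "k $ c \<in> {- \<lceil>b\<rceil>..\<lceil>b\<rceil>}" for c
    proof -
      have "norm x \<le> norm x0 + \<bar>R\<bar>" using x(2) norm_triangle_sub[of x x0] by (simp add: dist_norm norm_minus_commute)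
      then have "\<bar>x $ c\<bar> \<le> norm x0 + \<bar>R\<bar>" using component_le_norm_cart[of x c] by linarith
      then have "2 powi j * \<bar>x $ c\<bar> \<le> 2 powi j * (norm x0 + \<bar>R\<bar>)" by (intro mult_left_mono) auto
      then have "\<bar>2 powi j * x $ c\<bar> \<le> 2 powi j * (norm x0 + \<bar>R\<bar>)" by (simp add: abs_mult)
      moreover have "0 \<le> 2 powi j * x $ c - real_of_int (k $ c)" "2 powi j * x $ c - real_of_int (k $ c) \<le> L"
        using x(1) unfolding mem_supp_cube_iff by (auto simp: mem_box_cart)
      ultimately have "\<bar>real_of_int (k $ c)\<bar> \<le> b" using L1 unfolding b_def by linarith
      then have "real_of_int (k $ c) \<le> real_of_int \<lceil>b\<rceil>" "real_of_int (- \<lceil>b\<rceil>) \<le> real_of_int (k $ c)"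
        using le_of_int_ceiling[of b] by linarith+
      then show ?thesis by simp
    qed
    then show "k \<in> {k. \<forall>c. k $ c \<in> {- \<lceil>b\<rceil>..\<lceil>b\<rceil>}}" by blast
  qed
  then show ?thesis by (rule finite_subset) (rule finite_vec_set, simp)
qed

text \<open>Cancellation between wavelets can make \<open>level_sum\<close> vanish on large sets. On a bounded
  region all the functions \<open>level_sum\<close> of a localized \<open>f\<close> lie in one finite-dimensional space, so
  a nonzero one is nonzero at one of finitely many testing points. Hence \<open>p\<close> takes finitely many
  values on a dense subset of each support cube.\<close>

lemma level_sum_exponent_constant:
  assumes bnd: "bounded_by_on (Lp_space p w) (\<lambda>f. modular p w (level_sum \<psi> j f)) (modular p w)"
  shows "p constant_on UNIV"
proof -
  obtain C where C: "C > 0" and mod: "\<And>f. f \<in> Lp_space p w \<Longrightarrow> modular p w (level_sum \<psi> j f) \<le> ennreal C * modular p w f"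
    using bnd unfolding bounded_by_on_def by blast
  define types1 where "types1 = {1..2 ^ CARD('n) - 1 :: nat}"
  define e where "e z = dilate (\<psi> (fst z)) j (snd z)" for z
  have ec: "continuous_on UNIV (e z)" if "fst z \<in> types1" for z
    using dilate_cont[of "fst z" j "snd z"] that by (auto simp: types1_def types_def mother_def e_def)
  have eL2: "e z \<in> L2_space" if "fst z \<in> types1" for z
  proof -
    have "Inr (fst z, j, snd z) \<in> wavelet_index j" using that by (auto simp: wavelet_index_def types1_def)
    then have "wavelet_family \<phi> \<psi> j (Inr (fst z, j, snd z)) \<in> L2_space"
      using basis[of j] unfolding L2_orthonormal_basis_def by blast
    then show ?thesis by (simp add: wavelet_family_def e_def)
  qed
  have eo: "ip (e z) (e z') = (if z = z' then 1 else 0)" if "fst z \<in> types1" "fst z' \<in> types1" for z z'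
  proof -
    have "Inr (fst z, j, snd z) \<in> wavelet_index j" "Inr (fst z', j, snd z') \<in> wavelet_index j"
      using that by (auto simp: wavelet_index_def types1_def)
    then have "ip (wavelet_family \<phi> \<psi> j (Inr (fst z, j, snd z))) (wavelet_family \<phi> \<psi> j (Inr (fst z', j, snd z')))
      = (if (Inr (fst z, j, snd z) :: (int^'n) + nat \<times> int \<times> (int^'n)) = Inr (fst z', j, snd z') then 1 else 0)"
      using basis[of j] unfolding L2_orthonormal_basis_def by blast
    then show ?thesis by (simp add: wavelet_family_def e_def prod_eq_iff)
  qed
  define c0 where "c0 k = vertex j k" for k
  obtain R where R: "\<And>k x. x \<in> supp_cube j k \<Longrightarrow> dist (c0 k) x < R"
  proof -
    have "dist (c0 k) x < real CARD('n) * (2 powi (- j) * L) + 1" if "x \<in> supp_cube j k" for k x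
    proof -
      have "norm (x - c0 k) \<le> (\<Sum>c\<in>UNIV. \<bar>(x - c0 k) $ c\<bar>)" by (rule norm_le_l1_cart)
      also have "\<dots> \<le> (\<Sum>c\<in>(UNIV :: 'n set). 2 powi (- j) * L)"
        using that unfolding supp_cube_def c0_def by (intro sum_mono) (auto simp: mem_box_cart abs_le_iff algebra_simps add_increasing)
      finally show ?thesis by (simp add: dist_norm norm_minus_commute)
    qed
    then show ?thesis using that by blast
  qed
  \<comment> \<open>All wavelets of the level that a ball of radius at most 1 around a point of the
    support cube can meet. The set depends on \<open>k\<close> alone, so the testing points
    \<open>Y k\<close> are fixed before the centre, \<delta> and the radius.\<close>
  define Z where "Z k = types1 \<times> {k'. supp_cube j k' \<inter> ball (c0 k) (R + 1) \<noteq> {}}" for k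
  have finZ: "finite (Z k)" for k unfolding Z_def types1_def using finite_supp_cubes_meeting_ball by blast
  have Zt: "fst z \<in> types1" if "z \<in> Z k" for z k using that by (auto simp: Z_def)
  define Y where "Y k = (SOME Y. finite Y \<and> (\<forall>c. (\<forall>y\<in>Y. (\<Sum>z\<in>Z k. c z * e z y) = 0) \<longrightarrow> (\<forall>x. (\<Sum>z\<in>Z k. c z * e z x) = 0)))" for k
  have Y: "finite (Y k)" "\<And>c x. (\<And>y. y \<in> Y k \<Longrightarrow> (\<Sum>z\<in>Z k. c z * e z y) = 0) \<Longrightarrow> (\<Sum>z\<in>Z k. c z * e z x) = 0" for k
    using someI_ex[OF finite_testing_set[OF finZ[of k], of e]] unfolding Y_def by blast+
  show ?thesis
  proof (rule exponent_constant[of Y, OF Y(1)])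
    fix k x0 assume nz: "psi1 j k x0 \<noteq> 0"
    have x0: "x0 \<in> supp_cube j k" using dilate_zero[OF one_type(2), of x0 j k] nz unfolding one_type(3) by blast
    show "p x0 \<in> p ` Y k"
    proof (rule finite_exponent_values[OF Y(1)])
      fix \<delta> :: real assume "\<delta> > 0"
      obtain r1 where r1: "r1 > 0" "\<And>x. x\<in>ball x0 r1 \<Longrightarrow> \<bar>p x - p x0\<bar> \<le> \<delta>" using p_near[OF \<open>\<delta> > 0\<close>] by blast
      obtain r2 where r2: "r2 > 0" "\<And>r. 0 < r \<and> r \<le> r2 \<Longrightarrow> ip (ind 1 (ball x0 r)) (psi1 j k) \<noteq> 0"
        using ball_coefficient_nonzero[OF nz] by blast
      define r where "r = min 1 (min r1 r2)"
      have r: "0 < r" "r \<le> 1" "r \<le> r1" "r \<le> r2" using r1 r2 by (auto simp: r_def)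
      let ?B = "ball x0 r"
      define a where "a z = ip (ind 1 ?B) (e z)" for z
      define h where "h x = (\<Sum>z\<in>Z k. a z * e z x)" for x
      have Bsub: "?B \<subseteq> ball (c0 k) (R + 1)"
      proof
        fix x assume "x \<in> ?B"
        then have "dist x0 x < 1" using r by simp
        then show "x \<in> ball (c0 k) (R + 1)" using R[OF x0] dist_triangle[of "c0 k" x x0] by simp
      qed
      have a_out: "ip (ind t ?B) (dilate (\<psi> l) j k') = 0" if "l \<in> types1" "(l, k') \<notin> Z k" for l k' t
      proof -
        have "supp_cube j k' \<inter> ball (c0 k) (R + 1) = {}" using that by (auto simp: Z_def)
        then have "x \<notin> supp_cube j k'" if "x \<in> ?B" for x using Bsub that by blast
        moreover have "mother l = \<psi> l" "l \<in> types" using that(1) by (auto simp: types1_def types_def mother_def)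
        ultimately have "dilate (\<psi> l) j k' x = 0" if "x \<in> ?B" for x using dilate_zero[of l x j k'] that by metis
        then have "(\<lambda>x. ind t ?B x * cnj (dilate (\<psi> l) j k' x)) = (\<lambda>_. 0)"
          unfolding ind_def indicator_def by (intro ext) (simp del: mem_ball)
        then show ?thesis unfolding ip_def by (simp only:) simp
      qed
      have ls: "level_sum \<psi> j (ind t ?B) x = of_real t * h x" for t x
      proof -
        let ?K = "{k'. supp_cube j k' \<inter> ball (c0 k) (R + 1) \<noteq> {}}"
        have finK: "finite ?K" by (rule finite_supp_cubes_meeting_ball)
        have "(\<Sum>\<^sub>\<infinity>k'\<in>UNIV. ip (ind t ?B) (dilate (\<psi> l) j k') * dilate (\<psi> l) j k' x)
            = (\<Sum>k'\<in>?K. of_real t * (a (l, k') * e (l, k') x))" if l: "l \<in> types1" for l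
        proof -
          have "(\<Sum>\<^sub>\<infinity>k'\<in>UNIV. ip (ind t ?B) (dilate (\<psi> l) j k') * dilate (\<psi> l) j k' x)
            = (\<Sum>\<^sub>\<infinity>k'\<in>?K. ip (ind t ?B) (dilate (\<psi> l) j k') * dilate (\<psi> l) j k' x)"
          proof (rule infsum_cong_neutral)
            fix k' assume "k' \<in> UNIV - ?K"
            then have "(l, k') \<notin> Z k" by (auto simp: Z_def)
            then show "ip (ind t ?B) (dilate (\<psi> l) j k') * dilate (\<psi> l) j k' x = 0" using a_out[OF l] by simp
          qed auto
          also have "\<dots> = (\<Sum>k'\<in>?K. ip (ind t ?B) (dilate (\<psi> l) j k') * dilate (\<psi> l) j k' x)" by (rule infsum_finite[OF finK])
          also have "\<dots> = (\<Sum>k'\<in>?K. of_real t * (a (l, k') * e (l, k') x))"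
            by (rule sum.cong[OF refl]) (simp add: a_def e_def ip_ind[of t] mult.assoc)
          finally show ?thesis .
        qed
        then have "level_sum \<psi> j (ind t ?B) x = (\<Sum>l\<in>types1. \<Sum>k'\<in>?K. of_real t * (a (l, k') * e (l, k') x))"
          unfolding level_sum_def types1_def[symmetric] by (intro sum.cong) auto
        also have "\<dots> = (\<Sum>z\<in>Z k. of_real t * (a z * e z x))"
          unfolding Z_def by (simp add: sum.cartesian_product case_prod_unfold)
        finally show ?thesis by (simp add: h_def sum_distrib_left)
      qed
      \<comment> \<open>If \<open>h\<close> vanished at all testing points, it would vanish
        identically. But by orthonormality its pairing with the wavelet at \<open>k\<close> gives
        back the coefficient of the ball, which is nonzero.\<close>
      have "\<exists>y\<in>Y k. h y \<noteq> 0"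
      proof (rule ccontr)
        assume "\<not> ?thesis"
        then have h0: "h x = 0" for x unfolding h_def using Y(2)[of k a x] by (auto simp: h_def)
        define z0 where "z0 = (Suc 0, k)"
        have "x0 \<in> ball (c0 k) (R + 1)" using R[OF x0] by simp
        then have z0: "z0 \<in> Z k" using x0 one_type(1) by (auto simp: Z_def z0_def types1_def)
        have "ip h (e z0) = (\<Sum>z\<in>Z k. a z * ip (e z) (e z0))"
          unfolding h_def using eL2 Zt z0 by (intro ip_sum_left) auto
        also have "\<dots> = (\<Sum>z\<in>Z k. if z = z0 then a z0 else 0)"
          by (rule sum.cong[OF refl]) (use eo Zt z0 in auto)
        also have "\<dots> = a z0" using z0 finZ by simp
        finally have "ip h (e z0) = a z0" .
        moreover have "ip h (e z0) = 0" unfolding ip_def h0 by simp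
        moreover have "a z0 \<noteq> 0" unfolding a_def e_def z0_def using r2(2)[of r] r by simp
        ultimately show False by simp
      qed
      then obtain y where y: "y \<in> Y k" "h y \<noteq> 0" by blast
      have hc: "continuous_on UNIV h"
        unfolding h_def using ec Zt by (intro continuous_intros) auto
      define A where "A = {x. norm (h y) / 2 < norm (h x)}"
      have A: "open A" "y \<in> A"
        unfolding A_def using hc y by (auto intro!: open_Collect_less continuous_intros)
      have "\<bar>p y - p x0\<bar> \<le> \<delta>"
      proof (rule exponent_transfer[of "\<lambda>f x. ennreal (norm (level_sum \<psi> j f x))" C A y "norm (h y) / 2" x0 r, OF _ C A])
        show "emodular p w (\<lambda>x. ennreal (norm (level_sum \<psi> j f x))) \<le> ennreal C * modular p w f" if "f \<in> Lp_space p w" for f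
        proof -
          have "emodular p w (\<lambda>x. ennreal (norm (level_sum \<psi> j f x))) = modular p w (level_sum \<psi> j f)"
            unfolding emodular_def modular_def by (simp add: ennreal_powr_ennreal)
          then show ?thesis using mod[OF that] by simp
        qed
        show "norm (h y) / 2 > 0" using y by simp
        show "ennreal (t * (norm (h y) / 2)) \<le> ennreal (norm (level_sum \<psi> j (ind t ?B) x))" if "t > 0" "x \<in> A" for t x
          unfolding ls norm_mult using that by (intro ennreal_leI) (simp add: A_def)
        show "\<bar>p x - p x0\<bar> \<le> \<delta>" if "x \<in> ?B" for x using r1(2)[of x] that r by simp
      qed
      then show "\<exists>y\<in>Y k. \<bar>p y - p x0\<bar> \<le> \<delta>" using y by blast
    qed
  qed
qed

end

section \<open>The characterization\<close>

lemma LH0_continuous: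
  assumes "LH0 p"
  shows "continuous_on UNIV p"
  unfolding continuous_on_iff
proof (intro ballI allI impI)
  fix x and \<epsilon> :: real assume \<epsilon>: "\<epsilon> > 0"
  obtain C where C: "C > 0" and lh: "\<And>x y. norm (x - y) \<le> 1/2 \<Longrightarrow> \<bar>p x - p y\<bar> \<le> C / (- ln (norm (x - y)))"
    using assms unfolding LH0_def by blast
  \<comment> \<open>The second bound is where \<open>C / (- ln r)\<close> drops below \<epsilon>;
    the first is the range of the Hoelder condition.\<close>
  define d where "d = min (1/2) (exp (- (C / \<epsilon>)))"
  have d: "d > 0" by (simp add: d_def)
  have "dist (p y) (p x) < \<epsilon>" if y: "dist y x < d" for y
  proof (cases "y = x")
    case False
    then have n: "0 < norm (y - x)" "norm (y - x) < d" using y by (auto simp: dist_norm)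
    then have "ln (norm (y - x)) < ln d" using d by simp
    also have "\<dots> \<le> ln (exp (- (C / \<epsilon>)))" using d by (subst ln_le_cancel_iff) (auto simp: d_def)
    finally have l: "C / \<epsilon> < - ln (norm (y - x))" by simp
    then have l0: "0 < - ln (norm (y - x))" using C \<epsilon> by (smt (verit) divide_pos_pos)
    have "\<bar>p y - p x\<bar> \<le> C / (- ln (norm (y - x)))" using n by (intro lh) (simp add: d_def)
    also have "\<dots> < \<epsilon>"
    proof -
      have "C < - ln (norm (y - x)) * \<epsilon>" using l \<epsilon> by (simp only: pos_divide_less_eq)
      then show ?thesis by (simp only: pos_divide_less_eq[OF l0] mult.commute)
    qed
    finally show ?thesis by (simp add: dist_real_def)
  qed (use \<epsilon> in simp)
  then show "\<exists>d>0. \<forall>y\<in>UNIV. dist y x < d \<longrightarrow> dist (p y) (p x) < \<epsilon>" using d by blast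
qed

text \<open>An open null set is empty. This turns the essential bounds on a continuous exponent into
  bounds at every point.\<close>

lemma AE_ge_imp_ge:
  fixes p :: "'a::euclidean_space \<Rightarrow> real"
  assumes p: "continuous_on UNIV p" and ae: "AE x in lebesgue. m \<le> p x"
  shows "m \<le> p x"
proof (rule ccontr)
  assume "\<not> ?thesis"
  then have "x \<in> {x. p x < m}" by simp
  then have ne: "{x. p x < m} \<noteq> {}" by blast
  have op: "open {x. p x < m}" using p by (intro open_Collect_less continuous_intros)
  have "AE x in lebesgue. \<not> (x \<in> {x. p x < m})" using ae by (auto elim: eventually_mono)
  then have "emeasure lebesgue {x. p x < m} = 0" using emeasure_eq_0_AE[of "\<lambda>x. x \<in> {x. p x < m}" lebesgue] by simp
  then have "negligible {x. p x < m}" using op by (simp add: negligible_iff_null_sets null_sets_def lebesgue_openin)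
  then show False using ne op open_not_negligible by blast
qed

lemma exponent_bounds:
  fixes p :: "real^'n \<Rightarrow> real"
  assumes cont: "continuous_on UNIV p" and inf: "1 < essinf lebesgue (\<lambda>x. ereal (p x))"
    and sup: "esssup lebesgue (\<lambda>x. ereal (p x)) < \<infinity>" and pm: "p \<in> borel_measurable lebesgue"
  shows "\<And>x. 1 < p x" "\<exists>P. \<forall>x. p x \<le> P"
proof -
  have [measurable]: "(\<lambda>x. ereal (p x)) \<in> borel_measurable lebesgue" "(\<lambda>x. - ereal (p x)) \<in> borel_measurable lebesgue"
    using pm by measurable
  obtain m where m: "1 < ereal m" "ereal m < essinf lebesgue (\<lambda>x. ereal (p x))"
    using ereal_dense2[OF inf] by blast
  have "AE x in lebesgue. - ereal (p x) \<le> esssup lebesgue (\<lambda>x. - ereal (p x))" by (rule esssup_AE)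
  then have "AE x in lebesgue. m \<le> p x"
  proof (rule eventually_mono)
    fix x assume "- ereal (p x) \<le> esssup lebesgue (\<lambda>x. - ereal (p x))"
    then have "essinf lebesgue (\<lambda>x. ereal (p x)) \<le> ereal (p x)"
      unfolding essinf_def by (simp add: ereal_uminus_le_reorder)
    then show "m \<le> p x" using m(2) by (metis ereal_less_eq(3) less_imp_le order_trans)
  qed
  then have "m \<le> p x" for x by (rule AE_ge_imp_ge[OF cont])
  then show "1 < p x" for x using m(1) by (smt (verit) ereal_less(2) less_ereal.simps(1) one_ereal_def)
  obtain P where P: "esssup lebesgue (\<lambda>x. ereal (p x)) < ereal P" using ereal_dense2[OF sup] by blast
  have "AE x in lebesgue. ereal (p x) \<le> esssup lebesgue (\<lambda>x. ereal (p x))" by (rule esssup_AE)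
  then have "AE x in lebesgue. - P \<le> - p x"
  proof (rule eventually_mono)
    fix x assume "ereal (p x) \<le> esssup lebesgue (\<lambda>x. ereal (p x))"
    then have "ereal (p x) \<le> ereal P" using P by (metis less_imp_le order_trans)
    then show "- P \<le> - p x" by simp
  qed
  then have "- P \<le> - p x" for x using cont by (intro AE_ge_imp_ge[of "\<lambda>x. - p x"] continuous_intros)
  then show "\<exists>P. \<forall>x. p x \<le> P" by (intro exI[of _ P]) simp
qed

text \<open>The class controls cubes of volume one, and by compactness finitely many of them cover a
  ball; open unit cubes centred at its points provide the open cover.\<close>

lemma A_loc_locally_integrable:
  fixes w :: "real^'n \<Rightarrow> real"
  assumes w: "w \<in> A_loc p" and pm: "p \<in> borel_measurable lebesgue" and p1: "\<And>x. p x > 1" and P: "\<And>x. p x \<le> P"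
  shows "(\<integral>\<^sup>+x. ennreal (w x) * indicator (ball x0 r) x \<partial>lebesgue) < \<infinity>"
proof -
  have wm[measurable]: "w \<in> borel_measurable lebesgue" using w by (simp add: A_loc_def is_weight_def)
  define M where "M = density lebesgue (\<lambda>x. ennreal (w x))"
  have em: "emeasure M E = (\<integral>\<^sup>+x. ennreal (w x) * indicator E x \<partial>lebesgue)" if "E \<in> sets lebesgue" for E
    unfolding M_def using that by (subst emeasure_density) auto
  define U where "U z = box (z - vec (1/2)) (z - vec (1/2) + vec 1)" for z :: "real^'n"
  define Q where "Q z = cbox (z - vec (1/2)) (z - vec (1/2) + vec 1)" for z :: "real^'n"
  have Qfin: "emeasure M (Q z) < \<infinity>" for z
  proof -
    have "(\<integral>\<^sup>+x. ennreal (w x) * indicator (Q z) x \<partial>lebesgue) < \<infinity>"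
    proof (rule Lp_norm_indicator_finite[OF wm P])
      show "Lp_norm p w (indicator (Q z)) < \<infinity>"
        unfolding Q_def by (rule A_loc_norms(2)[OF w pm p1]) auto
      show "0 \<le> p x" for x using p1[of x] by simp
    qed (simp add: Q_def)
    then show ?thesis by (subst em) (auto simp: Q_def)
  qed
  have "z \<in> U z" for z by (simp add: U_def mem_box_cart)
  then have cov: "cball x0 r \<subseteq> (\<Union>z\<in>cball x0 r. U z)" by blast
  have Uo: "open (U z)" for z unfolding U_def by (rule open_box)
  obtain T where T: "T \<subseteq> cball x0 r" "finite T" "cball x0 r \<subseteq> (\<Union>z\<in>T. U z)"
    using compactE_image[OF compact_cball[of x0 r] _ cov] Uo by blast
  have "ball x0 r \<subseteq> (\<Union>z\<in>T. Q z)"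
  proof -
    have "U z \<subseteq> Q z" for z by (simp add: U_def Q_def box_subset_cbox)
    then show ?thesis using T(3) ball_subset_cball[of x0 r] by blast
  qed
  then have "emeasure M (ball x0 r) \<le> emeasure M (\<Union>z\<in>T. Q z)"
    by (rule emeasure_mono) (use T in \<open>auto simp: M_def Q_def\<close>)
  also have "\<dots> \<le> (\<Sum>z\<in>T. emeasure M (Q z))"
    using T(2) by (intro emeasure_subadditive_finite) (auto simp: M_def Q_def)
  also have "\<dots> < \<infinity>" using Qfin T(2) by (auto simp: less_top[symmetric])
  finally show ?thesis by (subst (asm) em) auto
qed

lemma modular_cong_AE:
  assumes "AE x in lebesgue. w' x = w x"
  shows "modular p w' = modular p w" "emodular p w' = emodular p w" "Lp_space p w' = Lp_space p w"
proof -
  show m: "modular p w' = modular p w"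
    unfolding modular_def using assms by (intro ext nn_integral_cong_AE) (auto elim: eventually_mono)
  show "emodular p w' = emodular p w"
    unfolding emodular_def using assms by (intro ext nn_integral_cong_AE) (auto elim: eventually_mono)
  show "Lp_space p w' = Lp_space p w"
    unfolding Lp_space_def Lp_norm_def m ..
qed

theorem theorem5p1:
  fixes p w \<phi> :: "real^'n \<Rightarrow> real"
    and \<psi> :: "nat \<Rightarrow> real^'n \<Rightarrow> real"
    and J jstar :: int
  assumes "wavelet_system \<phi> \<psi>"
    and "p \<in> borel_measurable lebesgue"
    and "\<And>x. p x \<ge> 1"
    and "1 < essinf lebesgue (\<lambda>x. ereal (p x))"
    and "esssup lebesgue (\<lambda>x. ereal (p x)) < \<infinity>"
    and "LH0 p" and "LHinf p"
    and "w \<in> A_loc p"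
  shows "(p constant_on UNIV \<longleftrightarrow>
            bounded_by_on (Lp_space p w)
              (\<lambda>f. modular p w (level_sum \<psi> jstar f)) (modular p w)) \<and>
         (p constant_on UNIV \<longleftrightarrow>
            comparable_on (Lp_space p w)
              (\<lambda>f. emodular p w (sq_V \<phi> J f) + emodular p w (sq_W1 \<psi> J f)) (modular p w)) \<and>
         (p constant_on UNIV \<longleftrightarrow>
            comparable_on (Lp_space p w)
              (\<lambda>f. emodular p w (sq_V \<phi> J f) + emodular p w (sq_W2 \<psi> J f)) (modular p w))"
proof -
  obtain N where wav: "wavelets \<phi> \<psi> N" using wavelet_system_imp_wavelets[OF assms(1)] .
  have wm[measurable]: "w \<in> borel_measurable lebesgue" and w0: "AE x in lebesgue. w x > 0"
    using assms(8) by (auto simp: A_loc_def is_weight_def)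
  note cont = LH0_continuous[OF assms(6)]
  note p1 = exponent_bounds(1)[OF cont assms(4,5,2)]
  obtain P where P: "\<And>x. p x \<le> P" using exponent_bounds(2)[OF cont assms(4,5,2)] by blast
  have ve: "variable_exponent p w P"
    by unfold_locales (use cont assms(3) P wm w0 A_loc_locally_integrable[OF assms(8,2) p1 P] in auto)
  interpret wavelet_exponent \<phi> \<psi> N p w P by (intro wavelet_exponent.intro wav ve)
  have const: "bounded_by_on (Lp_space p w) (\<lambda>f. modular p w (level_sum \<psi> jstar f)) (modular p w)
    \<and> comparable_on (Lp_space p w) (\<lambda>f. emodular p w (sq_V \<phi> J f) + emodular p w (sq_W1 \<psi> J f)) (modular p w)
    \<and> comparable_on (Lp_space p w) (\<lambda>f. emodular p w (sq_V \<phi> J f) + emodular p w (sq_W2 \<psi> J f)) (modular p w)"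
    if "p constant_on UNIV"
  proof -
    obtain c where pc: "p = (\<lambda>_. c)" using \<open>p constant_on UNIV\<close> unfolding constant_on_def by auto
    have c1: "c > 1" using p1 unfolding pc by simp
    \<comment> \<open>Positive at every point, as \<open>pos_weight\<close> requires, and equal to
      \<open>w\<close> almost everywhere; by \<open>modular_cong_AE\<close> spaces and modulars are
      unchanged.\<close>
    define w' where "w' x = (if w x > 0 then w x else 1)" for x
    have eq: "AE x in lebesgue. w' x = w x" using w0 by (auto simp: w'_def elim: eventually_mono)
    have pw: "pos_weight c w'"
    proof
      show "w' \<in> borel_measurable lebesgue" unfolding w'_def by measurable
    qed (use c1 in \<open>auto simp: w'_def\<close>)
    obtain A where A: "\<And>a s. 0 < s \<and> s \<le> 1 \<Longrightarrow> pos_weight.Apset c w' A (cbox a (a + vec s))"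
      using A_loc_const_Apset[OF _ c1 pw eq] assms(8) unfolding pc by blast
    have ww: "weighted_wavelets \<phi> \<psi> N c w' A"
      by (intro weighted_wavelets.intro wav pw weighted_wavelets_axioms.intro A) simp
    show ?thesis
      using weighted_wavelets.level_sum_bounded[OF ww, of jstar] weighted_wavelets.W1_comparable[OF ww, of J]
        weighted_wavelets.W2_comparable[OF ww, of J]
      unfolding pc modular_cong_AE[OF eq] by blast
  qed
  have "p constant_on UNIV" if cmp: "comparable_on (Lp_space p w) (\<lambda>f. emodular p w (sq_V \<phi> J f) + emodular p w (sq_W1 \<psi> J f)) (modular p w)"
  proof -
    obtain C where C: "C > 0" and le: "\<And>f. f \<in> Lp_space p w \<Longrightarrow> emodular p w (sq_V \<phi> J f) + emodular p w (sq_W1 \<psi> J f) \<le> ennreal C * modular p w f"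
      using cmp unfolding comparable_on_def bounded_by_on_def by blast
    show ?thesis
    proof (rule W1_exponent_constant[OF _ C])
      show "emodular p w (sq_W1 \<psi> J f) \<le> ennreal C * modular p w f" if "f \<in> Lp_space p w" for f
        by (rule order_trans[OF _ le[OF that]]) simp
    qed
  qed
  moreover have "p constant_on UNIV" if cmp: "comparable_on (Lp_space p w) (\<lambda>f. emodular p w (sq_V \<phi> J f) + emodular p w (sq_W2 \<psi> J f)) (modular p w)"
  proof -
    obtain C where C: "C > 0" and le: "\<And>f. f \<in> Lp_space p w \<Longrightarrow> emodular p w (sq_V \<phi> J f) + emodular p w (sq_W2 \<psi> J f) \<le> ennreal C * modular p w f"
      using cmp unfolding comparable_on_def bounded_by_on_def by blast
    show ?thesis
    proof (rule W2_exponent_constant[OF _ C])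
      show "emodular p w (sq_W2 \<psi> J f) \<le> ennreal C * modular p w f" if "f \<in> Lp_space p w" for f
        by (rule order_trans[OF _ le[OF that]]) simp
    qed
  qed
  ultimately show ?thesis using const level_sum_exponent_constant by blast
qed

end
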